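(* Let $f:\mathbb{R}_+\times\mathbb{R}_+\to\mathbb{R}_+$ satisfy Assumption (A$_f$) with constants $\rho>0$, $\alpha\ge 0$, $\gamma>-\alpha$, and let $\delta\in(0,\infty)$ and $y\in\mathbb{R}_+$. Let $(\Omega,\mathcal{F},(\mathcal{F}_t)_{t\ge0},\mathbb{P})$ be a filtered probability space carrying an $(\mathcal{F}_t)$-adapted triple $(S,Y,B)$, where $B$ is a real-valued $(\mathcal{F}_t)$-Brownian motion, $Y$ is a squared-Bessel process with law $\mathrm{BESQ}^\delta_y$, and $S$ is a continuous $\mathbb{R}_+$-valued process with deterministic $S_0\in\mathbb{R}_+$ satisfying $$S_t=S_0+\int_0^t\big(2f(s,Y_s)+1\big)\,ds+2\int_0^t\sqrt{S_s}\,dB_s\quad\text{for all }t\in\mathbb{R}_+.$$ Set $X_t:=\sqrt{S_t}$. Then: (a) $\displaystyle\lim_{t\to\infty}\frac{\log X_t}{\log t}=\frac{1+\gamma+\alpha}{2}$ almost surely; (b) as $t\to\infty$, $$t^{-(1+\gamma+\alpha)/2}X_t\ \xrightarrow{d}\ \Big(2\rho\int_0^1 s^\gamma\widetilde{Y}_s^\alpha\,ds\Big)^{1/2},$$ where $\widetilde{Y}$ has law $\mathrm{BESQ}^\delta_0$.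
   Context: $\mathbb{R}_+=[0,\infty)$. Assumption (A$_f$): $f:\mathbb{R}_+\times\mathbb{R}_+\to\mathbb{R}_+$ is continuous and there are constants $\rho\in(0,\infty)$, $\alpha\in\mathbb{R}_+$, $\gamma\in(-\alpha,\infty)$ such that for every $\varepsilon>0$ there is $r_\varepsilon\in\mathbb{R}_+$ with $$\sup_{(t,y)\in\mathbb{R}_+^2:\ t+y\ge r_\varepsilon}\big|f(t,y)(1+t)^{-\gamma}(1+y)^{-\alpha}-\rho\big|\le\varepsilon.$$ For $\delta>0$ and $y\in\mathbb{R}_+$, $\mathrm{BESQ}^\delta_y$ denotes the law of the squared-Bessel process of dimension $\delta$ started at $y$, i.e. the unique strong solution of $dY_t=\delta\,dt+2|Y_t|^{1/2}\,dW_t$, $Y_0=y$, for a Brownian motion $W$. In the theorem $Y$ is $\mathrm{BESQ}^\delta_y$ driven by some $(\mathcal{F}_t)$-Brownian motion $W$; no assumption is made on the dependence between $W$ (or $Y$) and $B$ beyond both being adapted to the same filtration. $\xrightarrow{d}$ denotes convergence in distribution. *)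

theory Defs
  imports "HOL-Probability.Probability"
begin

definition assumption_Af :: "(real \<Rightarrow> real \<Rightarrow> real) \<Rightarrow> real \<Rightarrow> real \<Rightarrow> real \<Rightarrow> bool" where
  "assumption_Af f \<rho> \<alpha> \<gamma> \<longleftrightarrow>
     continuous_on ({0..} \<times> {0..}) (\<lambda>(t, y). f t y) \<and>
     (\<forall>t\<ge>0. \<forall>y\<ge>0. f t y \<ge> 0) \<and>
     0 < \<rho> \<and> 0 \<le> \<alpha> \<and> - \<alpha> < \<gamma> \<and>
     (\<forall>\<epsilon>>0. \<exists>r\<ge>0. \<forall>t\<ge>0. \<forall>y\<ge>0. r \<le> t + y \<longrightarrow>
        \<bar>f t y * (1 + t) powr (- \<gamma>) * (1 + y) powr (- \<alpha>) - \<rho>\<bar> \<le> \<epsilon>)"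

definition filtration_of :: "'a measure \<Rightarrow> (real \<Rightarrow> 'a measure) \<Rightarrow> bool" where
  "filtration_of M F \<longleftrightarrow>
     (\<forall>t. space (F t) = space M) \<and>
     (\<forall>t. sets (F t) \<subseteq> sets M) \<and>
     (\<forall>s t. s \<le> t \<longrightarrow> sets (F s) \<subseteq> sets (F t))"

definition adapted_proc :: "(real \<Rightarrow> 'a measure) \<Rightarrow> (real \<Rightarrow> 'a \<Rightarrow> real) \<Rightarrow> bool" where
  "adapted_proc F X \<longleftrightarrow> (\<forall>t\<ge>0. X t \<in> borel_measurable (F t))"

definition continuous_paths :: "'a measure \<Rightarrow> (real \<Rightarrow> 'a \<Rightarrow> real) \<Rightarrow> bool" where
  "continuous_paths M X \<longleftrightarrow> (\<forall>\<omega>\<in>space M. continuous_on {0..} (\<lambda>t. X t \<omega>))"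

definition is_brownian_motion :: "'a measure \<Rightarrow> (real \<Rightarrow> 'a measure) \<Rightarrow> (real \<Rightarrow> 'a \<Rightarrow> real) \<Rightarrow> bool" where
  "is_brownian_motion M F B \<longleftrightarrow>
     (\<forall>\<omega>\<in>space M. B 0 \<omega> = 0) \<and>
     continuous_paths M B \<and>
     adapted_proc F B \<and>
     (\<forall>s t. 0 \<le> s \<and> s < t \<longrightarrow>
        distributed M lborel (\<lambda>\<omega>. B t \<omega> - B s \<omega>) (\<lambda>x. ennreal (normal_density 0 (sqrt (t - s)) x))) \<and>
     (\<forall>s t. 0 \<le> s \<and> s \<le> t \<longrightarrow> (\<forall>A\<in>sets (F s). \<forall>C\<in>sets borel.
        measure M (A \<inter> {\<omega>\<in>space M. B t \<omega> - B s \<omega> \<in> C})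
          = measure M A * measure M {\<omega>\<in>space M. B t \<omega> - B s \<omega> \<in> C}))"

definition ito_sum :: "(real \<Rightarrow> 'a \<Rightarrow> real) \<Rightarrow> (real \<Rightarrow> 'a \<Rightarrow> real) \<Rightarrow> real \<Rightarrow> nat \<Rightarrow> 'a \<Rightarrow> real" where
  "ito_sum H B t n \<omega> = (\<Sum>k<2^n. H (real k * t / 2^n) \<omega> *
       (B (real (Suc k) * t / 2^n) \<omega> - B (real k * t / 2^n) \<omega>))"

text \<open>I is (a version of) the Ito integral of the continuous adapted process H against
  the Brownian motion B over [0,t]: the limit in probability of the left-point Riemann sums.\<close>
definition is_ito_integral :: "'a measure \<Rightarrow> (real \<Rightarrow> 'a \<Rightarrow> real) \<Rightarrow> (real \<Rightarrow> 'a \<Rightarrow> real) \<Rightarrow> real \<Rightarrow> ('a \<Rightarrow> real) \<Rightarrow> bool" where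
  "is_ito_integral M H B t I \<longleftrightarrow>
     I \<in> borel_measurable M \<and>
     (\<forall>\<epsilon>>0. (\<lambda>n. measure M {\<omega>\<in>space M. \<epsilon> < \<bar>ito_sum H B t n \<omega> - I \<omega>\<bar>}) \<longlonglongrightarrow> 0)"

definition is_BESQ :: "'a measure \<Rightarrow> (real \<Rightarrow> 'a measure) \<Rightarrow> (real \<Rightarrow> 'a \<Rightarrow> real) \<Rightarrow> real \<Rightarrow> real \<Rightarrow> (real \<Rightarrow> 'a \<Rightarrow> real) \<Rightarrow> bool" where
  "is_BESQ M F W \<delta> y Y \<longleftrightarrow>
     is_brownian_motion M F W \<and> adapted_proc F Y \<and> continuous_paths M Y \<and>
     (\<forall>t\<ge>0. \<exists>I. is_ito_integral M (\<lambda>s \<omega>. sqrt \<bar>Y s \<omega>\<bar>) W t I \<and>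
        (AE \<omega> in M. Y t \<omega> = y + \<delta> * t + 2 * I \<omega>))"

definition conv_distr_at_top :: "'a measure \<Rightarrow> (real \<Rightarrow> 'a \<Rightarrow> real) \<Rightarrow> real measure \<Rightarrow> bool" where
  "conv_distr_at_top M Z L \<longleftrightarrow>
     (\<forall>tn :: nat \<Rightarrow> real. filterlim tn at_top sequentially \<longrightarrow>
        weak_conv_m (\<lambda>n. distr M borel (Z (tn n))) L)"

end

theory Submission
  imports Defs "HOL-Real_Asymp.Real_Asymp"
begin

text \<open>Everything rests on the Laplace transform of the transition law of a squared-Bessel process Y. It follows from
  a second-order expansion of \<open>exp (- a * Y)\<close> over dyadic steps of length h, whose error of order \<open>h * sqrt h\<close> sums
  to zero; the moment bounds needed come from exponential exit estimates for the integral of \<open>sqrt \<bar>Y\<bar>\<close>.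

  The process S is its drift \<open>2 * A\<close>, where A is the time integral of \<open>f s (Y s)\<close>, plus \<open>s0 + t\<close> and a
  martingale term. By Borel-Cantelli along dyadic times A is of order \<open>t powr (1 + \<gamma> + \<alpha>)\<close> up to arbitrarily small
  powers; the exit estimate, applied to S itself, makes the martingale term of smaller order, which gives (a).

  For (b) the Laplace transforms show that \<open>Y (t * u) / t\<close> converges to the process started at 0 in the sense
  of finite-dimensional distributions. Truncating in time and space turns the rescaled A into a bounded integral functional,
  and such functionals pass to the limit by polynomial approximation and Fubini, so no tightness in path space is needed.
  The moment bounds make the truncation errors uniformly small.\<close>

section \<open>Increments of Brownian motion\<close>

text \<open>The Ito integral is given only at each fixed time, as a limit in probability of
  left-point sums, with a null set that depends on the time. Every estimate is therefore proved for
  finite sums, where independence of one Gaussian increment from the past is enough, and is then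
  carried to dyadic times and, by path continuity, to all times. The Laplace transform is computable
  because the generator \<open>2 y D^2 + \<delta> D\<close> is affine in y: it maps
  \<open>exp (- a y)\<close> to itself times an affine function, and the flow
  \<open>a' = - 2 a^2\<close> has the explicit solution \<open>a / (1 + 2 a h)\<close>, with factor
  \<open>(1 + 2 a h) powr (- \<delta> / 2)\<close>. As B and W may depend on each other in any way,
  S cannot be treated conditionally on Y; only the pathwise size of A enters. The martingale term of
  S has order about the square root of \<open>t powr (\<kappa> + 1)\<close> with
  \<open>\<kappa> = 1 + \<gamma> + \<alpha>\<close>, and \<open>\<kappa> > 1\<close> is exactly what
  puts it below A.\<close>

locale brownian = prob_space M for M :: "'a measure" +
  fixes F :: "real \<Rightarrow> 'a measure" and B :: "real \<Rightarrow> 'a \<Rightarrow> real"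
  assumes filtration: "filtration_of M F" and brownian: "is_brownian_motion M F B"
begin

lemma space_F [simp]: "space (F t) = space M"
  using filtration by (auto simp: filtration_of_def)

lemma sets_F_le: "A \<in> sets (F t) \<Longrightarrow> A \<in> sets M"
  using filtration by (auto simp: filtration_of_def)

lemma sets_F_mono: "s \<le> t \<Longrightarrow> sets (F s) \<subseteq> sets (F t)"
  using filtration by (auto simp: filtration_of_def)

lemma measurable_F_mono:
  assumes "s \<le> t" "U \<in> measurable (F s) N" shows "U \<in> measurable (F t) N"
  using assms sets_F_mono[of s t] by (auto simp: measurable_def)

lemma measurable_F_le:
  assumes "U \<in> measurable (F s) N" shows "U \<in> measurable M N"
  using assms by (auto simp: measurable_def dest: sets_F_le)

lemma B_measurable: "0 \<le> t \<Longrightarrow> B t \<in> borel_measurable (F t)"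
  using brownian by (auto simp: is_brownian_motion_def adapted_proc_def)

lemma B_measurable_M: "0 \<le> t \<Longrightarrow> B t \<in> borel_measurable M"
  using B_measurable measurable_F_le by blast

lemma B_measurable_le: "0 \<le> s \<Longrightarrow> s \<le> t \<Longrightarrow> B s \<in> borel_measurable (F t)"
  using B_measurable measurable_F_mono by blast

lemma increment_distributed:
  assumes "0 \<le> s" "s < t"
  shows "distributed M lborel (\<lambda>w. B t w - B s w) (\<lambda>x. ennreal (normal_density 0 (sqrt (t - s)) x))"
  using assms brownian by (auto simp: is_brownian_motion_def)

text \<open>The event-wise independence in \<open>is_brownian_motion\<close> makes the two measures
  agree on rectangles, hence everywhere. The target \<open>N\<close> is arbitrary, so that
  \<open>U\<close> may be the identity into \<open>F s\<close>, that is, the whole past.\<close>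

lemma increment_pair_distr:
  assumes st: "0 \<le> s" "s \<le> t" and U: "U \<in> measurable (F s) N"
  shows "distr M N U \<Otimes>\<^sub>M distr M borel (\<lambda>w. B t w - B s w)
    = distr M (N \<Otimes>\<^sub>M borel) (\<lambda>w. (U w, B t w - B s w))"
proof -
  let ?D = "\<lambda>w. B t w - B s w"
  have [measurable]: "B s \<in> borel_measurable M" "B t \<in> borel_measurable M"
    using st by (auto intro: B_measurable_M)
  have [measurable]: "U \<in> measurable M N" by (rule measurable_F_le[OF U])
  show ?thesis
  proof (rule pair_measure_eqI)
    show "sigma_finite_measure (distr M N U)" "sigma_finite_measure (distr M borel ?D)"
      by (intro prob_space_imp_sigma_finite prob_space_distr; simp)+
    fix A C assume A[measurable]: "A \<in> sets (distr M N U)" and C[measurable]: "C \<in> sets (distr M borel ?D)"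
    have "U -` A \<inter> space M \<in> sets (F s)"
      using measurable_sets[OF U, of A] A by simp
    then have "prob ((U -` A \<inter> space M) \<inter> {w\<in>space M. ?D w \<in> C}) = prob (U -` A \<inter> space M) * prob {w\<in>space M. ?D w \<in> C}"
      using brownian st C by (auto simp: is_brownian_motion_def)
    moreover have "(U -` A \<inter> space M) \<inter> {w\<in>space M. ?D w \<in> C} = (\<lambda>w. (U w, ?D w)) -` (A \<times> C) \<inter> space M"
      "{w\<in>space M. ?D w \<in> C} = ?D -` C \<inter> space M" by auto
    moreover have "A \<times> C \<in> sets (N \<Otimes>\<^sub>M borel)" using A C by simp
    ultimately show "emeasure (distr M N U) A * emeasure (distr M borel ?D) C
        = emeasure (distr M (N \<Otimes>\<^sub>M borel) (\<lambda>w. (U w, ?D w))) (A \<times> C)"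
      using A C by (simp add: emeasure_distr emeasure_eq_measure ennreal_mult'[symmetric])
  qed (simp cong: sets_pair_measure_cong)
qed

lemma indep_increment:
  fixes N :: "real measure"
  assumes st: "0 \<le> s" "s \<le> t" and U: "U \<in> measurable (F s) N"
  shows "indep_var N U borel (\<lambda>w. B t w - B s w)"
  unfolding indep_var_distribution_eq
  using increment_pair_distr[OF assms] measurable_F_le[OF U] B_measurable_M[of s] B_measurable_M[of t] st
  by auto

text \<open>Freezing: with the identity as \<open>U\<close> in the product law, Tonelli integrates
  the increment while the past is held fixed. This does the work of a conditional
  expectation.\<close>

lemma nn_integral_increment:
  assumes st: "0 \<le> s" "s \<le> t" and [measurable]: "\<phi> \<in> borel_measurable (F s \<Otimes>\<^sub>M borel)"
  shows "(\<integral>\<^sup>+w. \<phi> (w, B t w - B s w) \<partial>M) = (\<integral>\<^sup>+w. (\<integral>\<^sup>+w'. \<phi> (w, B t w' - B s w') \<partial>M) \<partial>M)"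
proof -
  let ?D = "\<lambda>w. B t w - B s w"
  have [measurable]: "B s \<in> borel_measurable M" "B t \<in> borel_measurable M"
    using st by (auto intro: B_measurable_M)
  have id[measurable]: "(\<lambda>w. w) \<in> measurable M (F s)"
    by (rule measurable_F_le[of _ s]) simp
  have eq: "distr M (F s) (\<lambda>w. w) \<Otimes>\<^sub>M distr M borel ?D = distr M (F s \<Otimes>\<^sub>M borel) (\<lambda>w. (w, ?D w))"
    by (rule increment_pair_distr[OF st]) simp
  interpret D: prob_space "distr M borel ?D" by (rule prob_space_distr) simp
  have "(\<integral>\<^sup>+w. \<phi> (w, ?D w) \<partial>M) = integral\<^sup>N (distr M (F s \<Otimes>\<^sub>M borel) (\<lambda>w. (w, ?D w))) \<phi>"
    by (subst nn_integral_distr) auto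
  also have "\<dots> = integral\<^sup>N (distr M (F s) (\<lambda>w. w) \<Otimes>\<^sub>M distr M borel ?D) \<phi>" by (simp add: eq)
  also have "\<dots> = (\<integral>\<^sup>+w. (\<integral>\<^sup>+x. \<phi> (w, x) \<partial>distr M borel ?D) \<partial>distr M (F s) (\<lambda>w. w))"
    by (subst D.nn_integral_fst[symmetric]) (auto cong: measurable_cong_sets)
  also have "\<dots> = (\<integral>\<^sup>+w. (\<integral>\<^sup>+w'. \<phi> (w, ?D w') \<partial>M) \<partial>M)"
    by (subst nn_integral_distr) (auto simp: nn_integral_distr intro!: nn_integral_cong)
  finally show ?thesis .
qed

lemma increment_mgf:
  assumes st: "0 \<le> s" "s < t"
  shows "(\<integral>\<^sup>+w. ennreal (exp (\<theta> * (B t w - B s w))) \<partial>M) = ennreal (exp (\<theta>\<^sup>2 * (t - s) / 2))"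
proof -
  let ?s = "sqrt (t - s)"
  have [arith]: "?s > 0" "t - s > 0" using st by auto
  \<comment> \<open>Completing the square: the exponential tilt moves the mean of the Gaussian to
    \<open>\<theta> * (t - s)\<close>.\<close>
  have nd: "normal_density 0 ?s x * exp (\<theta> * x) = exp (\<theta>\<^sup>2 * (t - s) / 2) * normal_density (\<theta> * (t - s)) ?s x" for x
    using st unfolding normal_density_def
    by (simp add: mult_exp_exp field_simps power2_eq_square) 
  have "(\<integral>\<^sup>+w. ennreal (exp (\<theta> * (B t w - B s w))) \<partial>M) =
     (\<integral>\<^sup>+x. ennreal (normal_density 0 ?s x) * ennreal (exp (\<theta> * x)) \<partial>lborel)"
    by (subst distributed_nn_integral[OF increment_distributed[OF st]]) auto
  also have "\<dots> = (\<integral>\<^sup>+x. ennreal (exp (\<theta>\<^sup>2 * (t - s) / 2)) * ennreal (normal_density (\<theta> * (t - s)) ?s x) \<partial>lborel)"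
    by (intro nn_integral_cong) (simp add: ennreal_mult'[symmetric] nd)
  also have "\<dots> = ennreal (exp (\<theta>\<^sup>2 * (t - s) / 2)) * (\<integral>\<^sup>+x. ennreal (normal_density (\<theta> * (t - s)) ?s x) \<partial>lborel)"
    by (rule nn_integral_cmult) simp
  also have "(\<integral>\<^sup>+x. ennreal (normal_density (\<theta> * (t - s)) ?s x) \<partial>lborel) = 1"
    using integral_normal_density[of ?s "\<theta> * (t - s)"] integrable_normal_density[of ?s "\<theta> * (t - s)"]
    by (subst nn_integral_eq_integral) auto
  finally show ?thesis by simp
qed

definition incr :: "real \<Rightarrow> nat \<Rightarrow> 'a \<Rightarrow> real" where
  "incr h k w = B (real (Suc k) * h) w - B (real k * h) w"

text \<open>The martingale transform on the grid of mesh \<open>h\<close>, that is, the discrete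
  stochastic integral, used with each \<open>H k\<close> known at time \<open>k * h\<close>.\<close>

definition psum :: "real \<Rightarrow> (nat \<Rightarrow> 'a \<Rightarrow> real) \<Rightarrow> nat \<Rightarrow> 'a \<Rightarrow> real" where
  "psum h H J w = (\<Sum>k<J. H k w * incr h k w)"

lemma incr_measurable [measurable]: "0 \<le> h \<Longrightarrow> incr h k \<in> borel_measurable M"
  unfolding incr_def[abs_def] by (intro borel_measurable_diff B_measurable_M) auto

lemma incr_measurable_F: "0 \<le> h \<Longrightarrow> k < j \<Longrightarrow> incr h k \<in> borel_measurable (F (real j * h))"
  unfolding incr_def[abs_def]
  by (intro borel_measurable_diff B_measurable_le mult_right_mono mult_nonneg_nonneg) auto

lemma psum_measurable_F:
  assumes h: "0 \<le> h" and H: "\<And>k. k < J \<Longrightarrow> H k \<in> borel_measurable (F (real k * h))" and "J \<le> j"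
  shows "psum h H J \<in> borel_measurable (F (real j * h))"
  unfolding psum_def[abs_def]
proof (intro borel_measurable_sum borel_measurable_times)
  fix k assume k: "k \<in> {..<J}"
  show "H k \<in> borel_measurable (F (real j * h))"
    using k h assms(3) by (intro measurable_F_mono[OF _ H] mult_right_mono) auto
  show "incr h k \<in> borel_measurable (F (real j * h))"
    using k assms(3) by (intro incr_measurable_F h) auto
qed

lemma psum_measurable:
  assumes h: "0 \<le> h" and H: "\<And>k. k < J \<Longrightarrow> H k \<in> borel_measurable (F (real k * h))"
  shows "psum h H J \<in> borel_measurable M"
  using psum_measurable_F[OF assms order_refl] by (rule measurable_F_le)

text \<open>Given the past, the last summand is a centred Gaussian of variance at most
  \<open>h * (c J)\<^sup>2\<close>; integrating it out with the past frozen contributes one factor,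
  and the induction closes.\<close>

lemma psum_mgf:
  assumes h: "0 < h" and H: "\<And>k. k < J \<Longrightarrow> H k \<in> borel_measurable (F (real k * h))"
    and c: "\<And>k \<omega>. k < J \<Longrightarrow> \<omega> \<in> space M \<Longrightarrow> \<bar>H k \<omega>\<bar> \<le> c k"
  shows "(\<integral>\<^sup>+\<omega>. ennreal (exp (\<theta> * psum h H J \<omega>)) \<partial>M) \<le> ennreal (exp (\<theta>\<^sup>2 * h * (\<Sum>k<J. (c k)\<^sup>2) / 2))"
  using H c
proof (induction J)
  case 0
  then show ?case by (simp add: psum_def emeasure_space_1)
next
  case (Suc J)
  let ?F = "F (real J * h)"
  have [measurable]: "H J \<in> borel_measurable ?F" using Suc.prems by auto
  have [measurable]: "psum h H J \<in> borel_measurable ?F"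
    using h Suc.prems by (intro psum_measurable_F) auto
  define \<phi> where "\<phi> = (\<lambda>p. ennreal (exp (\<theta> * psum h H J (fst p))) * ennreal (exp (\<theta> * H J (fst p) * snd p)))"
  have [measurable]: "\<phi> \<in> borel_measurable (?F \<Otimes>\<^sub>M borel)" unfolding \<phi>_def by measurable
  have le: "real J * h < real (Suc J) * h" "0 \<le> real J * h" using h by auto
  have mM: "psum h H J \<in> borel_measurable M" by (rule measurable_F_le[of _ "real J * h"]) simp
  have "(\<integral>\<^sup>+\<omega>. ennreal (exp (\<theta> * psum h H (Suc J) \<omega>)) \<partial>M) = (\<integral>\<^sup>+\<omega>. \<phi> (\<omega>, incr h J \<omega>) \<partial>M)"
    by (intro nn_integral_cong) (simp add: psum_def \<phi>_def ennreal_mult'[symmetric] mult_exp_exp algebra_simps)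
  also have "\<dots> = (\<integral>\<^sup>+\<omega>. (\<integral>\<^sup>+\<omega>'. \<phi> (\<omega>, incr h J \<omega>') \<partial>M) \<partial>M)"
    unfolding incr_def using le by (intro nn_integral_increment) auto
  also have "\<dots> \<le> (\<integral>\<^sup>+\<omega>. ennreal (exp (\<theta> * psum h H J \<omega>)) * ennreal (exp (\<theta>\<^sup>2 * h * (c J)\<^sup>2 / 2)) \<partial>M)"
  proof (rule nn_integral_mono)
    fix \<omega> assume \<omega>: "\<omega> \<in> space M"
    have m: "incr h J \<in> borel_measurable M" using h by simp
    have "(\<integral>\<^sup>+\<omega>'. \<phi> (\<omega>, incr h J \<omega>') \<partial>M) =
       ennreal (exp (\<theta> * psum h H J \<omega>)) * (\<integral>\<^sup>+\<omega>'. ennreal (exp ((\<theta> * H J \<omega>) * incr h J \<omega>')) \<partial>M)"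
      unfolding \<phi>_def fst_conv snd_conv by (intro nn_integral_cmult) (use m in simp)
    also have "(\<integral>\<^sup>+\<omega>'. ennreal (exp ((\<theta> * H J \<omega>) * incr h J \<omega>')) \<partial>M) = ennreal (exp ((\<theta> * H J \<omega>)\<^sup>2 * h / 2))"
      unfolding incr_def using increment_mgf[OF le(2,1), of "\<theta> * H J \<omega>"] by (simp add: algebra_simps)
    also have "\<dots> \<le> ennreal (exp (\<theta>\<^sup>2 * h * (c J)\<^sup>2 / 2))"
    proof -
      have "\<bar>H J \<omega>\<bar> \<le> c J" using Suc.prems \<omega> by auto
      then have "(H J \<omega>)\<^sup>2 \<le> (c J)\<^sup>2" by (metis abs_ge_zero power2_abs power_mono)
      then have "\<theta>\<^sup>2 * h * (H J \<omega>)\<^sup>2 \<le> \<theta>\<^sup>2 * h * (c J)\<^sup>2" using h by (intro mult_left_mono) auto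
      then show ?thesis by (intro ennreal_leI) (simp add: power_mult_distrib mult_ac)
    qed
    finally show "(\<integral>\<^sup>+\<omega>'. \<phi> (\<omega>, incr h J \<omega>') \<partial>M) \<le> ennreal (exp (\<theta> * psum h H J \<omega>)) * ennreal (exp (\<theta>\<^sup>2 * h * (c J)\<^sup>2 / 2))"
      by (simp add: mult_left_mono)
  qed
  also have "\<dots> = (\<integral>\<^sup>+\<omega>. ennreal (exp (\<theta> * psum h H J \<omega>)) \<partial>M) * ennreal (exp (\<theta>\<^sup>2 * h * (c J)\<^sup>2 / 2))"
    by (intro nn_integral_multc) (use mM in simp)
  also have "\<dots> \<le> ennreal (exp (\<theta>\<^sup>2 * h * (\<Sum>k<J. (c k)\<^sup>2) / 2)) * ennreal (exp (\<theta>\<^sup>2 * h * (c J)\<^sup>2 / 2))"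
    using Suc by (intro mult_right_mono) auto
  also have "\<dots> = ennreal (exp (\<theta>\<^sup>2 * h * (\<Sum>k<Suc J. (c k)\<^sup>2) / 2))"
    by (simp add: ennreal_mult'[symmetric] mult_exp_exp algebra_simps add_divide_distrib)
  finally show ?case .
qed

lemma psum_tail:
  assumes h: "0 < h" and H: "\<And>k. k < J \<Longrightarrow> H k \<in> borel_measurable (F (real k * h))"
    and c: "\<And>k w. k < J \<Longrightarrow> w \<in> space M \<Longrightarrow> \<bar>H k w\<bar> \<le> c k"
    and v: "h * (\<Sum>k<J. (c k)\<^sup>2) \<le> v" "0 < v" and l: "0 \<le> l"
  shows "prob {w\<in>space M. l \<le> \<bar>psum h H J w\<bar>} \<le> 2 * exp (- l\<^sup>2 / (2 * v))"
proof -
  have [measurable]: "psum h H J \<in> borel_measurable M" using h H by (intro psum_measurable) auto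
  \<comment> \<open>The sign \<sigma> is 1 or -1; the two one-sided bounds produce the factor
    2.\<close>
  have one: "prob {w\<in>space M. l \<le> \<sigma> * psum h H J w} \<le> exp (- l\<^sup>2 / (2 * v))" if s: "\<sigma>\<^sup>2 = 1" for \<sigma>
  proof -
    \<comment> \<open>The minimiser of the Chernoff exponent
      \<open>- \<theta> * l + \<theta>\<^sup>2 * v / 2\<close>.\<close>
    define \<theta> where "\<theta> = l / v"
    have "emeasure M {w\<in>space M. 1 \<le> ennreal (exp (- \<theta> * l)) * ennreal (exp ((\<theta> * \<sigma>) * psum h H J w))}
       \<le> ennreal (exp (- \<theta> * l)) * (\<integral>\<^sup>+w. ennreal (exp ((\<theta> * \<sigma>) * psum h H J w)) * indicator (space M) w \<partial>M)"
      by (rule nn_integral_Markov_inequality) auto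
    also have "(\<integral>\<^sup>+w. ennreal (exp ((\<theta> * \<sigma>) * psum h H J w)) * indicator (space M) w \<partial>M) = (\<integral>\<^sup>+w. ennreal (exp ((\<theta> * \<sigma>) * psum h H J w)) \<partial>M)"
      by (intro nn_integral_cong) auto
    also have "ennreal (exp (- \<theta> * l)) * \<dots> \<le> ennreal (exp (- \<theta> * l)) * ennreal (exp ((\<theta> * \<sigma>)\<^sup>2 * h * (\<Sum>k<J. (c k)\<^sup>2) / 2))"
      by (intro mult_left_mono psum_mgf h H c) auto
    also have "\<dots> = ennreal (exp (- \<theta> * l + \<theta>\<^sup>2 * (h * (\<Sum>k<J. (c k)\<^sup>2)) / 2))"
      using s by (simp add: ennreal_mult'[symmetric] mult_exp_exp power_mult_distrib mult_ac)
    also have "\<dots> \<le> ennreal (exp (- \<theta> * l + \<theta>\<^sup>2 * v / 2))"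
      using v by (intro ennreal_leI) (simp add: mult_left_mono)
    also have "- \<theta> * l + \<theta>\<^sup>2 * v / 2 = - l\<^sup>2 / (2 * v)"
      using v by (simp add: \<theta>_def field_simps power2_eq_square)
    finally have "emeasure M {w\<in>space M. 1 \<le> ennreal (exp (- \<theta> * l)) * ennreal (exp ((\<theta> * \<sigma>) * psum h H J w))} \<le> ennreal (exp (- l\<^sup>2 / (2 * v)))" .
    moreover have "{w\<in>space M. l \<le> \<sigma> * psum h H J w} \<subseteq> {w\<in>space M. 1 \<le> ennreal (exp (- \<theta> * l)) * ennreal (exp ((\<theta> * \<sigma>) * psum h H J w))}"
    proof safe
      fix w assume "l \<le> \<sigma> * psum h H J w"
      moreover have "\<theta> \<ge> 0" using l v by (simp add: \<theta>_def)
      ultimately have "\<theta> * l \<le> \<theta> * (\<sigma> * psum h H J w)" by (rule mult_left_mono)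
      then show "1 \<le> ennreal (exp (- \<theta> * l)) * ennreal (exp ((\<theta> * \<sigma>) * psum h H J w))"
        by (simp add: ennreal_mult'[symmetric] mult_exp_exp mult_ac)
    qed
    moreover have XX: "{w\<in>space M. 1 \<le> ennreal (exp (- \<theta> * l)) * ennreal (exp ((\<theta> * \<sigma>) * psum h H J w))} \<in> sets M"
      by measurable
    ultimately have "emeasure M {w\<in>space M. l \<le> \<sigma> * psum h H J w} \<le> ennreal (exp (- l\<^sup>2 / (2 * v)))"
      using order_trans[OF emeasure_mono] XX by blast
    then show ?thesis by (simp add: emeasure_eq_measure)
  qed
  have "prob {w\<in>space M. l \<le> \<bar>psum h H J w\<bar>} \<le> prob ({w\<in>space M. l \<le> 1 * psum h H J w} \<union> {w\<in>space M. l \<le> (-1) * psum h H J w})"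
    by (intro finite_measure_mono) auto
  also have "\<dots> \<le> prob {w\<in>space M. l \<le> 1 * psum h H J w} + prob {w\<in>space M. l \<le> (-1) * psum h H J w}"
    by (intro measure_Un_le) auto
  also have "\<dots> \<le> 2 * exp (- l\<^sup>2 / (2 * v))" using one[of 1] one[of "-1"] by simp
  finally show ?thesis .
qed

text \<open>Stopping: \<open>G\<close> follows \<open>H\<close> as long as the bounds
  \<open>c\<close> hold and the sum is below \<open>l\<close>, and is 0 from then on. Its sum is
  thus frozen at the first passage, and \<open>psum_tail\<close> for \<open>G\<close> at the final
  index controls a passage at any earlier index. The bounds on \<open>H\<close> are asked for only
  along the path before the passage, so that \<open>H\<close> itself may be unbounded.\<close>

lemma psum_maximal:
  assumes h: "0 < h" and H: "\<And>k. k < J \<Longrightarrow> H k \<in> borel_measurable (F (real k * h))"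
    and v: "h * (\<Sum>k<J. (c k)\<^sup>2) \<le> v" "0 < v" and l: "0 < l" and c0: "\<And>k. 0 \<le> c k"
  shows "prob {w\<in>space M. \<exists>k\<le>J. l \<le> \<bar>psum h H k w\<bar> \<and> (\<forall>i<k. \<bar>H i w\<bar> \<le> c i)} \<le> 2 * exp (- l\<^sup>2 / (2 * v))"
proof -
  have mH: "H i \<in> borel_measurable (F (real k * h))" if "i \<le> k" "i < J" for i k
    using that h by (intro measurable_F_mono[OF _ H] mult_right_mono) auto
  have mP: "psum h H i \<in> borel_measurable (F (real k * h))" if "i \<le> k" "i \<le> J" for i k
    using that h by (intro psum_measurable_F) (auto intro: H)
  define G where "G k w = (if (\<forall>i\<in>{..k}. \<bar>H i w\<bar> \<le> c i) \<and> (\<forall>i\<in>{..k}. \<bar>psum h H i w\<bar> < l) then H k w else 0)" for k w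
  have mG: "G k \<in> borel_measurable (F (real k * h))" if k: "k < J" for k
  proof -
    have [measurable]: "H i \<in> borel_measurable (F (real k * h))" "psum h H i \<in> borel_measurable (F (real k * h))"
      if "i \<in> {..k}" for i using that k by (auto intro!: mH mP)
    have [measurable]: "H k \<in> borel_measurable (F (real k * h))" using k by (auto intro: H)
    show ?thesis unfolding G_def[abs_def] by measurable
  qed
  have "prob {w\<in>space M. l \<le> \<bar>psum h G J w\<bar>} \<le> 2 * exp (- l\<^sup>2 / (2 * v))"
    using c0 l by (intro psum_tail[OF h mG _ v]) (auto simp: G_def)
  moreover have "prob {w\<in>space M. \<exists>k\<le>J. l \<le> \<bar>psum h H k w\<bar> \<and> (\<forall>i<k. \<bar>H i w\<bar> \<le> c i)} \<le> prob {w\<in>space M. l \<le> \<bar>psum h G J w\<bar>}"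
  proof (rule finite_measure_mono)
    show "{w\<in>space M. l \<le> \<bar>psum h G J w\<bar>} \<in> events"
      using psum_measurable[of h J G, OF less_imp_le[OF h] mG] by simp
    show "{w\<in>space M. \<exists>k\<le>J. l \<le> \<bar>psum h H k w\<bar> \<and> (\<forall>i<k. \<bar>H i w\<bar> \<le> c i)} \<subseteq> {w\<in>space M. l \<le> \<bar>psum h G J w\<bar>}"
    proof safe
      fix w k assume k: "k \<le> J" "l \<le> \<bar>psum h H k w\<bar>" "\<forall>i<k. \<bar>H i w\<bar> \<le> c i"
      define m where "m = (LEAST k. l \<le> \<bar>psum h H k w\<bar>)"
      have m: "l \<le> \<bar>psum h H m w\<bar>" "m \<le> k" unfolding m_def using k(2) by (auto intro: LeastI Least_le)
      have m': "\<bar>psum h H i w\<bar> < l" if "i < m" for i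
        using not_less_Least[of i "\<lambda>k. l \<le> \<bar>psum h H k w\<bar>"] that by (simp add: m_def)
      have "psum h G J w = (\<Sum>i<m. G i w * incr h i w) + (\<Sum>i\<in>{m..<J}. G i w * incr h i w)"
        unfolding psum_def using m k by (subst sum.union_disjoint[symmetric]) (auto intro!: sum.cong)
      also have "(\<Sum>i\<in>{m..<J}. G i w * incr h i w) = 0"
      proof (intro sum.neutral ballI)
        fix i assume "i \<in> {m..<J}"
        then have "\<not> (\<forall>j\<in>{..i}. \<bar>psum h H j w\<bar> < l)" using m(1) by (auto simp: not_less)
        then have "G i w = 0" unfolding G_def by argo
        then show "G i w * incr h i w = 0" by simp
      qed
      also have "(\<Sum>i<m. G i w * incr h i w) = psum h H m w"
        unfolding psum_def using m m' k by (intro sum.cong) (auto simp: G_def)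
      finally show "l \<le> \<bar>psum h G J w\<bar>" using m by simp
    qed
  qed
  ultimately show ?thesis by linarith
qed

end

section \<open>Exit estimates for integrals of square roots\<close>

context prob_space
begin

definition conv_prob :: "(nat \<Rightarrow> 'a \<Rightarrow> real) \<Rightarrow> bool" where
  "conv_prob Z \<longleftrightarrow> (\<forall>\<epsilon>>0. (\<lambda>n. prob {w\<in>space M. \<epsilon> < \<bar>Z n w\<bar>}) \<longlonglongrightarrow> 0)"

lemma conv_probD: "conv_prob Z \<Longrightarrow> 0 < \<epsilon> \<Longrightarrow> (\<lambda>n. prob {w\<in>space M. \<epsilon> < \<bar>Z n w\<bar>}) \<longlonglongrightarrow> 0"
  by (auto simp: conv_prob_def)

lemma conv_prob_add:
  assumes [measurable]: "\<And>n. Z n \<in> borel_measurable M" "\<And>n. W n \<in> borel_measurable M"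
    and Z: "conv_prob Z" and W: "conv_prob W"
  shows "conv_prob (\<lambda>n w. Z n w + W n w)"
  unfolding conv_prob_def
proof (intro allI impI)
  fix \<epsilon> :: real assume e: "\<epsilon> > 0"
  have "(\<lambda>n. prob {w\<in>space M. \<epsilon>/2 < \<bar>Z n w\<bar>} + prob {w\<in>space M. \<epsilon>/2 < \<bar>W n w\<bar>}) \<longlonglongrightarrow> 0 + 0"
    using e by (intro tendsto_add conv_probD Z W) auto
  moreover have "prob {w\<in>space M. \<epsilon> < \<bar>Z n w + W n w\<bar>} \<le> prob {w\<in>space M. \<epsilon>/2 < \<bar>Z n w\<bar>} + prob {w\<in>space M. \<epsilon>/2 < \<bar>W n w\<bar>}" for n
  proof -
    have "prob {w\<in>space M. \<epsilon> < \<bar>Z n w + W n w\<bar>} \<le> prob ({w\<in>space M. \<epsilon>/2 < \<bar>Z n w\<bar>} \<union> {w\<in>space M. \<epsilon>/2 < \<bar>W n w\<bar>})"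
      by (intro finite_measure_mono) auto
    also have "\<dots> \<le> prob {w\<in>space M. \<epsilon>/2 < \<bar>Z n w\<bar>} + prob {w\<in>space M. \<epsilon>/2 < \<bar>W n w\<bar>}"
      by (intro measure_Un_le) auto
    finally show ?thesis .
  qed
  ultimately show "(\<lambda>n. prob {w\<in>space M. \<epsilon> < \<bar>Z n w + W n w\<bar>}) \<longlonglongrightarrow> 0"
    by (rule_tac tendsto_sandwich[OF _ _ tendsto_const]) auto
qed

lemma conv_prob_minus: "conv_prob Z \<Longrightarrow> conv_prob (\<lambda>n w. - Z n w)"
  by (simp add: conv_prob_def)

lemma prob_tendsto_zero:
  assumes [measurable]: "\<And>n. A n \<in> events" and ev: "\<And>w. w \<in> space M \<Longrightarrow> eventually (\<lambda>n. w \<notin> A n) sequentially"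
  shows "(\<lambda>n. prob (A n)) \<longlonglongrightarrow> 0"
proof -
  have "(\<lambda>n. \<integral>w. indicat_real (A n) w \<partial>M) \<longlonglongrightarrow> (\<integral>w. 0 \<partial>M)"
  proof (rule integral_dominated_convergence[where w="\<lambda>_. 1"])
    show "AE w in M. (\<lambda>n. indicat_real (A n) w) \<longlonglongrightarrow> 0"
    proof (intro AE_I2 tendsto_eventually)
      fix w assume "w \<in> space M"
      from ev[OF this] show "eventually (\<lambda>n. indicat_real (A n) w = 0) sequentially"
        by (rule eventually_mono) simp
    qed
  qed (auto intro!: AE_I2 simp: indicator_def)
  then show ?thesis by simp
qed

end

text \<open>Common frame for Y driven by W and for S driven by B: in both cases \<open>N\<close> is
  half of what remains after the initial value and the drift are subtracted. The drift is left open;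
  it enters later only through the implication that a large \<open>\<bar>X\<bar>\<close> forces a
  large \<open>\<bar>N\<bar>\<close>.\<close>

locale sqrt_integral = brownian M F B for M :: "'a measure" and F B +
  fixes X N :: "real \<Rightarrow> 'a \<Rightarrow> real"
  assumes X_adapted: "adapted_proc F X" and X_cont: "continuous_paths M X"
    and N_cont: "continuous_paths M N" and N_meas: "\<And>t. 0 \<le> t \<Longrightarrow> N t \<in> borel_measurable M"
    and ito: "\<And>t. 0 \<le> t \<Longrightarrow> \<exists>I. is_ito_integral M (\<lambda>s w. sqrt \<bar>X s w\<bar>) B t I \<and> (AE w in M. N t w = I w)"
begin

abbreviation (input) H :: "real \<Rightarrow> 'a \<Rightarrow> real" where "H s w \<equiv> sqrt \<bar>X s w\<bar>"

lemma X_measurable_F: "0 \<le> s \<Longrightarrow> s \<le> t \<Longrightarrow> X s \<in> borel_measurable (F t)"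
  using X_adapted measurable_F_mono[of s t "X s" borel] by (auto simp: adapted_proc_def)

lemma X_measurable: "0 \<le> s \<Longrightarrow> X s \<in> borel_measurable M"
  using X_measurable_F measurable_F_le by blast

lemma H_measurable_F: "0 \<le> s \<Longrightarrow> s \<le> t \<Longrightarrow> H s \<in> borel_measurable (F t)"
  using X_measurable_F[of s t] by measurable

definition R :: "real \<Rightarrow> nat \<Rightarrow> 'a \<Rightarrow> real" where
  "R h J = psum h (\<lambda>k. H (real k * h)) J"

lemma R_measurable [measurable]: "0 \<le> h \<Longrightarrow> R h J \<in> borel_measurable M"
  unfolding R_def by (intro psum_measurable H_measurable_F) auto

text \<open>The sums in \<open>ito_sum\<close> at time \<open>j / 2^m\<close> have mesh
  \<open>j / 2^(m+n)\<close>, which depends on the end time, whereas \<open>R\<close> uses one mesh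
  for all end times. The difference is the discrete integral of the oscillation \<open>d\<close> of
  the integrand over blocks of \<open>j\<close> cells, and this oscillation is small by uniform
  continuity of the path.\<close>

lemma R_conv_N_aux:
  fixes j m :: nat
  assumes j: "0 < j"
  defines "h \<equiv> \<lambda>n. 1 / 2 ^ (m + n) :: real"
  defines "d \<equiv> \<lambda>n l \<omega>. H (real (l div j * j) * h n) \<omega> - H (real l * h n) \<omega>"
  shows "ito_sum H B (real j / 2^m) n \<omega> - R (h n) (j * 2^n) \<omega> = psum (h n) (d n) (j * 2^n) \<omega>"
    and "conv_prob (\<lambda>n. psum (h n) (d n) (j * 2^n))"
proof -
  have hp: "h n > 0" for n by (simp add: h_def)
  have tk: "real k * (real j / 2^m) / 2^n = real (k * j) * h n" for k n
    by (simp add: h_def power_add)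
  have "ito_sum H B (real j / 2^m) n \<omega> = (\<Sum>k<2^n. H (real (k * j) * h n) \<omega> * (B (real (Suc k * j) * h n) \<omega> - B (real (k * j) * h n) \<omega>))"
    unfolding ito_sum_def tk ..
  also have "\<dots> = (\<Sum>k<2^n. \<Sum>i\<in>{k*j..<k*j+j}. H (real (i div j * j) * h n) \<omega> * incr (h n) i \<omega>)"
  proof (intro sum.cong refl)
    fix k
    have "(\<Sum>i\<in>{k*j..<k*j+j}. H (real (i div j * j) * h n) \<omega> * incr (h n) i \<omega>) = (\<Sum>i\<in>{k*j..<k*j+j}. H (real (k * j) * h n) \<omega> * incr (h n) i \<omega>)"
    proof (intro sum.cong refl)
      fix i assume i: "i \<in> {k*j..<k*j+j}"
      then have "i div j = k" using j by (intro div_nat_eqI) (auto simp: mult.commute)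
      then show "H (real (i div j * j) * h n) \<omega> * incr (h n) i \<omega> = H (real (k * j) * h n) \<omega> * incr (h n) i \<omega>" by simp
    qed
    also have "\<dots> = H (real (k * j) * h n) \<omega> * (\<Sum>i\<in>{k*j..<k*j+j}. incr (h n) i \<omega>)" by (simp add: sum_distrib_left)
    also have "(\<Sum>i\<in>{k*j..<k*j+j}. incr (h n) i \<omega>) = B (real (k*j+j) * h n) \<omega> - B (real (k*j) * h n) \<omega>"
      unfolding incr_def by (rule sum_Suc_diff'[of "k*j" "k*j+j" "\<lambda>i. B (real i * h n) \<omega>"]) simp
    finally show "H (real (k * j) * h n) \<omega> * (B (real (Suc k * j) * h n) \<omega> - B (real (k * j) * h n) \<omega>)
      = (\<Sum>i\<in>{k*j..<k*j+j}. H (real (i div j * j) * h n) \<omega> * incr (h n) i \<omega>)"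
      by (simp add: add.commute)
  qed
  also have "\<dots> = (\<Sum>i<2^n * j. H (real (i div j * j) * h n) \<omega> * incr (h n) i \<omega>)"
    by (rule sum.nat_group)
  finally show "ito_sum H B (real j / 2^m) n \<omega> - R (h n) (j * 2^n) \<omega> = psum (h n) (d n) (j * 2^n) \<omega>"
    by (simp add: R_def psum_def d_def sum_subtractf algebra_simps mult.commute)
next
  have hp: "h n > 0" for n by (simp add: h_def)
  have md: "d n l \<in> borel_measurable (F (real l * h n))" for n l
    unfolding d_def using hp[of n] of_nat_mono[OF div_times_less_eq_dividend[of l j], where 'a=real]
    by (intro borel_measurable_diff H_measurable_F mult_right_mono mult_nonneg_nonneg) (auto simp del: of_nat_mult)
  have md'[measurable]: "d n l \<in> borel_measurable M" for n l
    using md measurable_F_le by blast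
  define T where "T = real j / 2^m"
  have T: "T > 0" using j by (simp add: T_def)
  have hT: "real (j * 2^n) * h n = T" for n by (simp add: h_def T_def power_add)
  have mp[measurable]: "psum (h n) (d n) (j * 2^n) \<in> borel_measurable M" for n
    using hp[of n] by (intro psum_measurable md) auto
  define E where "E \<epsilon> n = {\<omega>\<in>space M. \<exists>l\<in>{..<j*2^n}. \<epsilon> < \<bar>d n l \<omega>\<bar>}" for \<epsilon> n
  have mE[measurable]: "E \<epsilon> n \<in> events" for \<epsilon> n unfolding E_def by measurable
  have E0: "(\<lambda>n. prob (E \<epsilon> n)) \<longlonglongrightarrow> 0" if e: "\<epsilon> > 0" for \<epsilon>
  proof (rule prob_tendsto_zero[OF mE])
    fix \<omega> assume w: "\<omega> \<in> space M"
    have "continuous_on {0..T} (\<lambda>s. X s \<omega>)"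
      using X_cont w by (auto simp: continuous_paths_def intro: continuous_on_subset)
    then have "continuous_on {0..T} (\<lambda>s. H s \<omega>)"
      by (intro continuous_intros)
    then have "uniformly_continuous_on {0..T} (\<lambda>s. H s \<omega>)"
      by (intro compact_uniformly_continuous) auto
    then obtain \<delta> where d: "\<delta> > 0" "\<And>u v. u \<in> {0..T} \<Longrightarrow> v \<in> {0..T} \<Longrightarrow> dist u v < \<delta> \<Longrightarrow> dist (H u \<omega>) (H v \<omega>) < \<epsilon>"
      using e unfolding uniformly_continuous_on_def by metis
    have "(\<lambda>n. real j * h n) \<longlonglongrightarrow> 0"
      unfolding h_def power_add by real_asymp
    then have "eventually (\<lambda>n. real j * h n < \<delta>) sequentially"
      using d(1) by (rule order_tendstoD)
    then show "eventually (\<lambda>n. \<omega> \<notin> E \<epsilon> n) sequentially"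
    proof eventually_elim
      case (elim n)
      have "\<bar>d n l \<omega>\<bar> \<le> \<epsilon>" if l: "l < j*2^n" for l
      proof -
        have le: "l div j * j \<le> l" by simp
        have up: "l < l div j * j + j" using j
          by (metis add.commute add_less_cancel_left div_mult_mod_eq mod_less_divisor)
        have in1: "real l * h n \<in> {0..T}" "real (l div j * j) * h n \<in> {0..T}"
        proof -
          have "real l \<le> real (j * 2^n)" "real (l div j * j) \<le> real (j * 2^n)"
            using l le by (simp_all only: of_nat_le_iff)
          then have "real l * h n \<le> T" "real (l div j * j) * h n \<le> T"
            unfolding hT[of n, symmetric] using hp[of n] by (simp_all only: mult_right_mono less_imp_le)
          then show "real l * h n \<in> {0..T}" "real (l div j * j) * h n \<in> {0..T}"
            using hp[of n] by auto
        qed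
        have "dist (real (l div j * j) * h n) (real l * h n) = (real l - real (l div j * j)) * h n"
          using hp[of n] le by (simp add: dist_real_def left_diff_distrib[symmetric] abs_mult del: of_nat_mult)
        also have "\<dots> \<le> real j * h n" using up hp[of n] by (intro mult_right_mono) linarith+
        also have "\<dots> < \<delta>" by fact
        finally show ?thesis using d(2)[OF in1(2,1)] by (simp add: d_def dist_real_def del: of_nat_mult)
      qed
      then show ?case by (auto simp: E_def not_less)
    qed
  qed
  \<comment> \<open>Off \<open>E \<epsilon> n\<close> the integrand stays within \<epsilon>, so the
    maximal inequality holds with variance \<open>\<epsilon>\<^sup>2 * T\<close>. Below, \<epsilon>
    is fixed first and n is sent to infinity afterwards.\<close>
  have bd: "prob {\<omega>\<in>space M. b < \<bar>psum (h n) (d n) (j * 2^n) \<omega>\<bar>} \<le> prob (E \<epsilon> n) + 2 * exp (- b\<^sup>2 / (2 * (\<epsilon>\<^sup>2 * T)))"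
    if e: "\<epsilon> > 0" and l: "b > 0" for \<epsilon> b n
  proof -
    let ?A = "{\<omega>\<in>space M. \<exists>k\<le>j*2^n. b \<le> \<bar>psum (h n) (d n) k \<omega>\<bar> \<and> (\<forall>i<k. \<bar>d n i \<omega>\<bar> \<le> \<epsilon>)}"
    have [measurable]: "psum (h n) (d n) k \<in> borel_measurable M" for k
      using hp[of n] by (intro psum_measurable md) auto
    have mA[measurable]: "?A \<in> events" by measurable
    have "prob {\<omega>\<in>space M. b < \<bar>psum (h n) (d n) (j * 2^n) \<omega>\<bar>} \<le> prob (E \<epsilon> n \<union> ?A)"
    proof (rule finite_measure_mono[OF subsetI])
      fix \<omega> assume w: "\<omega> \<in> {\<omega>\<in>space M. b < \<bar>psum (h n) (d n) (j * 2^n) \<omega>\<bar>}"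
      show "\<omega> \<in> E \<epsilon> n \<union> ?A"
      proof (cases "\<omega> \<in> E \<epsilon> n")
        case False
        then have "\<forall>i<j*2^n. \<bar>d n i \<omega>\<bar> \<le> \<epsilon>" using w by (auto simp: E_def not_less)
        then show ?thesis using w by (auto intro!: exI[of _ "j*2^n"])
      qed simp
    qed measurable
    also have "\<dots> \<le> prob (E \<epsilon> n) + prob ?A" by (intro measure_Un_le) auto
    also have "prob ?A \<le> 2 * exp (- b\<^sup>2 / (2 * (\<epsilon>\<^sup>2 * T)))"
      using hp[of n] md e l T hT[of n] by (intro psum_maximal[where c="\<lambda>_. \<epsilon>"]) (auto simp: mult_ac)
    finally show ?thesis by simp
  qed
  show "conv_prob (\<lambda>n. psum (h n) (d n) (j * 2^n))"
    unfolding conv_prob_def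
  proof (intro allI impI)
    fix b :: real assume l: "b > 0"
    show "(\<lambda>n. prob {\<omega>\<in>space M. b < \<bar>psum (h n) (d n) (j * 2^n) \<omega>\<bar>}) \<longlonglongrightarrow> 0"
    proof (rule tendstoI)
      fix r :: real assume r: "r > 0"
      have "((\<lambda>\<epsilon>. 2 * exp (- b\<^sup>2 / (2 * (\<epsilon>\<^sup>2 * T)))) \<longlongrightarrow> 0) (at_right 0)"
        using l T by real_asymp
      then have "eventually (\<lambda>\<epsilon>. 2 * exp (- b\<^sup>2 / (2 * (\<epsilon>\<^sup>2 * T))) < r/2) (at_right 0)"
        using r by (intro order_tendstoD) auto
      then have "eventually (\<lambda>\<epsilon>. 0 < \<epsilon> \<and> 2 * exp (- b\<^sup>2 / (2 * (\<epsilon>\<^sup>2 * T))) < r/2) (at_right 0)"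
        by (intro eventually_conj eventually_at_right_less)
      then obtain \<epsilon> where e: "\<epsilon> > 0" "2 * exp (- b\<^sup>2 / (2 * (\<epsilon>\<^sup>2 * T))) < r/2"
        using eventually_happens' trivial_limit_at_right_real by blast
      have "eventually (\<lambda>n. prob (E \<epsilon> n) < r/2) sequentially"
        using E0[OF e(1)] r by (intro order_tendstoD) auto
      then show "eventually (\<lambda>n. dist (prob {\<omega>\<in>space M. b < \<bar>psum (h n) (d n) (j * 2^n) \<omega>\<bar>}) 0 < r) sequentially"
      proof eventually_elim
        case (elim n)
        then show ?case using bd[OF e(1) l, of n] e(2) by (simp add: dist_real_def)
      qed
    qed
  qed
qed

text \<open>At time 0 all left-point sums vanish, hence so does their limit in probability. This is
  how the initial value of Y is recovered.\<close>

lemma N_zero: "AE w in M. N 0 w = 0"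
proof -
  obtain I where I: "is_ito_integral M H B 0 I" "AE w in M. N 0 w = I w" using ito[of 0] by auto
  have [measurable]: "I \<in> borel_measurable M" using I by (auto simp: is_ito_integral_def)
  have "ito_sum H B 0 n w = 0" for n w by (simp add: ito_sum_def)
  then have "prob {w\<in>space M. \<epsilon> < \<bar>I w\<bar>} = 0" if "\<epsilon> > 0" for \<epsilon>
    using I(1) that unfolding is_ito_integral_def by (auto simp: LIMSEQ_const_iff)
  then have "AE w in M. \<not> (1 / Suc n < \<bar>I w\<bar>)" for n
    by (subst AE_iff_measurable[OF _ refl]) (auto simp: emeasure_eq_measure)
  then have "AE w in M. \<forall>n. \<not> (1 / Suc n < \<bar>I w\<bar>)" by (simp add: AE_all_countable)
  with I(2) show ?thesis
  proof eventually_elim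
    case (elim w)
    then have "\<not> 0 < \<bar>I w\<bar>" using nat_approx_posE by (metis )
    then show ?case using elim by simp
  qed
qed

lemma R_conv_N:
  "conv_prob (\<lambda>n w. R (1 / 2^(m+n)) (j * 2^n) w - N (real j / 2^m) w)"
proof (cases "j = 0")
  case True
  have [measurable]: "N 0 \<in> borel_measurable M" by (rule N_meas) simp
  have "prob {w\<in>space M. \<epsilon> < \<bar>N 0 w\<bar>} = 0" if "\<epsilon> > 0" for \<epsilon>
    using N_zero that by (subst prob_eq_0) (auto elim!: eventually_mono)
  then show ?thesis using True by (auto simp: conv_prob_def R_def psum_def)
next
  case False
  let ?t = "real j / 2^m"
  let ?d = "\<lambda>n l w. H (real (l div j * j) * (1 / 2^(m+n))) w - H (real l * (1 / 2^(m+n))) w"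
  obtain I where I: "is_ito_integral M H B ?t I" "AE w in M. N ?t w = I w" using ito[of ?t] by auto
  have [measurable]: "I \<in> borel_measurable M" using I by (auto simp: is_ito_integral_def)
  have [measurable]: "N ?t \<in> borel_measurable M" by (rule N_meas) simp
  have mi[measurable]: "ito_sum H B ?t n \<in> borel_measurable M" for n
    unfolding ito_sum_def[abs_def]
    by (intro borel_measurable_sum borel_measurable_times borel_measurable_diff B_measurable_M measurable_F_le[OF H_measurable_F[OF _ order_refl]]) auto
  have c1: "conv_prob (\<lambda>n w. ito_sum H B ?t n w - I w)"
    using I(1) by (auto simp: conv_prob_def is_ito_integral_def)
  have eq: "psum (1 / 2^(m+n)) (?d n) (j * 2^n) = (\<lambda>w. ito_sum H B ?t n w - R (1 / 2^(m+n)) (j * 2^n) w)" for n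
    using R_conv_N_aux(1)[of j m n] False by auto
  have c2: "conv_prob (\<lambda>n w. ito_sum H B ?t n w - R (1 / 2^(m+n)) (j * 2^n) w)"
    using R_conv_N_aux(2)[of j m] False unfolding eq by auto
  have c3: "conv_prob (\<lambda>n w. I w - N ?t w)"
  proof -
    have "prob {w\<in>space M. \<epsilon> < \<bar>I w - N ?t w\<bar>} = 0" if "\<epsilon> > 0" for \<epsilon>
      using I(2) that by (subst prob_eq_0) (auto elim!: eventually_mono)
    then show ?thesis by (auto simp: conv_prob_def)
  qed
  have "conv_prob (\<lambda>n w. (ito_sum H B ?t n w - I w) + - (ito_sum H B ?t n w - R (1 / 2^(m+n)) (j * 2^n) w) + (I w - N ?t w))"
    by (intro conv_prob_add c1 c3 conv_prob_minus[OF c2]) auto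
  then show ?thesis by simp
qed

text \<open>Only countably many times enter, which makes the event measurable; by path continuity it contains the
  event that N leaves \<open>[-l, l]\<close> before time T while \<open>\<bar>X\<bar> \<le> K\<close>.\<close>

definition bad :: "real \<Rightarrow> real \<Rightarrow> real \<Rightarrow> 'a set" where
  "bad T K l = {w\<in>space M. \<exists>m j. real j / 2^m \<le> T \<and> l < \<bar>N (real j / 2^m) w\<bar> \<and>
      (\<forall>n i. real i / 2^n \<le> real j / 2^m \<longrightarrow> \<bar>X (real i / 2^n) w\<bar> \<le> K)}"

lemma N_dyadic_measurable [measurable]: "N (real j / 2^m) \<in> borel_measurable M"
  by (rule N_meas) simp

lemma X_dyadic_measurable [measurable]: "X (real j / 2^m) \<in> borel_measurable M"
  by (rule X_measurable) simp

lemma bad_measurable [measurable]: "bad T K l \<in> events"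
  unfolding bad_def by measurable

text \<open>As long as \<open>\<bar>X\<bar> \<le> K\<close>, the quadratic variation of
  \<open>N\<close> up to \<open>T\<close> is at most \<open>K * T\<close>, which is the variance in
  the maximal inequality. The sums are only asked to reach \<open>l/2\<close>, the other half being
  left to convergence in probability; hence the constant 8.\<close>

lemma prob_bad:
  assumes T: "0 < T" and K: "0 < K" and l: "0 < l"
  shows "prob (bad T K l) \<le> 2 * exp (- l\<^sup>2 / (8 * K * T))"
proof -
  \<comment> \<open>At a fixed level \<open>m\<close> only finitely many times
    \<open>j / 2^m\<close> are tested, so convergence in probability can be used for all of them at
    once. The bound on \<open>X\<close> still ranges over all levels, because the sums of mesh
    \<open>1 / 2^(m+n)\<close> see the finer times.\<close>
  define E where "E m = {\<omega>\<in>space M. \<exists>j. real j / 2^m \<le> T \<and> l < \<bar>N (real j / 2^m) \<omega>\<bar> \<and>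
      (\<forall>n i. real i / 2^n \<le> real j / 2^m \<longrightarrow> \<bar>X (real i / 2^n) \<omega>\<bar> \<le> K)}" for m
  have mE[measurable]: "E m \<in> events" for m unfolding E_def by measurable
  have inc: "incseq E"
  proof (rule incseq_SucI, rule subsetI)
    fix m \<omega> assume "\<omega> \<in> E m"
    then obtain j where w: "\<omega> \<in> space M" and j: "real j / 2^m \<le> T" "l < \<bar>N (real j / 2^m) \<omega>\<bar>"
      "(\<forall>n i. real i / 2^n \<le> real j / 2^m \<longrightarrow> \<bar>X (real i / 2^n) \<omega>\<bar> \<le> K)" by (auto simp: E_def)
    have "real j / 2^m = real (2*j) / 2^Suc m" by simp
    with w j show "\<omega> \<in> E (Suc m)" unfolding E_def mem_Collect_eq
      by - (intro conjI exI[of _ "2*j"], simp_all only:)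
  qed
  have Em: "prob (E m) \<le> 2 * exp (- l\<^sup>2 / (8 * K * T))" for m
  proof -
    define J where "J = {j. real j / 2^m \<le> T}"
    have "J \<subseteq> {..nat \<lceil>T * 2^m\<rceil>}"
      by (auto simp: J_def field_simps) linarith
    then have fJ: "finite J" by (rule finite_subset) simp
    define P where "P n = (\<Sum>j\<in>J. prob {\<omega>\<in>space M. l/2 < \<bar>R (1 / 2^(m+n)) (j * 2^n) \<omega> - N (real j / 2^m) \<omega>\<bar>})" for n
    have P0: "P \<longlonglongrightarrow> 0"
      unfolding P_def using l by (intro tendsto_null_sum conv_probD[OF R_conv_N]) auto
    have bound: "prob (E m) \<le> P n + 2 * exp (- l\<^sup>2 / (8 * K * T))" for n
    proof -
      define h where "h = (1 / 2^(m+n) :: real)"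
      have h: "h > 0" by (simp add: h_def)
      define Z where "Z = nat \<lfloor>T / h\<rfloor>"
      let ?A = "{\<omega>\<in>space M. \<exists>k\<le>Z. l/2 \<le> \<bar>psum h (\<lambda>k. H (real k * h)) k \<omega>\<bar> \<and> (\<forall>i<k. \<bar>H (real i * h) \<omega>\<bar> \<le> sqrt K)}"
      let ?C = "\<lambda>j. {\<omega>\<in>space M. l/2 < \<bar>R (1 / 2^(m+n)) (j * 2^n) \<omega> - N (real j / 2^m) \<omega>\<bar>}"
      have Hm: "(\<lambda>\<omega>. H (real k * h) \<omega>) \<in> borel_measurable (F (real k * h))" for k
        using h by (intro H_measurable_F) auto
      have [measurable]: "psum h (\<lambda>k. H (real k * h)) k \<in> borel_measurable M" for k
        using h Hm by (intro psum_measurable) auto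
      have [measurable]: "(\<lambda>\<omega>. H (real k * h) \<omega>) \<in> borel_measurable M" for k
        using Hm by (rule measurable_F_le)
      have "E m \<subseteq> (\<Union>j\<in>J. ?C j) \<union> ?A"
      proof (rule subsetI, rule ccontr)
        fix \<omega> assume "\<omega> \<in> E m" and no: "\<omega> \<notin> (\<Union>j\<in>J. ?C j) \<union> ?A"
        then obtain j where w: "\<omega> \<in> space M" and j: "j \<in> J" "l < \<bar>N (real j / 2^m) \<omega>\<bar>"
          and X: "\<And>n i. real i / 2^n \<le> real j / 2^m \<Longrightarrow> \<bar>X (real i / 2^n) \<omega>\<bar> \<le> K" by (auto simp: E_def J_def)
        have "\<bar>R h (j * 2^n) \<omega> - N (real j / 2^m) \<omega>\<bar> \<le> l/2" using no j w by (auto simp: h_def)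
        then have "l/2 \<le> \<bar>R h (j * 2^n) \<omega>\<bar>" using j(2) by linarith
        moreover have "j * 2^n \<le> Z"
        proof -
          have "real (j * 2^n) \<le> T / h" using j(1) by (simp add: J_def h_def field_simps power_add)
          then show ?thesis unfolding Z_def by linarith
        qed
        moreover have "\<bar>H (real i * h) \<omega>\<bar> \<le> sqrt K" if i: "i < j * 2^n" for i
        proof -
          have "real i \<le> real j * 2^n" using i by (metis less_imp_le of_nat_le_iff of_nat_mult of_nat_numeral of_nat_power)
          then have "real i / 2^(m+n) \<le> real j / 2^m" by (simp add: field_simps power_add)
          then have "\<bar>X (real i / 2^(m+n)) \<omega>\<bar> \<le> K" by (rule X)
          then show ?thesis by (simp add: h_def)
        qed
        ultimately have "\<omega> \<in> ?A" using w by (auto simp: R_def)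
        then show False using no by blast
      qed
      then have "prob (E m) \<le> prob ((\<Union>j\<in>J. ?C j) \<union> ?A)"
        by (rule finite_measure_mono) (use fJ in measurable)
      also have "\<dots> \<le> prob (\<Union>j\<in>J. ?C j) + prob ?A"
        by (rule measure_Un_le) (use fJ in measurable)
      also have "prob (\<Union>j\<in>J. ?C j) \<le> P n"
        unfolding P_def by (rule measure_UNION_le[OF fJ]) measurable
      also have "prob ?A \<le> 2 * exp (- (l/2)\<^sup>2 / (2 * (K * T)))"
      proof (rule psum_maximal[OF h Hm])
        have "real Z \<le> T / h" using h T unfolding Z_def by (intro of_nat_floor) auto
        then have "h * real Z \<le> T" using h by (simp add: field_simps)
        then show "h * (\<Sum>k<Z. (sqrt K)\<^sup>2) \<le> K * T" using K
          by (simp add: mult.commute mult.left_commute)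
      qed (use K T l in auto)
      also have "- (l/2)\<^sup>2 / (2 * (K * T)) = - l\<^sup>2 / (8 * K * T)" by (simp add: power_divide)
      finally show ?thesis by simp
    qed
    have "(\<lambda>n. P n + 2 * exp (- l\<^sup>2 / (8 * K * T))) \<longlonglongrightarrow> 0 + 2 * exp (- l\<^sup>2 / (8 * K * T))"
      by (intro tendsto_add P0 tendsto_const)
    then show ?thesis using bound by (intro LIMSEQ_le_const[of _ _ "prob (E m)"]) auto
  qed
  have "bad T K l = (\<Union>m. E m)" by (auto simp: bad_def E_def)
  moreover have "(\<lambda>m. prob (E m)) \<longlonglongrightarrow> prob (\<Union>m. E m)"
    using inc by (intro finite_Lim_measure_incseq) auto
  ultimately show ?thesis using Em by (intro LIMSEQ_le_const2[of "\<lambda>m. prob (E m)"]) auto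
qed

text \<open>Continuous paths cannot leave a level without being seen at dyadic times first.\<close>

lemma exit_bad:
  assumes w: "w \<in> space M" and x0: "\<bar>X 0 w\<bar> < K"
    and imp: "\<And>t. 0 \<le> t \<Longrightarrow> t \<le> T \<Longrightarrow> K \<le> \<bar>X t w\<bar> \<Longrightarrow> l < \<bar>N t w\<bar>"
    and ex: "0 \<le> s" "s \<le> T" "K \<le> \<bar>X s w\<bar>"
  shows "w \<in> bad T K l"
proof -
  have cX: "continuous_on {0..} (\<lambda>t. \<bar>X t w\<bar>)" and cN: "continuous_on {0..} (\<lambda>t. \<bar>N t w\<bar>)"
    using X_cont N_cont w by (auto simp: continuous_paths_def intro!: continuous_intros)
  define S where "S = {0..s} \<inter> (\<lambda>t. \<bar>X t w\<bar>) -` {K..}"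
  have "closed S" unfolding S_def
    by (intro continuous_closed_preimage continuous_on_subset[OF cX]) auto
  moreover have "s \<in> S" using ex by (auto simp: S_def)
  moreover have "bdd_below S" by (auto simp: S_def intro!: bdd_belowI[of _ 0])
  ultimately have inf: "Inf S \<in> S" by (intro closed_contains_Inf) auto
  define \<tau> where "\<tau> = Inf S"
  have t: "0 \<le> \<tau>" "\<tau> \<le> s" "K \<le> \<bar>X \<tau> w\<bar>" using inf by (auto simp: \<tau>_def S_def)
  have before: "\<bar>X u w\<bar> < K" if "0 \<le> u" "u < \<tau>" for u
  proof (rule ccontr)
    assume "\<not> ?thesis"
    then have "u \<in> S" using that t by (auto simp: S_def)
    then have "\<tau> \<le> u" unfolding \<tau>_def using \<open>bdd_below S\<close> by (intro cInf_lower)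
    then show False using that by simp
  qed
  have t0: "0 < \<tau>" using t x0 by (cases "\<tau> = 0") auto
  have "l < \<bar>N \<tau> w\<bar>" using t ex by (intro imp) auto
  moreover have "((\<lambda>t. \<bar>N t w\<bar>) \<longlongrightarrow> \<bar>N \<tau> w\<bar>) (at \<tau> within {0..})"
    using cN t0 by (simp add: continuous_on_def)
  ultimately have "eventually (\<lambda>t. l < \<bar>N t w\<bar>) (at \<tau> within {0..})" by (intro order_tendstoD)
  then obtain d where d: "d > 0" "\<And>x. 0 \<le> x \<Longrightarrow> x \<noteq> \<tau> \<Longrightarrow> dist x \<tau> < d \<Longrightarrow> l < \<bar>N x w\<bar>"
    unfolding eventually_at by auto
  \<comment> \<open>A dyadic time is sought strictly between \<open>a\<close> and \<tau>: near
    enough to \<tau> for \<open>\<bar>N\<bar> > l\<close> to hold there, and before \<tau>, so that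
    \<open>\<bar>X\<bar> < K\<close> at all earlier times.\<close>
  define a where "a = max 0 (\<tau> - d)"
  have a: "0 \<le> a" "a < \<tau>" using d t0 by (auto simp: a_def)
  obtain m where m: "1 / 2^m < \<tau> - a" using a
    using real_arch_pow_inv[of "\<tau> - a" "1/2"] by (auto simp: power_one_over)
  define j where "j = nat (\<lfloor>a * 2^m\<rfloor> + 1)"
  have jr: "real j = of_int \<lfloor>a * 2^m\<rfloor> + 1" using a by (simp add: j_def)
  have "a * 2^m < real j" "real j \<le> a * 2^m + 1" unfolding jr by linarith+
  then have j: "a < real j / 2^m" "real j / 2^m \<le> a + 1/2^m" by (simp_all add: field_simps)
  then have j': "a < real j / 2^m" "real j / 2^m < \<tau>" using m by auto
  have "l < \<bar>N (real j / 2^m) w\<bar>"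
    using j' a by (intro d(2)) (auto simp: dist_real_def a_def)
  moreover have "\<forall>n i. real i / 2^n \<le> real j / 2^m \<longrightarrow> \<bar>X (real i / 2^n) w\<bar> \<le> K"
    using j' before by (auto intro!: less_imp_le)
  moreover have "real j / 2^m \<le> T" using j' t ex by linarith
  ultimately show ?thesis using w unfolding bad_def mem_Collect_eq
    by - (intro conjI exI[of _ m] exI[of _ j])
qed

end

section \<open>Squared-Bessel processes\<close>

lemma summable_powr_exp:
  fixes c p :: real assumes "0 < c"
  shows "summable (\<lambda>k. (real k + 1) powr p * exp (- c * real k))"
proof (rule summable_comparison_test_bigo)
  show "summable (\<lambda>k. norm (inverse (real k ^ 2)))"
    using inverse_power_summable[of 2, where 'a=real] by simp
  show "(\<lambda>k. (real k + 1) powr p * exp (- c * real k)) \<in> O(\<lambda>k. inverse (real k ^ 2))"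
    using assms by real_asymp
qed

lemma summable_power_exp:
  fixes c :: real assumes "0 < c"
  shows "summable (\<lambda>k. (real k + 1) ^ p * exp (- c * real k))"
proof -
  have "(real k + 1) ^ p = (real k + 1) powr (real p)" for k
    by (subst powr_realpow) auto
  then show ?thesis using summable_powr_exp[OF assms, of "real p"] by simp
qed

section \<open>Moments from exponential tails, and convergence of second moments\<close>

context prob_space
begin

text \<open>Layer cake with unit steps: \<open>g Z\<close> is at most \<open>g (k + 1)\<close> when
  \<open>Z\<close> lies between \<open>k\<close> and \<open>k + 1\<close>, and the probability of
  \<open>k \<le> Z\<close> is given.\<close>

lemma tail_expectation:
  fixes Z :: "'a \<Rightarrow> real" and g :: "real \<Rightarrow> real"
  assumes [measurable]: "Z \<in> borel_measurable M" "g \<in> borel_measurable borel"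
    and Z0: "\<And>\<omega>. \<omega> \<in> space M \<Longrightarrow> 0 \<le> Z \<omega>"
    and tail: "\<And>k::nat. prob {\<omega>\<in>space M. real k \<le> Z \<omega>} \<le> C * exp (- c * real k)"
    and g0: "\<And>z. 0 \<le> z \<Longrightarrow> 0 \<le> g z" and gm: "\<And>u v. 0 \<le> u \<Longrightarrow> u \<le> v \<Longrightarrow> g u \<le> g v"
    and sm: "summable (\<lambda>k. g (real k + 1) * exp (- c * real k))"
  shows "integrable M (\<lambda>\<omega>. g (Z \<omega>))"
    and "expectation (\<lambda>\<omega>. g (Z \<omega>)) \<le> C * (\<Sum>k. g (real k + 1) * exp (- c * real k))"
proof -
  have "0 \<le> C" using order_trans[OF measure_nonneg tail[of 0]] by simp
  let ?E = "\<lambda>k::nat. {\<omega>\<in>space M. real k \<le> Z \<omega>}"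
  have "(\<integral>\<^sup>+\<omega>. ennreal (g (Z \<omega>)) \<partial>M) \<le> (\<integral>\<^sup>+\<omega>. (\<Sum>k. ennreal (g (real k + 1)) * indicator (?E k) \<omega>) \<partial>M)"
  proof (rule nn_integral_mono)
    fix \<omega> assume w: "\<omega> \<in> space M"
    define k where "k = nat \<lfloor>Z \<omega>\<rfloor>"
    have k: "real k \<le> Z \<omega>" "Z \<omega> \<le> real k + 1" using Z0[OF w] unfolding k_def by linarith+
    have "ennreal (g (Z \<omega>)) \<le> (\<Sum>i\<in>{k}. ennreal (g (real i + 1)) * indicator (?E i) \<omega>)"
      using k w gm[OF Z0[OF w] k(2)] by (auto intro: ennreal_leI)
    also have "\<dots> \<le> (\<Sum>k. ennreal (g (real k + 1)) * indicator (?E k) \<omega>)"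
      by (intro sum_le_suminf) auto
    finally show "ennreal (g (Z \<omega>)) \<le> (\<Sum>k. ennreal (g (real k + 1)) * indicator (?E k) \<omega>)" .
  qed
  also have "\<dots> = (\<Sum>k. \<integral>\<^sup>+\<omega>. ennreal (g (real k + 1)) * indicator (?E k) \<omega> \<partial>M)"
    by (rule nn_integral_suminf) measurable
  also have "\<dots> = (\<Sum>k. ennreal (g (real k + 1)) * emeasure M (?E k))"
    by (intro suminf_cong nn_integral_cmult_indicator) measurable
  also have "\<dots> \<le> (\<Sum>k. ennreal (C * (g (real k + 1) * exp (- c * real k))))"
  proof (intro suminf_le allI)
    fix k
    have "ennreal (g (real k + 1)) * emeasure M (?E k) = ennreal (g (real k + 1) * prob (?E k))"
      by (simp add: emeasure_eq_measure ennreal_mult' g0)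
    also have "\<dots> \<le> ennreal (g (real k + 1) * (C * exp (- c * real k)))"
      by (intro ennreal_leI mult_left_mono tail g0) auto
    finally show "ennreal (g (real k + 1)) * emeasure M (?E k) \<le> ennreal (C * (g (real k + 1) * exp (- c * real k)))"
      by (simp add: mult_ac)
  qed auto
  also have "\<dots> = ennreal (\<Sum>k. C * (g (real k + 1) * exp (- c * real k)))"
    using \<open>0 \<le> C\<close> by (intro suminf_ennreal2 summable_mult sm) (auto intro!: mult_nonneg_nonneg g0)
  also have "(\<Sum>k. C * (g (real k + 1) * exp (- c * real k))) = C * (\<Sum>k. g (real k + 1) * exp (- c * real k))"
    by (rule suminf_mult[OF sm])
  finally have le: "(\<integral>\<^sup>+\<omega>. ennreal (g (Z \<omega>)) \<partial>M) \<le> ennreal (C * (\<Sum>k. g (real k + 1) * exp (- c * real k)))" .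
  show int: "integrable M (\<lambda>\<omega>. g (Z \<omega>))"
    using le by (intro integrableI_nonneg) (auto intro!: AE_I2 g0 Z0 simp: le_less_trans)
  have "0 \<le> C * (\<Sum>k. g (real k + 1) * exp (- c * real k))"
    using \<open>0 \<le> C\<close> by (intro mult_nonneg_nonneg suminf_nonneg sm g0) auto
  then show "expectation (\<lambda>\<omega>. g (Z \<omega>)) \<le> C * (\<Sum>k. g (real k + 1) * exp (- c * real k))"
    using le nn_integral_eq_integral[OF int] by (simp add: AE_I2 g0 Z0)
qed

text \<open>Bounded fourth moments give uniform integrability:
  \<open>z^2 \<le> \<kappa> * z^4 + 1 / (4 * \<kappa>)\<close> from the square of
  \<open>2 * \<kappa> * z^2 - 1\<close>, with the constant term counted only where
  \<open>\<bar>z\<bar> > r\<close>.\<close>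

lemma conv_prob_L2:
  assumes [measurable]: "\<And>n. Z n \<in> borel_measurable M"
    and Z: "conv_prob Z" and int: "\<And>n. integrable M (\<lambda>w. Z n w ^ 4)"
    and bd: "\<And>n. expectation (\<lambda>w. Z n w ^ 4) \<le> C"
  shows "(\<lambda>n. expectation (\<lambda>w. (Z n w)\<^sup>2)) \<longlonglongrightarrow> 0"
proof (rule tendstoI)
  fix e :: real assume e: "e > 0"
  have C: "0 \<le> C" using order_trans[OF _ bd[of 0]] by (simp add: integral_nonneg_AE)
  \<comment> \<open>The bound has three parts: \<open>e/4\<close> from small values, less than
    \<open>e/2\<close> from the fourth moment, and a multiple of a vanishing probability.\<close>
  define \<kappa> where "\<kappa> = e / (4 * (C + 1))"
  have "e * C < e * (2 * (C + 1))" using e C by (intro mult_strict_left_mono) auto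
  then have k: "\<kappa> > 0" "\<kappa> * C < e / 2" using e C by (auto simp: \<kappa>_def field_simps)
  define r where "r = sqrt (e/4)"
  have r: "r > 0" "r\<^sup>2 = e/4" using e by (auto simp: r_def)
  have "(\<lambda>n. e/4 + \<kappa> * C + prob {w\<in>space M. r < \<bar>Z n w\<bar>} / (4 * \<kappa>)) \<longlonglongrightarrow> e/4 + \<kappa> * C + 0 / (4 * \<kappa>)"
    using k by (intro tendsto_intros conv_probD[OF Z r(1)]) auto
  then have "eventually (\<lambda>n. e/4 + \<kappa> * C + prob {w\<in>space M. r < \<bar>Z n w\<bar>} / (4 * \<kappa>) < e) sequentially"
    by (rule order_tendstoD(2)) (use k e in auto)
  then show "eventually (\<lambda>n. dist (expectation (\<lambda>w. (Z n w)\<^sup>2)) 0 < e) sequentially"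
  proof eventually_elim
    case (elim n)
    have *: "(Z n w)\<^sup>2 \<le> e/4 + \<kappa> * Z n w ^ 4 + indicat_real {w\<in>space M. r < \<bar>Z n w\<bar>} w / (4 * \<kappa>)" if "w \<in> space M" for w
    proof (cases "r < \<bar>Z n w\<bar>")
      case True
      have "0 \<le> (2 * \<kappa> * (Z n w)\<^sup>2 - 1)\<^sup>2 / (4 * \<kappa>)" using k by simp
      also have "\<dots> = \<kappa> * Z n w ^ 4 + 1 / (4 * \<kappa>) - (Z n w)\<^sup>2"
        using k by (simp add: field_simps power2_eq_square power4_eq_xxxx)
      finally show ?thesis using True that e by simp
    next
      case False
      then have "(Z n w)\<^sup>2 \<le> r\<^sup>2" using r by (metis abs_ge_zero linorder_not_less power2_abs power_mono)
      then show ?thesis using False k r by (simp add: add_increasing2)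
    qed
    have i2: "integrable M (\<lambda>w. (Z n w)\<^sup>2)"
    proof (rule Bochner_Integration.integrable_bound[of _ "\<lambda>w. 1 + Z n w ^ 4"])
      show "AE w in M. norm ((Z n w)\<^sup>2) \<le> norm (1 + Z n w ^ 4)"
      proof (rule AE_I2)
        fix w
        have "0 \<le> ((Z n w)\<^sup>2 - 1)\<^sup>2 + (Z n w)\<^sup>2" by simp
        then show "norm ((Z n w)\<^sup>2) \<le> norm (1 + Z n w ^ 4)"
          by (simp add: power2_eq_square power4_eq_xxxx algebra_simps)
      qed
    qed (use int in auto)
    have "expectation (\<lambda>w. (Z n w)\<^sup>2) \<le> expectation (\<lambda>w. e/4 + \<kappa> * Z n w ^ 4 + indicat_real {w\<in>space M. r < \<bar>Z n w\<bar>} w / (4 * \<kappa>))"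
      using * by (intro integral_mono i2 Bochner_Integration.integrable_add integrable_mult_right int integrable_divide_zero)
        (auto intro!: integrable_real_indicator simp: emeasure_eq_measure)
    also have "\<dots> = e/4 + \<kappa> * expectation (\<lambda>w. Z n w ^ 4) + prob {w\<in>space M. r < \<bar>Z n w\<bar>} / (4 * \<kappa>)"
    proof -
      have "integrable M (indicat_real {w\<in>space M. r < \<bar>Z n w\<bar>})"
        by (intro integrable_real_indicator) (auto simp: emeasure_eq_measure)
      then show ?thesis using int[of n] by (simp add: prob_space)
    qed
    also have "\<dots> \<le> e/4 + \<kappa> * C + prob {w\<in>space M. r < \<bar>Z n w\<bar>} / (4 * \<kappa>)"
      using bd[of n] k by simp
    also note elim
    finally show ?case by (simp add: integral_nonneg_AE)
  qed
qed

end

section \<open>Second moments of discrete stochastic integrals\<close>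

context brownian
begin

lemma increment_moments:
  assumes st: "0 \<le> s" "s < t"
  shows "integrable M (\<lambda>w. B t w - B s w)" "expectation (\<lambda>w. B t w - B s w) = 0"
    "integrable M (\<lambda>w. (B t w - B s w)\<^sup>2)" "expectation (\<lambda>w. (B t w - B s w)\<^sup>2) = t - s"
proof -
  let ?s = "sqrt (t - s)"
  note d = increment_distributed[OF st]
  have s: "?s > 0" using st by simp
  have "integrable lborel (\<lambda>x. normal_density 0 ?s x * x)"
    using integrable_normal_moment[OF s, of 0 1] by simp
  then show "integrable M (\<lambda>w. B t w - B s w)"
    using distributed_integrable[OF d, of "\<lambda>x. x"] by simp
  show "expectation (\<lambda>w. B t w - B s w) = 0"
    using normal_distributed_expectation[OF s, of "\<lambda>w. B t w - B s w" 0] d by simp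
  have "integrable lborel (\<lambda>x. normal_density 0 ?s x * x^2)"
    using integrable_normal_moment[OF s, of 0 2] by simp
  then show "integrable M (\<lambda>w. (B t w - B s w)\<^sup>2)"
    using distributed_integrable[OF d, of "\<lambda>x. x^2"] by simp
  show "expectation (\<lambda>w. (B t w - B s w)\<^sup>2) = t - s"
    using normal_distributed_variance[OF s, of "\<lambda>w. B t w - B s w" 0] d st
      normal_distributed_expectation[OF s, of "\<lambda>w. B t w - B s w" 0]
    by simp
qed

lemma expectation_mult_increment:
  assumes st: "0 \<le> s" "s < t" and U: "U \<in> borel_measurable (F s)" "integrable M U"
  shows "integrable M (\<lambda>w. U w * (B t w - B s w))" "expectation (\<lambda>w. U w * (B t w - B s w)) = 0"
    "integrable M (\<lambda>w. U w * (B t w - B s w)\<^sup>2)" "expectation (\<lambda>w. U w * (B t w - B s w)\<^sup>2) = (t - s) * expectation U"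
proof -
  have iv: "indep_var borel U borel (\<lambda>w. B t w - B s w)"
    using st U by (intro indep_increment) auto
  have iv2: "indep_var borel U borel (\<lambda>w. (B t w - B s w)\<^sup>2)"
    using indep_var_compose[OF iv, of "\<lambda>x. x" borel "\<lambda>x. x^2" borel] by (simp add: comp_def)
  note m = increment_moments[OF st]
  show "integrable M (\<lambda>w. U w * (B t w - B s w))"
    by (rule indep_var_integrable[OF iv U(2) m(1)])
  show "expectation (\<lambda>w. U w * (B t w - B s w)) = 0"
    using indep_var_lebesgue_integral[OF iv U(2) m(1)] m by simp
  show "integrable M (\<lambda>w. U w * (B t w - B s w)\<^sup>2)"
    by (rule indep_var_integrable[OF iv2 U(2) m(3)])
  show "expectation (\<lambda>w. U w * (B t w - B s w)\<^sup>2) = (t - s) * expectation U"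
    using indep_var_lebesgue_integral[OF iv2 U(2) m(3)] m by simp
qed

text \<open>The cross terms vanish because the next increment is centred and independent of the
  past; the square integrability that gives them a meaning is carried along in the
  induction.\<close>

lemma psum_isometry:
  assumes h: "0 < h" and H: "\<And>k. k < J \<Longrightarrow> H k \<in> borel_measurable (F (real k * h))"
    and H2: "\<And>k. k < J \<Longrightarrow> integrable M (\<lambda>w. (H k w)\<^sup>2)"
  shows "integrable M (\<lambda>w. (psum h H J w)\<^sup>2)" "integrable M (psum h H J)"
    "expectation (psum h H J) = 0"
    "expectation (\<lambda>w. (psum h H J w)\<^sup>2) = h * (\<Sum>k<J. expectation (\<lambda>w. (H k w)\<^sup>2))"
  using H H2
proof (induction J)
  case 0
  { case 1 show ?case by (simp add: psum_def) }
  { case 2 show ?case by (simp add: psum_def[abs_def]) }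
  { case 3 show ?case by (simp add: psum_def[abs_def]) }
  { case 4 show ?case by (simp add: psum_def[abs_def]) }
next
  case (Suc J)
  {
    assume H: "\<And>k. k < Suc J \<Longrightarrow> H k \<in> borel_measurable (F (real k * h))"
      and H2: "\<And>k. k < Suc J \<Longrightarrow> integrable M (\<lambda>w. (H k w)\<^sup>2)"
    let ?t = "real J * h"
    have st: "0 \<le> ?t" "?t < real (Suc J) * h" using h by auto
    have mH: "H J \<in> borel_measurable (F ?t)" using H by simp
    have mP: "psum h H J \<in> borel_measurable (F ?t)" using h H by (intro psum_measurable_F) auto
    have [measurable]: "H J \<in> borel_measurable M" "psum h H J \<in> borel_measurable M"
      using mH mP measurable_F_le by blast+
    have IH: "integrable M (\<lambda>w. (psum h H J w)\<^sup>2)" "integrable M (psum h H J)" "expectation (psum h H J) = 0"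
      "expectation (\<lambda>w. (psum h H J w)\<^sup>2) = h * (\<Sum>k<J. expectation (\<lambda>w. (H k w)\<^sup>2))"
      using Suc H H2 by auto
    have i1: "integrable M (H J)"
      using H2[of J] square_integrable_imp_integrable[of "H J"] by simp
    have i2: "integrable M (\<lambda>w. psum h H J w * H J w)"
    proof (rule Bochner_Integration.integrable_bound[of _ "\<lambda>w. (psum h H J w)\<^sup>2 + (H J w)\<^sup>2"])
      show "AE w in M. norm (psum h H J w * H J w) \<le> norm ((psum h H J w)\<^sup>2 + (H J w)\<^sup>2)"
      proof (rule AE_I2)
        fix w
        have "0 \<le> (\<bar>psum h H J w\<bar> - \<bar>H J w\<bar>)\<^sup>2 + (psum h H J w)\<^sup>2 + (H J w)\<^sup>2" by simp
        then show "norm (psum h H J w * H J w) \<le> norm ((psum h H J w)\<^sup>2 + (H J w)\<^sup>2)"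
          by (simp add: power2_diff abs_mult power2_abs)
      qed
    qed (use IH H2 in auto)
    note a = expectation_mult_increment[OF st mH i1, folded incr_def]
    note b = expectation_mult_increment[OF st borel_measurable_times[OF mP mH] i2, folded incr_def]
    have mH2: "(\<lambda>w. (H J w)\<^sup>2) \<in> borel_measurable (F ?t)" using mH by measurable
    note c = expectation_mult_increment[OF st mH2 H2[OF lessI], folded incr_def]
    have e1: "psum h H (Suc J) = (\<lambda>w. psum h H J w + H J w * incr h J w)"
      by (auto simp: psum_def)
    have e2: "(psum h H (Suc J) w)\<^sup>2 = (psum h H J w)\<^sup>2 + 2 * (psum h H J w * H J w * incr h J w) + (H J w)\<^sup>2 * (incr h J w)\<^sup>2" for w
      by (simp add: e1 power2_eq_square algebra_simps)
    have "integrable M (\<lambda>w. (psum h H (Suc J) w)\<^sup>2)" "integrable M (psum h H (Suc J))"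
      "expectation (psum h H (Suc J)) = 0"
      "expectation (\<lambda>w. (psum h H (Suc J) w)\<^sup>2) = h * (\<Sum>k<Suc J. expectation (\<lambda>w. (H k w)\<^sup>2))"
      using IH a b c unfolding e2 unfolding e1 by (simp_all add: distrib_left distrib_right)
  } note * = this
  { case 1 then show ?case using * by simp }
  { case 2 then show ?case using * by simp }
  { case 3 then show ?case using * by simp }
  { case 4 then show ?case using * by simp }
qed

end

section \<open>Tail bounds for the squared-Bessel process and its martingale part\<close>

locale besq = brownian M F W for M :: "'a measure" and F W +
  fixes \<delta> y :: real and Y :: "real \<Rightarrow> 'a \<Rightarrow> real"
  assumes \<delta>_pos: "0 < \<delta>" and y_nonneg: "0 \<le> y" and is_besq: "is_BESQ M F W \<delta> y Y"
begin

definition N :: "real \<Rightarrow> 'a \<Rightarrow> real" where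
  "N t w = (Y t w - y - \<delta> * t) / 2"

sublocale sqrt_integral M F W Y N
proof
  show a: "adapted_proc F Y" "continuous_paths M Y" using is_besq by (auto simp: is_BESQ_def)
  show "continuous_paths M N" using a unfolding continuous_paths_def N_def by (auto intro!: continuous_intros)
  fix t :: real assume t: "0 \<le> t"
  have "Y t \<in> borel_measurable M" using a(1) t measurable_F_le by (auto simp: adapted_proc_def)
  then show "N t \<in> borel_measurable M" unfolding N_def[abs_def] by measurable
  obtain I where "is_ito_integral M (\<lambda>s w. sqrt \<bar>Y s w\<bar>) W t I" "AE w in M. Y t w = y + \<delta> * t + 2 * I w"
    using is_besq t by (auto simp: is_BESQ_def)
  then show "\<exists>I. is_ito_integral M (\<lambda>s w. sqrt \<bar>Y s w\<bar>) W t I \<and> (AE w in M. N t w = I w)"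
    by (auto simp: N_def elim!: eventually_mono intro!: exI[of _ I])
qed

lemma Y_zero: "AE w in M. Y 0 w = y"
  using N_zero by (rule eventually_mono) (simp add: N_def)

definition supY :: "real \<Rightarrow> real \<Rightarrow> 'a set" where
  "supY T K = {w\<in>space M. \<exists>m j. real j / 2^m \<le> T \<and> K \<le> \<bar>Y (real j / 2^m) w\<bar>}"

lemma supY_measurable [measurable]: "supY T K \<in> events"
  unfolding supY_def by measurable

text \<open>The exponential factor makes the bound of \<open>prob_supY\<close> at least 1 when
  \<open>x < 2 * (y + \<delta>) + 1\<close>, the range in which the drift could carry the process to
  the level.\<close>

definition tailC :: real where "tailC = 2 * exp ((2 * (y + \<delta>) + 1) / 200)"

lemma tailC_ge: "2 \<le> tailC"
  using \<delta>_pos y_nonneg by (simp add: tailC_def)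

text \<open>When \<open>\<bar>Y\<bar>\<close> reaches a level \<open>K\<close> that is more than
  twice the initial value plus the drift, \<open>\<bar>N\<bar>\<close> is at least
  \<open>K/4\<close>, so \<open>exit_bad\<close> applies with \<open>l = K/5\<close>. The exponent
  \<open>(K/5)\<^sup>2 / (8 * K * T)\<close> is linear in \<open>K\<close>: the variance grows only
  linearly with the level, which leaves an exponential tail.\<close>

lemma prob_supY:
  assumes T: "0 < T" and x: "0 \<le> x"
  shows "prob (supY T (x * (1 + T))) \<le> tailC * exp (- x / 200)"
proof (cases "x \<ge> 2 * (y + \<delta>) + 1")
  case True
  define K where "K = x * (1 + T)"
  have "(2 * (y + \<delta>) + 1) * (1 + T) \<le> K" unfolding K_def using True T by (intro mult_right_mono) auto
  then have K: "2 * (y + \<delta> * T) + 1 \<le> K" using \<delta>_pos y_nonneg T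
    by (simp add: algebra_simps) (smt (verit) mult_nonneg_nonneg)
  have yK: "y < K" "0 < K" using K \<delta>_pos y_nonneg T by (smt (verit) mult_nonneg_nonneg)+
  have sub: "AE w in M. w \<in> supY T K \<longrightarrow> w \<in> bad T K (K/5)"
    using Y_zero AE_space
  proof eventually_elim
    case (elim w)
    show ?case
    proof
      assume "w \<in> supY T K"
      then obtain m j where j: "real j / 2^m \<le> T" "K \<le> \<bar>Y (real j / 2^m) w\<bar>" by (auto simp: supY_def)
      show "w \<in> bad T K (K/5)"
      proof (rule exit_bad[OF _ _ _ _ j])
        show "\<bar>Y 0 w\<bar> < K" using elim y_nonneg yK by simp
        fix t assume t: "0 \<le> t" "t \<le> T" "K \<le> \<bar>Y t w\<bar>"
        have "\<delta> * t \<le> \<delta> * T" "0 \<le> \<delta> * t" using t \<delta>_pos by auto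
        then have "K / 2 \<le> \<bar>Y t w - y - \<delta> * t\<bar>" using t(3) K y_nonneg by (smt (verit) field_sum_of_halves)
        then show "K / 5 < \<bar>N t w\<bar>" using yK by (simp add: N_def)
      qed (use elim in auto)
    qed
  qed
  have "prob (supY T K) \<le> prob (bad T K (K/5))"
    using sub by (intro finite_measure_mono_AE) auto
  also have "\<dots> \<le> 2 * exp (- (K/5)\<^sup>2 / (8 * K * T))"
    using T yK by (intro prob_bad) auto
  also have "- (K/5)\<^sup>2 / (8 * K * T) = - (K / T) / 200"
    using yK T by (simp add: field_simps power2_eq_square)
  also have "2 * exp \<dots> \<le> 2 * exp (- x / 200)"
    using T x by (simp add: K_def field_simps)
  also have "\<dots> \<le> tailC * exp (- x / 200)"
    using tailC_ge by simp
  finally show ?thesis by (simp add: K_def)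
next
  case False
  have "prob (supY T (x * (1 + T))) \<le> 1" by simp
  also have "1 \<le> 2 * exp ((2 * (y + \<delta>) + 1) / 200 + - x / 200)"
  proof -
    have "0 \<le> (2 * (y + \<delta>) + 1) / 200 + - x / 200" using False by (simp add: field_simps)
    then have "1 \<le> exp ((2 * (y + \<delta>) + 1) / 200 + - x / 200)" by simp
    then show ?thesis by linarith
  qed
  also have "\<dots> = tailC * exp (- x / 200)" by (simp only: tailC_def exp_add mult.assoc)
  finally show ?thesis .
qed

definition rate :: "real \<Rightarrow> real" where "rate T = 1 / (200 * (1 + T))"

lemma rate_pos: "0 < T \<Longrightarrow> 0 < rate T"
  by (simp add: rate_def)

lemma prob_supY': "0 < T \<Longrightarrow> 0 \<le> x \<Longrightarrow> prob (supY T x) \<le> tailC * exp (- rate T * x)"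
proof -
  assume T: "0 < T" "0 \<le> x"
  then have "x / (1 + T) * (1 + T) = x" "- (x / (1 + T)) / 200 = - rate T * x"
    by (simp_all add: rate_def)
  with prob_supY[of T "x / (1 + T)"] T show "prob (supY T x) \<le> tailC * exp (- rate T * x)"
    by simp
qed

text \<open>The left-point sum between \<open>i / 2^m\<close> and \<open>j / 2^m\<close>. Setting
  the integrand to 0 before the index \<open>i * 2^n\<close>, instead of starting the sum there,
  keeps it a \<open>psum\<close> from time 0, to which the maximal inequality and the isometry
  apply.\<close>

definition RI :: "nat \<Rightarrow> nat \<Rightarrow> nat \<Rightarrow> nat \<Rightarrow> 'a \<Rightarrow> real" where
  "RI m i j n = psum (1 / 2^(m+n)) (\<lambda>k w. if k < i * 2^n then 0 else sqrt \<bar>Y (real k * (1 / 2^(m+n))) w\<bar>) (j * 2^n)"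

lemma RI_eq:
  assumes "i \<le> j"
  shows "RI m i j n w = R (1 / 2^(m+n)) (j * 2^n) w - R (1 / 2^(m+n)) (i * 2^n) w"
proof -
  let ?h = "1 / 2^(m+n) :: real"
  have "(\<Sum>k<j * 2^n. sqrt \<bar>Y (real k * ?h) w\<bar> * incr ?h k w) =
     (\<Sum>k<i * 2^n. sqrt \<bar>Y (real k * ?h) w\<bar> * incr ?h k w) + (\<Sum>k\<in>{i*2^n..<j*2^n}. sqrt \<bar>Y (real k * ?h) w\<bar> * incr ?h k w)"
    using assms by (subst sum.union_disjoint[symmetric]) (auto intro!: sum.cong simp: ivl_disj_un)
  moreover have "(\<Sum>k\<in>{i*2^n..<j*2^n}. sqrt \<bar>Y (real k * ?h) w\<bar> * incr ?h k w) = RI m i j n w"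
    unfolding RI_def psum_def by (rule sum.mono_neutral_cong_left) auto
  ultimately show ?thesis unfolding R_def psum_def by simp
qed

lemma RI_integrand_measurable:
  "(\<lambda>w. if k < i * 2^n then 0 else sqrt \<bar>Y (real k * (1 / 2^(m+n))) w\<bar>) \<in> borel_measurable (F (real k * (1 / 2^(m+n))))"
proof -
  have "(\<lambda>w. sqrt \<bar>Y (real k * (1 / 2^(m+n))) w\<bar>) \<in> borel_measurable (F (real k * (1 / 2^(m+n))))"
    by (rule H_measurable_F) auto
  then show ?thesis by (cases "k < i * 2^n") (simp_all only: if_True if_False borel_measurable_const)
qed

lemma RI_measurable [measurable]: "RI m i j n \<in> borel_measurable M"
  unfolding RI_def by (intro psum_measurable RI_integrand_measurable) auto

lemma RI_conv:
  assumes "i \<le> j"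
  shows "conv_prob (\<lambda>n w. RI m i j n w - (N (real j / 2^m) w - N (real i / 2^m) w))"
proof -
  have "conv_prob (\<lambda>n w. (R (1 / 2^(m+n)) (j * 2^n) w - N (real j / 2^m) w) + - (R (1 / 2^(m+n)) (i * 2^n) w - N (real i / 2^m) w))"
    by (intro conv_prob_add conv_prob_minus R_conv_N) auto
  then show ?thesis using assms by (simp add: RI_eq algebra_simps)
qed

text \<open>Either the path reaches the level \<open>x\<close>, or the variance is at most
  \<open>x\<close> times the length of the interval. A deviation of \<open>x\<close> times the
  square root of the length then has exponent \<open>x/2\<close>, so both events have exponential
  tails in \<open>x\<close>, uniformly in the mesh and the length.\<close>

lemma RI_tail:
  assumes ij: "i < j" and T: "real j / 2^m \<le> T" "0 < T" and x: "0 \<le> x"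
  shows "prob {\<omega>\<in>space M. x * sqrt (real (j - i) / 2^m) \<le> \<bar>RI m i j n \<omega>\<bar>} \<le> (tailC + 2) * exp (- rate T * x)"
proof (cases "x = 0")
  case True
  have "prob {\<omega>\<in>space M. x * sqrt (real (j - i) / 2^m) \<le> \<bar>RI m i j n \<omega>\<bar>} \<le> 1" by simp
  then show ?thesis using True tailC_ge by (simp add: prob_space)
next
  case False
  then have x: "x > 0" using x by simp
  define h where "h = (1 / 2^(m+n) :: real)"
  have h: "h > 0" by (simp add: h_def)
  define l where "l = real (j - i) / 2^m"
  have l: "l > 0" using ij by (simp add: l_def)
  let ?G = "\<lambda>k \<omega>. if k < i * 2^n then 0 else sqrt \<bar>Y (real k * h) \<omega>\<bar>"
  \<comment> \<open>Off \<open>supY T x\<close> the integrand is at most \<open>sqrt x\<close> from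
    the index \<open>i * 2^n\<close> on, and it is 0 before.\<close>
  let ?c = "\<lambda>k. if k < i * 2^n then 0 else sqrt x"
  let ?A = "{\<omega>\<in>space M. \<exists>k\<le>j*2^n. x * sqrt l \<le> \<bar>psum h ?G k \<omega>\<bar> \<and> (\<forall>i<k. \<bar>?G i \<omega>\<bar> \<le> ?c i)}"
  have mG: "?G k \<in> borel_measurable (F (real k * h))" for k
    using RI_integrand_measurable unfolding h_def .
  have [measurable]: "psum h ?G k \<in> borel_measurable M" for k using h mG by (intro psum_measurable) auto
  have [measurable]: "?G k \<in> borel_measurable M" for k using mG by (rule measurable_F_le)
  have sub: "{\<omega>\<in>space M. x * sqrt l \<le> \<bar>RI m i j n \<omega>\<bar>} \<subseteq> supY T x \<union> ?A"
  proof (rule subsetI, rule ccontr)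
    fix \<omega> assume w: "\<omega> \<in> {\<omega>\<in>space M. x * sqrt l \<le> \<bar>RI m i j n \<omega>\<bar>}" and no: "\<omega> \<notin> supY T x \<union> ?A"
    have "\<bar>?G k \<omega>\<bar> \<le> ?c k" if k: "k < j * 2^n" for k
    proof -
      have "real k \<le> real (j * 2^n)" using k by (simp only: of_nat_le_iff)
      then have "real k / 2^(m+n) \<le> real (j * 2^n) / 2^(m+n)" by (intro divide_right_mono) simp_all
      also have "\<dots> = real j / 2^m" by (simp add: power_add)
      finally have "real k / 2^(m+n) \<le> T" using T by simp
      then have "\<not> x \<le> \<bar>Y (real k / 2^(m+n)) \<omega>\<bar>" using no w unfolding supY_def by blast
      then show ?thesis by (simp add: h_def)
    qed
    then have "\<forall>k<j*2^n. \<bar>?G k \<omega>\<bar> \<le> ?c k" by blast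
    moreover have "x * sqrt l \<le> \<bar>psum h ?G (j*2^n) \<omega>\<bar>" using w unfolding RI_def h_def by blast
    ultimately have "\<omega> \<in> ?A" using w by blast
    then show False using no by blast
  qed
  have "prob {\<omega>\<in>space M. x * sqrt l \<le> \<bar>RI m i j n \<omega>\<bar>} \<le> prob (supY T x \<union> ?A)"
    by (rule finite_measure_mono[OF sub]) measurable
  also have "\<dots> \<le> prob (supY T x) + prob ?A" by (rule measure_Un_le) measurable
  also have "prob (supY T x) \<le> tailC * exp (- rate T * x)" using T x by (intro prob_supY') auto
  also have "prob ?A \<le> 2 * exp (- (x * sqrt l)\<^sup>2 / (2 * (x * l)))"
  proof (rule psum_maximal[OF h mG])
    have "(\<Sum>k<j*2^n. (?c k)\<^sup>2) = (\<Sum>k\<in>{i*2^n..<j*2^n}. x)"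
      using x ij by (intro sum.mono_neutral_cong_right) auto
    also have "h * \<dots> = x * l"
      using ij by (simp add: h_def l_def power_add field_simps of_nat_diff left_diff_distrib)
    finally show "h * (\<Sum>k<j*2^n. (?c k)\<^sup>2) \<le> x * l" by simp
  qed (use x l in auto)
  also have "- (x * sqrt l)\<^sup>2 / (2 * (x * l)) = - x / 2"
    using x l by (simp add: power_mult_distrib field_simps power2_eq_square)
  also have "exp (- x / 2) \<le> exp (- rate T * x)"
  proof -
    have "rate T \<le> 1/2" using T by (simp add: rate_def field_simps)
    then have "rate T * x \<le> 1/2 * x" using x by (intro mult_right_mono) auto
    then show ?thesis by simp
  qed
  finally show ?thesis by (simp add: l_def algebra_simps)
qed

text \<open>In the limit half of the deviation is left to the sums, and an approximation error of
  one third then suffices since 1/2 + 1/3 < 1. This halves the rate.\<close>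

lemma N_tail:
  assumes ij: "i < j" and T: "real j / 2^m \<le> T" "0 < T" and x: "0 \<le> x"
  shows "prob {\<omega>\<in>space M. x * sqrt (real (j - i) / 2^m) \<le> \<bar>N (real j / 2^m) \<omega> - N (real i / 2^m) \<omega>\<bar>} \<le> (tailC + 2) * exp (- (rate T / 2) * x)"
proof (cases "x = 0")
  case True
  have "prob {\<omega>\<in>space M. x * sqrt (real (j - i) / 2^m) \<le> \<bar>N (real j / 2^m) \<omega> - N (real i / 2^m) \<omega>\<bar>} \<le> 1" by simp
  then show ?thesis using True tailC_ge by (simp add: prob_space)
next
  case False
  let ?l = "sqrt (real (j - i) / 2^m)"
  let ?D = "\<lambda>\<omega>. N (real j / 2^m) \<omega> - N (real i / 2^m) \<omega>"
  let ?P = "\<lambda>n. prob {\<omega>\<in>space M. x * ?l / 3 < \<bar>RI m i j n \<omega> - ?D \<omega>\<bar>}"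
  have l: "?l > 0" using ij by simp
  have le: "prob {\<omega>\<in>space M. x * ?l \<le> \<bar>?D \<omega>\<bar>} \<le> (tailC + 2) * exp (- rate T * (x/2)) + ?P n" for n
  proof -
    have "prob {\<omega>\<in>space M. x * ?l \<le> \<bar>?D \<omega>\<bar>} \<le> prob ({\<omega>\<in>space M. (x/2) * ?l \<le> \<bar>RI m i j n \<omega>\<bar>} \<union> {\<omega>\<in>space M. x * ?l / 3 < \<bar>RI m i j n \<omega> - ?D \<omega>\<bar>})"
    proof (rule finite_measure_mono[OF subsetI])
      fix \<omega> assume w: "\<omega> \<in> {\<omega>\<in>space M. x * ?l \<le> \<bar>?D \<omega>\<bar>}"
      have "0 \<le> x * ?l" using x l by (intro mult_nonneg_nonneg) auto
      then have "x * ?l / 2 \<le> \<bar>RI m i j n \<omega>\<bar> \<or> x * ?l / 3 < \<bar>RI m i j n \<omega> - ?D \<omega>\<bar>"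
        using w by (auto simp: abs_if split: if_splits)
      then show "\<omega> \<in> {\<omega>\<in>space M. (x/2) * ?l \<le> \<bar>RI m i j n \<omega>\<bar>} \<union> {\<omega>\<in>space M. x * ?l / 3 < \<bar>RI m i j n \<omega> - ?D \<omega>\<bar>}"
        using w by auto
    qed measurable
    also have "\<dots> \<le> prob {\<omega>\<in>space M. (x/2) * ?l \<le> \<bar>RI m i j n \<omega>\<bar>} + ?P n" by (intro measure_Un_le) auto
    also have "prob {\<omega>\<in>space M. (x/2) * ?l \<le> \<bar>RI m i j n \<omega>\<bar>} \<le> (tailC + 2) * exp (- rate T * (x/2))"
      using x by (intro RI_tail ij T) auto
    finally show ?thesis by simp
  qed
  have "?P \<longlonglongrightarrow> 0" using l x False ij by (intro conv_probD RI_conv) auto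
  then have "(\<lambda>n. (tailC + 2) * exp (- rate T * (x/2)) + ?P n) \<longlonglongrightarrow> (tailC + 2) * exp (- rate T * (x/2)) + 0"
    by (intro tendsto_intros)
  then have "prob {\<omega>\<in>space M. x * ?l \<le> \<bar>?D \<omega>\<bar>} \<le> (tailC + 2) * exp (- rate T * (x/2)) + 0"
    using le by (intro LIMSEQ_le_const) auto
  then show ?thesis by simp
qed

end

section \<open>Inequalities for square-integrable variables\<close>

context prob_space
begin

lemma integrable_mult_L2:
  fixes X Z :: "'a \<Rightarrow> real"
  assumes [measurable]: "X \<in> borel_measurable M" "Z \<in> borel_measurable M"
    and i: "integrable M (\<lambda>w. (X w)\<^sup>2)" "integrable M (\<lambda>w. (Z w)\<^sup>2)"
  shows "integrable M (\<lambda>w. X w * Z w)"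
proof (rule Bochner_Integration.integrable_bound[of _ "\<lambda>w. (X w)\<^sup>2 + (Z w)\<^sup>2"])
  show "AE w in M. norm (X w * Z w) \<le> norm ((X w)\<^sup>2 + (Z w)\<^sup>2)"
  proof (rule AE_I2)
    fix w
    have "0 \<le> (\<bar>X w\<bar> - \<bar>Z w\<bar>)\<^sup>2 + (X w)\<^sup>2 + (Z w)\<^sup>2" by simp
    then show "norm (X w * Z w) \<le> norm ((X w)\<^sup>2 + (Z w)\<^sup>2)"
      by (simp add: power2_diff abs_mult power2_abs)
  qed
qed (use i in auto)

lemma cauchy_schwarz_expectation:
  fixes X Z :: "'a \<Rightarrow> real"
  assumes m[measurable]: "X \<in> borel_measurable M" "Z \<in> borel_measurable M"
    and i: "integrable M (\<lambda>w. (X w)\<^sup>2)" "integrable M (\<lambda>w. (Z w)\<^sup>2)"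
  shows "\<bar>expectation (\<lambda>w. X w * Z w)\<bar> \<le> sqrt (expectation (\<lambda>w. (X w)\<^sup>2)) * sqrt (expectation (\<lambda>w. (Z w)\<^sup>2))"
proof -
  define a b c where "a = expectation (\<lambda>w. (X w)\<^sup>2)" and "b = expectation (\<lambda>w. (Z w)\<^sup>2)"
    and "c = expectation (\<lambda>w. X w * Z w)"
  note iXZ = integrable_mult_L2[OF m i]
  have ab: "0 \<le> a" "0 \<le> b" by (auto simp: a_def b_def integral_nonneg_AE)
  have q: "0 \<le> t\<^sup>2 * a + 2 * t * c + b" for t
  proof -
    have "0 \<le> expectation (\<lambda>w. (t * X w + Z w)\<^sup>2)" by (simp add: integral_nonneg_AE)
    also have "(\<lambda>w. (t * X w + Z w)\<^sup>2) = (\<lambda>w. t\<^sup>2 * (X w)\<^sup>2 + 2 * t * (X w * Z w) + (Z w)\<^sup>2)"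
      by (auto simp: power2_eq_square algebra_simps)
    also have "expectation \<dots> = t\<^sup>2 * a + 2 * t * c + b"
      using iXZ i by (simp add: a_def b_def c_def)
    finally show ?thesis .
  qed
  have "c\<^sup>2 \<le> a * b"
  proof (cases "a = 0")
    case True
    have "c = 0"
    proof (rule ccontr)
      assume "c \<noteq> 0"
      \<comment> \<open>With \<open>a = 0\<close> the quadratic is the line
        \<open>2 * t * c + b\<close>, and this \<open>t\<close> gives it the value -1.\<close>
      then show False using q[of "- (b + 1) / (2 * c)"] True by (simp add: field_simps)
    qed
    then show ?thesis using True by simp
  next
    case False
    then show ?thesis using q[of "- c / a"] ab by (simp add: field_simps power2_eq_square)
  qed
  then have "\<bar>c\<bar> \<le> sqrt (a * b)" by (metis real_sqrt_abs real_sqrt_le_iff)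
  then show ?thesis by (simp add: a_def b_def c_def real_sqrt_mult)
qed

lemma integrable_bounded_mult:
  fixes g X :: "'a \<Rightarrow> real"
  assumes "g \<in> borel_measurable M" "\<forall>w\<in>space M. \<bar>g w\<bar> \<le> G" "integrable M X"
  shows "integrable M (\<lambda>w. g w * X w)" "\<bar>expectation (\<lambda>w. g w * X w)\<bar> \<le> G * expectation (\<lambda>w. \<bar>X w\<bar>)"
proof -
  have [measurable]: "X \<in> borel_measurable M" using assms by auto
  show i: "integrable M (\<lambda>w. g w * X w)"
  proof (rule Bochner_Integration.integrable_bound[of _ "\<lambda>w. G * \<bar>X w\<bar>"])
    show "AE w in M. norm (g w * X w) \<le> norm (G * \<bar>X w\<bar>)"
    proof (rule AE_I2)
      fix w assume "w \<in> space M"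
      then have "\<bar>g w\<bar> * \<bar>X w\<bar> \<le> G * \<bar>X w\<bar>" using assms(2) by (intro mult_right_mono) auto
      then show "norm (g w * X w) \<le> norm (G * \<bar>X w\<bar>)"
        using mult_right_mono[OF abs_ge_self[of G], of "\<bar>X w\<bar>"] by (simp add: abs_mult)
    qed
  qed (use assms in auto)
  have "\<bar>expectation (\<lambda>w. g w * X w)\<bar> \<le> expectation (\<lambda>w. \<bar>g w * X w\<bar>)" by (rule integral_abs_bound)
  also have "\<dots> \<le> expectation (\<lambda>w. G * \<bar>X w\<bar>)"
  proof (rule integral_mono)
    show "integrable M (\<lambda>w. \<bar>g w * X w\<bar>)" using i by simp
    show "\<bar>g w * X w\<bar> \<le> G * \<bar>X w\<bar>" if "w \<in> space M" for w
      unfolding abs_mult using assms(2) that by (intro mult_right_mono) auto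
  qed (use assms in auto)
  finally show "\<bar>expectation (\<lambda>w. g w * X w)\<bar> \<le> G * expectation (\<lambda>w. \<bar>X w\<bar>)" by simp
qed

lemma expectation_abs_le_L2:
  fixes X :: "'a \<Rightarrow> real"
  assumes [measurable]: "X \<in> borel_measurable M" and "integrable M (\<lambda>w. (X w)\<^sup>2)"
  shows "expectation (\<lambda>w. \<bar>X w\<bar>) \<le> sqrt (expectation (\<lambda>w. (X w)\<^sup>2))"
  using cauchy_schwarz_expectation[of "\<lambda>w. \<bar>X w\<bar>" "\<lambda>_. 1"] assms by (simp add: prob_space)

end

lemma pow4_sum_le: "(a + b) ^ 4 \<le> 8 * (a ^ 4 + b ^ 4)" for a b :: real
proof -
  have sq: "(u + v)\<^sup>2 \<le> 2 * (u\<^sup>2 + v\<^sup>2)" for u v :: real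
    using sum_squares_bound[of u v] by (simp add: power2_sum)
  have "(a + b) ^ 4 = ((a + b)\<^sup>2)\<^sup>2" by simp
  also have "\<dots> \<le> (2 * (a\<^sup>2 + b\<^sup>2))\<^sup>2" by (intro power_mono sq) auto
  also have "\<dots> = 4 * (a\<^sup>2 + b\<^sup>2)\<^sup>2" by (simp only: power_mult_distrib) simp
  also have "\<dots> \<le> 4 * (2 * ((a\<^sup>2)\<^sup>2 + (b\<^sup>2)\<^sup>2))" by (intro mult_left_mono sq) auto
  finally show ?thesis by simp
qed

section \<open>Moments and conditional moments of the increments\<close>

context besq
begin

text \<open>One constant for the p-th moments of Y at grid times up to \<open>T\<close> and for
  those of increments of \<open>N\<close> divided by the square root of their length; the series
  sums the tail bound of \<open>N_tail\<close>.\<close>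

definition mc :: "real \<Rightarrow> nat \<Rightarrow> real" where
  "mc T p = (tailC + 2) * (\<Sum>k. (real k + 1) ^ p * exp (- (rate T / 2) * real k))"

lemma mc_nonneg: "0 < T \<Longrightarrow> 0 \<le> mc T p"
  unfolding mc_def using tailC_ge rate_pos[of T]
  by (intro mult_nonneg_nonneg suminf_nonneg summable_power_exp) auto

lemma moment_of_tail:
  assumes T: "0 < T" and [measurable]: "Z \<in> borel_measurable M"
    and tail: "\<And>x. 0 \<le> x \<Longrightarrow> prob {w\<in>space M. x \<le> \<bar>Z w\<bar>} \<le> (tailC + 2) * exp (- (rate T / 2) * x)"
  shows "integrable M (\<lambda>w. \<bar>Z w\<bar> ^ p)" "expectation (\<lambda>w. \<bar>Z w\<bar> ^ p) \<le> mc T p"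
  using tail_expectation[of "\<lambda>w. \<bar>Z w\<bar>" "\<lambda>z. z ^ p" "tailC + 2" "rate T / 2"]
    tail rate_pos[OF T] summable_power_exp[of "rate T / 2" p]
  unfolding mc_def by (auto intro: power_mono)

lemma scaled_moment:
  assumes T: "0 < T" and r: "0 < r" and [measurable]: "Z \<in> borel_measurable M"
    and tail: "\<And>x. 0 \<le> x \<Longrightarrow> prob {w\<in>space M. x * r \<le> \<bar>Z w\<bar>} \<le> (tailC + 2) * exp (- (rate T / 2) * x)"
  shows "integrable M (\<lambda>w. \<bar>Z w\<bar> ^ p)" "expectation (\<lambda>w. \<bar>Z w\<bar> ^ p) \<le> mc T p * r ^ p"
proof -
  have *: "prob {w\<in>space M. x \<le> \<bar>Z w / r\<bar>} \<le> (tailC + 2) * exp (- (rate T / 2) * x)" if "0 \<le> x" for x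
    using tail[OF that] r by (simp add: pos_le_divide_eq)
  have eq: "\<bar>Z w\<bar> ^ p = r ^ p * \<bar>Z w / r\<bar> ^ p" for w
    using r by (simp add: power_divide)
  have i: "integrable M (\<lambda>w. \<bar>Z w / r\<bar> ^ p)" and e: "expectation (\<lambda>w. \<bar>Z w / r\<bar> ^ p) \<le> mc T p"
    by (rule moment_of_tail[OF T _ *]; simp)+
  show "integrable M (\<lambda>w. \<bar>Z w\<bar> ^ p)" unfolding eq using i by (rule integrable_mult_right)
  have "expectation (\<lambda>w. \<bar>Z w\<bar> ^ p) = r ^ p * expectation (\<lambda>w. \<bar>Z w / r\<bar> ^ p)" unfolding eq by simp
  also have "\<dots> \<le> r ^ p * mc T p" using e r by (intro mult_left_mono) auto
  finally show "expectation (\<lambda>w. \<bar>Z w\<bar> ^ p) \<le> mc T p * r ^ p" by (simp add: mult.commute)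
qed

lemma Y_moment:
  assumes "real j / 2^m \<le> T" "0 < T"
  shows "integrable M (\<lambda>w. \<bar>Y (real j / 2^m) w\<bar> ^ p)" "expectation (\<lambda>w. \<bar>Y (real j / 2^m) w\<bar> ^ p) \<le> mc T p"
proof -
  have *: "prob {w\<in>space M. x \<le> \<bar>Y (real j / 2^m) w\<bar>} \<le> (tailC + 2) * exp (- (rate T / 2) * x)" if x: "0 \<le> x" for x
  proof -
    have "prob {w\<in>space M. x \<le> \<bar>Y (real j / 2^m) w\<bar>} \<le> prob (supY T x)"
      using assms by (intro finite_measure_mono) (auto simp: supY_def)
    also have "\<dots> \<le> tailC * exp (- rate T * x)" using assms x by (intro prob_supY') auto
    also have "\<dots> \<le> (tailC + 2) * exp (- (rate T / 2) * x)"
      using rate_pos[OF assms(2)] tailC_ge x by (intro mult_mono) auto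
    finally show ?thesis .
  qed
  show "integrable M (\<lambda>w. \<bar>Y (real j / 2^m) w\<bar> ^ p)" "expectation (\<lambda>w. \<bar>Y (real j / 2^m) w\<bar> ^ p) \<le> mc T p"
    by (rule moment_of_tail[OF assms(2) _ *]; simp)+
qed

definition D :: "nat \<Rightarrow> nat \<Rightarrow> nat \<Rightarrow> 'a \<Rightarrow> real" where
  "D m i j w = N (real j / 2^m) w - N (real i / 2^m) w"

lemma D_measurable [measurable]: "D m i j \<in> borel_measurable M"
  unfolding D_def[abs_def] by measurable

lemma D_moment:
  assumes "i < j" "real j / 2^m \<le> T" "0 < T"
  shows "integrable M (\<lambda>w. \<bar>D m i j w\<bar> ^ p)"
    "expectation (\<lambda>w. \<bar>D m i j w\<bar> ^ p) \<le> mc T p * sqrt (real (j - i) / 2^m) ^ p"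
proof -
  have *: "prob {w\<in>space M. x * sqrt (real (j - i) / 2^m) \<le> \<bar>D m i j w\<bar>} \<le> (tailC + 2) * exp (- (rate T / 2) * x)"
    if x: "0 \<le> x" for x
    using N_tail[OF assms x] by (simp add: D_def)
  show "integrable M (\<lambda>w. \<bar>D m i j w\<bar> ^ p)"
    "expectation (\<lambda>w. \<bar>D m i j w\<bar> ^ p) \<le> mc T p * sqrt (real (j - i) / 2^m) ^ p"
    by (rule scaled_moment[where r="sqrt (real (j - i) / 2^m)", OF assms(3) _ _ *]; (use assms in simp))+
qed

lemma RI_moment:
  assumes "i < j" "real j / 2^m \<le> T" "0 < T"
  shows "integrable M (\<lambda>w. \<bar>RI m i j n w\<bar> ^ p)"
    "expectation (\<lambda>w. \<bar>RI m i j n w\<bar> ^ p) \<le> mc T p * sqrt (real (j - i) / 2^m) ^ p"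
proof -
  have *: "prob {w\<in>space M. x * sqrt (real (j - i) / 2^m) \<le> \<bar>RI m i j n w\<bar>} \<le> (tailC + 2) * exp (- (rate T / 2) * x)"
    if x: "0 \<le> x" for x
  proof -
    note RI_tail[OF assms x, of n]
    also have "(tailC + 2) * exp (- rate T * x) \<le> (tailC + 2) * exp (- (rate T / 2) * x)"
      using rate_pos[OF assms(3)] tailC_ge x by (intro mult_left_mono) auto
    finally show ?thesis .
  qed
  show "integrable M (\<lambda>w. \<bar>RI m i j n w\<bar> ^ p)"
    "expectation (\<lambda>w. \<bar>RI m i j n w\<bar> ^ p) \<le> mc T p * sqrt (real (j - i) / 2^m) ^ p"
    by (rule scaled_moment[where r="sqrt (real (j - i) / 2^m)", OF assms(3) _ _ *]; (use assms in simp))+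
qed

text \<open>The definition of the integral only gives convergence in probability; the uniform fourth
  moments from the exponential tails upgrade it to convergence in L2, so that means and variances of
  the sums pass to \<open>D\<close>.\<close>

lemma RI_L2_conv:
  assumes "i < j"
  shows "(\<lambda>n. expectation (\<lambda>w. (RI m i j n w - D m i j w)\<^sup>2)) \<longlonglongrightarrow> 0"
proof -
  define T where "T = real j / 2^m"
  have T: "real j / 2^m \<le> T" "0 < T" using assms by (auto simp: T_def)
  note R4 = RI_moment[OF assms T, where p=4] and D4 = D_moment[OF assms T, where p=4]
  have le: "(RI m i j n w - D m i j w) ^ 4 \<le> 8 * (\<bar>RI m i j n w\<bar> ^ 4 + \<bar>D m i j w\<bar> ^ 4)" for n w
    using pow4_sum_le[of "RI m i j n w" "- D m i j w"] by simp
  have i4: "integrable M (\<lambda>w. (RI m i j n w - D m i j w) ^ 4)" for n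
    using R4(1)[of n] D4(1)
    by (intro Bochner_Integration.integrable_bound[of _ "\<lambda>w. 8 * (\<bar>RI m i j n w\<bar> ^ 4 + \<bar>D m i j w\<bar> ^ 4)" "\<lambda>w. (RI m i j n w - D m i j w) ^ 4"])
      (auto intro!: AE_I2 order_trans[OF le])
  show ?thesis
  proof (rule conv_prob_L2[OF _ _ i4])
    show "conv_prob (\<lambda>n w. RI m i j n w - D m i j w)"
      using RI_conv[of i j m] assms by (simp add: D_def)
    fix n
    have "expectation (\<lambda>w. (RI m i j n w - D m i j w) ^ 4) \<le> expectation (\<lambda>w. 8 * (\<bar>RI m i j n w\<bar> ^ 4 + \<bar>D m i j w\<bar> ^ 4))"
      using R4(1)[of n] D4(1) by (intro integral_mono i4 le) auto
    also have "\<dots> = 8 * (expectation (\<lambda>w. \<bar>RI m i j n w\<bar> ^ 4) + expectation (\<lambda>w. \<bar>D m i j w\<bar> ^ 4))"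
      using R4(1)[of n] D4(1) by simp
    also have "\<dots> \<le> 8 * (mc T 4 * sqrt (real (j - i) / 2^m) ^ 4 + mc T 4 * sqrt (real (j - i) / 2^m) ^ 4)"
      using R4(2)[of n] D4(2) by (intro mult_left_mono add_mono) auto
    finally show "expectation (\<lambda>w. (RI m i j n w - D m i j w) ^ 4)
      \<le> 8 * (mc T 4 * sqrt (real (j - i) / 2^m) ^ 4 + mc T 4 * sqrt (real (j - i) / 2^m) ^ 4)" .
  qed auto
qed

text \<open>The integrand is 0 before \<open>i / 2^m\<close> and \<open>g\<close> is known at that
  time, so \<open>g\<close> may be moved inside the sum without losing adaptedness; both claims are
  then those of \<open>psum_isometry\<close>.\<close>

lemma RI_weighted:
  assumes ij: "i < j" and g: "g \<in> borel_measurable (F (real i / 2^m))" "\<And>w. w \<in> space M \<Longrightarrow> \<bar>g w\<bar> \<le> G"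
  shows "expectation (\<lambda>w. g w * RI m i j n w) = 0"
    "expectation (\<lambda>w. (g w)\<^sup>2 * (RI m i j n w)\<^sup>2) =
      (1 / 2^(m+n)) * (\<Sum>k\<in>{i*2^n..<j*2^n}. expectation (\<lambda>w. (g w)\<^sup>2 * \<bar>Y (real k / 2^(m+n)) w\<bar>))"
proof -
  define h where "h = (1 / 2^(m+n) :: real)"
  have h: "h > 0" by (simp add: h_def)
  let ?K = "\<lambda>k w. if k < i * 2^n then 0 else sqrt \<bar>Y (real k * h) w\<bar>"
  let ?G = "\<lambda>k w. g w * ?K k w"
  define T where "T = real j / 2^m"
  have T: "0 < T" using ij by (simp add: T_def)
  have RIh: "RI m i j n = psum h ?K (j * 2^n)" unfolding RI_def h_def ..
  have eq: "g w * RI m i j n w = psum h ?G (j * 2^n) w" for w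
    unfolding RIh psum_def by (simp add: sum_distrib_left mult.assoc)
  have gM[measurable]: "g \<in> borel_measurable M" using g(1) by (rule measurable_F_le)
  have mG: "?G k \<in> borel_measurable (F (real k * h))" for k
  proof (cases "k < i * 2^n")
    case False
    then have "real (i * 2^n) \<le> real k" by (simp only: of_nat_le_iff)
    then have "real i / 2^m \<le> real k * h" by (simp add: h_def power_add field_simps)
    then have "g \<in> borel_measurable (F (real k * h))" using g(1) by (rule measurable_F_mono)
    then show ?thesis using RI_integrand_measurable[of k i n m] unfolding h_def by (rule borel_measurable_times)
  qed simp
  have sq: "(?G k w)\<^sup>2 = (if k < i * 2^n then 0 else (g w)\<^sup>2 * \<bar>Y (real k / 2^(m+n)) w\<bar>)" for k w
    by (simp add: power_mult_distrib h_def)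
  have i2: "integrable M (\<lambda>w. (?G k w)\<^sup>2)" if k: "k < j * 2^n" for k
  proof -
    have "real k \<le> real (j * 2^n)" using k by (simp only: of_nat_le_iff)
    then have "real k / 2^(m+n) \<le> T" by (simp add: T_def power_add field_simps)
    from Y_moment(1)[OF this T, of 1] have "integrable M (\<lambda>w. \<bar>Y (real k / 2^(m+n)) w\<bar>)" by simp
    then have "integrable M (\<lambda>w. (g w)\<^sup>2 * \<bar>Y (real k / 2^(m+n)) w\<bar>)"
    proof (rule integrable_bounded_mult(1)[where G="G\<^sup>2", rotated 2])
      have "\<bar>(g w)\<^sup>2\<bar> \<le> G\<^sup>2" if "w \<in> space M" for w
        using power_mono[OF g(2)[OF that] abs_ge_zero, of 2] by simp
      then show "\<forall>w\<in>space M. \<bar>(g w)\<^sup>2\<bar> \<le> G\<^sup>2" by blast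
    qed simp_all
    then show ?thesis unfolding sq by (cases "k < i * 2^n") simp_all
  qed
  note iso = psum_isometry[OF h mG i2, of "j * 2^n"]
  show "expectation (\<lambda>w. g w * RI m i j n w) = 0"
    unfolding eq using iso(3) by simp
  have "expectation (\<lambda>w. (g w)\<^sup>2 * (RI m i j n w)\<^sup>2) = expectation (\<lambda>w. (psum h ?G (j * 2^n) w)\<^sup>2)"
    by (simp only: eq[symmetric] power_mult_distrib)
  also have "\<dots> = h * (\<Sum>k<j*2^n. expectation (\<lambda>w. (?G k w)\<^sup>2))" by (rule iso(4))
  also have "(\<Sum>k<j*2^n. expectation (\<lambda>w. (?G k w)\<^sup>2)) = (\<Sum>k\<in>{i*2^n..<j*2^n}. expectation (\<lambda>w. (g w)\<^sup>2 * \<bar>Y (real k / 2^(m+n)) w\<bar>))"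
    unfolding sq by (rule sum.mono_neutral_cong_right) auto
  finally show "expectation (\<lambda>w. (g w)\<^sup>2 * (RI m i j n w)\<^sup>2) =
      (1 / 2^(m+n)) * (\<Sum>k\<in>{i*2^n..<j*2^n}. expectation (\<lambda>w. (g w)\<^sup>2 * \<bar>Y (real k / 2^(m+n)) w\<bar>))"
    by (simp add: h_def)
qed

lemma D_integrable:
  assumes ij: "i < j"
  shows "integrable M (\<lambda>w. (D m i j w)\<^sup>2)" "integrable M (D m i j)"
    "integrable M (\<lambda>w. (RI m i j n w)\<^sup>2)" "integrable M (RI m i j n)"
    "integrable M (\<lambda>w. (RI m i j n w - D m i j w)\<^sup>2)"
proof -
  define T where "T = real j / 2^m"
  have T: "real j / 2^m \<le> T" "0 < T" using assms by (auto simp: T_def)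
  show a: "integrable M (\<lambda>w. (D m i j w)\<^sup>2)" "integrable M (\<lambda>w. (RI m i j n w)\<^sup>2)"
    using D_moment(1)[OF ij T, of 2] RI_moment(1)[OF ij T, of n 2] by auto
  show "integrable M (D m i j)" "integrable M (RI m i j n)"
    using a by (auto intro: square_integrable_imp_integrable)
  have "integrable M (\<lambda>w. (RI m i j n w)\<^sup>2 - 2 * (RI m i j n w * D m i j w) + (D m i j w)\<^sup>2)"
    using a by (intro Bochner_Integration.integrable_add Bochner_Integration.integrable_diff integrable_mult_right integrable_mult_L2) auto
  then show "integrable M (\<lambda>w. (RI m i j n w - D m i j w)\<^sup>2)" by (simp add: power2_diff algebra_simps)
qed

text \<open>The martingale property of \<open>N\<close>, tested against bounded weights from the
  past. It is exact for the sums, and the error of replacing them by \<open>D\<close> is controlled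
  in L2.\<close>

lemma D_mean:
  assumes ij: "i < j" and g: "g \<in> borel_measurable (F (real i / 2^m))" "\<And>w. w \<in> space M \<Longrightarrow> \<bar>g w\<bar> \<le> G"
  shows "expectation (\<lambda>w. g w * D m i j w) = 0"
proof -
  have gB: "\<forall>w\<in>space M. \<bar>g w\<bar> \<le> G" using g(2) by blast
  have gM[measurable]: "g \<in> borel_measurable M" using g(1) by (rule measurable_F_le)
  obtain w0 where "w0 \<in> space M" using not_empty by auto
  then have G: "0 \<le> G" using g(2)[of w0] by linarith
  have "\<bar>expectation (\<lambda>w. g w * D m i j w)\<bar> \<le> G * sqrt (expectation (\<lambda>w. (RI m i j n w - D m i j w)\<^sup>2))" for n
  proof -
    note I = D_integrable[OF ij]
    note b = integrable_bounded_mult(1)[OF gM gB]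
    have "expectation (\<lambda>w. g w * (RI m i j n w - D m i j w)) = expectation (\<lambda>w. g w * RI m i j n w) - expectation (\<lambda>w. g w * D m i j w)"
      using b[OF I(2)] b[OF I(4)] by (simp add: right_diff_distrib)
    also have "\<dots> = - expectation (\<lambda>w. g w * D m i j w)" using RI_weighted(1)[OF ij g] by simp
    finally have "\<bar>expectation (\<lambda>w. g w * D m i j w)\<bar> = \<bar>expectation (\<lambda>w. g w * (RI m i j n w - D m i j w))\<bar>" by simp
    also have "\<dots> \<le> G * expectation (\<lambda>w. \<bar>RI m i j n w - D m i j w\<bar>)"
      using I by (intro integrable_bounded_mult(2)[OF gM gB]) auto
    also have "\<dots> \<le> G * sqrt (expectation (\<lambda>w. (RI m i j n w - D m i j w)\<^sup>2))"
      using I G by (intro mult_left_mono expectation_abs_le_L2) auto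
    finally show ?thesis .
  qed
  moreover have "(\<lambda>n. G * sqrt (expectation (\<lambda>w. (RI m i j n w - D m i j w)\<^sup>2))) \<longlonglongrightarrow> G * sqrt 0"
    by (intro tendsto_intros RI_L2_conv ij)
  ultimately have "\<bar>expectation (\<lambda>w. g w * D m i j w)\<bar> \<le> G * sqrt 0"
    by (intro LIMSEQ_le_const) auto
  then show ?thesis by simp
qed

lemma Y_increment:
  "Y (real j / 2^m) w - Y (real i / 2^m) w = \<delta> * (real j / 2^m - real i / 2^m) + 2 * D m i j w"
  by (simp add: D_def N_def diff_divide_distrib right_diff_distrib)

lemma Y_increment_L1:
  assumes ij: "i \<le> j" and T: "real j / 2^m \<le> T" "0 < T"
  shows "expectation (\<lambda>w. \<bar>Y (real j / 2^m) w - Y (real i / 2^m) w\<bar>) \<le> (\<delta> * sqrt T + 2 * mc T 1) * sqrt (real (j - i) / 2^m)"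
proof (cases "i = j")
  case False
  then have ij: "i < j" using ij by simp
  let ?h = "real (j - i) / 2^m"
  have h: "0 \<le> ?h" "?h \<le> T"
  proof -
    have "?h \<le> real j / 2^m" by (intro divide_right_mono) auto
    then show "?h \<le> T" using T(1) by simp
  qed simp
  have dt: "real j / 2^m - real i / 2^m = ?h" using ij by (simp add: of_nat_diff diff_divide_distrib)
  note D1 = D_moment[OF ij T, of 1, simplified]
  have "expectation (\<lambda>w. \<bar>Y (real j / 2^m) w - Y (real i / 2^m) w\<bar>) \<le> expectation (\<lambda>w. \<delta> * ?h + 2 * \<bar>D m i j w\<bar>)"
    unfolding Y_increment dt
  proof (rule integral_mono)
    show "integrable M (\<lambda>w. \<bar>\<delta> * ?h + 2 * D m i j w\<bar>)" using D_integrable(2)[OF ij] by auto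
    show "integrable M (\<lambda>w. \<delta> * ?h + 2 * \<bar>D m i j w\<bar>)" using D1 by auto
    fix w
    have "0 \<le> \<delta> * ?h" using h \<delta>_pos by simp
    then show "\<bar>\<delta> * ?h + 2 * D m i j w\<bar> \<le> \<delta> * ?h + 2 * \<bar>D m i j w\<bar>" by linarith
  qed
  also have "\<dots> = \<delta> * ?h + 2 * expectation (\<lambda>w. \<bar>D m i j w\<bar>)" using D1 by (simp add: prob_space)
  also have "\<dots> \<le> \<delta> * (sqrt T * sqrt ?h) + 2 * (mc T 1 * sqrt ?h)"
  proof (intro add_mono mult_left_mono)
    have "?h = sqrt ?h * sqrt ?h" using h by simp
    also have "\<dots> \<le> sqrt T * sqrt ?h" using h by (intro mult_right_mono) auto
    finally show "?h \<le> sqrt T * sqrt ?h" .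
  qed (use D1 \<delta>_pos in auto)
  finally show ?thesis by (simp add: algebra_simps)
qed (use T \<delta>_pos mc_nonneg[of T 1] in simp)

definition sqc :: "real \<Rightarrow> real" where "sqc T = \<delta> * sqrt T + 2 * mc T 1"

lemma sqc_nonneg: "0 < T \<Longrightarrow> 0 \<le> sqc T"
  using mc_nonneg[of T 1] \<delta>_pos by (simp add: sqc_def)

text \<open>The isometry turns the second moment into an average of the weighted means of
  \<open>\<bar>Y\<bar>\<close> over the interval. Replacing Y there by its value at the left end
  costs \<open>sqrt h\<close> in L1 by \<open>Y_increment_L1\<close>, on an interval of length
  \<open>h\<close>.\<close>

lemma D_square:
  assumes ij: "i < j" and T: "real j / 2^m \<le> T" "0 < T"
    and w: "w \<in> borel_measurable (F (real i / 2^m))" "\<And>\<omega>. \<omega> \<in> space M \<Longrightarrow> 0 \<le> w \<omega>" "\<And>\<omega>. \<omega> \<in> space M \<Longrightarrow> w \<omega> \<le> G"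
  defines "h \<equiv> real (j - i) / 2^m"
  shows "\<bar>expectation (\<lambda>\<omega>. w \<omega> * (D m i j \<omega>)\<^sup>2) - h * expectation (\<lambda>\<omega>. w \<omega> * \<bar>Y (real i / 2^m) \<omega>\<bar>)\<bar> \<le> G * sqc T * h * sqrt h"
proof -
  have wM[measurable]: "w \<in> borel_measurable M" using w(1) by (rule measurable_F_le)
  obtain \<omega>0 where "\<omega>0 \<in> space M" using not_empty by auto
  then have G: "0 \<le> G" using w(2,3)[of \<omega>0] by linarith
  have wB: "\<forall>\<omega>\<in>space M. \<bar>w \<omega>\<bar> \<le> G" using w(2,3) by auto
  have h: "h > 0" using ij by (simp add: h_def)
  have Yint: "integrable M (Y (real k / 2^l))" for k l
    using Y_moment(1)[of k l "real k / 2^l + 1" 1] by (subst integrable_abs_iff[symmetric]) (auto simp: add_nonneg_pos)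
  let ?E = "expectation (\<lambda>\<omega>. w \<omega> * \<bar>Y (real i / 2^m) \<omega>\<bar>)"
  \<comment> \<open>The isometry in \<open>RI_weighted\<close> carries the square of its weight, so
    it is used with the square root of \<open>w\<close>.\<close>
  have g: "(\<lambda>\<omega>. sqrt (w \<omega>)) \<in> borel_measurable (F (real i / 2^m))" using w(1) by measurable
  have sw: "\<bar>sqrt (w \<omega>)\<bar> \<le> sqrt G" if "\<omega> \<in> space M" for \<omega>
    using w(2,3)[OF that] by simp
  have R: "\<bar>expectation (\<lambda>\<omega>. w \<omega> * (RI m i j n \<omega>)\<^sup>2) - h * ?E\<bar> \<le> G * sqc T * h * sqrt h" for n
  proof -
    define \<eta> where "\<eta> = (1 / 2^(m+n) :: real)"
    have \<eta>: "\<eta> > 0" by (simp add: \<eta>_def)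
    let ?I = "{i*2^n..<j*2^n}"
    have card: "\<eta> * real (card ?I) = h"
      using ij by (simp add: \<eta>_def h_def power_add left_diff_distrib of_nat_diff field_simps)
    have wsq: "AE \<omega> in M. (sqrt (w \<omega>))\<^sup>2 = w \<omega>" by (rule AE_I2) (simp add: w)
    have "expectation (\<lambda>\<omega>. w \<omega> * (RI m i j n \<omega>)\<^sup>2) = expectation (\<lambda>\<omega>. (sqrt (w \<omega>))\<^sup>2 * (RI m i j n \<omega>)\<^sup>2)"
      by (intro Bochner_Integration.integral_cong) (auto simp: w)
    also have "\<dots> = \<eta> * (\<Sum>k\<in>?I. expectation (\<lambda>\<omega>. (sqrt (w \<omega>))\<^sup>2 * \<bar>Y (real k / 2^(m+n)) \<omega>\<bar>))"
      using RI_weighted(2)[OF ij g sw, of n] by (simp add: \<eta>_def)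
    also have "\<dots> = \<eta> * (\<Sum>k\<in>?I. expectation (\<lambda>\<omega>. w \<omega> * \<bar>Y (real k / 2^(m+n)) \<omega>\<bar>))"
      by (intro arg_cong2[where f="(*)"] sum.cong Bochner_Integration.integral_cong) (auto simp: w)
    finally have eq: "expectation (\<lambda>\<omega>. w \<omega> * (RI m i j n \<omega>)\<^sup>2) = \<eta> * (\<Sum>k\<in>?I. expectation (\<lambda>\<omega>. w \<omega> * \<bar>Y (real k / 2^(m+n)) \<omega>\<bar>))" .
    have "h * ?E = \<eta> * (\<Sum>k\<in>?I. ?E)" by (simp only: sum_constant card[symmetric] mult.assoc)
    then have "expectation (\<lambda>\<omega>. w \<omega> * (RI m i j n \<omega>)\<^sup>2) - h * ?E =
       \<eta> * (\<Sum>k\<in>?I. expectation (\<lambda>\<omega>. w \<omega> * \<bar>Y (real k / 2^(m+n)) \<omega>\<bar>) - ?E)"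
      by (simp only: eq sum_subtractf right_diff_distrib)
    also have "\<bar>\<dots>\<bar> \<le> \<eta> * (\<Sum>k\<in>?I. \<bar>expectation (\<lambda>\<omega>. w \<omega> * \<bar>Y (real k / 2^(m+n)) \<omega>\<bar>) - ?E\<bar>)"
      using \<eta> by (simp add: abs_mult sum_abs)
    also have "\<dots> \<le> \<eta> * (\<Sum>k\<in>?I. G * sqc T * sqrt h)"
    proof (intro mult_left_mono sum_mono)
      fix k assume k: "k \<in> ?I"
      have ii: "real (i * 2^n) / 2^(m+n) = real i / 2^m" by (simp add: power_add)
      have "expectation (\<lambda>\<omega>. w \<omega> * \<bar>Y (real k / 2^(m+n)) \<omega>\<bar>) - ?E =
         expectation (\<lambda>\<omega>. w \<omega> * (\<bar>Y (real k / 2^(m+n)) \<omega>\<bar> - \<bar>Y (real i / 2^m) \<omega>\<bar>))"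
        using integrable_bounded_mult(1)[OF wM wB, of "\<lambda>\<omega>. \<bar>Y (real k / 2^(m+n)) \<omega>\<bar>"]
          integrable_bounded_mult(1)[OF wM wB, of "\<lambda>\<omega>. \<bar>Y (real i / 2^m) \<omega>\<bar>"] Yint
        by (simp add: right_diff_distrib)
      also have "\<bar>\<dots>\<bar> \<le> G * expectation (\<lambda>\<omega>. \<bar>\<bar>Y (real k / 2^(m+n)) \<omega>\<bar> - \<bar>Y (real i / 2^m) \<omega>\<bar>\<bar>)"
        using Yint by (intro integrable_bounded_mult(2)[OF wM wB]) auto
      also have "\<dots> \<le> G * expectation (\<lambda>\<omega>. \<bar>Y (real k / 2^(m+n)) \<omega> - Y (real i / 2^m) \<omega>\<bar>)"
        using Yint G by (intro mult_left_mono integral_mono) auto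
      also have "\<dots> \<le> G * (sqc T * sqrt (real (k - i * 2^n) / 2^(m+n)))"
      proof (intro mult_left_mono G)
        have "real k \<le> real (j * 2^n)" using k by (simp only: of_nat_le_iff) simp
        then have "real k / 2^(m+n) \<le> real j / 2^m" by (simp add: power_add field_simps)
        then show "expectation (\<lambda>\<omega>. \<bar>Y (real k / 2^(m+n)) \<omega> - Y (real i / 2^m) \<omega>\<bar>) \<le> sqc T * sqrt (real (k - i * 2^n) / 2^(m+n))"
          using k T unfolding sqc_def ii[symmetric] by (intro Y_increment_L1) auto
      qed
      also have "\<dots> \<le> G * (sqc T * sqrt h)"
      proof (intro mult_left_mono G sqc_nonneg T real_sqrt_le_mono)
        have "k - i * 2^n \<le> (j - i) * 2^n" using k by (simp add: diff_mult_distrib diff_le_mono)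
        then have "real (k - i * 2^n) \<le> real ((j - i) * 2^n)" by (simp only: of_nat_le_iff)
        then show "real (k - i * 2^n) / 2^(m+n) \<le> h" by (simp add: h_def power_add field_simps)
      qed
      finally show "\<bar>expectation (\<lambda>\<omega>. w \<omega> * \<bar>Y (real k / 2^(m+n)) \<omega>\<bar>) - ?E\<bar> \<le> G * sqc T * sqrt h" by (simp add: mult_ac)
    qed (use \<eta> in simp)
    also have "\<dots> = G * sqc T * h * sqrt h" by (simp only: sum_constant card[symmetric] mult_ac)
    finally show ?thesis .
  qed
  have conv: "(\<lambda>n. expectation (\<lambda>\<omega>. w \<omega> * (RI m i j n \<omega>)\<^sup>2)) \<longlonglongrightarrow> expectation (\<lambda>\<omega>. w \<omega> * (D m i j \<omega>)\<^sup>2)"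
  proof -
    define e where "e n = expectation (\<lambda>\<omega>. (RI m i j n \<omega> - D m i j \<omega>)\<^sup>2)" for n
    define d where "d = expectation (\<lambda>\<omega>. (D m i j \<omega>)\<^sup>2)"
    have bound: "\<bar>expectation (\<lambda>\<omega>. w \<omega> * (RI m i j n \<omega>)\<^sup>2) - expectation (\<lambda>\<omega>. w \<omega> * (D m i j \<omega>)\<^sup>2)\<bar> \<le> G * (e n + 2 * (sqrt (e n) * sqrt d))" for n
    proof -
      let ?Z = "\<lambda>\<omega>. RI m i j n \<omega> - D m i j \<omega>"
      note I = D_integrable[OF ij]
      note b = integrable_bounded_mult(1)[OF wM wB]
      have iZD: "integrable M (\<lambda>\<omega>. \<bar>?Z \<omega>\<bar> * \<bar>D m i j \<omega>\<bar>)"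
        using I by (intro integrable_mult_L2) auto
      have "expectation (\<lambda>\<omega>. w \<omega> * (RI m i j n \<omega>)\<^sup>2) - expectation (\<lambda>\<omega>. w \<omega> * (D m i j \<omega>)\<^sup>2) = expectation (\<lambda>\<omega>. w \<omega> * ((RI m i j n \<omega>)\<^sup>2 - (D m i j \<omega>)\<^sup>2))"
        using b[OF I(1)] b[OF I(3)] by (simp add: right_diff_distrib)
      also have "\<bar>\<dots>\<bar> \<le> G * expectation (\<lambda>\<omega>. \<bar>(RI m i j n \<omega>)\<^sup>2 - (D m i j \<omega>)\<^sup>2\<bar>)"
        using I by (intro integrable_bounded_mult(2)[OF wM wB]) auto
      also have "\<dots> \<le> G * expectation (\<lambda>\<omega>. (?Z \<omega>)\<^sup>2 + 2 * (\<bar>?Z \<omega>\<bar> * \<bar>D m i j \<omega>\<bar>))"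
      proof (rule mult_left_mono[OF integral_mono G])
        show "integrable M (\<lambda>\<omega>. \<bar>(RI m i j n \<omega>)\<^sup>2 - (D m i j \<omega>)\<^sup>2\<bar>)"
          using I(1) I(3)[of m n] by simp
        show "integrable M (\<lambda>\<omega>. (?Z \<omega>)\<^sup>2 + 2 * (\<bar>?Z \<omega>\<bar> * \<bar>D m i j \<omega>\<bar>))"
          using I(5)[of m n] iZD by (intro Bochner_Integration.integrable_add integrable_mult_right)
        fix \<omega>
        have eq: "(RI m i j n \<omega>)\<^sup>2 - (D m i j \<omega>)\<^sup>2 = (?Z \<omega>)\<^sup>2 + 2 * (?Z \<omega> * D m i j \<omega>)"
          by (simp add: power2_eq_square algebra_simps)
        show "\<bar>(RI m i j n \<omega>)\<^sup>2 - (D m i j \<omega>)\<^sup>2\<bar> \<le> (?Z \<omega>)\<^sup>2 + 2 * (\<bar>?Z \<omega>\<bar> * \<bar>D m i j \<omega>\<bar>)"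
          unfolding eq by (rule order_trans[OF abs_triangle_ineq]) (simp add: abs_mult)
      qed
      also have "expectation (\<lambda>\<omega>. (?Z \<omega>)\<^sup>2 + 2 * (\<bar>?Z \<omega>\<bar> * \<bar>D m i j \<omega>\<bar>)) = e n + 2 * expectation (\<lambda>\<omega>. \<bar>?Z \<omega>\<bar> * \<bar>D m i j \<omega>\<bar>)"
        using I iZD by (simp add: e_def)
      also have "expectation (\<lambda>\<omega>. \<bar>?Z \<omega>\<bar> * \<bar>D m i j \<omega>\<bar>) \<le> sqrt (e n) * sqrt d"
        using cauchy_schwarz_expectation[of "\<lambda>\<omega>. \<bar>?Z \<omega>\<bar>" "\<lambda>\<omega>. \<bar>D m i j \<omega>\<bar>"] I by (simp add: e_def d_def)
      finally show ?thesis using G by (simp add: mult_left_mono)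
    qed
    have "e \<longlonglongrightarrow> 0" unfolding e_def by (rule RI_L2_conv[OF ij])
    then have "(\<lambda>n. G * (e n + 2 * (sqrt (e n) * sqrt d))) \<longlonglongrightarrow> G * (0 + 2 * (sqrt 0 * sqrt d))"
      by (intro tendsto_intros)
    then have "(\<lambda>n. expectation (\<lambda>\<omega>. w \<omega> * (RI m i j n \<omega>)\<^sup>2) - expectation (\<lambda>\<omega>. w \<omega> * (D m i j \<omega>)\<^sup>2)) \<longlonglongrightarrow> 0"
      by (rule_tac Lim_null_comparison[rotated]) (use bound in auto)
    then show ?thesis by (simp add: LIM_zero_iff)
  qed
  have "(\<lambda>n. \<bar>expectation (\<lambda>\<omega>. w \<omega> * (RI m i j n \<omega>)\<^sup>2) - h * ?E\<bar>) \<longlonglongrightarrow> \<bar>expectation (\<lambda>\<omega>. w \<omega> * (D m i j \<omega>)\<^sup>2) - h * ?E\<bar>"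
    by (intro tendsto_intros conv)
  then show ?thesis using R by (intro LIMSEQ_le_const2) auto
qed

end

section \<open>One-step expansions and non-negativity\<close>

text \<open>Only a Lipschitz bound on the second derivative is asked for, because the function made
  from \<open>psi\<close> and the negative part has a kink in its second derivative at 0.\<close>

lemma taylor3:
  fixes \<Phi> \<Phi>1 \<Phi>2 :: "real \<Rightarrow> real"
  assumes d1: "\<And>x. x \<in> closed_segment u v \<Longrightarrow> (\<Phi> has_real_derivative \<Phi>1 x) (at x)"
    and d2: "\<And>x. x \<in> closed_segment u v \<Longrightarrow> (\<Phi>1 has_real_derivative \<Phi>2 x) (at x)"
    and lip: "\<And>x. x \<in> closed_segment u v \<Longrightarrow> \<bar>\<Phi>2 x - \<Phi>2 u\<bar> \<le> L * \<bar>x - u\<bar>" and L: "0 \<le> L"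
  shows "\<bar>\<Phi> v - \<Phi> u - \<Phi>1 u * (v - u) - \<Phi>2 u * (v - u)\<^sup>2 / 2\<bar> \<le> L * \<bar>v - u\<bar> ^ 3"
proof -
  let ?S = "closed_segment u v"
  have seg: "\<bar>x - u\<bar> \<le> \<bar>v - u\<bar>" if "x \<in> ?S" for x
    using that by (auto simp: closed_segment_eq_real_ivl split: if_splits)
  have b1: "\<bar>\<Phi>1 x - \<Phi>1 u - \<Phi>2 u * (x - u)\<bar> \<le> L * \<bar>v - u\<bar>\<^sup>2" if x: "x \<in> ?S" for x
  proof -
    have "norm ((\<Phi>1 x - \<Phi>2 u * x) - (\<Phi>1 u - \<Phi>2 u * u)) \<le> L * \<bar>v - u\<bar> * norm (x - u)"
    proof (rule field_differentiable_bound[where S="?S" and f'="\<lambda>x. \<Phi>2 x - \<Phi>2 u"])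
      fix z assume z: "z \<in> ?S"
      have "((\<lambda>x. \<Phi>1 x - \<Phi>2 u * x) has_real_derivative \<Phi>2 z - \<Phi>2 u) (at z)"
        by (rule derivative_eq_intros d2[OF z] refl | simp)+
      then show "((\<lambda>x. \<Phi>1 x - \<Phi>2 u * x) has_real_derivative \<Phi>2 z - \<Phi>2 u) (at z within ?S)"
        by (rule has_field_derivative_at_within)
      show "norm (\<Phi>2 z - \<Phi>2 u) \<le> L * \<bar>v - u\<bar>"
        using lip[OF z] mult_left_mono[OF seg[OF z] L] by simp
    qed (use x in auto)
    also have "\<dots> \<le> L * \<bar>v - u\<bar> * \<bar>v - u\<bar>" using seg[OF x] L by (simp add: mult_left_mono)
    finally show ?thesis by (simp add: power2_eq_square algebra_simps)
  qed
  have "norm ((\<Phi> v - \<Phi>1 u * v - \<Phi>2 u * (v - u)\<^sup>2 / 2) - (\<Phi> u - \<Phi>1 u * u - \<Phi>2 u * (u - u)\<^sup>2 / 2)) \<le> L * \<bar>v - u\<bar>\<^sup>2 * norm (v - u)"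
  proof (rule field_differentiable_bound[where S="?S" and f'="\<lambda>x. \<Phi>1 x - \<Phi>1 u - \<Phi>2 u * (x - u)"])
    fix z assume z: "z \<in> ?S"
    have "((\<lambda>x. \<Phi> x - \<Phi>1 u * x - \<Phi>2 u * (x - u)\<^sup>2 / 2) has_real_derivative \<Phi>1 z - \<Phi>1 u - \<Phi>2 u * (z - u)) (at z)"
      by (rule derivative_eq_intros d1[OF z] refl | simp)+
    then show "((\<lambda>x. \<Phi> x - \<Phi>1 u * x - \<Phi>2 u * (x - u)\<^sup>2 / 2) has_real_derivative \<Phi>1 z - \<Phi>1 u - \<Phi>2 u * (z - u)) (at z within ?S)"
      by (rule has_field_derivative_at_within)
  qed (use b1 in auto)
  then show ?thesis by (simp add: power2_eq_square power3_eq_cube algebra_simps)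
qed

lemma cube_sum_le: "0 \<le> a \<Longrightarrow> 0 \<le> b \<Longrightarrow> (a + b) ^ 3 \<le> 4 * (a ^ 3 + b ^ 3)" for a b :: real
proof -
  assume "0 \<le> a" "0 \<le> b"
  then have "0 \<le> 3 * (a + b) * (a - b)\<^sup>2" by simp
  also have "\<dots> = 4 * (a ^ 3 + b ^ 3) - (a + b) ^ 3" by algebra
  finally show ?thesis by simp
qed

context besq
begin

definition onec :: "real \<Rightarrow> real" where
  "onec T = \<delta>\<^sup>2 + 2 * sqc T + 4 * \<delta> ^ 3 + 32 * mc T 3"

lemma onec_nonneg: "0 < T \<Longrightarrow> 0 \<le> onec T"
  using sqc_nonneg[of T] mc_nonneg[of T 3] \<delta>_pos by (simp add: onec_def)

text \<open>A weak form of Ito's formula over one grid step: an error of order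
  \<open>h * sqrt h\<close> remains small after summation over about \<open>1/h\<close> steps. The
  Taylor bound is required on a set \<open>U\<close> that contains the path values almost surely:
  the whole line while non-negativity is being proved, \<open>{0..}\<close> afterwards, where
  exponentials have bounded derivatives.\<close>

lemma one_step:
  fixes \<Phi> \<Phi>1 \<Phi>2 :: "real \<Rightarrow> real"
  assumes T: "real (Suc i) / 2^m \<le> T" "0 < T"
    and [measurable]: "\<Phi> \<in> borel_measurable borel" "\<Phi>1 \<in> borel_measurable borel" "\<Phi>2 \<in> borel_measurable borel"
    and \<Phi>1: "\<And>x. \<bar>\<Phi>1 x\<bar> \<le> G" and \<Phi>2: "\<And>x. 0 \<le> \<Phi>2 x" "\<And>x. \<Phi>2 x \<le> G" and L: "0 \<le> L"
    and U: "AE w in M. Y (real i / 2^m) w \<in> U" "AE w in M. Y (real (Suc i) / 2^m) w \<in> U"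
    and taylor: "\<And>u v. u \<in> U \<Longrightarrow> v \<in> U \<Longrightarrow> \<bar>\<Phi> v - \<Phi> u - \<Phi>1 u * (v - u) - \<Phi>2 u * (v - u)\<^sup>2 / 2\<bar> \<le> L * \<bar>v - u\<bar> ^ 3"
    and g: "g \<in> borel_measurable (F (real i / 2^m))" "\<And>w. w \<in> space M \<Longrightarrow> 0 \<le> g w" "\<And>w. w \<in> space M \<Longrightarrow> g w \<le> 1"
  defines "h \<equiv> 1 / 2^m"
  defines "\<Delta> \<equiv> \<lambda>w. g w * (\<Phi> (Y (real (Suc i) / 2^m) w) - \<Phi> (Y (real i / 2^m) w))"
  shows "integrable M \<Delta>"
    and "\<bar>expectation \<Delta> - h * (\<delta> * expectation (\<lambda>w. g w * \<Phi>1 (Y (real i / 2^m) w))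
        + 2 * expectation (\<lambda>w. g w * \<Phi>2 (Y (real i / 2^m) w) * \<bar>Y (real i / 2^m) w\<bar>))\<bar> \<le> onec T * (G + L) * (h * sqrt h)"
proof -
  let ?s = "real i / 2^m"
  have gM[measurable]: "g \<in> borel_measurable M" using g(1) by (rule measurable_F_le)
  have h: "0 < h" "h \<le> 1" by (auto simp: h_def)
  have ij: "i < Suc i" by simp
  have hh: "real (Suc i - i) / 2^m = h" by (simp add: h_def)
  define d where "d = D m i (Suc i)"
  have [measurable]: "d \<in> borel_measurable M" by (simp add: d_def)
  define c1 c2 where "c1 w = g w * \<Phi>1 (Y ?s w)" and "c2 w = g w * \<Phi>2 (Y ?s w)" for w
  have Ys: "Y ?s \<in> borel_measurable (F ?s)" by (rule X_measurable_F) auto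
  have m1: "c1 \<in> borel_measurable (F ?s)" "c2 \<in> borel_measurable (F ?s)"
    unfolding c1_def[abs_def] c2_def[abs_def] using g(1) Ys by measurable
  have m2[measurable]: "c1 \<in> borel_measurable M" "c2 \<in> borel_measurable M"
    using m1 measurable_F_le by blast+
  have G: "0 \<le> G" using \<Phi>1[of 0] by linarith
  have c1b: "\<bar>c1 w\<bar> \<le> G" if "w \<in> space M" for w
    using mult_mono[OF g(3)[OF that] \<Phi>1[of "Y ?s w"]] g(2)[OF that] by (simp add: c1_def abs_mult)
  have c2b: "0 \<le> c2 w" "c2 w \<le> G" if "w \<in> space M" for w
    using mult_mono[OF g(3)[OF that] \<Phi>2(2)[of "Y ?s w"]] g(2)[OF that] \<Phi>2(1)[of "Y ?s w"] by (simp_all add: c2_def)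
  have c2b': "\<bar>c2 w\<bar> \<le> G" if "w \<in> space M" for w using c2b[OF that] by simp
  have B1: "\<forall>w\<in>space M. \<bar>c1 w\<bar> \<le> G" and B2: "\<forall>w\<in>space M. \<bar>c2 w\<bar> \<le> G" using c1b c2b' by auto
  note dI = D_integrable[OF ij, of m, folded d_def]
  note d3 = D_moment[OF ij T, of 3, folded d_def, unfolded hh]
  have d1: "expectation (\<lambda>w. c1 w * d w) = 0" "expectation (\<lambda>w. c2 w * d w) = 0"
    unfolding d_def by (rule D_mean[OF ij]; use m1 c1b c2b' in blast)+
  have d2: "\<bar>expectation (\<lambda>w. c2 w * (d w)\<^sup>2) - h * expectation (\<lambda>w. c2 w * \<bar>Y ?s w\<bar>)\<bar> \<le> G * sqc T * h * sqrt h"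
    using D_square[OF ij T m1(2), of G] c2b unfolding hh d_def by blast
  define X where "X w = \<delta> * h + 2 * d w" for w
  have [measurable]: "X \<in> borel_measurable M" unfolding X_def[abs_def] by measurable
  have YX: "Y (real (Suc i) / 2^m) w - Y ?s w = X w" for w
    using Y_increment[of "Suc i" m w i] by (simp add: X_def d_def h_def add_divide_distrib)
  have [measurable]: "\<Delta> \<in> borel_measurable M" unfolding \<Delta>_def by measurable
  \<comment> \<open>The Taylor remainder. Its mean is controlled by \<open>h ^ 3\<close> and the
    third absolute moment of \<open>d\<close>, both at most of order
    \<open>h * sqrt h\<close>.\<close>
  define r where "r w = \<Delta> w - c1 w * X w - c2 w * (X w)\<^sup>2 / 2" for w
  have [measurable]: "r \<in> borel_measurable M" unfolding r_def[abs_def] by measurable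
  have X3: "\<bar>X w\<bar> ^ 3 \<le> 4 * ((\<delta> * h) ^ 3 + 8 * \<bar>d w\<bar> ^ 3)" for w
  proof -
    have p: "0 \<le> \<delta> * h" using h \<delta>_pos by simp
    then have "\<bar>X w\<bar> \<le> \<delta> * h + 2 * \<bar>d w\<bar>" unfolding X_def by linarith
    then have "\<bar>X w\<bar> ^ 3 \<le> (\<delta> * h + 2 * \<bar>d w\<bar>) ^ 3" by (rule power_mono) simp
    also have "\<dots> \<le> 4 * ((\<delta> * h) ^ 3 + (2 * \<bar>d w\<bar>) ^ 3)" by (rule cube_sum_le) (use p in auto)
    finally show ?thesis by (simp add: power_mult_distrib)
  qed
  have rle: "AE w in M. \<bar>r w\<bar> \<le> L * (4 * ((\<delta> * h) ^ 3 + 8 * \<bar>d w\<bar> ^ 3))"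
    using U AE_space
  proof eventually_elim
    case (elim w)
    let ?t = "\<Phi> (Y (real (Suc i) / 2^m) w) - \<Phi> (Y ?s w) - \<Phi>1 (Y ?s w) * X w - \<Phi>2 (Y ?s w) * (X w)\<^sup>2 / 2"
    have "r w = g w * ?t" by (simp add: r_def \<Delta>_def c1_def c2_def algebra_simps)
    then have "\<bar>r w\<bar> \<le> 1 * \<bar>?t\<bar>" using g(2,3)[OF elim(3)] by (simp add: abs_mult mult_left_le_one_le)
    also have "\<bar>?t\<bar> \<le> L * \<bar>X w\<bar> ^ 3" using taylor[OF elim(1,2)] by (simp only: YX)
    also have "\<dots> \<le> L * (4 * ((\<delta> * h) ^ 3 + 8 * \<bar>d w\<bar> ^ 3))" using X3 L by (intro mult_left_mono) auto
    finally show ?case by simp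
  qed
  have iB: "integrable M (\<lambda>w. L * (4 * ((\<delta> * h) ^ 3 + 8 * \<bar>d w\<bar> ^ 3)))"
    using d3(1) by simp
  have ir: "integrable M r"
    by (rule Bochner_Integration.integrable_bound[OF iB]) (use rle in \<open>auto elim!: eventually_mono\<close>)
  have Er: "\<bar>expectation r\<bar> \<le> L * (4 * \<delta> ^ 3 + 32 * mc T 3) * (h * sqrt h)"
  proof -
    have "\<bar>expectation r\<bar> \<le> expectation (\<lambda>w. \<bar>r w\<bar>)" by (rule integral_abs_bound)
    also have "\<dots> \<le> expectation (\<lambda>w. L * (4 * ((\<delta> * h) ^ 3 + 8 * \<bar>d w\<bar> ^ 3)))"
      using ir iB rle by (intro integral_mono_AE) auto
    also have "\<dots> = L * (4 * ((\<delta> * h) ^ 3 + 8 * expectation (\<lambda>w. \<bar>d w\<bar> ^ 3)))"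
      using d3(1) by (simp add: prob_space)
    also have "\<dots> \<le> L * (4 * (\<delta> ^ 3 * (h * sqrt h) + 8 * (mc T 3 * (h * sqrt h))))"
    proof (intro mult_left_mono add_mono L)
      have "h ^ 2 \<le> sqrt h"
      proof -
        have "h ^ 2 \<le> h" using h by (simp add: power2_eq_square mult_left_le)
        also have "h = sqrt h * sqrt h" using h by simp
        also have "\<dots> \<le> sqrt h" using h by (intro mult_left_le) auto
        finally show ?thesis .
      qed
      then have "h ^ 3 \<le> h * sqrt h" using h by (simp add: power3_eq_cube power2_eq_square mult_left_mono mult.assoc)
      then show "(\<delta> * h) ^ 3 \<le> \<delta> ^ 3 * (h * sqrt h)" using \<delta>_pos by (simp add: power_mult_distrib)
      have "sqrt h ^ 3 = h * sqrt h" using h by (simp add: power3_eq_cube)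
      then show "expectation (\<lambda>w. \<bar>d w\<bar> ^ 3) \<le> mc T 3 * (h * sqrt h)" using d3(2) by simp
    qed auto
    finally show ?thesis by (simp add: algebra_simps)
  qed
  note b1 = integrable_bounded_mult(1)[OF m2(1) B1] and b2 = integrable_bounded_mult(1)[OF m2(2) B2]
  have ic: "integrable M c1" "integrable M c2" using b1[of "\<lambda>_. 1"] b2[of "\<lambda>_. 1"] by auto
  have e1: "(\<lambda>w. c1 w * X w) = (\<lambda>w. \<delta> * h * c1 w + 2 * (c1 w * d w))"
    by (simp add: X_def algebra_simps)
  have i1: "integrable M (\<lambda>w. c1 w * X w)" and E1: "expectation (\<lambda>w. c1 w * X w) = \<delta> * h * expectation c1"
    unfolding e1 using ic b1[OF dI(2)] d1 by auto
  have e2: "(\<lambda>w. c2 w * (X w)\<^sup>2 / 2) = (\<lambda>w. \<delta>\<^sup>2 * h\<^sup>2 / 2 * c2 w + 2 * \<delta> * h * (c2 w * d w) + 2 * (c2 w * (d w)\<^sup>2))"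
    by (rule ext) (simp add: X_def power2_eq_square field_simps)
  have i2: "integrable M (\<lambda>w. c2 w * (X w)\<^sup>2 / 2)"
    and E2: "expectation (\<lambda>w. c2 w * (X w)\<^sup>2 / 2) = \<delta>\<^sup>2 * h\<^sup>2 / 2 * expectation c2 + 2 * expectation (\<lambda>w. c2 w * (d w)\<^sup>2)"
    unfolding e2 using ic b2[OF dI(2)] b2[OF dI(1)] d1 by auto
  have \<Delta>eq: "\<Delta> = (\<lambda>w. c1 w * X w + c2 w * (X w)\<^sup>2 / 2 + r w)" by (simp add: r_def)
  show "integrable M \<Delta>" unfolding \<Delta>eq using i1 i2 ir by simp
  have E: "expectation \<Delta> = expectation (\<lambda>w. c1 w * X w) + expectation (\<lambda>w. c2 w * (X w)\<^sup>2 / 2) + expectation r"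
    unfolding \<Delta>eq using i1 i2 ir by simp
  have c2E: "0 \<le> expectation c2" "expectation c2 \<le> G"
    using c2b ic by (auto intro!: integral_nonneg_AE integral_le_const AE_I2)
  have h2: "h\<^sup>2 \<le> h * sqrt h"
  proof -
    have "h = sqrt h * sqrt h" using h by simp
    also have "\<dots> \<le> sqrt h" using h by (intro mult_left_le) auto
    finally show ?thesis using h by (simp add: power2_eq_square mult_left_mono)
  qed
  let ?w = "h * sqrt h"
  have w: "0 \<le> ?w" using h by simp
  have "\<bar>expectation \<Delta> - h * (\<delta> * expectation c1 + 2 * expectation (\<lambda>w. c2 w * \<bar>Y ?s w\<bar>))\<bar> =
    \<bar>\<delta>\<^sup>2 * h\<^sup>2 / 2 * expectation c2 + 2 * (expectation (\<lambda>w. c2 w * (d w)\<^sup>2) - h * expectation (\<lambda>w. c2 w * \<bar>Y ?s w\<bar>)) + expectation r\<bar>"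
    unfolding E E1 E2 by (simp add: algebra_simps)
  also have "\<dots> \<le> \<bar>\<delta>\<^sup>2 * h\<^sup>2 / 2 * expectation c2\<bar> + 2 * \<bar>expectation (\<lambda>w. c2 w * (d w)\<^sup>2) - h * expectation (\<lambda>w. c2 w * \<bar>Y ?s w\<bar>)\<bar> + \<bar>expectation r\<bar>"
  proof -
    have "\<bar>a + 2 * b + c\<bar> \<le> \<bar>a\<bar> + 2 * \<bar>b\<bar> + \<bar>c\<bar>" for a b c :: real by linarith
    then show ?thesis .
  qed
  also have "\<dots> \<le> \<delta>\<^sup>2 * G * ?w + 2 * (G * sqc T * h * sqrt h) + L * (4 * \<delta> ^ 3 + 32 * mc T 3) * ?w"
  proof (intro add_mono mult_left_mono d2 Er)
    have "\<delta>\<^sup>2 * h\<^sup>2 / 2 * expectation c2 \<le> \<delta>\<^sup>2 * ?w * G"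
    proof (intro mult_mono)
      have "\<delta>\<^sup>2 * h\<^sup>2 / 2 \<le> \<delta>\<^sup>2 * h\<^sup>2" by simp
      also have "\<dots> \<le> \<delta>\<^sup>2 * ?w" using h2 by (intro mult_left_mono) auto
      finally show "\<delta>\<^sup>2 * h\<^sup>2 / 2 \<le> \<delta>\<^sup>2 * ?w" .
    qed (use c2E w in auto)
    then show "\<bar>\<delta>\<^sup>2 * h\<^sup>2 / 2 * expectation c2\<bar> \<le> \<delta>\<^sup>2 * G * ?w" using c2E by (simp add: mult_ac)
  qed auto
  also have "\<dots> = (\<delta>\<^sup>2 + 2 * sqc T) * G * ?w + (4 * \<delta> ^ 3 + 32 * mc T 3) * L * ?w"
    by (simp add: algebra_simps)
  also have "\<dots> \<le> onec T * G * ?w + onec T * L * ?w"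
    using G L w sqc_nonneg[OF T(2)] mc_nonneg[OF T(2), of 3] \<delta>_pos
    by (intro add_mono mult_right_mono) (auto simp: onec_def)
  also have "\<dots> = onec T * (G + L) * ?w" by (simp add: algebra_simps)
  finally show "\<bar>expectation \<Delta> - h * (\<delta> * expectation (\<lambda>w. g w * \<Phi>1 (Y ?s w))
        + 2 * expectation (\<lambda>w. g w * \<Phi>2 (Y ?s w) * \<bar>Y ?s w\<bar>))\<bar> \<le> onec T * (G + L) * ?w"
    by (simp add: c1_def[abs_def] c2_def)
qed

end

text \<open>\<open>psi \<epsilon>\<close> is a primitive of \<open>psi1 \<epsilon>\<close>, and \<open>z * psi2 \<epsilon> z\<close> is bounded by 2 uniformly in \<open>\<epsilon>\<close> although \<open>psi \<epsilon> z\<close>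
  tends to infinity for \<open>z > 0\<close> as \<open>\<epsilon>\<close> tends to 0: applied to the negative part of Y this forces \<open>Y \<ge> 0\<close>.\<close>

definition psi :: "real \<Rightarrow> real \<Rightarrow> real" where
  "psi \<epsilon> z = (z * ln (1 + z\<^sup>2 / \<epsilon>\<^sup>2) - 2 * z + 2 * \<epsilon> * arctan (z / \<epsilon>)) - (z * ln (1 + z\<^sup>2) - 2 * z + 2 * arctan z)"

definition psi1 :: "real \<Rightarrow> real \<Rightarrow> real" where
  "psi1 \<epsilon> z = ln (1 + z\<^sup>2 / \<epsilon>\<^sup>2) - ln (1 + z\<^sup>2)"

definition psi2 :: "real \<Rightarrow> real \<Rightarrow> real" where
  "psi2 \<epsilon> z = 2 * z / (\<epsilon>\<^sup>2 + z\<^sup>2) - 2 * z / (1 + z\<^sup>2)"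

lemma psi_aux_deriv:
  assumes "(0::real) < \<epsilon>"
  shows "((\<lambda>z. z * ln (1 + z\<^sup>2 / \<epsilon>\<^sup>2) - 2 * z + 2 * \<epsilon> * arctan (z / \<epsilon>)) has_real_derivative ln (1 + z\<^sup>2 / \<epsilon>\<^sup>2)) (at z)"
proof -
  have p: "1 + z\<^sup>2 / \<epsilon>\<^sup>2 > 0" by (intro add_pos_nonneg) auto
  have p': "\<epsilon>\<^sup>2 + z\<^sup>2 > 0" using assms by (intro add_pos_nonneg) auto
  have e: "z * (2 * z / \<epsilon>\<^sup>2 / (1 + z\<^sup>2 / \<epsilon>\<^sup>2)) - 2 + 2 * (1 / (1 + (z / \<epsilon>)\<^sup>2)) = 0"
  proof -
    have a: "1 + z\<^sup>2 / \<epsilon>\<^sup>2 = (\<epsilon>\<^sup>2 + z\<^sup>2) / \<epsilon>\<^sup>2" using assms by (simp add: field_simps)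
    have "z * (2 * z / \<epsilon>\<^sup>2 / (1 + z\<^sup>2 / \<epsilon>\<^sup>2)) - 2 + 2 * (1 / (1 + (z / \<epsilon>)\<^sup>2)) = 2 * z\<^sup>2 / (\<epsilon>\<^sup>2 + z\<^sup>2) - 2 + 2 * \<epsilon>\<^sup>2 / (\<epsilon>\<^sup>2 + z\<^sup>2)"
      unfolding power_divide a using assms by (simp add: power2_eq_square)
    also have "\<dots> = 0"
    proof -
      have *: "2 * (q - e) / q - 2 + 2 * e / q = 0" if "q > 0" for q e :: real
        using that by (simp add: field_simps)
      from *[OF p', of "\<epsilon>\<^sup>2"] show ?thesis by simp
    qed
    finally show ?thesis .
  qed
  have a0: "((\<lambda>z. z\<^sup>2) has_real_derivative 2 * z) (at z)" by (auto intro!: derivative_eq_intros)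
  have a: "((\<lambda>z. 1 + z\<^sup>2 / \<epsilon>\<^sup>2) has_real_derivative 2 * z / \<epsilon>\<^sup>2) (at z)"
    using DERIV_add[OF DERIV_const[of 1] DERIV_cdivide[OF a0, of "\<epsilon>\<^sup>2"]] by simp
  note b = DERIV_chain2[OF DERIV_ln_divide[OF p] a]
  have i: "((\<lambda>z. z / \<epsilon>) has_real_derivative 1 / \<epsilon>) (at z)"
    by (rule DERIV_cdivide[OF DERIV_ident])
  note c = DERIV_chain2[OF DERIV_arctan i]
  note d = DERIV_add[OF DERIV_diff[OF DERIV_mult[OF DERIV_ident b] DERIV_cmult[OF DERIV_ident, of 2]] DERIV_cmult[OF c, of "2 * \<epsilon>"]]
  have f: "2 * \<epsilon> * (inverse (1 + (z / \<epsilon>)\<^sup>2) * (1 / \<epsilon>)) = 2 * (1 / (1 + (z / \<epsilon>)\<^sup>2))"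
    using assms by (simp add: divide_inverse)
  have g: "1 / (1 + z\<^sup>2 / \<epsilon>\<^sup>2) * (2 * z / \<epsilon>\<^sup>2) * z = z * (2 * z / \<epsilon>\<^sup>2 / (1 + z\<^sup>2 / \<epsilon>\<^sup>2))"
    by (simp add: mult_ac)
  show ?thesis
  proof (rule DERIV_cong[OF d])
    show "1 * ln (1 + z\<^sup>2 / \<epsilon>\<^sup>2) + 1 / (1 + z\<^sup>2 / \<epsilon>\<^sup>2) * (2 * z / \<epsilon>\<^sup>2) * z - 2 * 1
      + 2 * \<epsilon> * (inverse (1 + (z / \<epsilon>)\<^sup>2) * (1 / \<epsilon>)) = ln (1 + z\<^sup>2 / \<epsilon>\<^sup>2)"
      unfolding f g using e by linarith
  qed
qed

lemma psi_deriv: "0 < \<epsilon> \<Longrightarrow> (psi \<epsilon> has_real_derivative psi1 \<epsilon> z) (at z)"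
  unfolding psi_def[abs_def] psi1_def
  using DERIV_diff[OF psi_aux_deriv[of \<epsilon> z] psi_aux_deriv[of 1 z]] by simp

lemma psi1_deriv: assumes "0 < \<epsilon>" shows "(psi1 \<epsilon> has_real_derivative psi2 \<epsilon> z) (at z)"
proof -
  have p: "1 + z\<^sup>2 / \<epsilon>\<^sup>2 > 0" "1 + z\<^sup>2 > 0" "\<epsilon>\<^sup>2 + z\<^sup>2 > 0" using assms by (auto intro!: add_pos_nonneg)
  have a0: "((\<lambda>z. z\<^sup>2) has_real_derivative 2 * z) (at z)" by (auto intro!: derivative_eq_intros)
  note a = DERIV_add[OF DERIV_const[of 1] DERIV_cdivide[OF a0, of "\<epsilon>\<^sup>2"]]
  note b = DERIV_diff[OF DERIV_chain2[OF DERIV_ln_divide[OF p(1)] a]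
    DERIV_chain2[OF DERIV_ln_divide[OF p(2)] DERIV_add[OF DERIV_const[of 1] a0]]]
  have q: "1 + z\<^sup>2 / \<epsilon>\<^sup>2 = (\<epsilon>\<^sup>2 + z\<^sup>2) / \<epsilon>\<^sup>2" using assms by (simp add: field_simps)
  show ?thesis unfolding psi1_def[abs_def] psi2_def
    by (rule DERIV_cong[OF b]) (use assms in \<open>simp add: q\<close>)
qed

lemma psi2_lipschitz:
  assumes e: "0 < \<epsilon>" "\<epsilon> < 1"
  shows "\<bar>psi2 \<epsilon> x - psi2 \<epsilon> u\<bar> \<le> (4 / \<epsilon>\<^sup>2) * \<bar>x - u\<bar>"
proof -
  have one: "\<bar>2 * (c\<^sup>2 - z\<^sup>2) / (c\<^sup>2 + z\<^sup>2)\<^sup>2\<bar> \<le> 2 / c\<^sup>2" if "0 < c" for c z :: real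
  proof -
    have p: "c\<^sup>2 + z\<^sup>2 > 0" "c\<^sup>2 > 0" using that by (auto intro!: add_pos_nonneg)
    have "\<bar>2 * (c\<^sup>2 - z\<^sup>2) / (c\<^sup>2 + z\<^sup>2)\<^sup>2\<bar> = 2 * \<bar>c\<^sup>2 - z\<^sup>2\<bar> / (c\<^sup>2 + z\<^sup>2)\<^sup>2" by (simp only: abs_divide abs_mult) simp
    also have "\<dots> \<le> 2 * (c\<^sup>2 + z\<^sup>2) / (c\<^sup>2 + z\<^sup>2)\<^sup>2"
      using p by (intro divide_right_mono mult_left_mono) (auto simp: abs_le_iff)
    also have "\<dots> = 2 / (c\<^sup>2 + z\<^sup>2)"
    proof -
      have *: "2 * q / q\<^sup>2 = 2 / q" for q :: real by (simp add: power2_eq_square)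
      show ?thesis by (rule *)
    qed
    also have "\<dots> \<le> 2 / c\<^sup>2" using p by (intro divide_left_mono) auto
    finally show ?thesis .
  qed
  have dd: "((\<lambda>z. 2 * z / (c\<^sup>2 + z\<^sup>2)) has_real_derivative 2 * (c\<^sup>2 - z\<^sup>2) / (c\<^sup>2 + z\<^sup>2)\<^sup>2) (at z)" if "0 < c" for c z :: real
  proof -
    have p: "c\<^sup>2 + z\<^sup>2 \<noteq> 0" using that by (auto simp: add_pos_nonneg less_imp_neq[symmetric])
    show ?thesis
      using that p by (auto intro!: derivative_eq_intros simp: power2_eq_square algebra_simps)
  qed
  have "norm (psi2 \<epsilon> x - psi2 \<epsilon> u) \<le> (4 / \<epsilon>\<^sup>2) * norm (x - u)"
  proof (rule field_differentiable_bound[where S=UNIV and f'="\<lambda>z. 2 * (\<epsilon>\<^sup>2 - z\<^sup>2) / (\<epsilon>\<^sup>2 + z\<^sup>2)\<^sup>2 - 2 * (1\<^sup>2 - z\<^sup>2) / (1\<^sup>2 + z\<^sup>2)\<^sup>2"])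
    fix z
    show "(psi2 \<epsilon> has_real_derivative 2 * (\<epsilon>\<^sup>2 - z\<^sup>2) / (\<epsilon>\<^sup>2 + z\<^sup>2)\<^sup>2 - 2 * (1\<^sup>2 - z\<^sup>2) / (1\<^sup>2 + z\<^sup>2)\<^sup>2) (at z within UNIV)"
      unfolding psi2_def[abs_def] using dd[OF e(1), of z] dd[of 1 z] by (intro DERIV_diff) auto
    have "2 / 1\<^sup>2 \<le> 2 / \<epsilon>\<^sup>2" using e by (intro divide_left_mono) (auto simp: power_le_one)
    then show "norm (2 * (\<epsilon>\<^sup>2 - z\<^sup>2) / (\<epsilon>\<^sup>2 + z\<^sup>2)\<^sup>2 - 2 * (1\<^sup>2 - z\<^sup>2) / (1\<^sup>2 + z\<^sup>2)\<^sup>2) \<le> 4 / \<epsilon>\<^sup>2"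
      using one[OF e(1), of z] one[of 1 z] unfolding real_norm_def by linarith
  qed auto
  then show ?thesis by simp
qed

lemma psi1_bounds:
  assumes e: "0 < \<epsilon>" "\<epsilon> < 1"
  shows "0 \<le> psi1 \<epsilon> z" "psi1 \<epsilon> z \<le> ln (1 / \<epsilon>\<^sup>2)"
proof -
  have p: "1 + z\<^sup>2 > 0" "1 + z\<^sup>2 / \<epsilon>\<^sup>2 > 0" by (auto intro!: add_pos_nonneg)
  have e2: "\<epsilon>\<^sup>2 \<le> 1" "\<epsilon>\<^sup>2 > 0" using e by (auto simp: power_le_one)
  have a: "z\<^sup>2 \<le> z\<^sup>2 / \<epsilon>\<^sup>2" using e2 by (simp add: pos_le_divide_eq mult_left_le)
  then show "0 \<le> psi1 \<epsilon> z" using p by (simp add: psi1_def)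
  have "1 \<le> 1 / \<epsilon>\<^sup>2" using e2 by simp
  then have "1 + z\<^sup>2 / \<epsilon>\<^sup>2 \<le> (1 / \<epsilon>\<^sup>2) * (1 + z\<^sup>2)" by (simp add: distrib_left)
  then have "ln (1 + z\<^sup>2 / \<epsilon>\<^sup>2) \<le> ln ((1 / \<epsilon>\<^sup>2) * (1 + z\<^sup>2))" using p by (subst ln_le_cancel_iff) auto
  also have "\<dots> = ln (1 / \<epsilon>\<^sup>2) + ln (1 + z\<^sup>2)" using e2 p by (subst ln_mult) auto
  finally show "psi1 \<epsilon> z \<le> ln (1 / \<epsilon>\<^sup>2)" by (simp add: psi1_def)
qed

lemma psi2_bounds:
  assumes e: "0 < \<epsilon>" "\<epsilon> < 1" and z: "0 \<le> z"
  shows "0 \<le> psi2 \<epsilon> z" "psi2 \<epsilon> z \<le> 1 / \<epsilon>" "z * psi2 \<epsilon> z \<le> 2"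
proof -
  have p: "\<epsilon>\<^sup>2 + z\<^sup>2 > 0" "1 + z\<^sup>2 > 0" using e by (auto intro!: add_pos_nonneg)
  have "2 * z / (1 + z\<^sup>2) \<le> 2 * z / (\<epsilon>\<^sup>2 + z\<^sup>2)" using p z e by (intro divide_left_mono) (auto simp: power_le_one)
  then show "0 \<le> psi2 \<epsilon> z" by (simp add: psi2_def)
  have nn: "0 \<le> 2 * z / (1 + z\<^sup>2)" using z by simp
  then have le: "psi2 \<epsilon> z \<le> 2 * z / (\<epsilon>\<^sup>2 + z\<^sup>2)" by (simp add: psi2_def)
  have "2 * z * \<epsilon> \<le> \<epsilon>\<^sup>2 + z\<^sup>2" using sum_squares_bound[of \<epsilon> z] by (simp add: mult_ac)
  then have "2 * z / (\<epsilon>\<^sup>2 + z\<^sup>2) \<le> 1 / \<epsilon>" using p e by (simp add: field_simps)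
  with le show "psi2 \<epsilon> z \<le> 1 / \<epsilon>" by simp
  have "z * psi2 \<epsilon> z \<le> z * (2 * z / (\<epsilon>\<^sup>2 + z\<^sup>2))" using le z by (rule mult_left_mono)
  also have "\<dots> \<le> 2" using p by (simp add: field_simps power2_eq_square)
  finally show "z * psi2 \<epsilon> z \<le> 2" .
qed

text \<open>Away from 0 the function is locally \<open>P (- x)\<close> or constant. At 0 the two
  pieces fit because \<open>P\<close> and \<open>P'\<close> vanish there; the difference quotient is
  dominated by the one of \<open>P (- x)\<close>.\<close>

lemma deriv_negpart:
  fixes P :: "real \<Rightarrow> real"
  assumes d: "\<And>z. (P has_real_derivative P' z) (at z)" and z: "P 0 = 0" "P' 0 = 0"
  shows "((\<lambda>x. P (max 0 (- x))) has_real_derivative - P' (max 0 (- x))) (at x)"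
proof -
  consider "x < 0" | "x > 0" | "x = 0" by linarith
  then show ?thesis
  proof cases
    case 1
    have "((\<lambda>x. P (- x)) has_real_derivative P' (- x) * (- 1)) (at x)"
      by (rule DERIV_chain2[OF d]) (auto intro!: derivative_eq_intros)
    then have "((\<lambda>x. P (max 0 (- x))) has_real_derivative P' (- x) * (- 1)) (at x)"
      by (rule has_field_derivative_transform_within_open[where S="{..<0}"]) (use 1 in auto)
    then show ?thesis using 1 by simp
  next
    case 2
    have "((\<lambda>x. 0) has_real_derivative 0) (at x)" by simp
    then have "((\<lambda>x. P (max 0 (- x))) has_real_derivative 0) (at x)"
      by (rule has_field_derivative_transform_within_open[where S="{0<..}"]) (use 2 z in auto)
    then show ?thesis using 2 z by simp
  next
    case 3
    have "((\<lambda>x. P (- x)) has_real_derivative P' (- 0) * (- 1)) (at 0)"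
      by (rule DERIV_chain2[OF d]) (auto intro!: derivative_eq_intros)
    then have "((\<lambda>h. P (- h) / h) \<longlongrightarrow> 0) (at 0)"
      using z by (simp add: has_field_derivative_iff)
    then have t: "((\<lambda>h. \<bar>P (- h) / h\<bar>) \<longlongrightarrow> 0) (at 0)" by (rule tendsto_rabs_zero)
    have "((\<lambda>h. P (max 0 (- h)) / h) \<longlongrightarrow> 0) (at 0)"
      by (rule Lim_null_comparison[OF _ t]) (auto simp: max_def z intro!: always_eventually)
    then show ?thesis using 3 z by (simp add: has_field_derivative_iff)
  qed
qed

text \<open>Rounded up and not down: a weight known at time s is still known at the grid time
  \<open>dyu n s\<close>.\<close>

definition dyu :: "nat \<Rightarrow> real \<Rightarrow> real" where
  "dyu n t = real (nat \<lceil>t * 2^n\<rceil>) / 2^n"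

lemma dyu_bounds: "0 \<le> t \<Longrightarrow> t \<le> dyu n t" "0 \<le> t \<Longrightarrow> dyu n t \<le> t + 1 / 2^n"
proof -
  assume t: "0 \<le> t"
  have "t * 2^n \<le> real (nat \<lceil>t * 2^n\<rceil>)" by linarith
  then show "t \<le> dyu n t" by (simp add: dyu_def field_simps)
  have "real (nat \<lceil>t * 2^n\<rceil>) = of_int \<lceil>t * 2^n\<rceil>" using t by simp
  then have "real (nat \<lceil>t * 2^n\<rceil>) \<le> t * 2^n + 1" by linarith
  then show "dyu n t \<le> t + 1 / 2^n" by (simp add: dyu_def field_simps)
qed

lemma dyu_nonneg: "0 \<le> dyu n t" by (simp add: dyu_def)

lemma dyu_tendsto:
  assumes t: "0 \<le> t" shows "(\<lambda>n. dyu n t) \<longlonglongrightarrow> t"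
proof (rule tendsto_sandwich[of "\<lambda>_. t" _ sequentially "\<lambda>n. t + 1 / 2^n"])
  show "(\<lambda>n. t + 1 / 2^n) \<longlonglongrightarrow> t" by real_asymp
qed (use dyu_bounds[OF t] in auto)

lemma exp_neg_lipschitz: "\<bar>exp (- p) - exp (- q)\<bar> \<le> \<bar>p - q\<bar>" if "0 \<le> p" "0 \<le> q" for p q :: real
proof -
  have *: "exp (- p) - exp (- q) \<le> q - p" if "0 \<le> p" "p \<le> q" for p q :: real
  proof -
    have "exp (- p) - exp (- q) = exp (- p) * (1 - exp (- (q - p)))" by (simp add: right_diff_distrib exp_add[symmetric])
    also have "\<dots> \<le> 1 * (1 - exp (- (q - p)))" using that by (intro mult_right_mono) auto
    also have "\<dots> \<le> q - p"
    proof -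
      have "1 - exp (- r) \<le> r" for r :: real using exp_ge_add_one_self[of "- r"] by linarith
      then show ?thesis unfolding mult_1_left .
    qed
    finally show ?thesis .
  qed
  show ?thesis
  proof (cases "p \<le> q")
    case True
    then have "exp (- q) \<le> exp (- p)" by simp
    then show ?thesis using *[of p q] True that by simp
  next
    case False
    then have "exp (- p) \<le> exp (- q)" by simp
    then show ?thesis using *[of q p] False that by simp
  qed
qed

lemma psi_zero [simp]: "psi \<epsilon> 0 = 0" "psi1 \<epsilon> 0 = 0" "psi2 \<epsilon> 0 = 0"
  by (simp_all add: psi_def psi1_def psi2_def)

lemma psi_mono:
  assumes "0 < \<epsilon>" "\<epsilon> < 1" "a \<le> b" shows "psi \<epsilon> a \<le> psi \<epsilon> b"
  by (rule DERIV_nonneg_imp_nondecreasing[OF assms(3)])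
    (use psi_deriv[OF assms(1)] psi1_bounds(1)[OF assms(1,2)] in blast)

lemma psi_at_top: "0 < z \<Longrightarrow> filterlim (\<lambda>\<epsilon>. psi \<epsilon> z) at_top (at_right 0)"
  unfolding psi_def by real_asymp

section \<open>Non-negativity of the squared-Bessel process\<close>

context besq
begin

lemma Y_tendsto:
  assumes "w \<in> space M" "u \<longlonglongrightarrow> (v::real)" "\<And>n. 0 \<le> u n" "0 \<le> v"
  shows "(\<lambda>n. Y (u n) w) \<longlonglongrightarrow> Y v w"
proof -
  have "continuous_on {0..} (\<lambda>t. Y t w)" using X_cont assms(1) by (auto simp: continuous_paths_def)
  from continuous_on_tendsto_compose[OF this assms(2)] assms show ?thesis by auto
qed

text \<open>The generator applied to \<open>\<Phi>\<close> is at most 4 for every \<epsilon>: the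
  drift part \<open>\<delta> * \<Phi>1\<close> is at most 0 because \<open>\<Phi>\<close> decreases,
  and \<open>2 * \<Phi>2 x * \<bar>x\<bar>\<close> is at most 4. The mean therefore grows at a rate
  of at most 4, starting from \<open>\<Phi> y = 0\<close>.\<close>

lemma psi_expectation:
  assumes e: "0 < \<epsilon>" "\<epsilon> < 1"
  defines "\<Phi> \<equiv> \<lambda>x. psi \<epsilon> (max 0 (- x))"
  shows "integrable M (\<lambda>w. \<Phi> (Y (real j / 2^m0) w))"
    and "expectation (\<lambda>w. \<Phi> (Y (real j / 2^m0) w)) \<le> 4 * (real j / 2^m0)"
proof -
  define \<Phi>1 where "\<Phi>1 x = - psi1 \<epsilon> (max 0 (- x))" for x
  define \<Phi>2 where "\<Phi>2 x = psi2 \<epsilon> (max 0 (- x))" for x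
  define G where "G = ln (1 / \<epsilon>\<^sup>2) + 1 / \<epsilon>"
  define L where "L = 4 / \<epsilon>\<^sup>2"
  define t where "t = real j / 2^m0"
  define T where "T = t + 1"
  have t: "0 \<le> t" "0 < T" by (auto simp: t_def T_def add_nonneg_pos)
  have ln0: "0 \<le> ln (1 / \<epsilon>\<^sup>2)" using psi1_bounds[OF e, of 0] by simp
  have L: "0 \<le> L" by (simp add: L_def)
  have d1: "(\<Phi> has_real_derivative \<Phi>1 x) (at x)" for x
    unfolding \<Phi>_def \<Phi>1_def by (rule deriv_negpart[OF psi_deriv]) (use e in auto)
  have d2: "(\<Phi>1 has_real_derivative \<Phi>2 x) (at x)" for x
    using DERIV_minus[OF deriv_negpart[OF psi1_deriv[OF e(1)], of x]] by (simp add: \<Phi>1_def[abs_def] \<Phi>2_def)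
  have lip: "\<bar>\<Phi>2 x - \<Phi>2 u\<bar> \<le> L * \<bar>x - u\<bar>" for x u
  proof -
    have "\<bar>\<Phi>2 x - \<Phi>2 u\<bar> \<le> L * \<bar>max 0 (- x) - max 0 (- u)\<bar>"
      unfolding \<Phi>2_def L_def by (rule psi2_lipschitz[OF e])
    also have "\<dots> \<le> L * \<bar>x - u\<bar>" using L by (intro mult_left_mono) auto
    finally show ?thesis .
  qed
  have [measurable]: "\<Phi> \<in> borel_measurable borel" "\<Phi>1 \<in> borel_measurable borel" 
    using d1 d2 by (auto intro!: borel_measurable_continuous_onI continuous_at_imp_continuous_on DERIV_isCont)
  have "L-lipschitz_on UNIV \<Phi>2" using lip L by (auto simp: lipschitz_on_def dist_real_def)
  then have [measurable]: "\<Phi>2 \<in> borel_measurable borel"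
    by (intro borel_measurable_continuous_onI lipschitz_on_continuous_on)
  have b1: "\<bar>\<Phi>1 x\<bar> \<le> G" "\<Phi>1 x \<le> 0" for x
    using psi1_bounds[OF e, of "max 0 (- x)"] e by (auto simp: \<Phi>1_def G_def add_increasing2)
  have b2: "0 \<le> \<Phi>2 x" "\<Phi>2 x \<le> G" for x
    using psi2_bounds(1,2)[OF e, of "max 0 (- x)"] ln0 by (auto simp: \<Phi>2_def G_def)
  have b3: "\<Phi>2 x * \<bar>x\<bar> \<le> 2" for x
    using psi2_bounds(3)[OF e, of "max 0 (- x)"] by (cases "x \<le> 0") (auto simp: \<Phi>2_def mult.commute)
  have G: "0 \<le> G" using b1[of 0] by linarith
  define K where "K = onec T * (G + L)"
  have step: "integrable M (\<lambda>w. \<Phi> (Y (real (Suc k) / 2^m) w) - \<Phi> (Y (real k / 2^m) w))" (is "integrable M ?\<Delta>")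
    "expectation (\<lambda>w. \<Phi> (Y (real (Suc k) / 2^m) w) - \<Phi> (Y (real k / 2^m) w)) \<le> (4 + K * sqrt (1 / 2^m)) * (1 / 2^m)"
    if k: "real (Suc k) / 2^m \<le> T" for k m
  proof -
    let ?h = "1 / 2^m :: real"
    let ?c = "\<delta> * expectation (\<lambda>w. \<Phi>1 (Y (real k / 2^m) w)) + 2 * expectation (\<lambda>w. \<Phi>2 (Y (real k / 2^m) w) * \<bar>Y (real k / 2^m) w\<bar>)"
    note os = one_step[where \<Phi>=\<Phi> and ?\<Phi>1.0=\<Phi>1 and ?\<Phi>2.0=\<Phi>2 and G=G and L=L and U=UNIV and g="\<lambda>_. 1" and i=k and m=m and T=T]
    have tay: "\<bar>\<Phi> v - \<Phi> u - \<Phi>1 u * (v - u) - \<Phi>2 u * (v - u)\<^sup>2 / 2\<bar> \<le> L * \<bar>v - u\<bar> ^ 3" for u v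
      by (rule taylor3[OF d1 d2 lip L])
    have "integrable M (\<lambda>w. 1 * ?\<Delta> w)"
      by (rule os(1)) (use k t b1 b2 L tay in auto)
    then show i: "integrable M ?\<Delta>" by simp
    have "\<bar>expectation (\<lambda>w. 1 * ?\<Delta> w) - ?h * (\<delta> * expectation (\<lambda>w. 1 * \<Phi>1 (Y (real k / 2^m) w))
        + 2 * expectation (\<lambda>w. 1 * \<Phi>2 (Y (real k / 2^m) w) * \<bar>Y (real k / 2^m) w\<bar>))\<bar> \<le> onec T * (G + L) * (?h * sqrt ?h)"
      by (rule os(2)) (use k t b1 b2 L tay in auto)
    then have "\<bar>expectation ?\<Delta> - ?h * ?c\<bar> \<le> K * (?h * sqrt ?h)" by (simp add: K_def)
    then have le: "expectation ?\<Delta> \<le> ?h * ?c + K * (?h * sqrt ?h)" by linarith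
    have c4: "?c \<le> 4"
    proof -
      have "expectation (\<lambda>w. \<Phi>1 (Y (real k / 2^m) w)) \<le> 0"
      proof -
        have "0 \<le> expectation (\<lambda>w. - \<Phi>1 (Y (real k / 2^m) w))"
          using b1(2) by (intro integral_nonneg_AE) auto
        then show ?thesis by simp
      qed
      then have "\<delta> * expectation (\<lambda>w. \<Phi>1 (Y (real k / 2^m) w)) \<le> 0" using \<delta>_pos by (simp add: mult_nonneg_nonpos)
      moreover have "expectation (\<lambda>w. \<Phi>2 (Y (real k / 2^m) w) * \<bar>Y (real k / 2^m) w\<bar>) \<le> 2"
        using b2 b3 by (intro integral_le_const integrable_const_bound[where B=2]) auto
      ultimately show ?thesis by simp
    qed
    have hp: "0 \<le> ?h" by simp
    have eq: "(4 + K * sqrt ?h) * ?h = ?h * 4 + K * (?h * sqrt ?h)" by (simp add: algebra_simps)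
    show "expectation ?\<Delta> \<le> (4 + K * sqrt ?h) * ?h"
      unfolding eq using le mult_left_mono[OF c4 hp] by linarith
  qed
  have tele: "integrable M (\<lambda>w. \<Phi> (Y (real l / 2^m) w) - \<Phi> (Y 0 w)) \<and>
     expectation (\<lambda>w. \<Phi> (Y (real l / 2^m) w) - \<Phi> (Y 0 w)) \<le> real l * ((4 + K * sqrt (1 / 2^m)) * (1 / 2^m))"
    if "real l / 2^m \<le> T" for l m
    using that
  proof (induction l)
    case (Suc l)
    have "real l / 2^m \<le> real (Suc l) / 2^m" by (simp add: divide_right_mono)
    then have IH: "integrable M (\<lambda>w. \<Phi> (Y (real l / 2^m) w) - \<Phi> (Y 0 w))"
      "expectation (\<lambda>w. \<Phi> (Y (real l / 2^m) w) - \<Phi> (Y 0 w)) \<le> real l * ((4 + K * sqrt (1 / 2^m)) * (1 / 2^m))"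
      using Suc by auto
    note s = step[OF Suc.prems]
    have eq: "(\<lambda>w. \<Phi> (Y (real (Suc l) / 2^m) w) - \<Phi> (Y 0 w)) =
      (\<lambda>w. (\<Phi> (Y (real (Suc l) / 2^m) w) - \<Phi> (Y (real l / 2^m) w)) + (\<Phi> (Y (real l / 2^m) w) - \<Phi> (Y 0 w)))" by simp
    have a: "integrable M (\<lambda>w. \<Phi> (Y (real (Suc l) / 2^m) w) - \<Phi> (Y 0 w))"
      unfolding eq by (rule Bochner_Integration.integrable_add[OF s(1) IH(1)])
    have "expectation (\<lambda>w. \<Phi> (Y (real (Suc l) / 2^m) w) - \<Phi> (Y 0 w)) =
       expectation (\<lambda>w. \<Phi> (Y (real (Suc l) / 2^m) w) - \<Phi> (Y (real l / 2^m) w)) + expectation (\<lambda>w. \<Phi> (Y (real l / 2^m) w) - \<Phi> (Y 0 w))"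
      unfolding eq by (rule Bochner_Integration.integral_add[OF s(1) IH(1)])
    also have "\<dots> \<le> (4 + K * sqrt (1 / 2^m)) * (1 / 2^m) + real l * ((4 + K * sqrt (1 / 2^m)) * (1 / 2^m))"
      by (rule add_mono[OF s(2) IH(2)])
    also have "\<dots> = real (Suc l) * ((4 + K * sqrt (1 / 2^m)) * (1 / 2^m))"
      by (simp only: of_nat_Suc distrib_right mult_1_left)
    finally show ?case using a by blast
  qed simp
  have z: "AE w in M. \<Phi> (Y t w) - \<Phi> (Y 0 w) = \<Phi> (Y t w)"
    using Y_zero by eventually_elim (use y_nonneg in \<open>simp add: \<Phi>_def max_def\<close>)
  have [measurable]: "Y 0 \<in> borel_measurable M" by (rule X_measurable) simp
  have "integrable M (\<lambda>w. \<Phi> (Y t w) - \<Phi> (Y 0 w))"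
    using tele[of j m0] by (simp add: T_def t_def)
  then show "integrable M (\<lambda>w. \<Phi> (Y (real j / 2^m0) w))"
    using integrable_cong_AE[OF _ _ z] by (simp add: t_def)
  \<comment> \<open>The same time on finer and finer grids: the errors add up to a multiple of
    \<open>sqrt h\<close>, and only the rate 4 survives.\<close>
  have "expectation (\<lambda>w. \<Phi> (Y t w)) \<le> (4 + K * sqrt (1 / 2^(m0+n))) * t" for n
  proof -
    have "real (j * 2^n) / 2^(m0+n) = t" by (simp add: t_def power_add)
    then have "expectation (\<lambda>w. \<Phi> (Y t w) - \<Phi> (Y 0 w)) \<le> real (j * 2^n) * ((4 + K * sqrt (1 / 2^(m0+n))) * (1 / 2^(m0+n)))"
      using tele[of "j * 2^n" "m0+n"] by (simp add: T_def)
    also have "\<dots> = (4 + K * sqrt (1 / 2^(m0+n))) * t" by (simp add: t_def power_add)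
    also have "expectation (\<lambda>w. \<Phi> (Y t w) - \<Phi> (Y 0 w)) = expectation (\<lambda>w. \<Phi> (Y t w))"
      by (rule integral_cong_AE[OF _ _ z]) (simp_all add: t_def)
    finally show ?thesis .
  qed
  moreover have "(\<lambda>n. (4 + K * sqrt (1 / 2^(m0+n))) * t) \<longlonglongrightarrow> (4 + K * sqrt 0) * t"
  proof (intro tendsto_intros)
    show "(\<lambda>n. 1 / 2^(m0+n) :: real) \<longlonglongrightarrow> 0" unfolding power_add by real_asymp
  qed
  ultimately have "expectation (\<lambda>w. \<Phi> (Y t w)) \<le> (4 + K * sqrt 0) * t"
    by (intro LIMSEQ_le_const) auto
  then show "expectation (\<lambda>w. \<Phi> (Y (real j / 2^m0) w)) \<le> 4 * (real j / 2^m0)" by (simp add: t_def)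
qed

text \<open>Markov's inequality: the mean in \<open>psi_expectation\<close> stays bounded while the
  test function blows up at \<open>- z\<close>, so no mass can lie at or below
  \<open>- z\<close>.\<close>

lemma Y_nonneg_dyadic: "AE w in M. 0 \<le> Y (real j / 2^m) w"
proof -
  let ?t = "real j / 2^m"
  have p0: "prob {w\<in>space M. Y ?t w \<le> - z} = 0" if z: "0 < z" for z
  proof (rule ccontr)
    assume "prob {w\<in>space M. Y ?t w \<le> - z} \<noteq> 0"
    then have p: "0 < prob {w\<in>space M. Y ?t w \<le> - z}" by (simp add: zero_less_measure_iff)
    have "eventually (\<lambda>\<epsilon>. 4 * ?t / prob {w\<in>space M. Y ?t w \<le> - z} < psi \<epsilon> z \<and> 0 < \<epsilon> \<and> \<epsilon> < 1) (at_right 0)"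
      using psi_at_top[OF z] by (intro eventually_conj eventually_at_right_less) (auto simp: filterlim_at_top_dense eventually_at_right_field intro!: exI[of _ 1])
    then obtain \<epsilon> where e: "0 < \<epsilon>" "\<epsilon> < 1" and big: "4 * ?t / prob {w\<in>space M. Y ?t w \<le> - z} < psi \<epsilon> z"
      using eventually_happens' trivial_limit_at_right_real by blast
    have nn: "0 \<le> psi \<epsilon> (max 0 (- x))" for x using psi_mono[OF e, of 0 "max 0 (- x)"] by simp
    have "expectation (\<lambda>w. psi \<epsilon> z * indicat_real {w\<in>space M. Y ?t w \<le> - z} w) \<le> expectation (\<lambda>w. psi \<epsilon> (max 0 (- Y ?t w)))"
    proof (rule integral_mono)
      show "integrable M (\<lambda>w. psi \<epsilon> z * indicat_real {w\<in>space M. Y ?t w \<le> - z} w)"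
        by (intro integrable_mult_right integrable_real_indicator) (auto simp: emeasure_eq_measure)
      show "integrable M (\<lambda>w. psi \<epsilon> (max 0 (- Y ?t w)))" by (rule psi_expectation(1)[OF e])
      show "psi \<epsilon> z * indicat_real {w\<in>space M. Y ?t w \<le> - z} w \<le> psi \<epsilon> (max 0 (- Y ?t w))" for w
        using nn[of "Y ?t w"] psi_mono[OF e, of z "max 0 (- Y ?t w)"] by (auto simp: indicator_def)
    qed
    also have "\<dots> \<le> 4 * ?t" by (rule psi_expectation(2)[OF e])
    finally have "psi \<epsilon> z * prob {w\<in>space M. Y ?t w \<le> - z} \<le> 4 * ?t" by simp
    then show False using big p by (simp add: field_simps)
  qed
  have "AE w in M. \<forall>n. \<not> (Y ?t w \<le> - (1 / real (Suc n)))"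
  proof (subst AE_all_countable, rule allI)
    fix n
    show "AE w in M. \<not> (Y ?t w \<le> - (1 / real (Suc n)))"
    proof -
      have "prob {w\<in>space M. Y ?t w \<le> - (1 / real (Suc n))} = 0" by (rule p0) simp
      then show ?thesis by (subst (asm) prob_eq_0) auto
    qed
  qed
  then show ?thesis
  proof eventually_elim
    case (elim w)
    show ?case
    proof (rule ccontr)
      assume "\<not> ?case"
      then obtain n where "1 / real (Suc n) < - Y ?t w" using nat_approx_posE[of "- Y ?t w"] by auto
      then show False using elim[rule_format, of n] by linarith
    qed
  qed
qed

lemma Y_nonneg: "AE w in M. \<forall>t\<ge>0. 0 \<le> Y t w"
proof -
  have "AE w in M. \<forall>m j. 0 \<le> Y (real j / 2^m) w"
    by (simp add: AE_all_countable Y_nonneg_dyadic)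
  then show ?thesis using AE_space
  proof eventually_elim
    case (elim w)
    show ?case
    proof (intro allI impI)
      fix t :: real assume t: "0 \<le> t"
      have "(\<lambda>n. Y (dyu n t) w) \<longlonglongrightarrow> Y t w"
        using elim t by (intro Y_tendsto dyu_tendsto dyu_nonneg) auto
      then show "0 \<le> Y t w" by (rule LIMSEQ_le_const) (use elim in \<open>auto simp: dyu_def\<close>)
    qed
  qed
qed

lemma Y_nonneg_at: "0 \<le> t \<Longrightarrow> AE w in M. 0 \<le> Y t w"
  using Y_nonneg by (auto elim: eventually_mono)

end

text \<open>As a function of \<open>h\<close>, the first term is the Laplace transform at
  \<open>a\<close> of the process started at \<open>z\<close> and run for time \<open>h\<close>. Its
  derivative at 0 is the generator applied to \<open>exp (- a * z)\<close>, and the right-hand side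
  comes from bounding its second derivative.\<close>

lemma laplace_expansion:
  fixes \<delta> a z h :: real
  assumes d: "0 < \<delta>" and a: "0 < a" and z: "0 \<le> z" and h: "0 \<le> h"
  shows "\<bar>(1 + 2 * a * h) powr (- \<delta> / 2) * exp (- (a / (1 + 2 * a * h)) * z) - exp (- a * z) * (1 + h * (- \<delta> * a + 2 * a\<^sup>2 * z))\<bar>
     \<le> h\<^sup>2 * ((\<delta> * a + 2 * a\<^sup>2 * z)\<^sup>2 + 2 * \<delta> * a\<^sup>2 + 8 * a ^ 3 * z)"
proof -
  define B where "B = (\<delta> * a + 2 * a\<^sup>2 * z)\<^sup>2 + 2 * \<delta> * a\<^sup>2 + 8 * a ^ 3 * z"
  have B: "0 \<le> B" using d a z by (simp add: B_def)
  define w where "w s = 1 + 2 * a * s" for s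
  define v where "v s = inverse (w s)" for s
  define q where "q s = exp (- (\<delta> / 2) * ln (w s) - a * z * v s)" for s
  \<comment> \<open>\<open>e1\<close> is the logarithmic derivative of \<open>q\<close> and
    \<open>e2\<close> the derivative of \<open>e1\<close>, so that
    \<open>q'' = q * (e1\<^sup>2 + e2)\<close>.\<close>
  define e1 where "e1 s = - (\<delta> * a) * v s + 2 * a\<^sup>2 * z * (v s)\<^sup>2" for s
  define e2 where "e2 s = 2 * \<delta> * a\<^sup>2 * (v s)\<^sup>2 - 8 * a ^ 3 * z * (v s) ^ 3" for s
  have w: "1 \<le> w s" "0 < w s" "w s \<noteq> 0" if "0 \<le> s" for s
  proof -
    have "0 \<le> 2 * a * s" using that a by simp
    then show "1 \<le> w s" "0 < w s" "w s \<noteq> 0" by (auto simp: w_def)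
  qed
  have v: "0 \<le> v s" "v s \<le> 1" if "0 \<le> s" for s
    using w[OF that] by (auto simp: v_def inverse_le_1_iff)
  have dw: "(w has_real_derivative 2 * a) (at s)" for s
    unfolding w_def[abs_def] by (auto intro!: derivative_eq_intros)
  have dv: "(v has_real_derivative - (2 * a * (v s)\<^sup>2)) (at s)" if s: "0 \<le> s" for s
    unfolding v_def[abs_def]
    by (rule DERIV_cong[OF DERIV_inverse_fun[OF dw w(3)[OF s]]]) (simp add: power_inverse power2_eq_square)
  have dq: "(q has_real_derivative q s * e1 s) (at s)" if s: "0 \<le> s" for s
    unfolding q_def[abs_def]
  proof (rule DERIV_cong[OF DERIV_fun_exp[OF DERIV_diff[OF DERIV_cmult[OF DERIV_chain2[OF DERIV_ln_divide[OF w(2)[OF s]] dw]] DERIV_cmult[OF dv[OF s]]]]])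
    have "1 / w s = v s" by (simp add: v_def divide_inverse)
    then show "exp (- (\<delta> / 2) * ln (w s) - a * z * v s) * (- (\<delta> / 2) * (1 / w s * (2 * a)) - a * z * - (2 * a * (v s)\<^sup>2)) =
      exp (- (\<delta> / 2) * ln (w s) - a * z * v s) * e1 s"
      by (simp add: e1_def power2_eq_square)
  qed
  have de1: "(e1 has_real_derivative e2 s) (at s)" if s: "0 \<le> s" for s
    unfolding e1_def[abs_def]
    by (rule DERIV_cong[OF DERIV_add[OF DERIV_cmult[OF dv[OF s]] DERIV_cmult[OF DERIV_power[OF dv[OF s]]]]])
      (simp add: e2_def power2_eq_square power3_eq_cube)
  have dq1: "((\<lambda>s. q s * e1 s) has_real_derivative q s * ((e1 s)\<^sup>2 + e2 s)) (at s)" if s: "0 \<le> s" for s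
    by (rule DERIV_cong[OF DERIV_mult[OF dq[OF s] de1[OF s]]]) (simp add: power2_eq_square algebra_simps)
  have div1: "x * (v s) ^ n \<le> x" "0 \<le> x * (v s) ^ n" if "0 \<le> s" "0 \<le> x" for x s n
    using v[OF that(1)] that(2) by (auto intro!: mult_left_le power_le_one)
  have bq2: "norm (q s * ((e1 s)\<^sup>2 + e2 s)) \<le> B" if s: "0 \<le> s" for s
  proof -
    have q1: "0 \<le> q s" "q s \<le> 1"
    proof -
      have "0 \<le> (\<delta> / 2) * ln (w s)" "0 \<le> a * z * v s" using w[OF s] v[OF s] d a z by auto
      then show "q s \<le> 1" by (simp add: q_def)
    qed (simp add: q_def)
    have "\<bar>e1 s\<bar> \<le> \<bar>- (\<delta> * a) * v s\<bar> + \<bar>2 * a\<^sup>2 * z * (v s)\<^sup>2\<bar>" unfolding e1_def by (rule abs_triangle_ineq)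
    also have "\<dots> = \<delta> * a * v s ^ 1 + 2 * a\<^sup>2 * z * (v s)\<^sup>2" using v[OF s] d a z by (simp add: abs_mult)
    also have "\<dots> \<le> \<delta> * a + 2 * a\<^sup>2 * z" using d a z by (intro add_mono div1 s) auto
    finally have "\<bar>e1 s\<bar> ^ 2 \<le> (\<delta> * a + 2 * a\<^sup>2 * z) ^ 2" by (rule power_mono) simp
    then have b1: "(e1 s)\<^sup>2 \<le> (\<delta> * a + 2 * a\<^sup>2 * z)\<^sup>2" by simp
    have b2: "\<bar>e2 s\<bar> \<le> 2 * \<delta> * a\<^sup>2 + 8 * a ^ 3 * z"
    proof -
      have p: "0 \<le> 2 * \<delta> * a\<^sup>2" "0 \<le> 8 * a ^ 3 * z" using d a z by auto
      show ?thesis unfolding e2_def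
        using div1[OF s p(1), of 2] div1[OF s p(2), of 3] by linarith
    qed
    have "norm (q s * ((e1 s)\<^sup>2 + e2 s)) = q s * \<bar>(e1 s)\<^sup>2 + e2 s\<bar>" using q1 by (simp add: abs_mult)
    also have "\<dots> \<le> 1 * \<bar>(e1 s)\<^sup>2 + e2 s\<bar>" using q1 by (intro mult_right_mono) auto
    also have "1 * \<bar>(e1 s)\<^sup>2 + e2 s\<bar> \<le> B" using b1 b2 zero_le_power2[of "e1 s"] unfolding B_def mult_1_left by linarith
    finally show ?thesis .
  qed
  let ?S = "{0..h}"
  have b1: "\<bar>q s * e1 s - q 0 * e1 0\<bar> \<le> B * h" if s: "s \<in> ?S" for s
  proof -
    have "norm (q s * e1 s - q 0 * e1 0) \<le> B * norm (s - 0)"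
    proof (rule field_differentiable_bound[where S="?S" and f'="\<lambda>s. q s * ((e1 s)\<^sup>2 + e2 s)"])
      fix z assume "z \<in> ?S"
      then have z: "0 \<le> z" by simp
      show "((\<lambda>s. q s * e1 s) has_real_derivative q z * ((e1 z)\<^sup>2 + e2 z)) (at z within ?S)"
        by (rule has_field_derivative_at_within[OF dq1[OF z]])
      show "norm (q z * ((e1 z)\<^sup>2 + e2 z)) \<le> B" by (rule bq2[OF z])
    qed (use s h in auto)
    also have "\<dots> \<le> B * h" using s B by (intro mult_left_mono) auto
    finally show ?thesis by simp
  qed
  have "norm ((q h - q 0 * e1 0 * h) - (q 0 - q 0 * e1 0 * 0)) \<le> B * h * norm (h - 0)"
  proof (rule field_differentiable_bound[where S="?S" and f'="\<lambda>s. q s * e1 s - q 0 * e1 0"])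
    fix s assume s: "s \<in> ?S"
    have "((\<lambda>s. q s - q 0 * e1 0 * s) has_real_derivative q s * e1 s - q 0 * e1 0 * 1) (at s)"
      using s by (intro DERIV_diff dq DERIV_cmult DERIV_ident) auto
    then show "((\<lambda>s. q s - q 0 * e1 0 * s) has_real_derivative q s * e1 s - q 0 * e1 0) (at s within ?S)"
      by (auto intro: has_field_derivative_at_within)
    show "norm (q s * e1 s - q 0 * e1 0) \<le> B * h" using b1[OF s] by simp
  qed (use h in auto)
  then have "\<bar>q h - q 0 * (1 + h * e1 0)\<bar> \<le> h\<^sup>2 * B" using h by (simp add: power2_eq_square algebra_simps)
  moreover have "q h = (1 + 2 * a * h) powr (- \<delta> / 2) * exp (- (a / (1 + 2 * a * h)) * z)"
  proof -
    have e: "q h = exp (- (\<delta> / 2) * ln (w h)) * exp (- (a * z * v h))"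
      by (simp only: q_def diff_conv_add_uminus exp_add)
    have f: "exp (- (\<delta> / 2) * ln (w h)) = w h powr (- \<delta> / 2)" using w[OF h] by (simp add: powr_def)
    have g: "- (a * z * v h) = - (a / w h) * z" by (simp add: v_def divide_inverse)
    show ?thesis unfolding e f g by (simp only: w_def)
  qed
  moreover have "q 0 = exp (- a * z)" "e1 0 = - \<delta> * a + 2 * a\<^sup>2 * z" by (simp_all add: q_def e1_def w_def v_def)
  ultimately show ?thesis by (simp add: B_def)
qed

section \<open>The Laplace transform of the transition law\<close>

context besq
begin

lemma integrable_laplace:
  assumes g: "g \<in> borel_measurable M" "\<And>w. w \<in> space M \<Longrightarrow> 0 \<le> g w" "\<And>w. w \<in> space M \<Longrightarrow> g w \<le> 1"
    and a: "0 \<le> a" and t: "0 \<le> t"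
  shows "integrable M (\<lambda>w. g w * exp (- a * Y t w))"
    "0 \<le> expectation (\<lambda>w. g w * exp (- a * Y t w))" "expectation (\<lambda>w. g w * exp (- a * Y t w)) \<le> 1"
proof -
  have [measurable]: "g \<in> borel_measurable M" "Y t \<in> borel_measurable M"
    using g X_measurable[OF t] by auto
  have b: "AE w in M. 0 \<le> g w * exp (- a * Y t w) \<and> g w * exp (- a * Y t w) \<le> 1"
    using Y_nonneg_at[OF t] AE_space
  proof eventually_elim
    case (elim w)
    have "exp (- a * Y t w) \<le> 1" using elim(1) a by simp
    then have "g w * exp (- a * Y t w) \<le> 1 * 1" using g(2,3)[OF elim(2)] by (intro mult_mono) auto
    then show ?case using g(2)[OF elim(2)] by simp
  qed
  show i: "integrable M (\<lambda>w. g w * exp (- a * Y t w))"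
  proof (rule integrable_const_bound[where B=1])
    show "AE w in M. norm (g w * exp (- a * Y t w)) \<le> 1" using b by eventually_elim simp
  qed simp
  show "0 \<le> expectation (\<lambda>w. g w * exp (- a * Y t w))"
    using b by (intro integral_nonneg_AE) (auto elim!: eventually_mono)
  show "expectation (\<lambda>w. g w * exp (- a * Y t w)) \<le> 1"
    using b i by (intro integral_le_const) (auto elim!: eventually_mono)
qed

definition lapc :: "real \<Rightarrow> real \<Rightarrow> real" where
  "lapc T \<Lambda> = onec T * (\<Lambda> + \<Lambda>\<^sup>2 + \<Lambda> ^ 3) + (2 * \<delta>\<^sup>2 * \<Lambda>\<^sup>2 + 8 * \<Lambda> ^ 4 * mc T 2 + 2 * \<delta> * \<Lambda>\<^sup>2 + 8 * \<Lambda> ^ 3 * mc T 1)"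

text \<open>The parameters met in \<open>laplace_dyadic\<close> never exceed the initial one, so one
  constant serves all steps.\<close>

lemma lapc_mono:
  assumes "0 < T" "0 \<le> a" "a \<le> \<Lambda>" shows "lapc T a \<le> lapc T \<Lambda>"
proof -
  have p: "a ^ n \<le> \<Lambda> ^ n" for n using assms by (intro power_mono) auto
  show ?thesis unfolding lapc_def
    using assms p[of 2] p[of 3] p[of 4] onec_nonneg[OF assms(1)] mc_nonneg[OF assms(1)] \<delta>_pos
    by (intro add_mono mult_mono) auto
qed

text \<open>The true transition and the explicit formula have the same first-order expansion in
  \<open>h\<close>: \<open>one_step\<close> gives the former, \<open>laplace_expansion\<close> with
  the moments of Y the latter. Their difference is thus of order \<open>h * sqrt h\<close>.\<close>

lemma laplace_step:
  assumes T: "real (Suc i) / 2^m \<le> T" "0 < T" and a: "0 < a"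
    and g: "g \<in> borel_measurable (F (real i / 2^m))" "\<And>w. w \<in> space M \<Longrightarrow> 0 \<le> g w" "\<And>w. w \<in> space M \<Longrightarrow> g w \<le> 1"
  defines "h \<equiv> 1 / 2^m :: real"
  shows "\<bar>expectation (\<lambda>w. g w * exp (- a * Y (real (Suc i) / 2^m) w)) -
     (1 + 2 * a * h) powr (- \<delta> / 2) * expectation (\<lambda>w. g w * exp (- (a / (1 + 2 * a * h)) * Y (real i / 2^m) w))\<bar>
     \<le> lapc T a * (h * sqrt h)"
proof -
  let ?s = "real i / 2^m" and ?t = "real (Suc i) / 2^m"
  have h: "0 < h" "h \<le> 1" by (auto simp: h_def)
  have gM[measurable]: "g \<in> borel_measurable M" using g(1) by (rule measurable_F_le)
  define G where "G = a + a\<^sup>2"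
  define L where "L = a ^ 3"
  \<comment> \<open>The \<open>max 0 x\<close> makes the derivatives bounded on the whole line, as
    \<open>one_step\<close> demands; on \<open>{0..}\<close>, where the Taylor bound is used,
    nothing changes.\<close>
  define \<Phi>1 where "\<Phi>1 x = - a * exp (- a * max 0 x)" for x
  define \<Phi>2 where "\<Phi>2 x = a\<^sup>2 * exp (- a * max 0 x)" for x
  have b1: "\<bar>\<Phi>1 x\<bar> \<le> G" for x
  proof -
    have "a * exp (- a * max 0 x) \<le> a * 1" using a by (intro mult_left_mono) auto
    then show ?thesis using a by (simp add: \<Phi>1_def G_def abs_mult add_increasing2)
  qed
  have b2: "0 \<le> \<Phi>2 x" "\<Phi>2 x \<le> G" for x
  proof -
    have "a\<^sup>2 * exp (- a * max 0 x) \<le> a\<^sup>2 * 1" using a by (intro mult_left_mono) auto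
    then show "\<Phi>2 x \<le> G" using a unfolding \<Phi>2_def G_def by linarith
  qed (simp add: \<Phi>2_def)
  have tay: "\<bar>exp (- a * v) - exp (- a * u) - \<Phi>1 u * (v - u) - \<Phi>2 u * (v - u)\<^sup>2 / 2\<bar> \<le> L * \<bar>v - u\<bar> ^ 3"
    if uv: "u \<in> {0..}" "v \<in> {0..}" for u v
  proof -
    have d1: "((\<lambda>x. exp (- a * x)) has_real_derivative - a * exp (- a * x)) (at x)" for x
      by (auto intro!: derivative_eq_intros)
    have d2: "((\<lambda>x. - a * exp (- a * x)) has_real_derivative a\<^sup>2 * exp (- a * x)) (at x)" for x
      by (auto intro!: derivative_eq_intros simp: power2_eq_square)
    have "\<bar>exp (- a * v) - exp (- a * u) - (- a * exp (- a * u)) * (v - u) - (a\<^sup>2 * exp (- a * u)) * (v - u)\<^sup>2 / 2\<bar> \<le> L * \<bar>v - u\<bar> ^ 3"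
    proof (rule taylor3[where \<Phi>="\<lambda>x. exp (- a * x)" and ?\<Phi>1.0="\<lambda>x. - a * exp (- a * x)" and ?\<Phi>2.0="\<lambda>x. a\<^sup>2 * exp (- a * x)"])
      show "0 \<le> L" using a by (simp add: L_def)
      fix x assume x: "x \<in> closed_segment u v"
      then have x0: "0 \<le> x" using uv by (auto simp: closed_segment_eq_real_ivl split: if_splits)
      have "\<bar>exp (- (a * x)) - exp (- (a * u))\<bar> \<le> \<bar>a * x - a * u\<bar>"
        using x0 uv a by (intro exp_neg_lipschitz) auto
      also have "\<dots> = a * \<bar>x - u\<bar>" using a by (simp add: abs_mult right_diff_distrib[symmetric])
      finally have "a\<^sup>2 * \<bar>exp (- (a * x)) - exp (- (a * u))\<bar> \<le> a\<^sup>2 * (a * \<bar>x - u\<bar>)" by (intro mult_left_mono) auto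
      moreover have "\<bar>a\<^sup>2 * exp (- a * x) - a\<^sup>2 * exp (- a * u)\<bar> = a\<^sup>2 * \<bar>exp (- (a * x)) - exp (- (a * u))\<bar>"
        by (simp add: right_diff_distrib[symmetric] abs_mult)
      ultimately show "\<bar>a\<^sup>2 * exp (- a * x) - a\<^sup>2 * exp (- a * u)\<bar> \<le> L * \<bar>x - u\<bar>"
        by (simp add: L_def power3_eq_cube power2_eq_square)
    qed (rule d1 d2)+
    then show ?thesis using uv by (simp add: \<Phi>1_def \<Phi>2_def max_def)
  qed
  note os = one_step[where \<Phi>="\<lambda>x. exp (- a * x)" and ?\<Phi>1.0=\<Phi>1 and ?\<Phi>2.0=\<Phi>2 and G=G and L=L and U="{0..}" and g=g and i=i and m=m and T=T]
  have Un: "AE w in M. Y ?s w \<in> {0..}" "AE w in M. Y ?t w \<in> {0..}"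
    using Y_nonneg_dyadic[of i m] Y_nonneg_dyadic[of "Suc i" m] by auto
  have [measurable]: "\<Phi>1 \<in> borel_measurable borel" "\<Phi>2 \<in> borel_measurable borel"
    unfolding \<Phi>1_def[abs_def] \<Phi>2_def[abs_def] by measurable
  have L0: "0 \<le> L" using a by (simp add: L_def)
  let ?E = "\<lambda>w. g w * (exp (- a * Y ?t w) - exp (- a * Y ?s w))"
  let ?c = "\<delta> * expectation (\<lambda>w. g w * \<Phi>1 (Y ?s w)) + 2 * expectation (\<lambda>w. g w * \<Phi>2 (Y ?s w) * \<bar>Y ?s w\<bar>)"
  have A: "\<bar>expectation ?E - h * ?c\<bar> \<le> onec T * (G + L) * (h * sqrt h)"
    unfolding h_def by (rule os(2)) (use T b1 b2 L0 Un tay g in auto)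
  define et es eb where "et = (\<lambda>w. g w * exp (- a * Y ?t w))" and "es = (\<lambda>w. g w * exp (- a * Y ?s w))"
    and "eb = (\<lambda>w. g w * exp (- (a / (1 + 2 * a * h)) * Y ?s w))"
  have ii: "integrable M et" "integrable M es" "integrable M eb"
    unfolding et_def es_def eb_def by (rule integrable_laplace(1)[where g=g]; use gM g(2,3) a h in simp)+
  note Y1 = Y_moment(1)[of i m T 1] and Y2 = Y_moment(1)[of i m T 2]
  have sT: "?s \<le> T" using T(1) by (rule order_trans[rotated]) (simp add: divide_right_mono)
  note Ym = Y_moment[OF sT T(2)]
  have gB: "\<forall>w\<in>space M. \<bar>g w * \<Phi>1 (Y ?s w)\<bar> \<le> G" "\<forall>w\<in>space M. \<bar>g w * \<Phi>2 (Y ?s w)\<bar> \<le> G"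
  proof -
    show "\<forall>w\<in>space M. \<bar>g w * \<Phi>1 (Y ?s w)\<bar> \<le> G"
      using mult_mono[OF g(3) b1] g(2) by (auto simp: abs_mult)
    show "\<forall>w\<in>space M. \<bar>g w * \<Phi>2 (Y ?s w)\<bar> \<le> G"
      using mult_mono[OF g(3) b2(2)] g(2) b2(1) by (auto simp: abs_mult)
  qed
  have i1: "integrable M (\<lambda>w. g w * \<Phi>1 (Y ?s w))"
    using integrable_bounded_mult(1)[OF _ gB(1), of "\<lambda>_. 1"] by simp
  have i2: "integrable M (\<lambda>w. g w * \<Phi>2 (Y ?s w) * \<bar>Y ?s w\<bar>)"
    using integrable_bounded_mult(1)[OF _ gB(2), of "\<lambda>w. \<bar>Y ?s w\<bar>"] Ym(1)[of 1] by simp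
  define r where "r w = es w + h * (\<delta> * (g w * \<Phi>1 (Y ?s w)) + 2 * (g w * \<Phi>2 (Y ?s w) * \<bar>Y ?s w\<bar>))" for w
  have ir: "integrable M r" unfolding r_def[abs_def] using ii i1 i2 by auto
  have Er: "expectation r = expectation es + h * ?c"
    unfolding r_def[abs_def] using ii i1 i2 by simp
  have EE: "expectation ?E = expectation et - expectation es"
    using ii unfolding et_def es_def by (simp add: right_diff_distrib)
  let ?w = "(1 + 2 * a * h) powr (- \<delta> / 2)"
  let ?Q = "\<lambda>w. h\<^sup>2 * (2 * \<delta>\<^sup>2 * a\<^sup>2 + 8 * a ^ 4 * \<bar>Y ?s w\<bar> ^ 2 + 2 * \<delta> * a\<^sup>2 + 8 * a ^ 3 * \<bar>Y ?s w\<bar> ^ 1)"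
  have iQ: "integrable M ?Q" using Ym(1)[of 1] Ym(1)[of 2] by auto
  have pt: "AE w in M. \<bar>?w * eb w - r w\<bar> \<le> ?Q w"
    using Un(1) AE_space
  proof eventually_elim
    case (elim w)
    define z where "z = Y ?s w"
    have z: "0 \<le> z" using elim by (simp add: z_def)
    let ?x = "?w * exp (- (a / (1 + 2 * a * h)) * z) - exp (- a * z) * (1 + h * (- \<delta> * a + 2 * a\<^sup>2 * z))"
    have "?w * eb w - r w = g w * ?x"
      using z by (simp add: eb_def r_def es_def \<Phi>1_def \<Phi>2_def z_def[symmetric] max_def algebra_simps)
    then have "\<bar>?w * eb w - r w\<bar> \<le> 1 * \<bar>?x\<bar>" using g(2,3)[OF elim(2)] by (simp add: abs_mult mult_left_le_one_le)
    also have "1 * \<bar>?x\<bar> \<le> h\<^sup>2 * ((\<delta> * a + 2 * a\<^sup>2 * z)\<^sup>2 + 2 * \<delta> * a\<^sup>2 + 8 * a ^ 3 * z)"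
      using laplace_expansion[OF \<delta>_pos a z less_imp_le[OF h(1)]] by simp
    also have "\<dots> \<le> ?Q w"
    proof (intro mult_left_mono)
      have "(\<delta> * a + 2 * a\<^sup>2 * z)\<^sup>2 \<le> 2 * (\<delta> * a)\<^sup>2 + 2 * (2 * a\<^sup>2 * z)\<^sup>2"
        using sum_squares_bound[of "\<delta> * a" "2 * a\<^sup>2 * z"] by (simp add: power2_sum)
      also have "\<dots> = 2 * \<delta>\<^sup>2 * a\<^sup>2 + 8 * a ^ 4 * z\<^sup>2" by (simp add: power_mult_distrib)
      finally show "(\<delta> * a + 2 * a\<^sup>2 * z)\<^sup>2 + 2 * \<delta> * a\<^sup>2 + 8 * a ^ 3 * z \<le> 2 * \<delta>\<^sup>2 * a\<^sup>2 + 8 * a ^ 4 * \<bar>Y ?s w\<bar> ^ 2 + 2 * \<delta> * a\<^sup>2 + 8 * a ^ 3 * \<bar>Y ?s w\<bar> ^ 1"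
        using z unfolding z_def[symmetric] by simp
    qed simp
    finally show ?case .
  qed
  have hh: "h\<^sup>2 \<le> h * sqrt h"
  proof -
    have "h = sqrt h * sqrt h" using h by simp
    also have "\<dots> \<le> sqrt h" using h by (intro mult_left_le) auto
    finally show ?thesis using h by (simp add: power2_eq_square mult_left_mono)
  qed
  define BB where "BB = 2 * \<delta>\<^sup>2 * a\<^sup>2 + 8 * a ^ 4 * mc T 2 + 2 * \<delta> * a\<^sup>2 + 8 * a ^ 3 * mc T 1"
  have BB0: "0 \<le> BB" using a \<delta>_pos mc_nonneg[OF T(2)] by (simp add: BB_def)
  have Bd: "\<bar>?w * expectation eb - expectation r\<bar> \<le> BB * (h * sqrt h)"
  proof -
    have "?w * expectation eb - expectation r = expectation (\<lambda>w. ?w * eb w - r w)" using ii ir by simp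
    also have "\<bar>\<dots>\<bar> \<le> expectation (\<lambda>w. \<bar>?w * eb w - r w\<bar>)" by (rule integral_abs_bound)
    also have "\<dots> \<le> expectation ?Q" using pt iQ ii ir by (intro integral_mono_AE) auto
    also have "\<dots> = h\<^sup>2 * (2 * \<delta>\<^sup>2 * a\<^sup>2 + 8 * a ^ 4 * expectation (\<lambda>w. \<bar>Y ?s w\<bar> ^ 2) + 2 * \<delta> * a\<^sup>2 + 8 * a ^ 3 * expectation (\<lambda>w. \<bar>Y ?s w\<bar> ^ 1))"
      using Ym(1)[of 1] Ym(1)[of 2] by (simp add: prob_space)
    also have "\<dots> \<le> h\<^sup>2 * BB"
      unfolding BB_def using Ym(2)[of 1] Ym(2)[of 2] a \<delta>_pos by (intro mult_left_mono add_mono) auto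
    also have "\<dots> \<le> (h * sqrt h) * BB" using hh BB0 by (rule mult_right_mono)
    finally show ?thesis by (simp add: mult.commute)
  qed
  have "\<bar>expectation et - ?w * expectation eb\<bar> \<le> onec T * (G + L) * (h * sqrt h) + BB * (h * sqrt h)"
    using A Bd unfolding EE Er by linarith
  also have "\<dots> = lapc T a * (h * sqrt h)"
    unfolding lapc_def BB_def G_def L_def by (simp add: algebra_simps)
  finally show ?thesis unfolding et_def eb_def .
qed

text \<open>Each of the \<open>\<tau> / h\<close> steps costs a multiple of
  \<open>h * sqrt h\<close>, so the identity holds up to a multiple of \<open>sqrt h\<close>. Its
  two sides do not depend on the grid, hence they are equal.\<close>

lemma laplace_dyadic:
  assumes ij: "i \<le> j" and l: "0 < \<Lambda>"
    and g: "g \<in> borel_measurable (F (real i / 2^m0))" "\<And>\<omega>. \<omega> \<in> space M \<Longrightarrow> 0 \<le> g \<omega>" "\<And>\<omega>. \<omega> \<in> space M \<Longrightarrow> g \<omega> \<le> 1"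
  defines "\<tau> \<equiv> real j / 2^m0 - real i / 2^m0"
  shows "expectation (\<lambda>\<omega>. g \<omega> * exp (- \<Lambda> * Y (real j / 2^m0) \<omega>)) =
    (1 + 2 * \<Lambda> * \<tau>) powr (- \<delta> / 2) * expectation (\<lambda>\<omega>. g \<omega> * exp (- (\<Lambda> / (1 + 2 * \<Lambda> * \<tau>)) * Y (real i / 2^m0) \<omega>))"
    (is "?l = ?r")
proof -
  define T where "T = real j / 2^m0 + 1"
  have T: "0 < T" by (simp add: T_def add_nonneg_pos)
  have \<tau>0: "0 \<le> \<tau>" using ij by (simp add: \<tau>_def divide_right_mono)
  have gM: "g \<in> borel_measurable M" using g(1) by (rule measurable_F_le)
  have bound: "\<bar>?l - ?r\<bar> \<le> \<tau> * lapc T \<Lambda> * sqrt (1 / 2^(m0+n))" for n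
  proof -
    define m where "m = m0 + n"
    define h where "h = (1 / 2^m :: real)"
    have h: "0 < h" by (simp add: h_def)
    define I J where "I = i * 2^n" and "J = j * 2^n"
    have IJ: "I \<le> J" using ij by (simp add: I_def J_def)
    have It: "real I / 2^m = real i / 2^m0" and Jt: "real J / 2^m = real j / 2^m0"
      by (simp_all add: I_def J_def m_def power_add)
    have tau: "\<tau> = real (J - I) * h"
      using IJ by (simp add: \<tau>_def It[symmetric] Jt[symmetric] h_def of_nat_diff diff_divide_distrib)
    define w where "w k = 1 + 2 * \<Lambda> * (real (J - k) * h)" for k
    have w1: "1 \<le> w k" for k using l h by (simp add: w_def)
    \<comment> \<open>Interpolates between the two sides: the process at time
      \<open>k / 2^m\<close>, with the parameter and the factor that the remaining time
      \<open>(J - k) * h\<close> produces.\<close>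
    define V where "V k = w k powr (- \<delta> / 2) * expectation (\<lambda>\<omega>. g \<omega> * exp (- (\<Lambda> / w k) * Y (real k / 2^m) \<omega>))" for k
    define c where "c = lapc T \<Lambda> * (h * sqrt h)"
    have step: "\<bar>V (Suc k) - V k\<bar> \<le> c" if k: "I \<le> k" "k < J" for k
    proof -
      define a where "a = \<Lambda> / w (Suc k)"
      have a: "0 < a" "a \<le> \<Lambda>" using w1[of "Suc k"] l by (auto simp: a_def field_simps)
      \<comment> \<open>The semigroup property of the Riccati flow: run for time \<open>h\<close>
        from \<open>\<Lambda> / w (Suc k)\<close>, it arrives at
        \<open>\<Lambda> / w k\<close>.\<close>
      have wk: "w k = w (Suc k) * (1 + 2 * a * h)"
      proof -
        have "real (J - k) = real (J - Suc k) + 1" using k by linarith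
        then have "w k = w (Suc k) + 2 * \<Lambda> * h" by (simp add: w_def algebra_simps)
        also have "\<dots> = w (Suc k) * (1 + 2 * a * h)" using w1[of "Suc k"] by (simp add: a_def field_simps)
        finally show ?thesis .
      qed
      have "0 \<le> 2 * a * h" using a h by simp
      then have p: "0 < 1 + 2 * a * h" by linarith
      have b: "a / (1 + 2 * a * h) = \<Lambda> / w k" using wk by (simp add: a_def)
      have wp: "w k powr (- \<delta> / 2) = w (Suc k) powr (- \<delta> / 2) * (1 + 2 * a * h) powr (- \<delta> / 2)"
        unfolding wk by (rule powr_mult)
      have kT: "real (Suc k) / 2^m \<le> T"
      proof -
        have "real (Suc k) / 2^m \<le> real J / 2^m" using k by (intro divide_right_mono) auto
        then show ?thesis using Jt by (simp add: T_def)
      qed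
      have gk: "g \<in> borel_measurable (F (real k / 2^m))"
      proof (rule measurable_F_mono[OF _ g(1)])
        have "real I / 2^m \<le> real k / 2^m" using k by (intro divide_right_mono) auto
        then show "real i / 2^m0 \<le> real k / 2^m" using It by simp
      qed
      define e where "e = expectation (\<lambda>\<omega>. g \<omega> * exp (- a * Y (real (Suc k) / 2^m) \<omega>)) -
         (1 + 2 * a * h) powr (- \<delta> / 2) * expectation (\<lambda>\<omega>. g \<omega> * exp (- (a / (1 + 2 * a * h)) * Y (real k / 2^m) \<omega>))"
      have e: "\<bar>e\<bar> \<le> lapc T a * (h * sqrt h)"
        using laplace_step[OF kT T a(1) gk g(2,3)] unfolding e_def h_def by blast
      have "V (Suc k) - V k = w (Suc k) powr (- \<delta> / 2) * e"
        unfolding V_def wp e_def b a_def[symmetric] by (simp only: right_diff_distrib mult.assoc)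
      then have "\<bar>V (Suc k) - V k\<bar> = w (Suc k) powr (- \<delta> / 2) * \<bar>e\<bar>"
        by (simp only: abs_mult abs_of_nonneg[OF powr_ge_zero])
      also have "\<dots> \<le> 1 * (lapc T a * (h * sqrt h))"
      proof (rule mult_mono[OF _ e])
        have "w (Suc k) powr (- \<delta> / 2) \<le> w (Suc k) powr 0"
          using w1[of "Suc k"] \<delta>_pos by (intro powr_mono) auto
        then show "w (Suc k) powr (- \<delta> / 2) \<le> 1" using w1[of "Suc k"] by simp
      qed auto
      also have "1 * (lapc T a * (h * sqrt h)) \<le> c" unfolding c_def mult_1_left
        using lapc_mono[OF T less_imp_le[OF a(1)] a(2)] h by (intro mult_right_mono) auto
      finally show ?thesis .
    qed
    have "\<bar>V (I + q) - V I\<bar> \<le> real q * c" if "I + q \<le> J" for q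
      using that
    proof (induction q)
      case (Suc q)
      then have "\<bar>V (I + q) - V I\<bar> \<le> real q * c" "\<bar>V (Suc (I + q)) - V (I + q)\<bar> \<le> c" using step[of "I + q"] by auto
      then have "\<bar>V (Suc (I + q)) - V I\<bar> \<le> real q * c + c" by linarith
      then show ?case by (simp add: algebra_simps)
    qed simp
    from this[of "J - I"] have VV: "\<bar>V J - V I\<bar> \<le> real (J - I) * c" using IJ by simp
    have "V J = ?l" unfolding V_def Jt by (simp add: w_def)
    moreover have "V I = ?r" unfolding V_def It by (simp add: w_def tau)
    moreover have "real (J - I) * c = \<tau> * lapc T \<Lambda> * sqrt (1 / 2^(m0+n))"
      by (simp add: c_def tau h_def m_def mult_ac)
    ultimately show ?thesis using VV by simp
  qed
  have "(\<lambda>n. \<tau> * lapc T \<Lambda> * sqrt (1 / 2^(m0+n))) \<longlonglongrightarrow> \<tau> * lapc T \<Lambda> * sqrt 0"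
  proof (intro tendsto_intros)
    show "(\<lambda>n. 1 / 2^(m0+n) :: real) \<longlonglongrightarrow> 0" unfolding power_add by real_asymp
  qed
  then have "\<bar>?l - ?r\<bar> \<le> \<tau> * lapc T \<Lambda> * sqrt 0" using bound by (intro LIMSEQ_le_const) auto
  then show ?thesis by simp
qed

text \<open>The Markov property in Laplace form: \<open>g\<close> is any weight from the past of s.
  Path continuity and dominated convergence carry it over from the grid times \<open>dyu n s\<close>
  and \<open>dyu n t\<close>.\<close>

theorem laplace:
  assumes st: "0 \<le> s" "s \<le> t" and l: "0 \<le> \<Lambda>"
    and g: "g \<in> borel_measurable (F s)" "\<And>\<omega>. \<omega> \<in> space M \<Longrightarrow> 0 \<le> g \<omega>" "\<And>\<omega>. \<omega> \<in> space M \<Longrightarrow> g \<omega> \<le> 1"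
  shows "expectation (\<lambda>\<omega>. g \<omega> * exp (- \<Lambda> * Y t \<omega>)) =
    (1 + 2 * \<Lambda> * (t - s)) powr (- \<delta> / 2) * expectation (\<lambda>\<omega>. g \<omega> * exp (- (\<Lambda> / (1 + 2 * \<Lambda> * (t - s))) * Y s \<omega>))"
proof (cases "\<Lambda> = 0")
  case False
  then have l: "0 < \<Lambda>" using l by simp
  have t0: "0 \<le> t" using st by simp
  have gM[measurable]: "g \<in> borel_measurable M" using g(1) by (rule measurable_F_le)
  define w where "w n = 1 + 2 * \<Lambda> * (dyu n t - dyu n s)" for n
  define w0 where "w0 = 1 + 2 * \<Lambda> * (t - s)"
  have dy_le: "dyu n s \<le> dyu n t" for n
    unfolding dyu_def using st by (intro divide_right_mono of_nat_mono nat_mono ceiling_mono mult_right_mono) auto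
  have w1: "1 \<le> w n" "1 \<le> w0" for n using dy_le[of n] st l by (auto simp: w_def w0_def)
  have wlim: "w \<longlonglongrightarrow> w0"
    unfolding w_def w0_def by (intro tendsto_intros dyu_tendsto st t0)
  have eq: "expectation (\<lambda>\<omega>. g \<omega> * exp (- \<Lambda> * Y (dyu n t) \<omega>)) =
     w n powr (- \<delta> / 2) * expectation (\<lambda>\<omega>. g \<omega> * exp (- (\<Lambda> / w n) * Y (dyu n s) \<omega>))" for n
    unfolding dyu_def w_def
  proof (rule laplace_dyadic[OF _ l _ g(2,3)])
    show "nat \<lceil>s * 2^n\<rceil> \<le> nat \<lceil>t * 2^n\<rceil>" using st by (intro nat_mono ceiling_mono mult_right_mono) auto
    show "g \<in> borel_measurable (F (real (nat \<lceil>s * 2^n\<rceil>) / 2^n))"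
      using g(1) dyu_bounds(1)[OF st(1), of n] by (auto simp: dyu_def intro: measurable_F_mono)
  qed
  have conv: "(\<lambda>n. expectation (\<lambda>\<omega>. g \<omega> * exp (- c n * Y (u n) \<omega>))) \<longlonglongrightarrow> expectation (\<lambda>\<omega>. g \<omega> * exp (- c0 * Y u0 \<omega>))"
    if c: "c \<longlonglongrightarrow> c0" "\<And>n. 0 \<le> c n" and u: "u \<longlonglongrightarrow> u0" "\<And>n. 0 \<le> u n" "0 \<le> u0" for c c0 u u0
  proof (rule integral_dominated_convergence[where w="\<lambda>_. 1"])
    have [measurable]: "Y u0 \<in> borel_measurable M" "Y (u n) \<in> borel_measurable M" for n
      using u X_measurable by auto
    show "(\<lambda>\<omega>. g \<omega> * exp (- c0 * Y u0 \<omega>)) \<in> borel_measurable M"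
      "(\<lambda>\<omega>. g \<omega> * exp (- c n * Y (u n) \<omega>)) \<in> borel_measurable M" for n by measurable
    show "AE \<omega> in M. (\<lambda>n. g \<omega> * exp (- c n * Y (u n) \<omega>)) \<longlonglongrightarrow> g \<omega> * exp (- c0 * Y u0 \<omega>)"
      by (intro AE_I2 tendsto_intros c Y_tendsto u)
    fix n
    show "AE \<omega> in M. norm (g \<omega> * exp (- c n * Y (u n) \<omega>)) \<le> 1"
      using Y_nonneg_at[OF u(2)[of n]] AE_space
    proof eventually_elim
      case (elim \<omega>)
      have "g \<omega> * exp (- c n * Y (u n) \<omega>) \<le> 1 * 1"
        using g(2,3)[OF elim(2)] elim(1) c(2)[of n] by (intro mult_mono) auto
      then show ?case using g(2)[OF elim(2)] by simp
    qed
  qed simp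
  have "(\<lambda>n. expectation (\<lambda>\<omega>. g \<omega> * exp (- \<Lambda> * Y (dyu n t) \<omega>))) \<longlonglongrightarrow> expectation (\<lambda>\<omega>. g \<omega> * exp (- \<Lambda> * Y t \<omega>))"
    using l by (intro conv tendsto_const dyu_tendsto t0 dyu_nonneg) auto
  moreover have "(\<lambda>n. w n powr (- \<delta> / 2) * expectation (\<lambda>\<omega>. g \<omega> * exp (- (\<Lambda> / w n) * Y (dyu n s) \<omega>)))
     \<longlonglongrightarrow> w0 powr (- \<delta> / 2) * expectation (\<lambda>\<omega>. g \<omega> * exp (- (\<Lambda> / w0) * Y s \<omega>))"
  proof (intro tendsto_mult conv)
    show "(\<lambda>n. w n powr (- \<delta> / 2)) \<longlonglongrightarrow> w0 powr (- \<delta> / 2)"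
      using w1 by (intro tendsto_powr wlim tendsto_const) (metis not_one_le_zero)
    show "(\<lambda>n. \<Lambda> / w n) \<longlonglongrightarrow> \<Lambda> / w0"
      using w1(2) by (intro tendsto_divide wlim tendsto_const) auto
    show "0 \<le> \<Lambda> / w n" for n using w1(1)[of n] l by simp
  qed (use st dyu_tendsto dyu_nonneg in auto)
  ultimately show ?thesis
    unfolding eq w0_def by (rule LIMSEQ_unique)
qed simp

end

section \<open>Moments and the additive functional\<close>

context sqrt_integral
begin

text \<open>Converse use of the exit event: off \<open>bad\<close>, \<open>exit_bad\<close> keeps
  \<open>\<bar>X\<bar> \<le> K\<close> on the whole interval, and then \<open>N\<close> above
  \<open>l\<close> at a single time would be visible at a dyadic time just before it.\<close>

lemma not_bad_bound:
  assumes w: "w \<in> space M" "w \<notin> bad T K l" and x0: "\<bar>X 0 w\<bar> < K"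
    and imp: "\<And>t. 0 \<le> t \<Longrightarrow> t \<le> T \<Longrightarrow> K \<le> \<bar>X t w\<bar> \<Longrightarrow> l < \<bar>N t w\<bar>"
    and t: "0 \<le> t" "t \<le> T"
  shows "\<bar>N t w\<bar> \<le> l"
proof (rule ccontr)
  assume "\<not> ?thesis"
  then have lt: "l < \<bar>N t w\<bar>" by simp
  \<comment> \<open>Rounded down, so that the grid times do not pass \<open>t\<close> and hence stay
    within \<open>T\<close>.\<close>
  define u where "u n = real (nat \<lfloor>t * 2^n\<rfloor>) / 2^n" for n
  have ub: "u n \<le> t" "t - 1 / 2^n \<le> u n" "0 \<le> u n" for n
  proof -
    have a: "real (nat \<lfloor>t * 2^n\<rfloor>) = of_int \<lfloor>t * 2^n\<rfloor>" using t by simp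
    have "of_int \<lfloor>t * 2^n\<rfloor> \<le> t * 2^n" "t * 2^n - 1 \<le> of_int \<lfloor>t * 2^n\<rfloor>" by linarith+
    then have "of_int \<lfloor>t * 2^n\<rfloor> / 2^n \<le> t * 2^n / 2^n" "(t * 2^n - 1) / 2^n \<le> of_int \<lfloor>t * 2^n\<rfloor> / 2^n"
      by (simp_all only: divide_right_mono zero_le_power zero_le_numeral)
    then show "u n \<le> t" "t - 1 / 2^n \<le> u n" unfolding u_def a by (simp_all add: diff_divide_distrib)
  qed (simp add: u_def)
  have "(\<lambda>n. t - 1 / 2^n) \<longlonglongrightarrow> t" by real_asymp
  then have lim: "u \<longlonglongrightarrow> t"
    by (rule tendsto_sandwich[of "\<lambda>n. t - 1 / 2^n" u sequentially "\<lambda>_. t", rotated 2]) (use ub in auto)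
  have "continuous_on {0..} (\<lambda>t. \<bar>N t w\<bar>)"
    using N_cont w by (auto simp: continuous_paths_def intro!: continuous_intros)
  from continuous_on_tendsto_compose[OF this lim] have "(\<lambda>n. \<bar>N (u n) w\<bar>) \<longlonglongrightarrow> \<bar>N t w\<bar>"
    using ub t by auto
  then have "eventually (\<lambda>n. l < \<bar>N (u n) w\<bar>) sequentially" using lt by (rule order_tendstoD)
  then obtain n where n: "l < \<bar>N (u n) w\<bar>" using eventually_happens by fastforce
  have "\<bar>X v w\<bar> \<le> K" if v: "0 \<le> v" "v \<le> T" for v
  proof (rule ccontr)
    assume "\<not> ?thesis"
    then have "w \<in> bad T K l" by - (rule exit_bad[OF w(1) x0, where s=v], use imp v in auto)
    then show False using w by blast
  qed
  then have X: "\<forall>m i. real i / 2^m \<le> real (nat \<lfloor>t * 2^n\<rfloor>) / 2^n \<longrightarrow> \<bar>X (real i / 2^m) w\<bar> \<le> K"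
    using ub(1)[of n] t unfolding u_def by auto
  moreover have "real (nat \<lfloor>t * 2^n\<rfloor>) / 2^n \<le> T" using ub(1)[of n] t unfolding u_def by linarith
  ultimately have "w \<in> bad T K l" using n w(1) unfolding bad_def u_def by blast
  then show False using w by blast
qed

end

context besq
begin

text \<open>The path is caught at a dyadic time rounded up by at most 1; therefore
  \<open>T = t + 1\<close> is taken in \<open>prob_supY\<close>, and
  \<open>1 + T = 2 + t\<close>.\<close>

lemma tail_fixed_time:
  assumes t: "0 \<le> t" and k: "0 \<le> x"
  shows "prob {\<omega>\<in>space M. x < \<bar>Y t \<omega>\<bar> / (2 + t)} \<le> tailC * exp (- x / 200)"
proof -
  have "{\<omega>\<in>space M. x < \<bar>Y t \<omega>\<bar> / (2 + t)} \<subseteq> supY (t + 1) (x * (1 + (t + 1)))"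
  proof safe
    fix \<omega> assume w: "\<omega> \<in> space M" and "x < \<bar>Y t \<omega>\<bar> / (2 + t)"
    then have lt: "x * (2 + t) < \<bar>Y t \<omega>\<bar>" using t by (simp add: pos_less_divide_eq)
    have "(\<lambda>n. \<bar>Y (dyu n t) \<omega>\<bar>) \<longlonglongrightarrow> \<bar>Y t \<omega>\<bar>"
      using w t by (intro tendsto_intros Y_tendsto dyu_tendsto dyu_nonneg)
    then have "eventually (\<lambda>n. x * (2 + t) < \<bar>Y (dyu n t) \<omega>\<bar>) sequentially" using lt by (rule order_tendstoD)
    then obtain n where n: "x * (2 + t) < \<bar>Y (dyu n t) \<omega>\<bar>" using eventually_happens by fastforce
    have "dyu n t \<le> t + 1 / 2^n" by (rule dyu_bounds(2)[OF t])
    also have "\<dots> \<le> t + 1" by simp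
    finally have "dyu n t \<le> t + 1" .
    then show "\<omega> \<in> supY (t + 1) (x * (1 + (t + 1)))"
      using n w unfolding supY_def dyu_def by (auto simp: algebra_simps intro: less_imp_le)
  qed
  then have "prob {\<omega>\<in>space M. x < \<bar>Y t \<omega>\<bar> / (2 + t)} \<le> prob (supY (t + 1) (x * (1 + (t + 1))))"
    by (rule finite_measure_mono) measurable
  also have "\<dots> \<le> tailC * exp (- x / 200)" using t k by (intro prob_supY) auto
  finally show ?thesis .
qed

definition MP :: "real \<Rightarrow> real" where
  "MP p = 2 powr p * (tailC * exp (1/200) * (\<Sum>k. (1 + (real k + 1)) powr p * exp (- (1/200) * real k)))"

text \<open>Unlike \<open>mc\<close>, the constant \<open>MP p\<close> does not depend on the time:
  the tail of \<open>\<bar>Y t\<bar> / (2 + t)\<close> is bounded uniformly in \<open>t\<close>. The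
  growth \<open>(1 + t) powr p\<close> is the one that the scaling limit needs, and p is real
  because \<alpha> is.\<close>

lemma Y_moment_powr:
  assumes t: "0 \<le> t" and p: "0 \<le> p"
  shows "integrable M (\<lambda>w. (1 + \<bar>Y t w\<bar>) powr p)" "expectation (\<lambda>w. (1 + \<bar>Y t w\<bar>) powr p) \<le> MP p * (1 + t) powr p"
proof -
  have [measurable]: "Y t \<in> borel_measurable M" by (rule X_measurable[OF t])
  define Z where "Z w = \<bar>Y t w\<bar> / (2 + t)" for w
  have [measurable]: "Z \<in> borel_measurable M" unfolding Z_def[abs_def] by measurable
  have sm: "summable (\<lambda>k. (1 + (real k + 1)) powr p * exp (- (1/200) * real k))"
  proof (rule summable_comparison_test')
    show "summable (\<lambda>k. 2 powr p * ((real k + 1) powr p * exp (- (1/200) * real k)))"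
      by (intro summable_mult summable_powr_exp) simp
    fix k :: nat
    have "(1 + (real k + 1)) powr p \<le> (2 * (real k + 1)) powr p" using p by (intro powr_mono2) auto
    also have "\<dots> = 2 powr p * (real k + 1) powr p" by (rule powr_mult)
    finally show "norm ((1 + (real k + 1)) powr p * exp (- (1/200) * real k)) \<le> 2 powr p * ((real k + 1) powr p * exp (- (1/200) * real k))"
      by (simp add: mult.assoc[symmetric] mult_right_mono)
  qed
  have tail: "prob {w\<in>space M. real k \<le> Z w} \<le> (tailC * exp (1/200)) * exp (- (1/200) * real k)" for k
  proof (cases k)
    case 0
    have "prob {w\<in>space M. real k \<le> Z w} \<le> 1" by simp
    also have "1 \<le> tailC * exp (1/200)"
      using mult_mono[of 1 tailC 1 "exp (1/200)"] tailC_ge by simp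
    finally show ?thesis using 0 by simp
  next
    case (Suc l)
    have "prob {w\<in>space M. real k \<le> Z w} \<le> prob {w\<in>space M. real l < \<bar>Y t w\<bar> / (2 + t)}"
      using Suc by (intro finite_measure_mono) (auto simp: Z_def)
    also have "\<dots> \<le> tailC * exp (- real l / 200)" by (rule tail_fixed_time[OF t]) simp
    also have "- real l / 200 = 1/200 + (- (1/200) * real k)" using Suc by (simp add: field_simps)
    also have "tailC * exp \<dots> = (tailC * exp (1/200)) * exp (- (1/200) * real k)" by (simp only: exp_add mult.assoc)
    finally show ?thesis .
  qed
  note te = tail_expectation[of Z "\<lambda>z. (1 + z) powr p" "tailC * exp (1/200)" "1/200", OF _ _ _ tail]
  have i: "integrable M (\<lambda>w. (1 + Z w) powr p)"
    by (rule te(1)) (use p sm t in \<open>auto simp: Z_def intro: powr_mono2\<close>)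
  have e: "expectation (\<lambda>w. (1 + Z w) powr p) \<le> tailC * exp (1/200) * (\<Sum>k. (1 + (real k + 1)) powr p * exp (- (1/200) * real k))"
    by (rule te(2)) (use p sm t in \<open>auto simp: Z_def intro: powr_mono2\<close>)
  have le: "(1 + \<bar>Y t w\<bar>) powr p \<le> (2 powr p * (1 + t) powr p) * (1 + Z w) powr p" for w
  proof -
    have "1 + \<bar>Y t w\<bar> \<le> (2 + t) * (1 + Z w)" using t by (simp add: Z_def field_simps)
    also have "\<dots> \<le> (2 * (1 + t)) * (1 + Z w)" using t by (intro mult_right_mono) (auto simp: Z_def)
    finally have "(1 + \<bar>Y t w\<bar>) powr p \<le> ((2 * (1 + t)) * (1 + Z w)) powr p" using p by (intro powr_mono2) auto
    then show ?thesis by (simp only: powr_mult)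
  qed
  have ib: "integrable M (\<lambda>w. (2 powr p * (1 + t) powr p) * (1 + Z w) powr p)"
    using i by (rule integrable_mult_right)
  show int: "integrable M (\<lambda>w. (1 + \<bar>Y t w\<bar>) powr p)"
    by (rule Bochner_Integration.integrable_bound[OF ib]) (use le in \<open>auto intro!: AE_I2 order_trans[OF le]\<close>)
  have "expectation (\<lambda>w. (1 + \<bar>Y t w\<bar>) powr p) \<le> expectation (\<lambda>w. (2 powr p * (1 + t) powr p) * (1 + Z w) powr p)"
    by (rule integral_mono[OF int ib le])
  also have "\<dots> = (2 powr p * (1 + t) powr p) * expectation (\<lambda>w. (1 + Z w) powr p)" by simp
  also have "\<dots> \<le> (2 powr p * (1 + t) powr p) * (tailC * exp (1/200) * (\<Sum>k. (1 + (real k + 1)) powr p * exp (- (1/200) * real k)))"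
    by (intro mult_left_mono e) auto
  finally show "expectation (\<lambda>w. (1 + \<bar>Y t w\<bar>) powr p) \<le> MP p * (1 + t) powr p"
    by (simp only: MP_def mult_ac)
qed

lemma MP_nonneg: "0 \<le> p \<Longrightarrow> 0 \<le> MP p"
proof -
  assume p: "0 \<le> p"
  have "0 \<le> expectation (\<lambda>w. (1 + \<bar>Y 0 w\<bar>) powr p)" by (rule integral_nonneg_AE) simp
  from order_trans[OF this Y_moment_powr(2)[OF order_refl p]] show "0 \<le> MP p" by simp
qed

text \<open>A pointwise limit of processes that only see countably many times. Times are clipped at
  0 so that Tonelli can be used with Lebesgue measure on the whole line.\<close>

lemma Y_joint [measurable]: "(\<lambda>(s, w). Y (max 0 s) w) \<in> borel_measurable (borel \<Otimes>\<^sub>M M)"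
proof -
  let ?g = "\<lambda>n p. Y (dyu n (max 0 (fst p))) (snd p)"
  have m: "?g n \<in> borel_measurable (borel \<Otimes>\<^sub>M M)" for n
  proof -
    have "(\<lambda>p. (\<lambda>j p. Y (real j / 2^n) (snd p)) (nat \<lceil>max 0 (fst p :: real) * 2^n\<rceil>) p) \<in> borel_measurable (borel \<Otimes>\<^sub>M M)"
      by (rule measurable_compose_countable, rule measurable_compose[OF measurable_snd X_dyadic_measurable]) measurable
    then show ?thesis by (simp add: dyu_def)
  qed
  have c: "(\<lambda>n. ?g n p) \<longlonglongrightarrow> Y (max 0 (fst p)) (snd p)" if "p \<in> space (borel \<Otimes>\<^sub>M M)" for p
    using that by (intro Y_tendsto dyu_tendsto dyu_nonneg) (auto simp: space_pair_measure)
  show ?thesis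
    using borel_measurable_LIMSEQ_real[OF c m] by (simp add: case_prod_beta')
qed

text \<open>Chernoff's bound with parameter \<open>1/q\<close> in the Laplace transform: the process
  at time s is below \<open>q\<close> with probability of order
  \<open>(q / s) powr (\<delta> / 2)\<close>. This is where \<open>\<delta> > 0\<close> makes the
  process leave 0.\<close>

lemma prob_Y_le:
  assumes s: "0 \<le> s" and q: "0 < q"
  shows "prob {w\<in>space M. Y s w \<le> q} \<le> exp 1 * (1 + 2 * s / q) powr (- \<delta> / 2)"
proof -
  have [measurable]: "Y s \<in> borel_measurable M" by (rule X_measurable[OF s])
  have i: "integrable M (\<lambda>w. exp (- (1/q) * Y s w))"
    using integrable_laplace(1)[of "\<lambda>_. 1" "1/q" s] s q by simp
  have "prob {w\<in>space M. Y s w \<le> q} = expectation (indicat_real {w\<in>space M. Y s w \<le> q})" by simp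
  also have "\<dots> \<le> expectation (\<lambda>w. exp 1 * exp (- (1/q) * Y s w))"
  proof (rule integral_mono)
    show "integrable M (indicat_real {w\<in>space M. Y s w \<le> q})"
      by (intro integrable_real_indicator) (auto simp: emeasure_eq_measure)
    show "integrable M (\<lambda>w. exp 1 * exp (- (1/q) * Y s w))" using i by (rule integrable_mult_right)
    fix w
    show "indicat_real {w\<in>space M. Y s w \<le> q} w \<le> exp 1 * exp (- (1/q) * Y s w)"
    proof (cases "Y s w \<le> q")
      case True
      then have "0 \<le> 1 + - (1/q) * Y s w" using q by (simp add: field_simps)
      then have "1 \<le> exp (1 + - (1/q) * Y s w)" by simp
      also have "\<dots> = exp 1 * exp (- (1/q) * Y s w)" by (rule exp_add)
      finally show ?thesis by (simp add: indicator_def)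
    qed simp
  qed
  also have "\<dots> = exp 1 * expectation (\<lambda>w. exp (- (1/q) * Y s w))" by simp
  also have "\<dots> \<le> exp 1 * (1 + 2 * s / q) powr (- \<delta> / 2)"
  proof (rule mult_left_mono)
    have "expectation (\<lambda>w. 1 * exp (- (1/q) * Y s w)) = (1 + 2 * (1/q) * (s - 0)) powr (- \<delta> / 2) *
       expectation (\<lambda>w. 1 * exp (- ((1/q) / (1 + 2 * (1/q) * (s - 0))) * Y 0 w))"
      by (rule laplace) (use s q in auto)
    also have "\<dots> \<le> (1 + 2 * (1/q) * (s - 0)) powr (- \<delta> / 2) * 1"
      using s q by (intro mult_left_mono integrable_laplace(3)) auto
    finally show "expectation (\<lambda>w. exp (- (1/q) * Y s w)) \<le> (1 + 2 * s / q) powr (- \<delta> / 2)" by simp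
  qed simp
  finally show ?thesis .
qed

lemma Y_pos: assumes s: "0 < s" shows "AE w in M. 0 < Y s w"
proof -
  have [measurable]: "Y s \<in> borel_measurable M" using s by (intro X_measurable) simp
  have "((\<lambda>q. exp 1 * (1 + 2 * s / q) powr (- \<delta> / 2)) \<longlongrightarrow> 0) (at_right 0)"
    using s \<delta>_pos by real_asymp
  moreover have "eventually (\<lambda>q. prob {w\<in>space M. Y s w \<le> 0} \<le> exp 1 * (1 + 2 * s / q) powr (- \<delta> / 2)) (at_right 0)"
    using eventually_at_right_less
  proof eventually_elim
    case (elim q)
    have "prob {w\<in>space M. Y s w \<le> 0} \<le> prob {w\<in>space M. Y s w \<le> q}"
      using elim by (intro finite_measure_mono) auto
    also have "\<dots> \<le> exp 1 * (1 + 2 * s / q) powr (- \<delta> / 2)" using s elim by (intro prob_Y_le) auto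
    finally show ?case .
  qed
  ultimately have "prob {w\<in>space M. Y s w \<le> 0} \<le> 0"
    by (intro tendsto_lowerbound) auto
  then have "prob {w\<in>space M. Y s w \<le> 0} = 0" by (simp add: antisym)
  then have "AE w in M. \<not> Y s w \<le> 0" by (subst (asm) prob_eq_0) auto
  then show ?thesis by (rule eventually_mono) simp
qed

end

text \<open>The ratio of \<open>f\<close> to the model function is near \<rho> outside a compact
  corner and bounded on it by continuity. The lower bound holds only far away, as \<open>f\<close>
  may vanish in the corner.\<close>

lemma assumption_Af_bounds:
  assumes "assumption_Af f \<rho> \<alpha> \<gamma>"
  shows "\<exists>C>0. \<forall>t\<ge>0. \<forall>y\<ge>0. f t y \<le> C * (1 + t) powr \<gamma> * (1 + y) powr \<alpha>"
    and "\<exists>r\<ge>0. \<forall>t\<ge>0. \<forall>y\<ge>0. r \<le> t + y \<longrightarrow> (\<rho>/2) * (1 + t) powr \<gamma> * (1 + y) powr \<alpha> \<le> f t y"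
proof -
  define \<phi> where "\<phi> p = f (fst p) (snd p) * (1 + fst p) powr (- \<gamma>) * (1 + snd p) powr (- \<alpha>)" for p
  have feq: "f t y = \<phi> (t, y) * (1 + t) powr \<gamma> * (1 + y) powr \<alpha>" if "0 \<le> t" "0 \<le> y" for t y
    using that by (simp add: \<phi>_def powr_minus field_simps)
  have cf: "continuous_on ({0..} \<times> {0..}) (\<lambda>p. f (fst p) (snd p))"
    using assms by (simp add: assumption_Af_def case_prod_beta')
  have lim: "\<exists>r\<ge>0. \<forall>t\<ge>0. \<forall>y\<ge>0. r \<le> t + y \<longrightarrow> \<bar>\<phi> (t, y) - \<rho>\<bar> \<le> \<epsilon>" if "\<epsilon> > 0" for \<epsilon>
    using assms that by (auto simp: assumption_Af_def \<phi>_def)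
  have \<rho>: "0 < \<rho>" using assms by (simp add: assumption_Af_def)
  obtain r where r: "0 \<le> r" "\<And>t y. 0 \<le> t \<Longrightarrow> 0 \<le> y \<Longrightarrow> r \<le> t + y \<Longrightarrow> \<bar>\<phi> (t, y) - \<rho>\<bar> \<le> 1"
    using lim[of 1] by auto
  have "continuous_on ({0..r} \<times> {0..r}) \<phi>"
    unfolding \<phi>_def[abs_def]
    by (intro continuous_on_mult continuous_on_powr continuous_on_subset[OF cf]) (auto intro!: continuous_intros)
  then have "compact (\<phi> ` ({0..r} \<times> {0..r}))" by (intro compact_continuous_image compact_Times) auto
  then obtain C0 where C0: "\<And>p. p \<in> {0..r} \<times> {0..r} \<Longrightarrow> norm (\<phi> p) \<le> C0"
    using compact_imp_bounded bounded_iff by (metis imageI)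
  define C where "C = max C0 0 + \<rho> + 1"
  have "\<phi> (t, y) \<le> C" if "0 \<le> t" "0 \<le> y" for t y
  proof (cases "r \<le> t + y")
    case True
    then show ?thesis using r(2)[OF that True] by (simp add: C_def)
  next
    case False
    then have "norm (\<phi> (t, y)) \<le> C0" using that by (intro C0) auto
    then show ?thesis using \<rho> by (simp add: C_def)
  qed
  then have "\<forall>t\<ge>0. \<forall>y\<ge>0. f t y \<le> C * (1 + t) powr \<gamma> * (1 + y) powr \<alpha>"
    by (auto simp: feq intro!: mult_right_mono)
  moreover have "C > 0" using \<rho> by (simp add: C_def add_nonneg_pos)
  ultimately show "\<exists>C>0. \<forall>t\<ge>0. \<forall>y\<ge>0. f t y \<le> C * (1 + t) powr \<gamma> * (1 + y) powr \<alpha>" by blast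
  obtain r' where r': "0 \<le> r'" "\<And>t y. 0 \<le> t \<Longrightarrow> 0 \<le> y \<Longrightarrow> r' \<le> t + y \<Longrightarrow> \<bar>\<phi> (t, y) - \<rho>\<bar> \<le> \<rho>/2"
    using lim[of "\<rho>/2"] \<rho> by auto
  have "(\<rho>/2) * (1 + t) powr \<gamma> * (1 + y) powr \<alpha> \<le> f t y" if "0 \<le> t" "0 \<le> y" "r' \<le> t + y" for t y
  proof -
    have "\<rho>/2 \<le> \<phi> (t, y)" using r'(2)[OF that] by linarith
    then show ?thesis using that by (simp only: feq) (intro mult_right_mono, auto)
  qed
  then show "\<exists>r\<ge>0. \<forall>t\<ge>0. \<forall>y\<ge>0. r \<le> t + y \<longrightarrow> (\<rho>/2) * (1 + t) powr \<gamma> * (1 + y) powr \<alpha> \<le> f t y"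
    using r'(1) by blast
qed

section \<open>The drift along Y and its time integral\<close>

locale besq_drift = besq M F W \<delta> y Y for M :: "'a measure" and F W \<delta> y Y +
  fixes f :: "real \<Rightarrow> real \<Rightarrow> real" and \<rho> \<alpha> \<gamma> :: real
  assumes Af: "assumption_Af f \<rho> \<alpha> \<gamma>"
begin

lemma params: "0 < \<rho>" "0 \<le> \<alpha>" "0 < \<gamma> + \<alpha>"
  using Af by (auto simp: assumption_Af_def)

definition \<kappa> :: real where "\<kappa> = 1 + \<gamma> + \<alpha>"

lemma \<kappa>_gt_1: "1 < \<kappa>" using params by (simp add: \<kappa>_def)

text \<open>Both arguments are clipped because \<open>f\<close> is controlled only on the quadrant
  and Y is non-negative only almost surely; the clipped version is continuous along every path and
  non-negative everywhere.\<close>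

definition fY :: "real \<Rightarrow> 'a \<Rightarrow> real" where
  "fY s w = f (max 0 s) (max 0 (Y (max 0 s) w))"

lemma f_cont: "continuous_on UNIV (\<lambda>p. f (max 0 (fst p)) (max 0 (snd p)))"
proof -
  have "continuous_on ({0..} \<times> {0..}) (\<lambda>p. f (fst p) (snd p))"
    using Af by (simp add: assumption_Af_def case_prod_beta')
  then have "continuous_on UNIV (\<lambda>p. (\<lambda>p. f (fst p) (snd p)) (max 0 (fst p), max 0 (snd p)))"
    by (rule continuous_on_compose2) (auto intro!: continuous_intros)
  then show ?thesis by simp
qed

lemma f_measurable [measurable]: "(\<lambda>p. f (max 0 (fst p)) (max 0 (snd p))) \<in> borel_measurable (borel \<Otimes>\<^sub>M borel)"
  using borel_measurable_continuous_onI[OF f_cont] by (simp add: borel_prod)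

lemma fY_joint [measurable]: "(\<lambda>(s, w). fY s w) \<in> borel_measurable (borel \<Otimes>\<^sub>M M)"
proof -
  have "(\<lambda>p. (fst p, (\<lambda>(s, w). Y (max 0 s) w) p)) \<in> measurable (borel \<Otimes>\<^sub>M M) (borel \<Otimes>\<^sub>M borel)"
    by (intro measurable_Pair measurable_fst Y_joint)
  from measurable_compose[OF this f_measurable] show ?thesis
    by (simp add: fY_def case_prod_beta')
qed

lemma fY_nonneg: "0 \<le> fY s w"
  using Af by (auto simp: assumption_Af_def fY_def)

lemma fY_cont: assumes w: "w \<in> space M" shows "continuous_on UNIV (\<lambda>s. fY s w)"
proof -
  have "continuous_on {0..} (\<lambda>s. Y s w)" using X_cont w by (auto simp: continuous_paths_def)
  then have "continuous_on UNIV (\<lambda>s. Y (max 0 s) w)"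
    by (rule continuous_on_compose2[where g="\<lambda>s. Y s w"]) (auto intro!: continuous_intros)
  then have "continuous_on UNIV (\<lambda>s. (s, Y (max 0 s) w))" by (intro continuous_intros)
  from continuous_on_compose2[OF f_cont this] show ?thesis by (simp add: fY_def)
qed

definition A :: "real \<Rightarrow> 'a \<Rightarrow> real" where
  "A t w = (\<integral>s. indicator {0..t} s * fY s w \<partial>lborel)"

lemma A_integrable:
  assumes "w \<in> space M" shows "integrable lborel (\<lambda>s. indicator {a..t} s * fY s w)"
  using borel_integrable_compact[of "{a..t}" "\<lambda>s. fY s w"] continuous_on_subset[OF fY_cont[OF assms]]
  by (simp add: indicator_scaleR_eq_if if_distrib[of "\<lambda>x. x * _"] cong: if_cong)

lemma A_eq: assumes "w \<in> space M" shows "A t w = integral {0..t} (\<lambda>s. fY s w)"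
  using set_borel_integral_eq_integral(2)[of "{0..t}" "\<lambda>s. fY s w"] A_integrable[OF assms, of 0 t]
  by (simp add: A_def set_lebesgue_integral_def set_integrable_def)

lemma A_measurable [measurable]: "A t \<in> borel_measurable M"
proof -
  have "(\<lambda>p. indicator {0..t} (snd p) * (\<lambda>(s, w). fY s w) (snd p, fst p)) \<in> borel_measurable (M \<Otimes>\<^sub>M lborel)"
    by measurable
  then have "(\<lambda>(w, s). indicator {0..t} s * fY s w) \<in> borel_measurable (M \<Otimes>\<^sub>M lborel)" by (simp add: case_prod_beta')
  from lborel.borel_measurable_lebesgue_integral[OF this] show ?thesis by (simp add: A_def[abs_def])
qed

lemma A_mono: assumes "w \<in> space M" "s \<le> t" shows "A s w \<le> A t w"
  unfolding A_def using assms fY_nonneg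
  by (intro integral_mono A_integrable) (auto simp: indicator_def)

lemma A_cont: assumes w: "w \<in> space M" shows "continuous_on {0..} (\<lambda>t. A t w)"
  unfolding continuous_on_eq_continuous_within
proof
  fix t :: real assume t: "t \<in> {0..}"
  have "continuous_on {0..t+1} (\<lambda>x. integral {0..x} (\<lambda>s. fY s w))"
    by (intro indefinite_integral_continuous_1 integrable_continuous_real continuous_on_subset[OF fY_cont[OF w]]) auto
  then have "continuous (at t within {0..t+1}) (\<lambda>x. A x w)"
    using t by (auto simp: A_eq[OF w] continuous_on_eq_continuous_within)
  moreover have "at t within {0..t+1} = at t within {0..}"
    using t by (intro at_within_nhd[of _ "{..<t+1}"]) auto
  ultimately show "continuous (at t within {0..}) (\<lambda>x. A x w)" by simp
qed

definition Cf :: real where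
  "Cf = (SOME C. 0 < C \<and> (\<forall>t\<ge>0. \<forall>y\<ge>0. f t y \<le> C * (1 + t) powr \<gamma> * (1 + y) powr \<alpha>))"

lemma Cf: "0 < Cf" "0 \<le> t \<Longrightarrow> 0 \<le> z \<Longrightarrow> f t z \<le> Cf * (1 + t) powr \<gamma> * (1 + z) powr \<alpha>"
  using someI_ex[of "\<lambda>C. 0 < C \<and> (\<forall>t\<ge>0. \<forall>y\<ge>0. f t y \<le> C * (1 + t) powr \<gamma> * (1 + y) powr \<alpha>)"]
    assumption_Af_bounds(1)[OF Af] unfolding Cf_def[symmetric] by blast+

lemma fY_measurable [measurable]: "fY s \<in> borel_measurable M"
  using measurable_compose[OF measurable_Pair1' fY_joint, of s] by simp

lemma fY_le: "0 \<le> s \<Longrightarrow> fY s w \<le> Cf * (1 + s) powr \<gamma> * (1 + \<bar>Y s w\<bar>) powr \<alpha>"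
proof -
  assume s: "0 \<le> s"
  have "fY s w \<le> Cf * (1 + s) powr \<gamma> * (1 + max 0 (Y s w)) powr \<alpha>"
    using Cf(2)[of s "max 0 (Y s w)"] s by (simp add: fY_def)
  also have "\<dots> \<le> Cf * (1 + s) powr \<gamma> * (1 + \<bar>Y s w\<bar>) powr \<alpha>"
    using Cf(1) params by (intro mult_left_mono powr_mono2) auto
  finally show ?thesis .
qed

lemma fY_expectation:
  assumes s: "0 \<le> s"
  shows "integrable M (fY s)" "expectation (fY s) \<le> Cf * MP \<alpha> * (1 + s) powr (\<gamma> + \<alpha>)"
proof -
  note m = Y_moment_powr[OF s params(2)]
  have i: "integrable M (\<lambda>w. Cf * (1 + s) powr \<gamma> * (1 + \<bar>Y s w\<bar>) powr \<alpha>)"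
    using m(1) by (rule integrable_mult_right)
  show i': "integrable M (fY s)"
    by (rule Bochner_Integration.integrable_bound[OF i])
      (use fY_le[OF s] fY_nonneg in \<open>auto intro!: AE_I2 order_trans[OF fY_le[OF s]]\<close>)
  have "expectation (fY s) \<le> expectation (\<lambda>w. Cf * (1 + s) powr \<gamma> * (1 + \<bar>Y s w\<bar>) powr \<alpha>)"
    by (rule integral_mono[OF i' i fY_le[OF s]])
  also have "\<dots> = Cf * (1 + s) powr \<gamma> * expectation (\<lambda>w. (1 + \<bar>Y s w\<bar>) powr \<alpha>)" by simp
  also have "\<dots> \<le> Cf * (1 + s) powr \<gamma> * (MP \<alpha> * (1 + s) powr \<alpha>)"
    using Cf(1) by (intro mult_left_mono m(2)) auto
  also have "\<dots> = Cf * MP \<alpha> * (1 + s) powr (\<gamma> + \<alpha>)" by (simp add: powr_add)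
  finally show "expectation (fY s) \<le> Cf * MP \<alpha> * (1 + s) powr (\<gamma> + \<alpha>)" .
qed

end

section \<open>Almost sure growth\<close>

lemma pow2_powr: "(2^n :: real) powr b = (2 powr b) ^ n"
proof -
  have "(2^n :: real) powr b = (2 powr real n) powr b" by (simp add: powr_realpow)
  also have "\<dots> = (2 powr b) powr real n" by (simp only: powr_powr mult.commute)
  finally show ?thesis by (simp add: powr_realpow)
qed

lemma summable_pow2_powr: "b < 0 \<Longrightarrow> summable (\<lambda>n. (2^n :: real) powr b)"
  unfolding pow2_powr by (intro summable_geometric) (simp add: powr_less_one)

lemma dyadic_eventually_at_top:
  assumes "eventually Q sequentially"
  shows "eventually (\<lambda>t::real. \<exists>n. Q n \<and> Q (Suc n) \<and> 2^n \<le> t \<and> t \<le> 2^Suc n) at_top"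
proof -
  obtain n0 where n0: "\<And>n. n \<ge> n0 \<Longrightarrow> Q n" using assms by (auto simp: eventually_sequentially)
  show ?thesis
    using eventually_ge_at_top[of "2^n0"]
  proof eventually_elim
    case (elim t)
    define n where "n = nat \<lfloor>log 2 t\<rfloor>"
    have t: "1 \<le> t" using elim one_le_power[of "2::real" n0] by linarith
    have l0: "0 \<le> log 2 t" using t by simp
    have "real n0 = log 2 (2^n0)" by simp
    also have "\<dots> \<le> log 2 t" using elim t by (subst log_le_cancel_iff) auto
    finally have "n0 \<le> n" unfolding n_def by linarith
    have rn: "real n \<le> log 2 t" "log 2 t \<le> real (Suc n)" unfolding n_def using l0 by linarith+
    have "2 powr real n \<le> t" using rn(1) t by (subst (asm) le_log_iff) auto
    moreover have "t \<le> 2 powr real (Suc n)" using rn(2) t by (subst (asm) log_le_iff) auto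
    ultimately have "2^n \<le> t" "t \<le> 2^Suc n" by (simp_all add: powr_realpow del: of_nat_Suc power_Suc)
    then show ?case using n0[of n] n0[of "Suc n"] \<open>n0 \<le> n\<close> by auto
  qed
qed

lemma eventually_powr_ge:
  fixes c e :: real assumes "0 < e" shows "eventually (\<lambda>t. c \<le> t powr e) at_top"
proof -
  have "filterlim (\<lambda>t::real. t powr e) at_top at_top" using assms by real_asymp
  then show ?thesis by (simp add: filterlim_at_top)
qed

lemma eventually_pow2:
  assumes "eventually P (at_top :: real filter)" shows "eventually (\<lambda>n. P (2^n)) sequentially"
proof -
  have "filterlim (\<lambda>n. 2^n :: real) at_top sequentially" by real_asymp
  then show ?thesis using assms by (rule eventually_compose_filterlim[rotated])
qed

lemma ln_sqrt_limit:
  fixes S :: "real \<Rightarrow> real"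
  assumes b: "\<And>\<epsilon>. 0 < \<epsilon> \<Longrightarrow> eventually (\<lambda>t. t powr (\<kappa> - \<epsilon>) \<le> S t \<and> S t \<le> t powr (\<kappa> + \<epsilon>)) at_top"
  shows "((\<lambda>t. ln (sqrt (S t)) / ln t) \<longlongrightarrow> \<kappa> / 2) at_top"
proof (rule tendstoI)
  fix e :: real assume e: "e > 0"
  show "eventually (\<lambda>t. dist (ln (sqrt (S t)) / ln t) (\<kappa> / 2) < e) at_top"
    using b[OF e] eventually_gt_at_top[of 1]
  proof eventually_elim
    case (elim t)
    have t: "0 < ln t" "0 < t powr (\<kappa> - e)" using elim by auto
    have S: "0 < S t" using elim t by linarith
    have "ln (t powr (\<kappa> - e)) \<le> ln (S t)" "ln (S t) \<le> ln (t powr (\<kappa> + e))"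
      using elim t S by (subst ln_le_cancel_iff; auto)+
    then have "(\<kappa> - e) * ln t \<le> ln (S t)" "ln (S t) \<le> (\<kappa> + e) * ln t" using elim by (simp_all add: ln_powr)
    then have "\<kappa> - e \<le> ln (S t) / ln t" "ln (S t) / ln t \<le> \<kappa> + e" using t by (simp_all add: pos_le_divide_eq pos_divide_le_eq)
    moreover have "ln (sqrt (S t)) / ln t = (ln (S t) / ln t) / 2" using S by (simp add: ln_sqrt)
    ultimately show ?case using e by (simp add: dist_real_def abs_less_iff)
  qed
qed

context prob_space
begin

lemma borel_cantelli_bound:
  assumes [measurable]: "\<And>n. A n \<in> events" and le: "eventually (\<lambda>n. prob (A n) \<le> a n) sequentially" and sm: "summable a"
  shows "AE w in M. eventually (\<lambda>n. w \<notin> A n) sequentially"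
proof -
  have "summable (\<lambda>n. prob (A n))"
    by (rule summable_comparison_test_ev[OF _ sm]) (use le in \<open>auto elim: eventually_mono\<close>)
  then have "AE w in M. eventually (\<lambda>n. w \<in> space M - A n) sequentially"
    by (intro borel_cantelli_AE1) (auto simp: emeasure_eq_measure)
  then show ?thesis by (rule eventually_mono) (auto elim: eventually_mono)
qed

lemma nn_integral_time:
  fixes g :: "real \<Rightarrow> 'a \<Rightarrow> ennreal"
  assumes g[measurable]: "(\<lambda>(s, w). g s w) \<in> borel_measurable (borel \<Otimes>\<^sub>M M)"
    and b: "\<And>s. s \<in> {a..b} \<Longrightarrow> (\<integral>\<^sup>+w. g s w \<partial>M) \<le> ennreal c" and ab: "a \<le> b" "0 \<le> c"
  shows "(\<integral>\<^sup>+w. (\<integral>\<^sup>+s. indicator {a..b} s * g s w \<partial>lborel) \<partial>M) \<le> ennreal (c * (b - a))"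
proof -
  interpret P: pair_sigma_finite lborel M ..
  have [measurable]: "(\<lambda>(s, w). g s w) \<in> borel_measurable (lborel \<Otimes>\<^sub>M M)" using g by simp
  have m1: "(\<lambda>(s, w). indicator {a..b} s * g s w) \<in> borel_measurable (lborel \<Otimes>\<^sub>M M)"
  proof -
    have "(\<lambda>p. indicator {a..b} (fst p) * (\<lambda>(s, w). g s w) p) \<in> borel_measurable (lborel \<Otimes>\<^sub>M M)" by measurable
    then show ?thesis by (simp add: case_prod_beta')
  qed
  have sec: "(\<lambda>w. g s w) \<in> borel_measurable M" for s
    using measurable_compose[OF measurable_Pair1' g, of s] by simp
  have "(\<integral>\<^sup>+w. (\<integral>\<^sup>+s. indicator {a..b} s * g s w \<partial>lborel) \<partial>M) = (\<integral>\<^sup>+s. (\<integral>\<^sup>+w. indicator {a..b} s * g s w \<partial>M) \<partial>lborel)"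
    by (rule P.Fubini'[OF m1])
  also have "\<dots> = (\<integral>\<^sup>+s. indicator {a..b} s * (\<integral>\<^sup>+w. g s w \<partial>M) \<partial>lborel)"
    by (intro nn_integral_cong nn_integral_cmult sec)
  also have "\<dots> \<le> (\<integral>\<^sup>+s. ennreal c * indicator {a..b} s \<partial>lborel)"
    by (intro nn_integral_mono) (auto simp: indicator_def b)
  also have "\<dots> = ennreal c * emeasure lborel {a..b}" by (rule nn_integral_cmult_indicator) simp
  also have "\<dots> = ennreal (c * (b - a))" using ab by (simp add: ennreal_mult)
  finally show ?thesis .
qed

end

context besq_drift
begin

lemma A_nn: "w \<in> space M \<Longrightarrow> ennreal (A t w) = (\<integral>\<^sup>+s. indicator {0..t} s * ennreal (fY s w) \<partial>lborel)"
proof -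
  assume w: "w \<in> space M"
  have "(\<integral>\<^sup>+s. ennreal (indicator {0..t} s * fY s w) \<partial>lborel) = ennreal (A t w)"
    unfolding A_def by (rule nn_integral_eq_integral[OF A_integrable[OF w]]) (use fY_nonneg in auto)
  moreover have "ennreal (indicator {0..t} s * fY s w) = indicator {0..t} s * ennreal (fY s w)" for s
    by (simp add: indicator_def)
  ultimately show ?thesis by simp
qed

lemma A_nonneg: "0 \<le> A t w"
  unfolding A_def by (intro integral_nonneg_AE AE_I2) (simp add: fY_nonneg)

lemma A_expectation:
  assumes t: "0 \<le> t"
  shows "integrable M (A t)" "expectation (A t) \<le> Cf * MP \<alpha> * (1 + t) powr \<kappa>"
proof -
  define c where "c = Cf * MP \<alpha> * (1 + t) powr (\<gamma> + \<alpha>)"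
  have c: "0 \<le> c" using Cf(1) MP_nonneg[OF params(2)] by (simp add: c_def)
  have "(\<integral>\<^sup>+w. ennreal (A t w) \<partial>M) = (\<integral>\<^sup>+w. (\<integral>\<^sup>+s. indicator {0..t} s * ennreal (fY s w) \<partial>lborel) \<partial>M)"
    by (intro nn_integral_cong A_nn)
  also have "\<dots> \<le> ennreal (c * (t - 0))"
  proof (rule nn_integral_time)
    have "(\<lambda>p. ennreal ((\<lambda>(s, w). fY s w) p)) \<in> borel_measurable (borel \<Otimes>\<^sub>M M)" by measurable
    then show "(\<lambda>(s, w). ennreal (fY s w)) \<in> borel_measurable (borel \<Otimes>\<^sub>M M)" by (simp add: case_prod_beta')
    fix s assume s: "s \<in> {0..t}"
    then have s0: "0 \<le> s" by simp
    have "(\<integral>\<^sup>+w. ennreal (fY s w) \<partial>M) = ennreal (expectation (fY s))"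
      by (rule nn_integral_eq_integral[OF fY_expectation(1)[OF s0]]) (use fY_nonneg in auto)
    also have "expectation (fY s) \<le> Cf * MP \<alpha> * (1 + s) powr (\<gamma> + \<alpha>)" by (rule fY_expectation(2)[OF s0])
    also have "\<dots> \<le> c" unfolding c_def using s Cf(1) MP_nonneg[OF params(2)] params
      by (intro mult_left_mono powr_mono2) auto
    finally show "(\<integral>\<^sup>+w. ennreal (fY s w) \<partial>M) \<le> ennreal c" by (simp add: ennreal_leI)
  qed (use t c in auto)
  finally have le: "(\<integral>\<^sup>+w. ennreal (A t w) \<partial>M) \<le> ennreal (c * t)" by simp
  show i: "integrable M (A t)"
    using le by (intro integrableI_nonneg) (auto intro: A_nonneg le_less_trans)
  have "ennreal (expectation (A t)) \<le> ennreal (c * t)"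
    using le nn_integral_eq_integral[OF i] A_nonneg by simp
  then have "expectation (A t) \<le> c * t" using c t by (simp add: ennreal_le_iff)
  also have "\<dots> \<le> c * (1 + t)" using c by (intro mult_left_mono) auto
  also have "\<dots> = Cf * MP \<alpha> * (1 + t) powr \<kappa>"
    using t by (simp add: c_def \<kappa>_def powr_add)
  finally show "expectation (A t) \<le> Cf * MP \<alpha> * (1 + t) powr \<kappa>" .
qed

lemma A_upper_dyadic:
  assumes e: "0 < \<epsilon>"
  shows "AE w in M. eventually (\<lambda>n. A (2^n) w \<le> (2^n) powr (\<kappa> + \<epsilon>)) sequentially"
proof -
  define C where "C = Cf * MP \<alpha> * 2 powr \<kappa>"
  have C: "0 \<le> C" using Cf(1) MP_nonneg[OF params(2)] by (simp add: C_def)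
  have "AE w in M. eventually (\<lambda>n. w \<notin> {w\<in>space M. (2^n) powr (\<kappa> + \<epsilon>) \<le> A (2^n) w}) sequentially"
  proof (rule borel_cantelli_bound)
    show "summable (\<lambda>n. C * (2^n) powr (- \<epsilon>))" using e by (intro summable_mult summable_pow2_powr) simp
    show "eventually (\<lambda>n. prob {w\<in>space M. (2^n) powr (\<kappa> + \<epsilon>) \<le> A (2^n) w} \<le> C * (2^n) powr (- \<epsilon>)) sequentially"
    proof (intro always_eventually allI)
      fix n
      let ?t = "2^n :: real"
      have t: "1 \<le> ?t" "0 < ?t" by auto
      have "prob {w\<in>space M. ?t powr (\<kappa> + \<epsilon>) \<le> A ?t w} \<le> expectation (A ?t) / ?t powr (\<kappa> + \<epsilon>)"
        using A_nonneg by (intro integral_Markov_inequality_measure[where A="space M", OF A_expectation(1)]) auto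
      also have "\<dots> \<le> (C * ?t powr \<kappa>) / ?t powr (\<kappa> + \<epsilon>)"
      proof (rule divide_right_mono)
        have "expectation (A ?t) \<le> Cf * MP \<alpha> * (1 + ?t) powr \<kappa>" using t by (intro A_expectation) auto
        also have "\<dots> \<le> Cf * MP \<alpha> * (2 * ?t) powr \<kappa>"
          using t Cf(1) MP_nonneg[OF params(2)] \<kappa>_gt_1 by (intro mult_left_mono powr_mono2) auto
        finally show "expectation (A ?t) \<le> C * ?t powr \<kappa>" by (simp only: C_def powr_mult mult.assoc)
      qed simp
      also have "\<dots> = C * ?t powr (- \<epsilon>)" using t by (simp add: powr_add powr_minus divide_inverse)
      finally show "prob {w\<in>space M. ?t powr (\<kappa> + \<epsilon>) \<le> A ?t w} \<le> C * ?t powr (- \<epsilon>)" .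
    qed
  qed measurable
  then show ?thesis using AE_space by eventually_elim (auto elim: eventually_mono)
qed

text \<open>If Y exceeds \<open>q\<close> during more than half of \<open>{t/2..t}\<close>, then
  \<open>A t\<close> is at least \<open>m * (t/4)\<close>. Otherwise the time \<open>Oc\<close>
  spent below \<open>q\<close> is at least \<open>t/4\<close>, and Markov's inequality with
  \<open>prob_Y_le\<close> bounds the probability of that; the factor 2 is \<open>4/t\<close> times
  \<open>t/2\<close>.\<close>

lemma prob_A_lower:
  assumes r: "\<And>t y. 0 \<le> t \<Longrightarrow> 0 \<le> y \<Longrightarrow> r \<le> t + y \<Longrightarrow> (\<rho>/2) * (1 + t) powr \<gamma> * (1 + y) powr \<alpha> \<le> f t y"
    and t: "1 \<le> t" "2 * r \<le> t" and q: "0 < q"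
  shows "prob {\<omega>\<in>space M. A t \<omega> < (\<rho>/8) * 2 powr (- \<bar>\<gamma>\<bar>) * t powr (1 + \<gamma>) * q powr \<alpha>}
    \<le> 2 * exp 1 * (1 + t / q) powr (- \<delta> / 2)"
proof -
  \<comment> \<open>A lower bound for \<open>f\<close> at times in \<open>{t/2..t}\<close> and
    points above \<open>q\<close>. As \<open>1 + s\<close> lies between \<open>t/2\<close> and
    \<open>2 * t\<close>, the factor \<open>2 powr (- \<bar>\<gamma>\<bar>)\<close> serves both
    signs of \<gamma>.\<close>
  define m where "m = (\<rho>/2) * (2 powr (- \<bar>\<gamma>\<bar>) * t powr \<gamma>) * q powr \<alpha>"
  have m0: "0 \<le> m" using params by (simp add: m_def)
  have tm: "(\<rho>/8) * 2 powr (- \<bar>\<gamma>\<bar>) * t powr (1 + \<gamma>) * q powr \<alpha> = m * (t / 4)"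
    using t by (simp add: m_def powr_add)
  define Oc where "Oc \<omega> = (\<integral>\<^sup>+s. indicator {t/2..t} s * indicator {..q} (Y (max 0 s) \<omega>) \<partial>lborel)" for \<omega>
  have jm: "(\<lambda>(s, \<omega>). indicator {..q} (Y (max 0 s) \<omega>) :: ennreal) \<in> borel_measurable (borel \<Otimes>\<^sub>M M)"
  proof -
    have "(\<lambda>p. indicator {..q} ((\<lambda>(s, \<omega>). Y (max 0 s) \<omega>) p) :: ennreal) \<in> borel_measurable (borel \<Otimes>\<^sub>M M)" by measurable
    then show ?thesis by (simp add: case_prod_beta')
  qed
  have Om[measurable]: "Oc \<in> borel_measurable M"
  proof -
    have "(\<lambda>p. indicator {t/2..t} (snd p) * indicator {..q} ((\<lambda>(s, \<omega>). Y (max 0 s) \<omega>) (snd p, fst p)) :: ennreal) \<in> borel_measurable (M \<Otimes>\<^sub>M lborel)"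
      by measurable
    then have "(\<lambda>(\<omega>, s). indicator {t/2..t} s * indicator {..q} (Y (max 0 s) \<omega>) :: ennreal) \<in> borel_measurable (M \<Otimes>\<^sub>M lborel)"
      by (simp add: case_prod_beta')
    then show ?thesis unfolding Oc_def[abs_def] by (rule lborel.borel_measurable_nn_integral)
  qed
  let ?c = "exp 1 * (1 + t / q) powr (- \<delta> / 2)"
  have EO: "(\<integral>\<^sup>+\<omega>. Oc \<omega> \<partial>M) \<le> ennreal (?c * (t - t/2))"
    unfolding Oc_def
  proof (rule nn_integral_time[OF jm])
    fix s assume s: "s \<in> {t/2..t}"
    then have s0: "0 \<le> s" "t \<le> 2 * s" using t by auto
    have [measurable]: "Y s \<in> borel_measurable M" by (rule X_measurable[OF s0(1)])
    have "(\<integral>\<^sup>+\<omega>. indicator {..q} (Y (max 0 s) \<omega>) \<partial>M) = (\<integral>\<^sup>+\<omega>. indicator {\<omega>\<in>space M. Y s \<omega> \<le> q} \<omega> \<partial>M)"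
      using s0 by (intro nn_integral_cong) (auto simp: indicator_def)
    also have "\<dots> = ennreal (prob {\<omega>\<in>space M. Y s \<omega> \<le> q})" by (simp add: emeasure_eq_measure)
    also have "\<dots> \<le> ennreal ?c"
    proof (rule ennreal_leI)
      have "prob {\<omega>\<in>space M. Y s \<omega> \<le> q} \<le> exp 1 * (1 + 2 * s / q) powr (- \<delta> / 2)" by (rule prob_Y_le[OF s0(1) q])
      also have "\<dots> \<le> ?c"
      proof (intro mult_left_mono powr_mono2')
        show "1 + t / q \<le> 1 + 2 * s / q" using s0 q by (intro add_left_mono divide_right_mono) auto
        show "0 < 1 + t / q" using t q by (intro add_pos_nonneg) auto
      qed (use \<delta>_pos in auto)
      finally show "prob {\<omega>\<in>space M. Y s \<omega> \<le> q} \<le> ?c" .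
    qed
    finally show "(\<integral>\<^sup>+\<omega>. indicator {..q} (Y (max 0 s) \<omega>) \<partial>M) \<le> ennreal ?c" .
  qed (use t in auto)
  have key: "m * (t / 4) \<le> A t \<omega>" if w: "\<omega> \<in> space M" and o: "Oc \<omega> < ennreal (t/4)" for \<omega>
  proof -
    \<comment> \<open>At each time of \<open>{t/2..t}\<close> either \<open>f\<close> is at least
      \<open>m\<close> or the time is counted in \<open>Oc\<close>; integration gives
      \<open>m * (t/2) \<le> A t + m * Oc\<close>.\<close>
    have pt: "ennreal m * indicator {t/2..t} s \<le> indicator {0..t} s * ennreal (fY s \<omega>) + ennreal m * (indicator {t/2..t} s * indicator {..q} (Y (max 0 s) \<omega>))" for s
    proof (cases "s \<in> {t/2..t} \<and> q < Y (max 0 s) \<omega>")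
      case True
      then have s: "0 \<le> s" "s \<le> t" "t \<le> 2 * s" "q < Y s \<omega>" using t by auto
      have "2 powr (- \<bar>\<gamma>\<bar>) * t powr \<gamma> \<le> (1 + s) powr \<gamma>"
      proof (cases "0 \<le> \<gamma>")
        case True
        have "2 powr (- \<bar>\<gamma>\<bar>) * t powr \<gamma> = (t / 2) powr \<gamma>" using True t by (simp add: powr_divide powr_minus_divide)
        also have "\<dots> \<le> (1 + s) powr \<gamma>" using True s t by (intro powr_mono2) auto
        finally show ?thesis .
      next
        case False
        have "2 powr (- \<bar>\<gamma>\<bar>) * t powr \<gamma> = (2 * t) powr \<gamma>" using False by (simp add: powr_mult)
        also have "\<dots> \<le> (1 + s) powr \<gamma>" using False s t by (intro powr_mono2') auto
        finally show ?thesis .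
      qed
      moreover have "q powr \<alpha> \<le> (1 + Y s \<omega>) powr \<alpha>" using s q params by (intro powr_mono2) auto
      ultimately have "m \<le> (\<rho>/2) * (1 + s) powr \<gamma> * (1 + Y s \<omega>) powr \<alpha>"
        unfolding m_def using params by (intro mult_mono) auto
      also have "\<dots> \<le> f s (Y s \<omega>)" using s t q by (intro r) auto
      also have "\<dots> = fY s \<omega>" using s q by (simp add: fY_def)
      finally have "ennreal m \<le> ennreal (fY s \<omega>)" by (rule ennreal_leI)
      then show ?thesis using True s by (auto intro: add_increasing2)
    next
      case False
      then show ?thesis by (auto simp: indicator_def)
    qed
    have ms: "(\<lambda>s. Y (max 0 s) \<omega>) \<in> borel_measurable lborel"
      using measurable_compose[OF measurable_Pair2'[OF w] Y_joint] by simp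
    have mf: "(\<lambda>s. fY s \<omega>) \<in> borel_measurable lborel"
      using measurable_compose[OF measurable_Pair2'[OF w] fY_joint] by simp
    have m2: "(\<lambda>s. indicator {t/2..t} s * indicator {..q} (Y (max 0 s) \<omega>) :: ennreal) \<in> borel_measurable lborel"
      using ms by measurable
    have "ennreal m * ennreal (t/2) = (\<integral>\<^sup>+s. ennreal m * indicator {t/2..t} s \<partial>lborel)"
      using t by (subst nn_integral_cmult_indicator) auto
    also have "\<dots> \<le> (\<integral>\<^sup>+s. indicator {0..t} s * ennreal (fY s \<omega>) + ennreal m * (indicator {t/2..t} s * indicator {..q} (Y (max 0 s) \<omega>)) \<partial>lborel)"
      by (rule nn_integral_mono) (rule pt)
    also have "\<dots> = (\<integral>\<^sup>+s. indicator {0..t} s * ennreal (fY s \<omega>) \<partial>lborel) + (\<integral>\<^sup>+s. ennreal m * (indicator {t/2..t} s * indicator {..q} (Y (max 0 s) \<omega>)) \<partial>lborel)"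
    proof (rule nn_integral_add)
      show "(\<lambda>s. indicator {0..t} s * ennreal (fY s \<omega>)) \<in> borel_measurable lborel"
        by (intro borel_measurable_times_ennreal measurable_compose[OF mf measurable_ennreal]) simp
      show "(\<lambda>s. ennreal m * (indicator {t/2..t} s * indicator {..q} (Y (max 0 s) \<omega>))) \<in> borel_measurable lborel"
        by (intro borel_measurable_times_ennreal m2) simp
    qed
    also have "\<dots> = ennreal (A t \<omega>) + ennreal m * Oc \<omega>"
      unfolding A_nn[OF w] Oc_def by (subst nn_integral_cmult[OF m2]) simp
    also have "\<dots> \<le> ennreal (A t \<omega>) + ennreal m * ennreal (t/4)"
      using o by (intro add_left_mono mult_left_mono) auto
    also have "\<dots> = ennreal (A t \<omega> + m * (t/4))"
    proof -
      have "ennreal m * ennreal (t/4) = ennreal (m * (t/4))" using m0 t by (intro ennreal_mult[symmetric]) auto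
      moreover have "0 \<le> m * (t/4)" using m0 t by simp
      ultimately show ?thesis using ennreal_plus[OF A_nonneg] by metis
    qed
    finally have "ennreal m * ennreal (t/2) \<le> ennreal (A t \<omega> + m * (t/4))" .
    moreover have "ennreal m * ennreal (t/2) = ennreal (m * (t/2))" using m0 t by (intro ennreal_mult[symmetric]) auto
    ultimately have "ennreal (m * (t/2)) \<le> ennreal (A t \<omega> + m * (t/4))" by metis
    then have "m * (t/2) \<le> A t \<omega> + m * (t/4)" using m0 t A_nonneg by (subst (asm) ennreal_le_iff) auto
    then show ?thesis by simp
  qed
  have "{\<omega>\<in>space M. A t \<omega> < m * (t / 4)} \<subseteq> {\<omega>\<in>space M. 1 \<le> ennreal (4/t) * Oc \<omega>}"
  proof safe
    fix \<omega> assume w: "\<omega> \<in> space M" and "A t \<omega> < m * (t / 4)"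
    then have "ennreal (t/4) \<le> Oc \<omega>" using key[OF w] by (force simp: not_less[symmetric])
    then have "ennreal (4/t) * ennreal (t/4) \<le> ennreal (4/t) * Oc \<omega>" by (rule mult_left_mono) simp
    then show "1 \<le> ennreal (4/t) * Oc \<omega>" using t by (simp add: ennreal_mult[symmetric])
  qed
  then have "emeasure M {\<omega>\<in>space M. A t \<omega> < m * (t / 4)} \<le> emeasure M {\<omega>\<in>space M. 1 \<le> ennreal (4/t) * Oc \<omega>}"
    by (rule emeasure_mono) measurable
  also have "\<dots> \<le> ennreal (4/t) * (\<integral>\<^sup>+\<omega>. Oc \<omega> * indicator (space M) \<omega> \<partial>M)"
    by (rule nn_integral_Markov_inequality) auto
  also have "(\<integral>\<^sup>+\<omega>. Oc \<omega> * indicator (space M) \<omega> \<partial>M) = (\<integral>\<^sup>+\<omega>. Oc \<omega> \<partial>M)"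
    by (intro nn_integral_cong) auto
  also have "ennreal (4/t) * \<dots> \<le> ennreal (4/t) * ennreal (?c * (t - t/2))" by (intro mult_left_mono EO) auto
  also have "\<dots> = ennreal (2 * ?c)" using t by (simp add: ennreal_mult[symmetric])
  finally show ?thesis unfolding tm by (simp add: emeasure_eq_measure mult.assoc)
qed

text \<open>With the threshold \<open>q = t powr (1 - \<theta>)\<close> the probability in
  \<open>prob_A_lower\<close> is at most a multiple of
  \<open>t powr (- \<theta> * \<delta> / 2)\<close>, summable along powers of 2, and the bound for
  \<open>A t\<close> is a multiple of
  \<open>t powr (\<kappa> - \<theta> * \<alpha>)\<close>.\<close>

lemma A_lower_dyadic:
  assumes e: "0 < \<epsilon>"
  shows "AE w in M. eventually (\<lambda>n. (2^n) powr (\<kappa> - \<epsilon>) \<le> A (2^n) w) sequentially"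
proof -
  obtain r where r: "0 \<le> r" "\<And>t y. 0 \<le> t \<Longrightarrow> 0 \<le> y \<Longrightarrow> r \<le> t + y \<Longrightarrow> (\<rho>/2) * (1 + t) powr \<gamma> * (1 + y) powr \<alpha> \<le> f t y"
    using assumption_Af_bounds(2)[OF Af] by blast
  \<comment> \<open>The loss \<open>\<theta> * \<alpha>\<close> is at most
    \<open>\<epsilon> / 2\<close>, and the other half absorbs the constant \<open>c\<close>. The
    denominator uses \<open>\<alpha> + 1\<close> since \<alpha> may be 0.\<close>
  define \<theta> where "\<theta> = \<epsilon> / (2 * (\<alpha> + 1))"
  have \<theta>: "0 < \<theta>" "\<theta> * \<alpha> \<le> \<epsilon> / 2"
  proof -
    show "0 < \<theta>" using e params by (simp add: \<theta>_def)
    have "\<theta> * \<alpha> \<le> \<theta> * (\<alpha> + 1)" using \<open>0 < \<theta>\<close> by (intro mult_left_mono) auto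
    also have "\<dots> = \<epsilon> / 2"
    proof -
      have "\<epsilon> / (2 * a) * a = \<epsilon> / 2" if "a \<noteq> 0" for a using that by simp
      from this[of "\<alpha> + 1"] show ?thesis using params unfolding \<theta>_def by simp
    qed
    finally show "\<theta> * \<alpha> \<le> \<epsilon> / 2" .
  qed
  define c where "c = (\<rho>/8) * 2 powr (- \<bar>\<gamma>\<bar>)"
  have c: "0 < c" using params by (simp add: c_def)
  have a1: "AE w in M. eventually (\<lambda>n. w \<notin> {w\<in>space M. A (2^n) w < c * (2^n) powr (1 + \<gamma>) * ((2^n) powr (1 - \<theta>)) powr \<alpha>}) sequentially"
  proof (rule borel_cantelli_bound)
    show "summable (\<lambda>n. 2 * exp 1 * (2^n) powr (- (\<theta> * \<delta> / 2)) :: real)"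
      using \<theta> \<delta>_pos by (intro summable_mult summable_pow2_powr) simp
    have "eventually (\<lambda>n. max 1 (2 * r) \<le> 2^n) sequentially" by (rule eventually_pow2[OF eventually_ge_at_top])
    then show "eventually (\<lambda>n. prob {w\<in>space M. A (2^n) w < c * (2^n) powr (1 + \<gamma>) * ((2^n) powr (1 - \<theta>)) powr \<alpha>} \<le> 2 * exp 1 * (2^n) powr (- (\<theta> * \<delta> / 2))) sequentially"
    proof eventually_elim
      case (elim n)
      let ?t = "2^n :: real"
      let ?q = "?t powr (1 - \<theta>)"
      have tq: "?t / ?q = ?t powr \<theta>" by (simp add: powr_diff)
      have "prob {w\<in>space M. A ?t w < (\<rho>/8) * 2 powr (- \<bar>\<gamma>\<bar>) * ?t powr (1 + \<gamma>) * ?q powr \<alpha>} \<le> 2 * exp 1 * (1 + ?t / ?q) powr (- \<delta> / 2)"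
        using elim by (intro prob_A_lower[OF r(2)]) auto
      also have "\<dots> \<le> 2 * exp 1 * (?t powr \<theta>) powr (- \<delta> / 2)"
        unfolding tq using \<delta>_pos by (intro mult_left_mono powr_mono2') auto
      also have "\<dots> = 2 * exp 1 * ?t powr (- (\<theta> * \<delta> / 2))" by (simp add: powr_powr)
      finally show ?case by (simp only: c_def)
    qed
  qed measurable
  have a2: "eventually (\<lambda>n. (2^n) powr (\<kappa> - \<epsilon>) \<le> c * (2^n) powr (1 + \<gamma>) * ((2^n) powr (1 - \<theta>)) powr \<alpha>) sequentially"
  proof (rule eventually_pow2)
    have "0 < \<epsilon> - \<theta> * \<alpha>" using \<theta> e by linarith
    from eventually_powr_ge[OF this, of "1/c"] eventually_gt_at_top[of 0]
    show "eventually (\<lambda>t. t powr (\<kappa> - \<epsilon>) \<le> c * t powr (1 + \<gamma>) * (t powr (1 - \<theta>)) powr \<alpha>) at_top"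
    proof eventually_elim
      case (elim t)
      have "c * t powr (1 + \<gamma>) * (t powr (1 - \<theta>)) powr \<alpha> = c * t powr ((\<epsilon> - \<theta> * \<alpha>) + (\<kappa> - \<epsilon>))"
        by (simp only: powr_powr mult.assoc powr_add[symmetric]) (simp add: \<kappa>_def algebra_simps)
      also have "\<dots> = (c * t powr (\<epsilon> - \<theta> * \<alpha>)) * t powr (\<kappa> - \<epsilon>)" by (simp only: powr_add mult.assoc)
      also have "1 * t powr (\<kappa> - \<epsilon>) \<le> \<dots>"
        using elim c by (intro mult_right_mono) (auto simp: field_simps)
      finally show ?case by simp
    qed
  qed
  show ?thesis
    using a1 AE_space
  proof eventually_elim
    case (elim w)
    from elim(1) a2 show ?case by eventually_elim (use elim in auto)
  qed
qed

end

context besq_drift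
begin

lemma A_growth:
  "AE w in M. \<forall>\<epsilon>>0. eventually (\<lambda>t. t powr (\<kappa> - \<epsilon>) \<le> A t w \<and> A t w \<le> t powr (\<kappa> + \<epsilon>)) at_top"
proof -
  \<comment> \<open>Countably many exponents, so that one null set serves all \<epsilon>. Only
    \<open>e k / 2\<close> is used at the dyadic times; the other half pays for the factor 2 between
    consecutive ones.\<close>
  define e where "e k = 1 / real (Suc k)" for k
  have e: "0 < e k" "e k \<le> 1" for k by (auto simp: e_def)
  have "AE w in M. \<forall>k. eventually (\<lambda>n. (2^n) powr (\<kappa> - e k / 2) \<le> A (2^n) w \<and> A (2^n) w \<le> (2^n) powr (\<kappa> + e k / 2)) sequentially"
  proof (subst AE_all_countable, rule allI)
    fix k
    have e2: "0 < e k / 2" using e by simp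
    from A_upper_dyadic[OF e2] A_lower_dyadic[OF e2]
    show "AE w in M. eventually (\<lambda>n. (2^n) powr (\<kappa> - e k / 2) \<le> A (2^n) w \<and> A (2^n) w \<le> (2^n) powr (\<kappa> + e k / 2)) sequentially"
      by eventually_elim (rule eventually_conj)
  qed
  then show ?thesis
    using AE_space
  proof eventually_elim
    case (elim w)
    have k: "eventually (\<lambda>t. t powr (\<kappa> - e k) \<le> A t w \<and> A t w \<le> t powr (\<kappa> + e k)) at_top" for k
    proof -
      have e2: "0 < e k / 2" using e by simp
      show ?thesis
        using dyadic_eventually_at_top[OF elim(1)[rule_format, of k]] eventually_gt_at_top[of 1]
          eventually_powr_ge[OF e2, of "2 powr (\<kappa> + e k / 2)"] eventually_powr_ge[OF e2, of "2 powr (\<kappa> - e k / 2)"]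
      proof eventually_elim
        case (elim t)
        then obtain n where n: "(2^n) powr (\<kappa> - e k / 2) \<le> A (2^n) w" "A (2^Suc n) w \<le> (2^Suc n) powr (\<kappa> + e k / 2)"
          "2^n \<le> t" "t \<le> 2^Suc n" by blast
        have ex: "0 < \<kappa> - e k / 2" using \<kappa>_gt_1 e(2)[of k] by simp
        have "A t w \<le> A (2^Suc n) w" using \<open>w \<in> space M\<close> n by (intro A_mono) auto
        also note n(2)
        also have "(2^Suc n) powr (\<kappa> + e k / 2) \<le> (2 * t) powr (\<kappa> + e k / 2)"
          using n(3) ex e(1)[of k] by (intro powr_mono2) auto
        also have "\<dots> = 2 powr (\<kappa> + e k / 2) * t powr (\<kappa> + e k / 2)" by (rule powr_mult)
        also have "\<dots> \<le> t powr (e k / 2) * t powr (\<kappa> + e k / 2)" using elim by (intro mult_right_mono) auto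
        also have "\<dots> = t powr (\<kappa> + e k)" by (simp add: powr_add[symmetric] add.commute)
        finally have U: "A t w \<le> t powr (\<kappa> + e k)" .
        have "t powr (\<kappa> - e k) * 2 powr (\<kappa> - e k / 2) \<le> t powr (\<kappa> - e k) * t powr (e k / 2)"
          using elim by (intro mult_left_mono) auto
        also have "\<dots> = t powr (\<kappa> - e k / 2)" by (simp add: powr_add[symmetric])
        also have "\<dots> \<le> (2 * 2^n) powr (\<kappa> - e k / 2)" using n(4) ex elim by (intro powr_mono2) auto
        also have "\<dots> = (2^n) powr (\<kappa> - e k / 2) * 2 powr (\<kappa> - e k / 2)" by (simp only: powr_mult mult.commute)
        finally have "t powr (\<kappa> - e k) \<le> (2^n) powr (\<kappa> - e k / 2)" by simp
        also note n(1)
        also have "A (2^n) w \<le> A t w" using \<open>w \<in> space M\<close> n by (intro A_mono) auto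
        finally show ?case using U by blast
      qed
    qed
    show ?case
    proof (intro allI impI)
      fix \<epsilon> :: real assume "0 < \<epsilon>"
      then obtain n where "1 / real (Suc n) < \<epsilon>" using nat_approx_posE by blast
      then have en: "e n \<le> \<epsilon>" by (simp add: e_def)
      show "eventually (\<lambda>t. t powr (\<kappa> - \<epsilon>) \<le> A t w \<and> A t w \<le> t powr (\<kappa> + \<epsilon>)) at_top"
        using k[of n] eventually_gt_at_top[of 1]
      proof eventually_elim
        case (elim t)
        have "t powr (\<kappa> - \<epsilon>) \<le> t powr (\<kappa> - e n)" "t powr (\<kappa> + e n) \<le> t powr (\<kappa> + \<epsilon>)"
          using elim en by (auto intro: powr_mono)
        then show ?case using elim by linarith
      qed
    qed
  qed
qed

end

section \<open>The driven process S and its martingale part\<close>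

locale besq_driven = besq_drift M F W \<delta> y Y f \<rho> \<alpha> \<gamma> for M :: "'a measure" and F W \<delta> y Y f \<rho> \<alpha> \<gamma> +
  fixes B S :: "real \<Rightarrow> 'a \<Rightarrow> real" and s0 :: real
  assumes B: "is_brownian_motion M F B"
    and S_adapted: "adapted_proc F S" and S_cont: "continuous_paths M S"
    and S_nonneg: "\<forall>t\<ge>0. \<forall>w\<in>space M. 0 \<le> S t w"
    and s0: "0 \<le> s0" "\<forall>w\<in>space M. S 0 w = s0"
    and S_sde: "\<forall>t\<ge>0. \<exists>I. is_ito_integral M (\<lambda>s w. sqrt (S s w)) B t I \<and>
           (AE w in M. S t w = s0 + integral {0..t} (\<lambda>s. 2 * f s (Y s w) + 1) + 2 * I w)"
begin

definition NS :: "real \<Rightarrow> 'a \<Rightarrow> real" where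
  "NS t w = (S t w - s0 - t - 2 * A t w) / 2"

lemma drift_eq:
  assumes w: "w \<in> space M" and Y0: "\<forall>t\<ge>0. 0 \<le> Y t w" and t: "0 \<le> t"
  shows "integral {0..t} (\<lambda>s. 2 * f s (Y s w) + 1) = 2 * A t w + t"
proof -
  have i: "(\<lambda>s. fY s w) integrable_on {0..t}"
    by (intro integrable_continuous_real continuous_on_subset[OF fY_cont[OF w]]) auto
  have "integral {0..t} (\<lambda>s. 2 * f s (Y s w) + 1) = integral {0..t} (\<lambda>s. 2 * fY s w + 1)"
    using Y0 by (intro Henstock_Kurzweil_Integration.integral_cong) (auto simp: fY_def)
  also have "\<dots> = integral {0..t} (\<lambda>s. 2 * fY s w) + integral {0..t} (\<lambda>s. 1)"
    using i by (intro Henstock_Kurzweil_Integration.integral_add integrable_on_mult_right) auto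
  also have "\<dots> = 2 * A t w + t" using t by (simp add: A_eq[OF w])
  finally show ?thesis .
qed

sublocale SI: sqrt_integral M F B S NS
proof
  show "filtration_of M F" by (rule filtration)
  show "is_brownian_motion M F B" by (rule B)
  show "adapted_proc F S" "continuous_paths M S" by (rule S_adapted S_cont)+
  show "continuous_paths M NS"
    unfolding continuous_paths_def NS_def
  proof
    fix \<omega> assume w: "\<omega> \<in> space M"
    have c: "continuous_on {0..} (\<lambda>t. S t \<omega>)" using S_cont w by (auto simp: continuous_paths_def)
    show "continuous_on {0..} (\<lambda>t. (S t \<omega> - s0 - t - 2 * A t \<omega>) / 2)"
      using c A_cont[OF w] by (intro continuous_intros) auto
  qed
  fix t :: real assume t: "0 \<le> t"
  have [measurable]: "S t \<in> borel_measurable M"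
    using S_adapted t measurable_F_le by (auto simp: adapted_proc_def)
  show "NS t \<in> borel_measurable M" unfolding NS_def[abs_def] by measurable
  obtain I where I: "is_ito_integral M (\<lambda>s \<omega>. sqrt (S s \<omega>)) B t I"
    "AE \<omega> in M. S t \<omega> = s0 + integral {0..t} (\<lambda>s. 2 * f s (Y s \<omega>) + 1) + 2 * I \<omega>" using S_sde t by blast
  have "ito_sum (\<lambda>s \<omega>. sqrt \<bar>S s \<omega>\<bar>) B t n \<omega> = ito_sum (\<lambda>s \<omega>. sqrt (S s \<omega>)) B t n \<omega>" if "\<omega> \<in> space M" for n \<omega>
    unfolding ito_sum_def using S_nonneg that t by (intro sum.cong) auto
  then have "{\<omega>\<in>space M. \<epsilon> < \<bar>ito_sum (\<lambda>s \<omega>. sqrt \<bar>S s \<omega>\<bar>) B t n \<omega> - I \<omega>\<bar>} = {\<omega>\<in>space M. \<epsilon> < \<bar>ito_sum (\<lambda>s \<omega>. sqrt (S s \<omega>)) B t n \<omega> - I \<omega>\<bar>}" for n \<epsilon>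
    by auto
  then have "is_ito_integral M (\<lambda>s \<omega>. sqrt \<bar>S s \<omega>\<bar>) B t I" using I(1) by (simp add: is_ito_integral_def)
  moreover have "AE \<omega> in M. NS t \<omega> = I \<omega>"
    using I(2) Y_nonneg AE_space
    by eventually_elim (simp add: NS_def drift_eq t)
  ultimately show "\<exists>I. is_ito_integral M (\<lambda>s \<omega>. sqrt \<bar>S s \<omega>\<bar>) B t I \<and> (AE \<omega> in M. NS t \<omega> = I \<omega>)" by blast
qed

text \<open>With \<open>A\<close> below \<open>t powr (\<kappa> + e0)\<close> and the martingale
  level \<open>t powr (\<kappa> - e0)\<close>, the exponent in \<open>prob_bad\<close> is of order
  \<open>t powr (\<kappa> - 1 - 3 * e0)\<close>; this choice makes its power equal to
  \<open>(\<kappa> - 1) / 2 > 0\<close>.\<close>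

definition e0 :: real where "e0 = (\<kappa> - 1) / 6"

lemma e0_pos: "0 < e0" using \<kappa>_gt_1 by (simp add: e0_def)

text \<open>A self-bounding argument: the variance of \<open>NS\<close> depends on S, but if
  \<open>A\<close> is of its proper size then S cannot reach \<open>K n\<close> unless
  \<open>NS\<close> has passed \<open>l n\<close> as well. The exit estimate makes this improbable,
  and off the exit event \<open>not_bad_bound\<close> bounds \<open>NS\<close> at all times.\<close>

lemma NS_dyadic:
  "AE w in M. eventually (\<lambda>n. \<forall>s. 0 \<le> s \<and> s \<le> 2^n \<longrightarrow> \<bar>NS s w\<bar> \<le> (2^n) powr (\<kappa> - e0)) sequentially"
proof -
  \<comment> \<open>\<open>K n\<close> is one more than \<open>s0 + t + 2 * A + 2 * l\<close> can be
    for \<open>t \<le> 2^n\<close> and \<open>A \<le> V n\<close>, so a value of S above it forces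
    \<open>NS > l n\<close>.\<close>
  define V l K where "V n = ((2^n :: real) powr (\<kappa> + e0))" and "l n = ((2^n :: real) powr (\<kappa> - e0))"
    and "K n = s0 + 2^n + 2 * V n + 2 * l n + 1" for n
  have T1: "1 \<le> (2^n :: real)" for n by simp
  have Vl: "1 \<le> V n" "2^n \<le> V n" "0 < l n" "l n \<le> V n" for n
  proof -
    have "(2^n :: real) powr 0 \<le> V n" "(2^n :: real) powr 1 \<le> V n" "l n \<le> V n"
      unfolding V_def l_def using \<kappa>_gt_1 e0_pos by (intro powr_mono; simp)+
    then show "1 \<le> V n" "2^n \<le> V n" "l n \<le> V n" by auto
    show "0 < l n" by (simp add: l_def)
  qed
  have K: "s0 < K n" "0 < K n" "K n \<le> (s0 + 6) * V n" for n
  proof -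
    show "s0 < K n" "0 < K n" using Vl[of n] s0 T1[of n] unfolding K_def by linarith+
    have "s0 * 1 \<le> s0 * V n" using Vl(1)[of n] s0 by (intro mult_left_mono) auto
    then show "K n \<le> (s0 + 6) * V n" using Vl[of n] by (simp add: K_def distrib_right)
  qed
  define c where "c = 1 / (8 * (s0 + 6))"
  have c: "0 < c" using s0 by (simp add: c_def)
  have "AE w in M. eventually (\<lambda>n. w \<notin> SI.bad (2^n) (K n) (l n)) sequentially"
  proof (rule borel_cantelli_bound)
    show "summable (\<lambda>n. (2 / c) * (2^n) powr (- (\<kappa> - 1 - 3 * e0)) :: real)"
      using \<kappa>_gt_1 by (intro summable_mult summable_pow2_powr) (simp add: e0_def)
    show "eventually (\<lambda>n. prob (SI.bad (2^n) (K n) (l n)) \<le> (2 / c) * (2^n) powr (- (\<kappa> - 1 - 3 * e0))) sequentially"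
    proof (intro always_eventually allI)
      fix n
      let ?t = "2^n :: real"
      let ?x = "?t powr (\<kappa> - 1 - 3 * e0)"
      have "c * ?x \<le> (l n)\<^sup>2 / (8 * K n * ?t)"
      proof -
        have "c * ?x = (l n)\<^sup>2 / (8 * ((s0 + 6) * V n) * ?t)"
        proof -
          have "(l n)\<^sup>2 = ?t powr (2 * (\<kappa> - e0))" by (simp add: l_def powr_power)
          also have "2 * (\<kappa> - e0) = (\<kappa> - 1 - 3 * e0) + (\<kappa> + e0) + 1" by simp
          also have "?t powr \<dots> = ?x * V n * ?t" by (simp only: powr_add V_def) simp
          finally have "(l n)\<^sup>2 = ?x * (V n * ?t)" by simp
          moreover have "1 / (8 * a) * x = (x * (v * u)) / (8 * (a * v) * u)" if "a \<noteq> 0" "v \<noteq> 0" "u \<noteq> 0" for a v u x :: real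
            using that by (simp add: field_simps)
          from this[of "s0 + 6" "V n" ?t ?x] have "c * ?x = (?x * (V n * ?t)) / (8 * ((s0 + 6) * V n) * ?t)"
            using Vl(1)[of n] s0(1) unfolding c_def by fastforce
          ultimately show ?thesis by simp
        qed
        also have "\<dots> \<le> (l n)\<^sup>2 / (8 * K n * ?t)"
          using K[of n] Vl(1)[of n] s0(1) by (intro divide_left_mono mult_right_mono mult_left_mono mult_pos_pos) auto
        finally show ?thesis .
      qed
      then have le: "exp (- (l n)\<^sup>2 / (8 * K n * ?t)) \<le> exp (- (c * ?x))" by simp
      have x: "0 < c * ?x" using c by simp
      \<comment> \<open>The crude bound \<open>exp (- u) \<le> 1 / u\<close> is enough, since
        \<open>1 / u\<close> is already geometric in \<open>n\<close>.\<close>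
      have "c * ?x \<le> exp (c * ?x)" using exp_ge_add_one_self[of "c * ?x"] by linarith
      then have "1 / exp (c * ?x) \<le> 1 / (c * ?x)" using x by (intro divide_left_mono) auto
      then have "exp (- (c * ?x)) \<le> 1 / (c * ?x)" by (simp add: exp_minus inverse_eq_divide)
      also have "\<dots> = (1 / c) * ?t powr (- (\<kappa> - 1 - 3 * e0))"
        by (subst powr_minus) (simp add: divide_inverse)
      finally have "exp (- (l n)\<^sup>2 / (8 * K n * ?t)) \<le> (1 / c) * ?t powr (- (\<kappa> - 1 - 3 * e0))"
        by (rule order_trans[OF le])
      then have "2 * exp (- (l n)\<^sup>2 / (8 * K n * ?t)) \<le> 2 * ((1 / c) * ?t powr (- (\<kappa> - 1 - 3 * e0)))"
        by (rule mult_left_mono) simp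
      moreover have "2 * ((1 / c) * u) = (2 / c) * u" for u :: real by simp
      ultimately have "2 * exp (- (l n)\<^sup>2 / (8 * K n * ?t)) \<le> (2 / c) * ?t powr (- (\<kappa> - 1 - 3 * e0))"
        by metis
      moreover have "prob (SI.bad ?t (K n) (l n)) \<le> 2 * exp (- (l n)\<^sup>2 / (8 * K n * ?t))"
        using K[of n] Vl[of n] by (intro SI.prob_bad) auto
      ultimately show "prob (SI.bad ?t (K n) (l n)) \<le> (2 / c) * ?t powr (- (\<kappa> - 1 - 3 * e0))" by linarith
    qed
  qed measurable
  then show ?thesis
    using A_upper_dyadic[OF e0_pos] AE_space
  proof eventually_elim
    case (elim w)
    from elim(1,2) show ?case
    proof eventually_elim
      case (elim n)
      show ?case
      proof (intro allI impI, elim conjE)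
        fix s :: real assume s: "0 \<le> s" "s \<le> 2^n"
        have "\<bar>NS s w\<bar> \<le> l n"
        proof (rule SI.not_bad_bound[OF \<open>w \<in> space M\<close> elim(1) _ _ s])
          show "\<bar>S 0 w\<bar> < K n" using s0 K(1)[of n] \<open>w \<in> space M\<close> by simp
          fix t assume t: "0 \<le> t" "t \<le> 2^n" "K n \<le> \<bar>S t w\<bar>"
          have "A t w \<le> A (2^n) w" using t \<open>w \<in> space M\<close> by (intro A_mono) auto
          also have "\<dots> \<le> V n" using elim(2) by (simp add: V_def)
          finally have "A t w \<le> V n" .
          moreover have "\<bar>S t w\<bar> = S t w" using S_nonneg t \<open>w \<in> space M\<close> by simp
          moreover have "l' < (S' - s0 - t - 2 * a) / 2" if "a \<le> v" "s0 + u + 2 * v + 2 * l' + 1 \<le> S'" "t \<le> u" for a v S' l' u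
            using that by (simp add: field_simps)
          ultimately have "l n < (S t w - s0 - t - 2 * A t w) / 2" using t(2,3) unfolding K_def by metis
          then show "l n < \<bar>NS t w\<bar>" unfolding NS_def by linarith
        qed
        then show "\<bar>NS s w\<bar> \<le> (2^n) powr (\<kappa> - e0)" by (simp add: l_def)
      qed
    qed
  qed
qed

lemma NS_growth: "AE w in M. eventually (\<lambda>t. \<bar>NS t w\<bar> \<le> t powr (\<kappa> - e0 / 2)) at_top"
  using NS_dyadic
proof eventually_elim
  case (elim w)
  have e2: "0 < e0 / 2" using e0_pos by simp
  show ?case
    using dyadic_eventually_at_top[OF elim] eventually_gt_at_top[of 1] eventually_powr_ge[OF e2, of "2 powr (\<kappa> - e0)"]
  proof eventually_elim
    case (elim t)
    then obtain n where n: "\<forall>s. 0 \<le> s \<and> s \<le> 2^Suc n \<longrightarrow> \<bar>NS s w\<bar> \<le> (2^Suc n) powr (\<kappa> - e0)" "2^n \<le> t" "t \<le> 2^Suc n" by blast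
    have "\<bar>NS t w\<bar> \<le> (2^Suc n) powr (\<kappa> - e0)" using n elim by auto
    also have "\<dots> \<le> (2 * t) powr (\<kappa> - e0)" using n(2) \<kappa>_gt_1 by (intro powr_mono2) (auto simp: e0_def)
    also have "\<dots> = 2 powr (\<kappa> - e0) * t powr (\<kappa> - e0)" by (rule powr_mult)
    also have "\<dots> \<le> t powr (e0 / 2) * t powr (\<kappa> - e0)" using elim by (intro mult_right_mono) auto
    also have "\<dots> = t powr (\<kappa> - e0 / 2)" by (simp add: powr_add[symmetric])
    finally show ?case .
  qed
qed

lemma S_growth:
  "AE w in M. \<forall>\<epsilon>>0. eventually (\<lambda>t. t powr (\<kappa> - \<epsilon>) \<le> S t w \<and> S t w \<le> t powr (\<kappa> + \<epsilon>)) at_top"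
  using A_growth NS_growth
proof eventually_elim
  case (elim w)
  show ?case
  proof (intro allI impI)
    fix \<epsilon> :: real assume e: "0 < \<epsilon>"
    \<comment> \<open>Being smaller than \<open>e0 / 2\<close>, it lets the lower bound
      \<open>t powr (\<kappa> - d)\<close> of \<open>A\<close> beat the bound
      \<open>t powr (\<kappa> - e0 / 2)\<close> of \<open>NS\<close>.\<close>
    define d where "d = min (\<epsilon> / 2) (e0 / 4)"
    have d: "0 < d" "d \<le> \<epsilon> / 2" "d < e0 / 2" using e e0_pos by (auto simp: d_def)
    have d1: "0 < \<epsilon> / 2" "0 < e0 / 2 - d" using d e by auto
    show "eventually (\<lambda>t. t powr (\<kappa> - \<epsilon>) \<le> S t w \<and> S t w \<le> t powr (\<kappa> + \<epsilon>)) at_top"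
      using elim(1)[rule_format, OF d(1)] elim(2) eventually_ge_at_top[of "max 1 s0"]
        eventually_powr_ge[OF d1(1), of 6] eventually_powr_ge[OF d1(2), of 2]
    proof eventually_elim
      case (elim t)
      have t: "1 \<le> t" "s0 \<le> t" using elim by auto
      have S: "S t w = s0 + t + 2 * A t w + 2 * NS t w" by (simp add: NS_def field_simps)
      let ?p = "t powr (\<kappa> + \<epsilon> / 2)"
      have "t powr 1 \<le> ?p" "t powr (\<kappa> + d) \<le> ?p" "t powr (\<kappa> - e0 / 2) \<le> ?p"
        by (rule powr_mono; use t \<kappa>_gt_1 e d e0_pos in linarith)+
      \<comment> \<open>6 = 1 + 1 + 2 + 2, for \<open>s0\<close>, \<open>t\<close>,
        \<open>2 * A\<close> and \<open>2 * NS\<close>.\<close>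
      then have "S t w \<le> 6 * ?p" using S elim t by auto
      also have "\<dots> \<le> t powr (\<epsilon> / 2) * ?p" using elim by (intro mult_right_mono) auto
      also have "\<dots> = t powr (\<kappa> + \<epsilon>)" by (simp add: powr_add[symmetric] add.commute)
      finally have U: "S t w \<le> t powr (\<kappa> + \<epsilon>)" .
      have "2 * t powr (\<kappa> - e0 / 2) \<le> t powr (e0 / 2 - d) * t powr (\<kappa> - e0 / 2)" using elim by (intro mult_right_mono) auto
      also have "\<dots> = t powr (\<kappa> - d)" by (simp add: powr_add[symmetric])
      finally have "2 * t powr (\<kappa> - e0 / 2) \<le> t powr (\<kappa> - d)" .
      then have "t powr (\<kappa> - d) \<le> S t w" using S elim s0 t by linarith
      moreover have "t powr (\<kappa> - \<epsilon>) \<le> t powr (\<kappa> - d)" using t d e by (intro powr_mono) auto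
      ultimately show ?case using U by linarith
    qed
  qed
qed

theorem log_growth: "AE w in M. ((\<lambda>t. ln (sqrt (S t w)) / ln t) \<longlongrightarrow> (1 + \<gamma> + \<alpha>) / 2) at_top"
  using S_growth
proof eventually_elim
  case (elim w)
  then show ?case unfolding \<kappa>_def[symmetric] by (intro ln_sqrt_limit) auto
qed

end

section \<open>Convergence of functionals of finite-dimensional distributions\<close>

text \<open>The Laplace functional of a path, for a list of pairs of a weight and a time. A list
  rather than a set, so that the Markov property can be applied by recursion.\<close>

definition eL :: "(real \<times> real) list \<Rightarrow> (real \<Rightarrow> real) \<Rightarrow> real" where
  "eL L w = exp (- (\<Sum>(l, u)\<leftarrow>L. l * w u))"

definition valid :: "(real \<times> real) list \<Rightarrow> bool" where
  "valid L \<longleftrightarrow> (\<forall>(l, u)\<in>set L. 0 \<le> l \<and> 0 \<le> u)"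

lemma eL_Nil [simp]: "eL [] w = 1" by (simp add: eL_def)

lemma eL_Cons: "eL ((l, u) # L) w = exp (- l * w u) * eL L w"
  by (simp add: eL_def exp_add[symmetric])

lemma valid_Nil [simp]: "valid []" by (simp add: valid_def)

lemma valid_Cons: "valid ((l, u) # L) \<longleftrightarrow> 0 \<le> l \<and> 0 \<le> u \<and> valid L" by (auto simp: valid_def)

lemma eL_bounds: "valid L \<Longrightarrow> (\<And>u. 0 \<le> u \<Longrightarrow> 0 \<le> w u) \<Longrightarrow> 0 < eL L w \<and> eL L w \<le> 1"
proof (induction L)
  case (Cons p L)
  obtain l u where p: "p = (l, u)" by force
  have v: "0 \<le> l" "0 \<le> u" "valid L" using Cons.prems(1) by (auto simp: p valid_Cons)
  have "0 \<le> l * w u" using v Cons.prems(2) by simp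
  then have "exp (- l * w u) \<le> 1" by simp
  then show ?case using Cons.IH[OF v(3) Cons.prems(2)] by (auto simp: p eL_Cons intro: mult_le_one)
qed simp

lemma eL_measurable:
  assumes "\<And>l u. (l, u) \<in> set L \<Longrightarrow> w u \<in> borel_measurable M"
  shows "(\<lambda>\<omega>. eL L (\<lambda>u. w u \<omega>)) \<in> borel_measurable M"
  using assms
proof (induction L)
  case (Cons p L)
  obtain l u where p: "p = (l, u)" by force
  have [measurable]: "w u \<in> borel_measurable M" "(\<lambda>\<omega>. eL L (\<lambda>u. w u \<omega>)) \<in> borel_measurable M"
    using Cons.prems[of l u] Cons.IH Cons.prems by (auto simp: p)
  show ?case unfolding p eL_Cons by measurable
qed simp

definition leb_on :: "real \<Rightarrow> real \<Rightarrow> real measure" where "leb_on a b = density lborel (indicator {a..b})"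

lemma leb_on_finite: "finite_measure (leb_on a b)"
proof
  have "emeasure (leb_on a b) (space (leb_on a b)) = emeasure lborel {a..b}"
    by (simp add: leb_on_def emeasure_density)
  then show "emeasure (leb_on a b) (space (leb_on a b)) \<noteq> \<infinity>" by (simp add: emeasure_lborel_Icc_eq)
qed

lemma sets_leb_on [measurable_cong]: "sets (leb_on a b) = sets borel" by (simp add: leb_on_def)

lemma AE_leb_on: "(\<And>u. u \<in> {a..b} \<Longrightarrow> Q u) \<Longrightarrow> AE u in leb_on a b. Q u"
  unfolding leb_on_def by (subst AE_density) (auto simp: indicator_def)

text \<open>A sequence of pairs (G n, G') is called good when G n converges to G' jointly in law with the
  finite-dimensional distributions of the non-negative processes U n and V, tested by Laplace functionals.\<close>

locale fdd_conv = A: prob_space M + B: prob_space P for M :: "'a measure" and P :: "'b measure" +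
  fixes U :: "nat \<Rightarrow> real \<Rightarrow> 'a \<Rightarrow> real" and V :: "real \<Rightarrow> 'b \<Rightarrow> real"
  assumes U_meas: "\<And>n u. 0 \<le> u \<Longrightarrow> U n u \<in> borel_measurable M" and V_meas: "\<And>u. 0 \<le> u \<Longrightarrow> V u \<in> borel_measurable P"
    and U_nonneg: "\<And>n u w. 0 \<le> u \<Longrightarrow> 0 \<le> U n u w" and V_nonneg: "\<And>u w. 0 \<le> u \<Longrightarrow> 0 \<le> V u w"
    and fdd: "\<And>L. valid L \<Longrightarrow> (\<lambda>n. \<integral>w. eL L (\<lambda>u. U n u w) \<partial>M) \<longlonglongrightarrow> (\<integral>w. eL L (\<lambda>u. V u w) \<partial>P)"
begin

definition good :: "(nat \<Rightarrow> 'a \<Rightarrow> real) \<Rightarrow> ('b \<Rightarrow> real) \<Rightarrow> bool" where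
  "good G G' \<longleftrightarrow> (\<forall>n. G n \<in> borel_measurable M) \<and> G' \<in> borel_measurable P \<and>
     (\<exists>C. (\<forall>n. \<forall>w\<in>space M. \<bar>G n w\<bar> \<le> C) \<and> (\<forall>w\<in>space P. \<bar>G' w\<bar> \<le> C)) \<and>
     (\<forall>L. valid L \<longrightarrow> (\<lambda>n. \<integral>w. G n w * eL L (\<lambda>u. U n u w) \<partial>M) \<longlonglongrightarrow> (\<integral>w. G' w * eL L (\<lambda>u. V u w) \<partial>P))"

lemma goodD:
  assumes "good G G'"
  shows "G n \<in> borel_measurable M" "G' \<in> borel_measurable P"
    "valid L \<Longrightarrow> (\<lambda>n. \<integral>w. G n w * eL L (\<lambda>u. U n u w) \<partial>M) \<longlonglongrightarrow> (\<integral>w. G' w * eL L (\<lambda>u. V u w) \<partial>P)"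
  using assms by (auto simp: good_def)

lemma good_bound:
  assumes "good G G'"
  obtains C where "0 \<le> C" "\<And>n w. w \<in> space M \<Longrightarrow> \<bar>G n w\<bar> \<le> C" "\<And>w. w \<in> space P \<Longrightarrow> \<bar>G' w\<bar> \<le> C"
proof -
  obtain C where C: "\<forall>n. \<forall>w\<in>space M. \<bar>G n w\<bar> \<le> C" "\<forall>w\<in>space P. \<bar>G' w\<bar> \<le> C"
    using assms by (auto simp: good_def)
  obtain w where "w \<in> space M" using A.not_empty by auto
  then have "0 \<le> C" using C(1) by (meson abs_ge_zero order_trans)
  then show ?thesis using that C by blast
qed

lemma UeL: 
  assumes "valid L" 
  shows "(\<lambda>w. eL L (\<lambda>u. U n u w)) \<in> borel_measurable M" "0 < eL L (\<lambda>u. U n u w)" "eL L (\<lambda>u. U n u w) \<le> 1"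
proof -
  have "0 \<le> u" if "(l, u) \<in> set L" for l u using assms that by (auto simp: valid_def)
  then show "(\<lambda>w. eL L (\<lambda>u. U n u w)) \<in> borel_measurable M" by (intro eL_measurable U_meas)
qed (use eL_bounds[OF assms, of "\<lambda>u. U n u w"] U_nonneg in auto)

lemma VeL: 
  assumes "valid L" 
  shows "(\<lambda>w. eL L (\<lambda>u. V u w)) \<in> borel_measurable P" "0 < eL L (\<lambda>u. V u w)" "eL L (\<lambda>u. V u w) \<le> 1"
proof -
  have "0 \<le> u" if "(l, u) \<in> set L" for l u using assms that by (auto simp: valid_def)
  then show "(\<lambda>w. eL L (\<lambda>u. V u w)) \<in> borel_measurable P" by (intro eL_measurable V_meas)
qed (use eL_bounds[OF assms, of "\<lambda>u. V u w"] V_nonneg in auto)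

lemma bounded_eL_integrable_M:
  assumes L: "valid L" and [measurable]: "g \<in> borel_measurable M" and b: "\<And>w. w \<in> space M \<Longrightarrow> \<bar>g w\<bar> \<le> C"
  shows "integrable M (\<lambda>w. g w * eL L (\<lambda>u. U n u w))" "\<bar>\<integral>w. g w * eL L (\<lambda>u. U n u w) \<partial>M\<bar> \<le> C"
proof -
  note [measurable] = UeL(1)[OF L, of n]
  have le: "\<bar>g w * eL L (\<lambda>u. U n u w)\<bar> \<le> C" if "w \<in> space M" for w
  proof -
    have "\<bar>g w\<bar> * eL L (\<lambda>u. U n u w) \<le> \<bar>g w\<bar> * 1" using UeL(3)[OF L] by (intro mult_left_mono) auto
    then show ?thesis using b[OF that] UeL(2)[OF L, of n w] by (simp add: abs_mult)
  qed
  show i: "integrable M (\<lambda>w. g w * eL L (\<lambda>u. U n u w))"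
    by (rule A.integrable_const_bound[where B=C]) (use le in auto)
  have "\<bar>\<integral>w. g w * eL L (\<lambda>u. U n u w) \<partial>M\<bar> \<le> (\<integral>w. \<bar>g w * eL L (\<lambda>u. U n u w)\<bar> \<partial>M)" by (rule integral_abs_bound)
  also have "\<dots> \<le> C" using i le by (intro A.integral_le_const) auto
  finally show "\<bar>\<integral>w. g w * eL L (\<lambda>u. U n u w) \<partial>M\<bar> \<le> C" .
qed

lemma bounded_eL_integrable_P:
  assumes L: "valid L" and [measurable]: "g \<in> borel_measurable P" and b: "\<And>w. w \<in> space P \<Longrightarrow> \<bar>g w\<bar> \<le> C"
  shows "integrable P (\<lambda>w. g w * eL L (\<lambda>u. V u w))" "\<bar>\<integral>w. g w * eL L (\<lambda>u. V u w) \<partial>P\<bar> \<le> C"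
proof -
  note [measurable] = VeL(1)[OF L]
  have le: "\<bar>g w * eL L (\<lambda>u. V u w)\<bar> \<le> C" if "w \<in> space P" for w
  proof -
    have "\<bar>g w\<bar> * eL L (\<lambda>u. V u w) \<le> \<bar>g w\<bar> * 1" using VeL(3)[OF L] by (intro mult_left_mono) auto
    then show ?thesis using b[OF that] VeL(2)[OF L, of w] by (simp add: abs_mult)
  qed
  show i: "integrable P (\<lambda>w. g w * eL L (\<lambda>u. V u w))"
    by (rule B.integrable_const_bound[where B=C]) (use le in auto)
  have "\<bar>\<integral>w. g w * eL L (\<lambda>u. V u w) \<partial>P\<bar> \<le> (\<integral>w. \<bar>g w * eL L (\<lambda>u. V u w)\<bar> \<partial>P)" by (rule integral_abs_bound)
  also have "\<dots> \<le> C" using i le by (intro B.integral_le_const) auto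
  finally show "\<bar>\<integral>w. g w * eL L (\<lambda>u. V u w) \<partial>P\<bar> \<le> C" .
qed

lemma good_one: "good (\<lambda>n w. 1) (\<lambda>w. 1)"
  unfolding good_def using fdd by (auto intro!: exI[of _ 1])

lemma good_exp:
  assumes G: "good G G'" and l: "0 \<le> l" "0 \<le> u"
  shows "good (\<lambda>n w. G n w * exp (- l * U n u w)) (\<lambda>w. G' w * exp (- l * V u w))"
proof -
  obtain C where C: "0 \<le> C" "\<And>n w. w \<in> space M \<Longrightarrow> \<bar>G n w\<bar> \<le> C" "\<And>w. w \<in> space P \<Longrightarrow> \<bar>G' w\<bar> \<le> C"
    using good_bound[OF G] by blast
  have e: "\<bar>x * exp (- l * v)\<bar> \<le> C" if "\<bar>x\<bar> \<le> C" "0 \<le> v" for x v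
  proof -
    have "exp (- l * v) \<le> 1" using l that by simp
    then have "\<bar>x\<bar> * exp (- l * v) \<le> C * 1" using that C(1) by (intro mult_mono) auto
    then show ?thesis by (simp add: abs_mult)
  qed
  have [measurable]: "U n u \<in> borel_measurable M" "V u \<in> borel_measurable P" "G n \<in> borel_measurable M" "G' \<in> borel_measurable P" for n
    using U_meas V_meas goodD(1,2)[OF G] l by auto
  show ?thesis unfolding good_def
  proof (intro conjI allI impI exI[of _ C] ballI)
    show "\<bar>G n w * exp (- l * U n u w)\<bar> \<le> C" if "w \<in> space M" for n w using e[OF C(2)[OF that] U_nonneg[OF l(2)]] .
    show "\<bar>G' w * exp (- l * V u w)\<bar> \<le> C" if "w \<in> space P" for w using e[OF C(3)[OF that] V_nonneg[OF l(2)]] .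
    fix L assume "valid L"
    then have "valid ((l, u) # L)" using l by (simp add: valid_Cons)
    from goodD(3)[OF G this] show "(\<lambda>n. \<integral>w. G n w * exp (- l * U n u w) * eL L (\<lambda>u. U n u w) \<partial>M) \<longlonglongrightarrow> (\<integral>w. G' w * exp (- l * V u w) * eL L (\<lambda>u. V u w) \<partial>P)"
      by (simp add: eL_Cons mult.assoc)
  qed measurable
qed

lemma good_add:
  assumes G: "good G G'" and H: "good H H'"
  shows "good (\<lambda>n w. G n w + H n w) (\<lambda>w. G' w + H' w)"
proof -
  obtain C where C: "0 \<le> C" "\<And>n w. w \<in> space M \<Longrightarrow> \<bar>G n w\<bar> \<le> C" "\<And>w. w \<in> space P \<Longrightarrow> \<bar>G' w\<bar> \<le> C"
    using good_bound[OF G] by blast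
  obtain D where D: "0 \<le> D" "\<And>n w. w \<in> space M \<Longrightarrow> \<bar>H n w\<bar> \<le> D" "\<And>w. w \<in> space P \<Longrightarrow> \<bar>H' w\<bar> \<le> D"
    using good_bound[OF H] by blast
  note m = goodD(1,2)[OF G] goodD(1,2)[OF H]
  show ?thesis unfolding good_def
  proof (intro conjI allI impI exI[of _ "C + D"] ballI)
    show "\<bar>G n w + H n w\<bar> \<le> C + D" if "w \<in> space M" for n w using C(2)[OF that, of n] D(2)[OF that, of n] by linarith
    show "\<bar>G' w + H' w\<bar> \<le> C + D" if "w \<in> space P" for w using C(3)[OF that] D(3)[OF that] by linarith
    fix L assume L: "valid L"
    have "(\<lambda>n. (\<integral>w. G n w * eL L (\<lambda>u. U n u w) \<partial>M) + (\<integral>w. H n w * eL L (\<lambda>u. U n u w) \<partial>M))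
       \<longlonglongrightarrow> (\<integral>w. G' w * eL L (\<lambda>u. V u w) \<partial>P) + (\<integral>w. H' w * eL L (\<lambda>u. V u w) \<partial>P)"
      by (intro tendsto_add goodD(3)[OF G L] goodD(3)[OF H L])
    moreover have "(\<integral>w. G n w * eL L (\<lambda>u. U n u w) \<partial>M) + (\<integral>w. H n w * eL L (\<lambda>u. U n u w) \<partial>M) = (\<integral>w. (G n w + H n w) * eL L (\<lambda>u. U n u w) \<partial>M)" for n
      unfolding distrib_right
      by (rule Bochner_Integration.integral_add[symmetric]; rule bounded_eL_integrable_M(1)[OF L]; use m C D in blast)
    moreover have "(\<integral>w. G' w * eL L (\<lambda>u. V u w) \<partial>P) + (\<integral>w. H' w * eL L (\<lambda>u. V u w) \<partial>P) = (\<integral>w. (G' w + H' w) * eL L (\<lambda>u. V u w) \<partial>P)"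
      unfolding distrib_right
      by (rule Bochner_Integration.integral_add[symmetric]; rule bounded_eL_integrable_P(1)[OF L]; use m C D in blast)
    ultimately show "(\<lambda>n. \<integral>w. (G n w + H n w) * eL L (\<lambda>u. U n u w) \<partial>M) \<longlonglongrightarrow> (\<integral>w. (G' w + H' w) * eL L (\<lambda>u. V u w) \<partial>P)"
      by simp
  qed (use m in \<open>auto intro: borel_measurable_add\<close>)
qed

lemma good_cmult:
  assumes G: "good G G'" shows "good (\<lambda>n w. c * G n w) (\<lambda>w. c * G' w)"
proof -
  obtain C where C: "0 \<le> C" "\<And>n w. w \<in> space M \<Longrightarrow> \<bar>G n w\<bar> \<le> C" "\<And>w. w \<in> space P \<Longrightarrow> \<bar>G' w\<bar> \<le> C"
    using good_bound[OF G] by blast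
  note m = goodD(1,2)[OF G]
  show ?thesis unfolding good_def
  proof (intro conjI allI impI exI[of _ "\<bar>c\<bar> * C"] ballI)
    show "\<bar>c * G n w\<bar> \<le> \<bar>c\<bar> * C" if "w \<in> space M" for n w using C(2)[OF that, of n] by (simp add: abs_mult mult_left_mono)
    show "\<bar>c * G' w\<bar> \<le> \<bar>c\<bar> * C" if "w \<in> space P" for w using C(3)[OF that] by (simp add: abs_mult mult_left_mono)
    fix L assume L: "valid L"
    show "(\<lambda>n. \<integral>w. c * G n w * eL L (\<lambda>u. U n u w) \<partial>M) \<longlonglongrightarrow> (\<integral>w. c * G' w * eL L (\<lambda>u. V u w) \<partial>P)"
      using tendsto_mult[OF tendsto_const goodD(3)[OF G L], of c] by (simp add: mult.assoc)
  qed (use m in auto)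
qed

text \<open>As \<open>eL\<close> is at most 1, a uniform error in \<open>G n\<close> changes each
  tested integral by no more than that error.\<close>

lemma good_limit:
  assumes m: "\<And>n. G n \<in> borel_measurable M" "G' \<in> borel_measurable P"
    and b: "\<And>n w. w \<in> space M \<Longrightarrow> \<bar>G n w\<bar> \<le> C" "\<And>w. w \<in> space P \<Longrightarrow> \<bar>G' w\<bar> \<le> C"
    and app: "\<And>\<epsilon>. 0 < \<epsilon> \<Longrightarrow> \<exists>H H'. good H H' \<and> eventually (\<lambda>n. \<forall>w\<in>space M. \<bar>G n w - H n w\<bar> \<le> \<epsilon>) sequentially \<and> (\<forall>w\<in>space P. \<bar>G' w - H' w\<bar> \<le> \<epsilon>)"
  shows "good G G'"
  unfolding good_def
proof (intro conjI allI impI exI[of _ C] ballI)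
  fix L assume L: "valid L"
  let ?I = "\<lambda>G n. \<integral>w. G n w * eL L (\<lambda>u. U n u w) \<partial>M" and ?J = "\<lambda>G'. \<integral>w. G' w * eL L (\<lambda>u. V u w) \<partial>P"
  show "?I G \<longlonglongrightarrow> ?J G'"
  proof (rule tendstoI)
    fix e :: real assume e: "e > 0"
    then have "0 < e / 4" by simp
    from app[OF this] obtain H H' where H: "good H H'"
      and H1: "eventually (\<lambda>n. \<forall>w\<in>space M. \<bar>G n w - H n w\<bar> \<le> e / 4) sequentially"
      and H2: "\<forall>w\<in>space P. \<bar>G' w - H' w\<bar> \<le> e / 4" by (elim exE conjE)
    obtain D where D0: "0 \<le> D" and D: "\<And>n w. w \<in> space M \<Longrightarrow> \<bar>H n w\<bar> \<le> D" "\<And>w. w \<in> space P \<Longrightarrow> \<bar>H' w\<bar> \<le> D"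
      using good_bound[OF H] by blast
    note mH = goodD(1,2)[OF H]
    have P: "\<bar>?J G' - ?J H'\<bar> \<le> e / 4"
    proof -
      have "?J G' - ?J H' = (\<integral>w. (G' w - H' w) * eL L (\<lambda>u. V u w) \<partial>P)"
        unfolding left_diff_distrib
        by (rule Bochner_Integration.integral_diff[symmetric]; rule bounded_eL_integrable_P(1)[OF L]; use m b mH D in blast)
      also have "\<bar>\<dots>\<bar> \<le> e / 4" using m mH H2 by (intro bounded_eL_integrable_P(2)[OF L]) auto
      finally show ?thesis .
    qed
    have "eventually (\<lambda>n. dist (?I H n) (?J H') < e / 4) sequentially"
      using goodD(3)[OF H L] \<open>0 < e / 4\<close> by (rule tendstoD)
    then show "eventually (\<lambda>n. dist (?I G n) (?J G') < e) sequentially"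
      using H1
    proof eventually_elim
      case (elim n)
      have "?I G n - ?I H n = (\<integral>w. (G n w - H n w) * eL L (\<lambda>u. U n u w) \<partial>M)"
        unfolding left_diff_distrib
        by (rule Bochner_Integration.integral_diff[symmetric]; rule bounded_eL_integrable_M(1)[OF L]; use m b mH D in blast)
      also have "\<bar>\<dots>\<bar> \<le> e / 4" using m mH elim(2) by (intro bounded_eL_integrable_M(2)[OF L]) auto
      finally have "\<bar>?I G n - ?I H n\<bar> \<le> e / 4" .
      then show ?case using P elim(1) e unfolding dist_real_def by linarith
    qed
  qed
qed (use m b in auto)

text \<open>The hypothesis \<open>step\<close> is about all good pairs, not one, so it can be
  iterated to reach the powers of \<open>I\<close>.\<close>

lemma good_poly:
  assumes p: "real_polynomial_function (p :: real \<Rightarrow> real)"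
    and step: "\<And>G G'. good G G' \<Longrightarrow> good (\<lambda>n w. G n w * I n w) (\<lambda>w. G' w * I' w)"
  shows "good G G' \<Longrightarrow> good (\<lambda>n w. G n w * p (I n w)) (\<lambda>w. G' w * p (I' w))"
  using p
proof (induction arbitrary: G G' rule: real_polynomial_function.induct)
  case (linear f)
  have f: "f x = f 1 * x" for x
    using real_bounded_linear[of f] linear.hyps by auto
  show ?case using good_cmult[OF step[OF linear.prems], of "f 1"] by (subst (1 2) f) (simp add: mult_ac)
next
  case (const c)
  show ?case using good_cmult[OF const.prems, of c] by (simp add: mult.commute)
next
  case (add f g)
  show ?case unfolding distrib_left by (rule good_add[OF add.IH(1)[OF add.prems] add.IH(2)[OF add.prems]])
next
  case (mult f g)
  show ?case unfolding mult.assoc[symmetric] by (rule mult.IH(2)[OF mult.IH(1)[OF mult.prems]])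
qed

text \<open>Polynomials in I approximate continuous functions of I uniformly when I is bounded.\<close>

lemma good_continuous:
  assumes G: "good G G'"
    and step: "\<And>G G'. good G G' \<Longrightarrow> good (\<lambda>n w. G n w * I n w) (\<lambda>w. G' w * I' w)"
    and Ib: "\<And>n w. w \<in> space M \<Longrightarrow> I n w \<in> {a..b}" "\<And>w. w \<in> space P \<Longrightarrow> I' w \<in> {a..b}"
    and q: "continuous_on UNIV (q :: real \<Rightarrow> real)"
  shows "good (\<lambda>n w. G n w * q (I n w)) (\<lambda>w. G' w * q (I' w))"
proof -
  obtain C where C: "0 \<le> C" "\<And>n w. w \<in> space M \<Longrightarrow> \<bar>G n w\<bar> \<le> C" "\<And>w. w \<in> space P \<Longrightarrow> \<bar>G' w\<bar> \<le> C"
    using good_bound[OF G] by blast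
  have cq: "continuous_on {a..b} q" using q by (rule continuous_on_subset) simp
  then have "compact (q ` {a..b})" by (intro compact_continuous_image) auto
  then obtain D where D: "\<And>x. x \<in> {a..b} \<Longrightarrow> \<bar>q x\<bar> \<le> D"
    using compact_imp_bounded bounded_iff by (metis imageI real_norm_def)
  have [measurable]: "q \<in> borel_measurable borel" using q by (rule borel_measurable_continuous_onI)
  note G1 = step[OF good_one]
  have [measurable]: "I n \<in> borel_measurable M" "I' \<in> borel_measurable P" for n
    using goodD(1,2)[OF G1] by auto
  have [measurable]: "G n \<in> borel_measurable M" "G' \<in> borel_measurable P" for n using goodD(1,2)[OF G] by auto
  show ?thesis
  proof (rule good_limit[where C="C * D"])
    show "\<bar>G n w * q (I n w)\<bar> \<le> C * D" if "w \<in> space M" for n w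
      unfolding abs_mult using C(1) C(2)[OF that] D[OF Ib(1)[OF that]] by (intro mult_mono) auto
    show "\<bar>G' w * q (I' w)\<bar> \<le> C * D" if "w \<in> space P" for w
      unfolding abs_mult using C(1) C(3)[OF that] D[OF Ib(2)[OF that]] by (intro mult_mono) auto
    fix \<epsilon> :: real assume e: "0 < \<epsilon>"
    define e' where "e' = \<epsilon> / (C + 1)"
    have e': "0 < e'" "C * e' \<le> \<epsilon>" using e C(1) by (auto simp: e'_def field_simps)
    obtain p where p: "real_polynomial_function p" "\<And>x. x \<in> {a..b} \<Longrightarrow> \<bar>q x - p x\<bar> < e'"
      using Stone_Weierstrass_real_polynomial_function[OF compact_Icc cq e'(1)] by blast
    have d: "\<bar>x * q y - x * p y\<bar> \<le> \<epsilon>" if "\<bar>x\<bar> \<le> C" "y \<in> {a..b}" for x y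
    proof -
      have "\<bar>x * q y - x * p y\<bar> = \<bar>x\<bar> * \<bar>q y - p y\<bar>" by (simp add: right_diff_distrib[symmetric] abs_mult)
      also have "\<dots> \<le> C * e'" using that p(2)[OF that(2)] C(1) by (intro mult_mono) auto
      finally show ?thesis using e' by linarith
    qed
    show "\<exists>H H'. good H H' \<and> eventually (\<lambda>n. \<forall>w\<in>space M. \<bar>G n w * q (I n w) - H n w\<bar> \<le> \<epsilon>) sequentially \<and> (\<forall>w\<in>space P. \<bar>G' w * q (I' w) - H' w\<bar> \<le> \<epsilon>)"
    proof (intro exI conjI)
      show "good (\<lambda>n w. G n w * p (I n w)) (\<lambda>w. G' w * p (I' w))" by (rule good_poly[OF p(1) step G])
    qed (use d C Ib in auto)
  qed measurable
qed

text \<open>A function of the capped value is a continuous function \<open>q\<close> of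
  \<open>exp (- U)\<close>, which lies in \<open>{0..1}\<close>, and powers of
  \<open>exp (- U)\<close> are Laplace functionals again. So polynomial approximation needs nothing
  but \<open>good_exp\<close>.\<close>

lemma good_mult_capped:
  assumes G: "good G G'" and u: "0 \<le> u" and g: "continuous_on UNIV (g :: real \<Rightarrow> real)" and K: "0 \<le> K"
  shows "good (\<lambda>n w. G n w * g (min (U n u w) K)) (\<lambda>w. G' w * g (min (V u w) K))"
proof -
  \<comment> \<open>The cap on the value is a floor \<open>exp (- K)\<close> under its exponential,
    which keeps the logarithm continuous down to 0.\<close>
  define q where "q v = g (- ln (max v (exp (- K))))" for v
  have pos: "0 < max v (exp (- K))" for v by (simp add: less_max_iff_disj)
  have "continuous_on UNIV (\<lambda>v. - ln (max v (exp (- K))))"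
    using pos by (intro continuous_intros) (auto simp: less_imp_neq[symmetric])
  then have cq: "continuous_on UNIV q"
    unfolding q_def by (rule continuous_on_compose2[OF g]) simp
  have qe: "q (exp (- 1 * x)) = g (min x K)" for x
  proof -
    have "max (exp (- x)) (exp (- K)) = exp (- min x K)" by (simp add: max_def min_def)
    then show ?thesis by (simp add: q_def)
  qed
  have e01: "exp (- 1 * x) \<in> {0..1}" if "0 \<le> x" for x :: real using that by simp
  have "good (\<lambda>n w. G n w * q (exp (- 1 * U n u w))) (\<lambda>w. G' w * q (exp (- 1 * V u w)))"
  proof (rule good_continuous[OF G _ _ _ cq])
    show "good (\<lambda>n w. G n w * exp (- 1 * U n u w)) (\<lambda>w. G' w * exp (- 1 * V u w))" if "good G G'" for G G'
      using good_exp[OF that, of 1 u] u by simp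
    show "exp (- 1 * U n u w) \<in> {0..1}" for n w by (rule e01[OF U_nonneg[OF u]])
    show "exp (- 1 * V u w) \<in> {0..1}" for w by (rule e01[OF V_nonneg[OF u]])
  qed
  then show ?thesis unfolding qe .
qed

text \<open>Fubini moves the time integral to the outside. There convergence at each fixed
  \<open>u\<close> and the uniform bound suffice, and no joint control over different times is
  called for. The result is good again, so powers of the integral follow by iteration.\<close>

lemma good_integral:
  fixes \<xi> :: "nat \<Rightarrow> real \<Rightarrow> 'a \<Rightarrow> real" and \<xi>' :: "real \<Rightarrow> 'b \<Rightarrow> real"
  assumes G: "good G G'"
    and m[measurable]: "\<And>n. (\<lambda>(w, u). \<xi> n u w) \<in> borel_measurable (M \<Otimes>\<^sub>M borel)" "(\<lambda>(w, u). \<xi>' u w) \<in> borel_measurable (P \<Otimes>\<^sub>M borel)"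
    and b: "\<And>n u w. w \<in> space M \<Longrightarrow> \<bar>\<xi> n u w\<bar> \<le> D" "\<And>u w. w \<in> space P \<Longrightarrow> \<bar>\<xi>' u w\<bar> \<le> D"
    and step: "\<And>u. u \<in> {a..b} \<Longrightarrow> good (\<lambda>n w. G n w * \<xi> n u w) (\<lambda>w. G' w * \<xi>' u w)"
  shows "good (\<lambda>n w. G n w * (\<integral>u. \<xi> n u w \<partial>leb_on a b)) (\<lambda>w. G' w * (\<integral>u. \<xi>' u w \<partial>leb_on a b))"
proof -
  interpret nu: finite_measure "leb_on a b" by (rule leb_on_finite)
  interpret MN: pair_sigma_finite M "leb_on a b" ..
  interpret PN: pair_sigma_finite P "leb_on a b" ..
  interpret MNf: finite_measure "M \<Otimes>\<^sub>M leb_on a b" by (intro finite_measure_pair_measure leb_on_finite A.finite_measure_axioms)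
  interpret PNf: finite_measure "P \<Otimes>\<^sub>M leb_on a b" by (intro finite_measure_pair_measure leb_on_finite B.finite_measure_axioms)
  obtain C where C: "0 \<le> C" "\<And>n w. w \<in> space M \<Longrightarrow> \<bar>G n w\<bar> \<le> C" "\<And>w. w \<in> space P \<Longrightarrow> \<bar>G' w\<bar> \<le> C"
    using good_bound[OF G] by blast
  have [measurable]: "G n \<in> borel_measurable M" "G' \<in> borel_measurable P" for n using goodD(1,2)[OF G] by auto
  have mM[measurable]: "(\<lambda>(w, u). \<xi> n u w) \<in> borel_measurable (M \<Otimes>\<^sub>M leb_on a b)" for n
    using m(1) unfolding measurable_cong_sets[OF sets_pair_measure_cong[OF refl sets_leb_on] refl] .
  have mP[measurable]: "(\<lambda>(w, u). \<xi>' u w) \<in> borel_measurable (P \<Otimes>\<^sub>M leb_on a b)"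
    using m(2) unfolding measurable_cong_sets[OF sets_pair_measure_cong[OF refl sets_leb_on] refl] .
  have mI[measurable]: "(\<lambda>w. \<integral>u. \<xi> n u w \<partial>leb_on a b) \<in> borel_measurable M" for n
    using nu.borel_measurable_lebesgue_integral[OF mM] .
  have mI'[measurable]: "(\<lambda>w. \<integral>u. \<xi>' u w \<partial>leb_on a b) \<in> borel_measurable P"
    using nu.borel_measurable_lebesgue_integral[OF mP] .
  define T where "T = measure (leb_on a b) (space (leb_on a b))"
  have T: "0 \<le> T" by (simp add: T_def)
  obtain w0 where "w0 \<in> space M" using A.not_empty by auto
  then have D0: "0 \<le> D" using b(1)[of w0 0 0] by linarith
  have secM: "(\<lambda>u. \<xi> n u w) \<in> borel_measurable (leb_on a b)" if "w \<in> space M" for n w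
    using measurable_compose[OF measurable_Pair1'[OF that] mM] by simp
  have secP: "(\<lambda>u. \<xi>' u w) \<in> borel_measurable (leb_on a b)" if "w \<in> space P" for w
    using measurable_compose[OF measurable_Pair1'[OF that] mP] by simp
  have Ib: "\<bar>\<integral>u. h u \<partial>leb_on a b\<bar> \<le> D * T" if h: "h \<in> borel_measurable (leb_on a b)" "\<And>u. \<bar>h u\<bar> \<le> D" for h
  proof -
    have "\<bar>\<integral>u. h u \<partial>leb_on a b\<bar> \<le> (\<integral>u. \<bar>h u\<bar> \<partial>leb_on a b)" by (rule integral_abs_bound)
    also have "\<dots> \<le> (\<integral>u. D \<partial>leb_on a b)"
      using h D0 by (intro integral_mono nu.integrable_const_bound[where B=D]) auto
    also have "\<dots> = D * T" by (simp add: T_def mult.commute)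
    finally show ?thesis .
  qed
  show ?thesis unfolding good_def
  proof (intro conjI allI impI exI[of _ "C * (D * T)"] ballI)
    show "\<bar>G n w * (\<integral>u. \<xi> n u w \<partial>leb_on a b)\<bar> \<le> C * (D * T)" if "w \<in> space M" for n w
      unfolding abs_mult using C(1) C(2)[OF that] Ib[OF secM[OF that] b(1)[OF that]] by (intro mult_mono) auto
    show "\<bar>G' w * (\<integral>u. \<xi>' u w \<partial>leb_on a b)\<bar> \<le> C * (D * T)" if "w \<in> space P" for w
      unfolding abs_mult using C(1) C(3)[OF that] Ib[OF secP[OF that] b(2)[OF that]] by (intro mult_mono) auto
    fix L assume L: "valid L"
    note mE = UeL(1)[OF L] VeL(1)[OF L]
    have mG: "G n \<in> borel_measurable M" "G' \<in> borel_measurable P" for n using goodD(1,2)[OF G] by auto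
    have sw: "(\<lambda>p. (snd p, fst p)) \<in> measurable (leb_on a b \<Otimes>\<^sub>M M) (M \<Otimes>\<^sub>M leb_on a b)"
      "(\<lambda>p. (snd p, fst p)) \<in> measurable (leb_on a b \<Otimes>\<^sub>M P) (P \<Otimes>\<^sub>M leb_on a b)"
      by (intro measurable_Pair measurable_snd measurable_fst)+
    have eq: "(\<integral>w. G n w * (\<integral>u. \<xi> n u w \<partial>leb_on a b) * eL L (\<lambda>u. U n u w) \<partial>M) =
       (\<integral>u. (\<integral>w. G n w * \<xi> n u w * eL L (\<lambda>u. U n u w) \<partial>M) \<partial>leb_on a b)" for n
    proof -
      have "(\<lambda>p. G n (fst p) * (\<lambda>(w, u). \<xi> n u w) p * eL L (\<lambda>u. U n u (fst p))) \<in> borel_measurable (M \<Otimes>\<^sub>M leb_on a b)"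
        by (rule borel_measurable_times[OF borel_measurable_times[OF measurable_compose[OF measurable_fst mG(1)] mM] measurable_compose[OF measurable_fst mE(1)]])
      then have mm: "(\<lambda>(w, u). G n w * \<xi> n u w * eL L (\<lambda>u. U n u w)) \<in> borel_measurable (M \<Otimes>\<^sub>M leb_on a b)"
        by (simp add: case_prod_beta')
      have "integrable (M \<Otimes>\<^sub>M leb_on a b) (\<lambda>(w, u). G n w * \<xi> n u w * eL L (\<lambda>u. U n u w))"
      proof (rule MNf.integrable_const_bound[OF AE_I2 mm, where B="C * D"])
        fix p assume "p \<in> space (M \<Otimes>\<^sub>M leb_on a b)"
        then have w: "fst p \<in> space M" by (auto simp: space_pair_measure)
        have "\<bar>G n (fst p) * \<xi> n (snd p) (fst p)\<bar> * eL L (\<lambda>u. U n u (fst p)) \<le> (C * D) * 1"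
          unfolding abs_mult using C(1) C(2)[OF w] b(1)[OF w] UeL(2,3)[OF L, of n "fst p"] D0 
          by (intro mult_mono) (auto intro: less_imp_le)
        then show "norm (case p of (w, u) \<Rightarrow> G n w * \<xi> n u w * eL L (\<lambda>u. U n u w)) \<le> C * D"
          using UeL(2)[OF L, of n "fst p"] by (simp add: case_prod_beta' abs_mult)
      qed
      from MN.Fubini_integral[OF this] show ?thesis by (simp add: mult_ac)
    qed
    have eq': "(\<integral>w. G' w * (\<integral>u. \<xi>' u w \<partial>leb_on a b) * eL L (\<lambda>u. V u w) \<partial>P) =
       (\<integral>u. (\<integral>w. G' w * \<xi>' u w * eL L (\<lambda>u. V u w) \<partial>P) \<partial>leb_on a b)"
    proof -
      have "(\<lambda>p. G' (fst p) * (\<lambda>(w, u). \<xi>' u w) p * eL L (\<lambda>u. V u (fst p))) \<in> borel_measurable (P \<Otimes>\<^sub>M leb_on a b)"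
        by (rule borel_measurable_times[OF borel_measurable_times[OF measurable_compose[OF measurable_fst mG(2)] mP] measurable_compose[OF measurable_fst mE(2)]])
      then have mm: "(\<lambda>(w, u). G' w * \<xi>' u w * eL L (\<lambda>u. V u w)) \<in> borel_measurable (P \<Otimes>\<^sub>M leb_on a b)"
        by (simp add: case_prod_beta')
      have "integrable (P \<Otimes>\<^sub>M leb_on a b) (\<lambda>(w, u). G' w * \<xi>' u w * eL L (\<lambda>u. V u w))"
      proof (rule PNf.integrable_const_bound[OF AE_I2 mm, where B="C * D"])
        fix p assume "p \<in> space (P \<Otimes>\<^sub>M leb_on a b)"
        then have w: "fst p \<in> space P" by (auto simp: space_pair_measure)
        have "\<bar>G' (fst p) * \<xi>' (snd p) (fst p)\<bar> * eL L (\<lambda>u. V u (fst p)) \<le> (C * D) * 1"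
          unfolding abs_mult using C(1) C(3)[OF w] b(2)[OF w] VeL(2,3)[OF L, of "fst p"] D0
          by (intro mult_mono) (auto intro: less_imp_le)
        then show "norm (case p of (w, u) \<Rightarrow> G' w * \<xi>' u w * eL L (\<lambda>u. V u w)) \<le> C * D"
          using VeL(2)[OF L, of "fst p"] by (simp add: case_prod_beta' abs_mult)
      qed
      from PN.Fubini_integral[OF this] show ?thesis by (simp add: mult_ac)
    qed
    show "(\<lambda>n. \<integral>w. G n w * (\<integral>u. \<xi> n u w \<partial>leb_on a b) * eL L (\<lambda>u. U n u w) \<partial>M) \<longlonglongrightarrow> (\<integral>w. G' w * (\<integral>u. \<xi>' u w \<partial>leb_on a b) * eL L (\<lambda>u. V u w) \<partial>P)"
      unfolding eq eq'
    proof (rule integral_dominated_convergence[where w="\<lambda>_. C * D"])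
      show "AE u in leb_on a b. (\<lambda>n. \<integral>w. G n w * \<xi> n u w * eL L (\<lambda>u. U n u w) \<partial>M) \<longlonglongrightarrow> (\<integral>w. G' w * \<xi>' u w * eL L (\<lambda>u. V u w) \<partial>P)"
        by (rule AE_leb_on) (rule goodD(3)[OF step L])
      have sM: "(\<lambda>w. \<xi> n u w) \<in> borel_measurable M" for n u
        using measurable_compose[OF measurable_Pair2' m(1), of u] by simp
      show "AE u in leb_on a b. norm (\<integral>w. G n w * \<xi> n u w * eL L (\<lambda>u. U n u w) \<partial>M) \<le> C * D" for n
      proof (rule AE_I2)
        fix u
        have "\<bar>G n w * \<xi> n u w\<bar> \<le> C * D" if "w \<in> space M" for w
          unfolding abs_mult using C(1) C(2)[OF that] b(1)[OF that] by (intro mult_mono) auto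
        then show "norm (\<integral>w. G n w * \<xi> n u w * eL L (\<lambda>u. U n u w) \<partial>M) \<le> C * D"
          unfolding real_norm_def using sM by (intro bounded_eL_integrable_M(2)[OF L]) auto
      qed
      have "(\<lambda>p. G n (snd p) * (\<lambda>(w, u). \<xi> n u w) (snd p, fst p) * eL L (\<lambda>u. U n u (snd p))) \<in> borel_measurable (leb_on a b \<Otimes>\<^sub>M M)" for n
        by (rule borel_measurable_times[OF borel_measurable_times[OF measurable_compose[OF measurable_snd mG(1)] measurable_compose[OF sw(1) mM]] measurable_compose[OF measurable_snd mE(1)]])
      then have "(\<lambda>(u, w). G n w * \<xi> n u w * eL L (\<lambda>u. U n u w)) \<in> borel_measurable (leb_on a b \<Otimes>\<^sub>M M)" for n
        by (simp add: case_prod_beta')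
      then show "(\<lambda>u. \<integral>w. G n w * \<xi> n u w * eL L (\<lambda>u. U n u w) \<partial>M) \<in> borel_measurable (leb_on a b)" for n
        by (rule A.borel_measurable_lebesgue_integral)
      have "(\<lambda>p. G' (snd p) * (\<lambda>(w, u). \<xi>' u w) (snd p, fst p) * eL L (\<lambda>u. V u (snd p))) \<in> borel_measurable (leb_on a b \<Otimes>\<^sub>M P)"
        by (rule borel_measurable_times[OF borel_measurable_times[OF measurable_compose[OF measurable_snd mG(2)] measurable_compose[OF sw(2) mP]] measurable_compose[OF measurable_snd mE(2)]])
      then have "(\<lambda>(u, w). G' w * \<xi>' u w * eL L (\<lambda>u. V u w)) \<in> borel_measurable (leb_on a b \<Otimes>\<^sub>M P)"
        by (simp add: case_prod_beta')
      then show "(\<lambda>u. \<integral>w. G' w * \<xi>' u w * eL L (\<lambda>u. V u w) \<partial>P) \<in> borel_measurable (leb_on a b)"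
        by (rule B.borel_measurable_lebesgue_integral)
    qed simp
  qed (use mI mI' goodD(1,2)[OF G] in \<open>auto intro: borel_measurable_times\<close>)
qed

end

text \<open>The joint Laplace transform of \<open>BESQ\<close> at the times in the list, ordered decreasingly: the Markov property
  moves the weight of the latest time to the preceding one.\<close>

fun LT :: "real \<Rightarrow> real \<Rightarrow> (real \<times> real) list \<Rightarrow> real" where
  "LT \<delta> y [] = 1"
| "LT \<delta> y [(l, u)] = (1 + 2 * l * u) powr (- \<delta> / 2) * exp (- (l / (1 + 2 * l * u)) * y)"
| "LT \<delta> y ((l, u) # (m, v) # L) =
    (1 + 2 * l * (u - v)) powr (- \<delta> / 2) * LT \<delta> y ((m + l / (1 + 2 * l * (u - v)), v) # L)"

definition scale :: "real \<Rightarrow> (real \<times> real) list \<Rightarrow> (real \<times> real) list" where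
  "scale t L = map (\<lambda>(l, u). (l / t, t * u)) L"

text \<open>Brownian scaling: the recursion only meets products of a weight with a time difference,
  which \<open>scale\<close> preserves. The initial value appears in the innermost factor alone, as
  \<open>y / t\<close>, which tends to 0.\<close>

lemma LT_scale_tendsto:
  assumes tn: "filterlim tn at_top sequentially"
  shows "(\<lambda>n. LT \<delta> y (scale (tn n) L)) \<longlonglongrightarrow> LT \<delta> 0 L"
proof (induction \<delta> "0 :: real" L rule: LT.induct)
  case (1 \<delta>)
  then show ?case by (simp add: scale_def)
next
  case (2 \<delta> l u)
  have pos: "eventually (\<lambda>n. 0 < tn n) sequentially" using tn by (simp add: filterlim_at_top_dense)
  have "(\<lambda>n. inverse (tn n)) \<longlonglongrightarrow> 0" using tn by (rule tendsto_inverse_0_at_top)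
  then have "(\<lambda>n. (1 + 2 * l * u) powr (- \<delta> / 2) * exp (- (l * y / (1 + 2 * l * u)) * inverse (tn n)))
    \<longlonglongrightarrow> (1 + 2 * l * u) powr (- \<delta> / 2) * exp (- (l * y / (1 + 2 * l * u)) * 0)"
    by (intro tendsto_mult tendsto_exp tendsto_const)
  moreover have "eventually (\<lambda>n. (1 + 2 * l * u) powr (- \<delta> / 2) * exp (- (l * y / (1 + 2 * l * u)) * inverse (tn n)) = LT \<delta> y (scale (tn n) [(l, u)])) sequentially"
    using pos
  proof eventually_elim
    case (elim n)
    have "(l / tn n) * (tn n * u) = l * u" using elim by simp
    then have e: "2 * (l / tn n) * (tn n * u) = 2 * l * u" by (simp only: mult.assoc)
    have "l / tn n / c * y = l * y / c * inverse (tn n)" for c by (simp add: divide_inverse mult_ac)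
    then have "- (l / tn n / c) * y = - (l * y / c) * inverse (tn n)" for c by (simp only: minus_mult_left[symmetric])
    then show ?case by (simp only: scale_def list.map case_prod_conv LT.simps e)
  qed
  ultimately show ?case by (simp add: tendsto_cong)
next
  case (3 \<delta> l u m v L)
  have pos: "eventually (\<lambda>n. 0 < tn n) sequentially" using tn by (simp add: filterlim_at_top_dense)
  let ?c = "1 + 2 * l * (u - v)"
  have "(\<lambda>n. ?c powr (- \<delta> / 2) * LT \<delta> y (scale (tn n) ((m + l / ?c, v) # L))) \<longlonglongrightarrow> ?c powr (- \<delta> / 2) * LT \<delta> 0 ((m + l / ?c, v) # L)"
    by (intro tendsto_mult tendsto_const 3)
  moreover have "eventually (\<lambda>n. ?c powr (- \<delta> / 2) * LT \<delta> y (scale (tn n) ((m + l / ?c, v) # L)) = LT \<delta> y (scale (tn n) ((l, u) # (m, v) # L))) sequentially"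
    using pos
  proof eventually_elim
    case (elim n)
    have e: "2 * (l / tn n) * (tn n * u - tn n * v) = 2 * l * (u - v)" using elim by (simp add: right_diff_distrib[symmetric])
    have e2: "m / tn n + l / tn n / c = (m + l / c) / tn n" for c by (simp add: add_divide_distrib)
    show ?case by (simp only: scale_def list.map case_prod_conv LT.simps e e2)
  qed
  ultimately show ?case by (simp add: tendsto_cong)
qed

lemma eL_scale: "eL L (\<lambda>u. w (t * u) / t) = eL (scale t L) w"
  by (induction L) (auto simp: scale_def eL_Cons)

text \<open>Lets the times be sorted before the recursion of \<open>LT\<close> is applied.\<close>

lemma eL_mset: "mset L = mset L' \<Longrightarrow> eL L w = eL L' w"
proof -
  assume "mset L = mset L'"
  then have "image_mset (\<lambda>(l, u). l * w u) (mset L) = image_mset (\<lambda>(l, u). l * w u) (mset L')" by simp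
  then have "sum_mset (mset (map (\<lambda>(l, u). l * w u) L)) = sum_mset (mset (map (\<lambda>(l, u). l * w u) L'))" by simp
  then show ?thesis unfolding eL_def sum_mset_sum_list by simp
qed

context besq
begin

abbreviation Yp :: "real \<Rightarrow> 'a \<Rightarrow> real" where "Yp u w \<equiv> max 0 (Y u w)"

lemma LT_eq:
  assumes "valid L" "sorted_wrt (\<lambda>p q. snd q \<le> snd p) L"
  shows "expectation (\<lambda>w. eL L (\<lambda>u. Yp u w)) = LT \<delta> y L"
  using assms 
proof (induction \<delta>\<equiv>"\<delta>" y\<equiv>"y" L rule: LT.induct)
  case 1
  then show ?case by (simp add: prob_space)
next
  case (2 l u)
  then have l: "0 \<le> l" "0 \<le> u" by (auto simp: valid_Cons)
  have [measurable]: "Y u \<in> borel_measurable M" "Y 0 \<in> borel_measurable M" using l by (auto intro: X_measurable)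
  let ?c = "l / (1 + 2 * l * u)"
  have "expectation (\<lambda>w. eL [(l, u)] (\<lambda>u. Yp u w)) = expectation (\<lambda>w. 1 * exp (- l * Y u w))"
  proof (rule integral_cong_AE)
    show "AE w in M. eL [(l, u)] (\<lambda>u. Yp u w) = 1 * exp (- l * Y u w)"
      using Y_nonneg_at[OF l(2)] by eventually_elim (simp add: eL_Cons max_absorb2)
  qed (simp_all add: eL_Cons)
  also have "\<dots> = (1 + 2 * l * (u - 0)) powr (- \<delta> / 2) * expectation (\<lambda>w. 1 * exp (- (l / (1 + 2 * l * (u - 0))) * Y 0 w))"
    by (rule laplace) (use l in auto)
  also have "expectation (\<lambda>w. 1 * exp (- (l / (1 + 2 * l * (u - 0))) * Y 0 w)) = expectation (\<lambda>w. exp (- ?c * y))"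
    by (rule integral_cong_AE) (use Y_zero in \<open>auto elim!: eventually_mono\<close>)
  finally show ?case by (simp add: prob_space)
next
  case (3 l u m v L)
  then have l: "0 \<le> l" "0 \<le> u" "0 \<le> m" "0 \<le> v" "valid L" "v \<le> u" "\<And>a b. (a, b) \<in> set L \<Longrightarrow> b \<le> v"
    by (auto simp: valid_Cons)
  have Lnn: "\<And>a b. (a, b) \<in> set L \<Longrightarrow> 0 \<le> b" using l(5) by (auto simp: valid_def)
  let ?c = "1 + 2 * l * (u - v)"
  have c: "1 \<le> ?c" using l by simp
  \<comment> \<open>Everything up to time v forms one weight with values in \<open>{0..1}\<close>
    that is known at v, so \<open>laplace\<close> applies to the last time alone.\<close>
  define g where "g w = exp (- m * Yp v w) * eL L (\<lambda>u. Yp u w)" for w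
  have mF: "(\<lambda>w. eL L (\<lambda>u. Yp u w)) \<in> borel_measurable (F v)"
    by (rule eL_measurable) (use X_measurable_F l(7) Lnn in \<open>auto intro!: borel_measurable_max\<close>)
  have mv: "Y v \<in> borel_measurable (F v)" using l by (intro X_measurable_F) auto
  have gF: "g \<in> borel_measurable (F v)" unfolding g_def[abs_def] using mF mv by measurable
  have gM[measurable]: "g \<in> borel_measurable M" using gF by (rule measurable_F_le)
  have eb: "0 < eL L (\<lambda>u. Yp u w) \<and> eL L (\<lambda>u. Yp u w) \<le> 1" for w by (rule eL_bounds[OF l(5)]) simp
  have g01: "0 \<le> g w" "g w \<le> 1" for w
  proof -
    show "0 \<le> g w" using eb[of w] by (simp add: g_def)
    have "exp (- m * Yp v w) \<le> 1" using l by simp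
    then show "g w \<le> 1" using eb[of w] unfolding g_def by (intro mult_le_one) auto
  qed
  have [measurable]: "Y u \<in> borel_measurable M" "Y v \<in> borel_measurable M" using l by (auto intro: X_measurable)
  have [measurable]: "(\<lambda>w. eL L (\<lambda>u. Yp u w)) \<in> borel_measurable M" using mF by (rule measurable_F_le)
  have "expectation (\<lambda>w. eL ((l, u) # (m, v) # L) (\<lambda>u. Yp u w)) = expectation (\<lambda>w. g w * exp (- l * Y u w))"
  proof (rule integral_cong_AE)
    show "AE w in M. eL ((l, u) # (m, v) # L) (\<lambda>u. Yp u w) = g w * exp (- l * Y u w)"
      using Y_nonneg_at[OF l(2)] by eventually_elim (simp add: eL_Cons g_def max_absorb2 mult_ac)
  qed (simp_all add: eL_Cons)
  also have "\<dots> = ?c powr (- \<delta> / 2) * expectation (\<lambda>w. g w * exp (- (l / ?c) * Y v w))"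
    by (rule laplace) (use l gF g01 in auto)
  also have "expectation (\<lambda>w. g w * exp (- (l / ?c) * Y v w)) = expectation (\<lambda>w. eL ((m + l / ?c, v) # L) (\<lambda>u. Yp u w))"
  proof (rule integral_cong_AE)
    show "AE w in M. g w * exp (- (l / ?c) * Y v w) = eL ((m + l / ?c, v) # L) (\<lambda>u. Yp u w)"
      using Y_nonneg_at[OF l(4)]
    proof eventually_elim
      case (elim w)
      have "exp (- (m + l / ?c) * Y v w) = exp (- m * Y v w) * exp (- (l / ?c) * Y v w)"
        by (simp only: exp_add[symmetric]) (simp add: algebra_simps)
      then show ?case using elim by (simp only: eL_Cons g_def max_absorb2 mult_ac)
    qed
  qed (simp_all add: eL_Cons)
  also have "\<dots> = LT \<delta> y ((m + l / ?c, v) # L)"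
  proof (rule 3(1))
    have "0 \<le> l / ?c" using l c by simp
    then show "valid ((m + l / ?c, v) # L)" using l by (simp add: valid_Cons)
    show "sorted_wrt (\<lambda>p q. snd q \<le> snd p) ((m + l / ?c, v) # L)" using 3(3) by auto
  qed
  finally show ?case by simp
qed

end

lemma (in besq) fdd_limit:
  assumes Q: "besq P G X' \<delta> 0 Z" and tn: "filterlim tn at_top sequentially" "\<And>n. 0 < tn n" and L: "valid L"
  shows "(\<lambda>n. \<integral>\<omega>. eL L (\<lambda>u. max 0 (Y (tn n * u) \<omega>) / tn n) \<partial>M) \<longlonglongrightarrow> (\<integral>\<omega>. eL L (\<lambda>u. max 0 (Z u \<omega>)) \<partial>P)"
proof -
  interpret Q: besq P G X' \<delta> 0 Z by (rule Q)
  define K where "K = sort_key (\<lambda>p. - snd p) L"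
  have KL: "eL L w = eL K w" for w by (rule eL_mset) (simp add: K_def)
  have K: "valid K" using L by (simp add: valid_def K_def)
  have "sorted (map (\<lambda>p. - snd p) K)" by (simp add: K_def)
  then have sK: "sorted_wrt (\<lambda>p q. snd q \<le> snd p) K" by (simp add: sorted_map)
  have "(\<integral>\<omega>. eL L (\<lambda>u. max 0 (Y (tn n * u) \<omega>) / tn n) \<partial>M) = LT \<delta> y (scale (tn n) K)" for n
  proof -
    have "valid (scale (tn n) K)" using K tn(2)[of n] by (auto simp: valid_def scale_def)
    moreover have "sorted_wrt (\<lambda>p q. snd q \<le> snd p) (scale (tn n) K)"
      unfolding scale_def sorted_wrt_map using sK tn(2)[of n] by (auto simp: case_prod_beta elim!: sorted_wrt_mono_rel[rotated])
    ultimately have "LT \<delta> y (scale (tn n) K) = expectation (\<lambda>\<omega>. eL (scale (tn n) K) (\<lambda>u. Yp u \<omega>))" by (simp add: LT_eq)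
    moreover have "eL L (\<lambda>u. max 0 (Y (tn n * u) \<omega>) / tn n) = eL (scale (tn n) K) (\<lambda>u. Yp u \<omega>)" for \<omega>
      unfolding KL by (rule eL_scale)
    ultimately show ?thesis by simp
  qed
  moreover have "(\<integral>\<omega>. eL L (\<lambda>u. max 0 (Z u \<omega>)) \<partial>P) = LT \<delta> 0 K"
    unfolding KL by (rule Q.LT_eq[OF K sK])
  ultimately show ?thesis using LT_scale_tendsto[OF tn(1)] by simp
qed

section \<open>The scaling limit\<close>

lemma leb_on_integral:
  fixes h :: "real \<Rightarrow> real"
  assumes "h \<in> borel_measurable borel"
  shows "(\<integral>u. h u \<partial>leb_on a b) = (\<integral>u. indicator {a..b} u * h u \<partial>lborel)"
proof -
  have "leb_on a b = density lborel (\<lambda>u. ennreal (indicator {a..b} u))"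
    unfolding leb_on_def by (rule arg_cong[where f="density lborel"]) (auto simp: indicator_def fun_eq_iff)
  then show ?thesis using assms by (simp add: integral_density)
qed

text \<open>\<open>c1\<close> bounds the part of the integrand dropped at times below \<eta>, which
  costs \<open>c1 * \<eta>\<close>, and \<open>c2\<close> the error of the cap in space at each
  time. The estimates are made under the expectation at fixed times, then integrated by
  Tonelli.\<close>

lemma (in prob_space) trunc_error:
  fixes g k :: "real \<Rightarrow> 'a \<Rightarrow> real"
  assumes g[measurable]: "(\<lambda>(s, w). g s w) \<in> borel_measurable (borel \<Otimes>\<^sub>M M)"
    and k[measurable]: "(\<lambda>(s, w). k s w) \<in> borel_measurable (borel \<Otimes>\<^sub>M M)"
    and nn: "\<And>s w. 0 \<le> g s w" "\<And>s w. 0 \<le> k s w" "\<And>s w. k s w \<le> D"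
    and \<eta>: "0 \<le> \<eta>" "\<eta> \<le> 1" "\<And>s w. s < \<eta> \<Longrightarrow> k s w = 0"
    and c: "0 \<le> c1" "0 \<le> c2"
    and b1: "\<And>s. s \<in> {0..\<eta>} \<Longrightarrow> (\<integral>\<^sup>+w. ennreal \<bar>g s w - k s w\<bar> \<partial>M) \<le> ennreal (c1 + c2)"
    and b2: "\<And>s. s \<in> {\<eta>..1} \<Longrightarrow> (\<integral>\<^sup>+w. ennreal \<bar>g s w - k s w\<bar> \<partial>M) \<le> ennreal c2"
  shows "(\<lambda>w. \<integral>s. indicator {0..1} s * g s w \<partial>lborel) \<in> borel_measurable M"
    and "(\<lambda>w. \<integral>s. k s w \<partial>leb_on \<eta> 1) \<in> borel_measurable M"
    and "integrable M (\<lambda>w. \<bar>(\<integral>s. indicator {0..1} s * g s w \<partial>lborel) - (\<integral>s. k s w \<partial>leb_on \<eta> 1)\<bar>)"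
    and "expectation (\<lambda>w. \<bar>(\<integral>s. indicator {0..1} s * g s w \<partial>lborel) - (\<integral>s. k s w \<partial>leb_on \<eta> 1)\<bar>) \<le> (c1 + c2) * \<eta> + c2"
proof -
  have swap: "(\<lambda>p. (snd p, fst p)) \<in> measurable (M \<Otimes>\<^sub>M lborel) (borel \<Otimes>\<^sub>M M)"
    by (intro measurable_Pair) auto
  have [measurable]: "(\<lambda>p. g (snd p) (fst p)) \<in> borel_measurable (M \<Otimes>\<^sub>M lborel)" "(\<lambda>p. k (snd p) (fst p)) \<in> borel_measurable (M \<Otimes>\<^sub>M lborel)"
    using measurable_compose[OF swap g] measurable_compose[OF swap k] by simp_all
  have "(\<lambda>p. indicator {0..1} (snd p) * g (snd p) (fst p)) \<in> borel_measurable (M \<Otimes>\<^sub>M lborel)" by measurable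
  then have "(\<lambda>(w, s). indicator {0..1} s * g s w) \<in> borel_measurable (M \<Otimes>\<^sub>M lborel)" by (simp add: case_prod_beta')
  from lborel.borel_measurable_lebesgue_integral[OF this]
  show mG[measurable]: "(\<lambda>w. \<integral>s. indicator {0..1} s * g s w \<partial>lborel) \<in> borel_measurable M" by simp
  have sec: "(\<lambda>s. g s w) \<in> borel_measurable borel" "(\<lambda>s. k s w) \<in> borel_measurable borel" if "w \<in> space M" for w
    using measurable_compose[OF measurable_Pair2'[OF that] g] measurable_compose[OF measurable_Pair2'[OF that] k] by simp_all
  have keq: "(\<integral>s. k s w \<partial>leb_on \<eta> 1) = (\<integral>s. indicator {0..1} s * k s w \<partial>lborel)" if "w \<in> space M" for w
    unfolding leb_on_integral[OF sec(2)[OF that]] by (rule Bochner_Integration.integral_cong) (use \<eta> in \<open>auto simp: indicator_def not_le\<close>)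
  have "(\<lambda>p. indicator {0..1} (snd p) * k (snd p) (fst p)) \<in> borel_measurable (M \<Otimes>\<^sub>M lborel)" by measurable
  then have "(\<lambda>(w, s). indicator {0..1} s * k s w) \<in> borel_measurable (M \<Otimes>\<^sub>M lborel)" by (simp add: case_prod_beta')
  from lborel.borel_measurable_lebesgue_integral[OF this]
  have mK': "(\<lambda>w. \<integral>s. indicator {0..1} s * k s w \<partial>lborel) \<in> borel_measurable M" by simp
  then show mK[measurable]: "(\<lambda>w. \<integral>s. k s w \<partial>leb_on \<eta> 1) \<in> borel_measurable M"
    by (rule measurable_cong[THEN iffD1, rotated]) (simp add: keq)
  let ?d = "\<lambda>s w. ennreal \<bar>g s w - k s w\<bar>"
  let ?J = "\<lambda>a b w. \<integral>\<^sup>+s. indicator {a..b} s * ?d s w \<partial>lborel"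
  have "(\<lambda>p. ennreal \<bar>(\<lambda>(s, w). g s w) p - (\<lambda>(s, w). k s w) p\<bar>) \<in> borel_measurable (borel \<Otimes>\<^sub>M M)" by measurable
  then have md: "(\<lambda>(s, w). ?d s w) \<in> borel_measurable (borel \<Otimes>\<^sub>M M)" by (simp add: case_prod_beta')
  have mJ[measurable]: "?J a b \<in> borel_measurable M" for a b
  proof -
    have "(\<lambda>p. indicator {a..b} (snd p) * ennreal \<bar>g (snd p) (fst p) - k (snd p) (fst p)\<bar>) \<in> borel_measurable (M \<Otimes>\<^sub>M lborel)" by measurable
    then have "(\<lambda>(w, s). indicator {a..b} s * ?d s w) \<in> borel_measurable (M \<Otimes>\<^sub>M lborel)" by (simp add: case_prod_beta')
    from lborel.borel_measurable_nn_integral[OF this] show ?thesis by simp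
  qed
  have Jle: "?J 0 1 w \<le> ?J 0 \<eta> w + ?J \<eta> 1 w" if "w \<in> space M" for w
  proof -
    have [measurable]: "(\<lambda>s. g s w) \<in> borel_measurable lborel" "(\<lambda>s. k s w) \<in> borel_measurable lborel" using sec[OF that] by simp_all
    have "?J 0 1 w \<le> (\<integral>\<^sup>+s. indicator {0..\<eta>} s * ?d s w + indicator {\<eta>..1} s * ?d s w \<partial>lborel)"
      by (intro nn_integral_mono) (auto simp: indicator_def)
    also have "\<dots> = ?J 0 \<eta> w + ?J \<eta> 1 w" by (rule nn_integral_add) measurable
    finally show ?thesis .
  qed
  have "(\<integral>\<^sup>+w. ?J 0 1 w \<partial>M) \<le> (\<integral>\<^sup>+w. ?J 0 \<eta> w + ?J \<eta> 1 w \<partial>M)" by (intro nn_integral_mono Jle)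
  also have "\<dots> = (\<integral>\<^sup>+w. ?J 0 \<eta> w \<partial>M) + (\<integral>\<^sup>+w. ?J \<eta> 1 w \<partial>M)" by (rule nn_integral_add) measurable
  also have "\<dots> \<le> ennreal ((c1 + c2) * (\<eta> - 0)) + ennreal (c2 * (1 - \<eta>))"
    by (intro add_mono nn_integral_time md b1 b2) (use \<eta> c in auto)
  also have "\<dots> = ennreal ((c1 + c2) * \<eta> + c2 * (1 - \<eta>))" using \<eta> c by (subst ennreal_plus) auto
  also have "\<dots> \<le> ennreal ((c1 + c2) * \<eta> + c2)" using \<eta> c by (intro ennreal_leI add_left_mono) (simp add: mult_left_le)
  finally have J: "(\<integral>\<^sup>+w. ?J 0 1 w \<partial>M) \<le> ennreal ((c1 + c2) * \<eta> + c2)" .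
  \<comment> \<open>Path by path \<open>g\<close> is not known to be integrable near time 0; the
    finite mean shows that it is so almost surely.\<close>
  have fin: "AE w in M. ?J 0 1 w \<noteq> \<infinity>" 
    by (rule nn_integral_PInf_AE) (use J in \<open>auto simp: top_unique\<close>)
  let ?R = "\<lambda>w. \<bar>(\<integral>s. indicator {0..1} s * g s w \<partial>lborel) - (\<integral>s. k s w \<partial>leb_on \<eta> 1)\<bar>"
  have "AE w in M. ennreal (?R w) \<le> ?J 0 1 w"
    using fin AE_space
  proof eventually_elim
    case (elim w)
    have [measurable]: "(\<lambda>s. g s w) \<in> borel_measurable lborel" "(\<lambda>s. k s w) \<in> borel_measurable lborel" using sec[OF elim(2)] by simp_all
    have Jeq: "?J 0 1 w = (\<integral>\<^sup>+s. ennreal \<bar>indicator {0..1} s * g s w - indicator {0..1} s * k s w\<bar> \<partial>lborel)"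
      by (intro nn_integral_cong) (auto simp: indicator_def)
    have id: "integrable lborel (\<lambda>s. indicator {0..1} s * g s w - indicator {0..1} s * k s w)"
      using elim(1) by (intro integrableI_bounded) (auto simp: Jeq less_top)
    have D: "0 \<le> D" using nn(2,3)[of 0 w] by linarith
    have "integrable lborel (\<lambda>s. D * indicator {0..1::real} s)" by simp
    then have ik: "integrable lborel (\<lambda>s. indicator {0..1} s * k s w)"
      by (rule Bochner_Integration.integrable_bound) (use nn D in \<open>auto simp: indicator_def\<close>)
    have ig: "integrable lborel (\<lambda>s. indicator {0..1} s * g s w)"
      using Bochner_Integration.integrable_add[OF id ik] by simp
    have "?R w = \<bar>\<integral>s. indicator {0..1} s * g s w - indicator {0..1} s * k s w \<partial>lborel\<bar>"
      unfolding keq[OF elim(2)] Bochner_Integration.integral_diff[OF ig ik] ..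
    then have "?R w \<le> (\<integral>s. \<bar>indicator {0..1} s * g s w - indicator {0..1} s * k s w\<bar> \<partial>lborel)"
      by (simp only: integral_abs_bound)
    then have "ennreal (?R w) \<le> ennreal (\<integral>s. \<bar>indicator {0..1} s * g s w - indicator {0..1} s * k s w\<bar> \<partial>lborel)" by (rule ennreal_leI)
    also have "\<dots> = ?J 0 1 w" unfolding Jeq by (rule nn_integral_eq_integral[symmetric]) (use id in auto)
    finally show ?case .
  qed
  then have "(\<integral>\<^sup>+w. ennreal (?R w) \<partial>M) \<le> (\<integral>\<^sup>+w. ?J 0 1 w \<partial>M)" by (rule nn_integral_mono_AE)
  with J have R: "(\<integral>\<^sup>+w. ennreal (?R w) \<partial>M) \<le> ennreal ((c1 + c2) * \<eta> + c2)" by (rule order_trans[rotated])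
  show iR: "integrable M ?R" by (rule integrableI_nonneg) (use R in \<open>auto simp: less_top[symmetric] top_unique intro: le_less_trans\<close>)
  have "ennreal (expectation ?R) \<le> ennreal ((c1 + c2) * \<eta> + c2)"
    using R nn_integral_eq_integral[OF iR] by simp
  then show "expectation ?R \<le> (c1 + c2) * \<eta> + c2" using \<eta> c by (subst (asm) ennreal_le_iff) auto
qed

text \<open>A power with value 1 at exponent 0. Since \<open>0 powr 0 = 0\<close>,
  \<open>powr\<close> itself would be discontinuous at the origin in the admissible case
  \<open>\<alpha> = 0\<close>.\<close>

definition pw :: "real \<Rightarrow> real \<Rightarrow> real" where "pw p x = (if p = 0 then 1 else x powr p)"

lemma pw_nonneg: "0 \<le> pw p x" by (simp add: pw_def)

lemma pw_pos_eq: "0 < x \<Longrightarrow> pw p x = x powr p" by (simp add: pw_def)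

lemma pw_mono: "0 \<le> p \<Longrightarrow> 0 \<le> x \<Longrightarrow> x \<le> z \<Longrightarrow> pw p x \<le> pw p z"
  by (simp add: pw_def powr_mono2)

lemma pw_le: "0 \<le> p \<Longrightarrow> 0 \<le> x \<Longrightarrow> x \<le> z \<Longrightarrow> 0 < z \<Longrightarrow> pw p x \<le> z powr p"
  by (simp add: pw_def powr_mono2)

lemma pw_cont: assumes "0 \<le> p" shows "continuous_on UNIV (\<lambda>x. pw p (max 0 x))"
proof (cases "p = 0")
  case False
  have "continuous_on UNIV (\<lambda>x. max 0 x powr p)"
    by (rule continuous_on_powr') (use assms False in \<open>auto intro!: continuous_intros\<close>)
  then show ?thesis using False by (simp add: pw_def)
qed (simp add: pw_def)

lemma pw_measurable: "0 \<le> p \<Longrightarrow> (\<lambda>x. pw p (max 0 x)) \<in> borel_measurable borel"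
  by (intro borel_measurable_continuous_onI pw_cont)

lemma powr_rescale:
  fixes t :: real
  assumes t: "0 < t"
  shows "t powr (- (a + b)) * ((1 + t * u) powr a * (1 + t * x) powr b) = (1 / t + u) powr a * (1 / t + x) powr b"
proof -
  have "1 + t * u = t * (1 / t + u)" "1 + t * x = t * (1 / t + x)" using t by (auto simp: field_simps)
  then have "t powr (- (a + b)) * ((1 + t * u) powr a * (1 + t * x) powr b)
    = (t powr (- (a + b)) * t powr a * t powr b) * ((1 / t + u) powr a * (1 / t + x) powr b)"
    by (simp only: powr_mult mult_ac)
  also have "t powr (- (a + b)) * t powr a * t powr b = 1" using t by (simp add: powr_add[symmetric])
  finally show ?thesis by simp
qed

text \<open>The rescaled model function is \<open>h (1 / t, x)\<close> for one \<open>h\<close> that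
  is continuous on a compact rectangle, so uniform continuity lets the first argument tend to 0
  uniformly in \<open>x\<close>. With \<open>u > 0\<close> the power of \<open>1 / t + u\<close> is
  continuous for negative \<gamma> as well, and \<open>t * u\<close> alone reaches the asymptotic
  region of \<open>f\<close>.\<close>

lemma (in besq_drift) f_scaled_uniform:
  assumes u: "0 < u" and K: "0 \<le> K" and e: "0 < e"
  shows "eventually (\<lambda>t. \<forall>x\<in>{0..K}. \<bar>t powr (- (\<gamma> + \<alpha>)) * f (t * u) (t * x) - \<rho> * u powr \<gamma> * pw \<alpha> x\<bar> \<le> e) at_top"
proof -
  define h where "h p = (fst p + u) powr \<gamma> * pw \<alpha> (max 0 (fst p + snd p))" for p :: "real \<times> real"
  have "continuous_on ({0..1} \<times> {0..K}) (\<lambda>p. pw \<alpha> (max 0 (fst p + snd p)))"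
    by (rule continuous_on_compose2[OF pw_cont[OF params(2)]]) (auto intro!: continuous_intros)
  then have ch: "continuous_on ({0..1} \<times> {0..K}) h"
    unfolding h_def by (intro continuous_on_mult continuous_on_powr) (use u in \<open>auto intro!: continuous_intros\<close>)
  have cpt: "compact ({0..1::real} \<times> {0..K})" by (intro compact_Times) auto
  then have "compact (h ` ({0..1} \<times> {0..K}))" by (rule compact_continuous_image[OF ch])
  then obtain H where H: "\<And>p. p \<in> {0..1} \<times> {0..K} \<Longrightarrow> \<bar>h p\<bar> \<le> H"
    using compact_imp_bounded bounded_iff by (metis imageI real_norm_def)
  have "\<bar>h (0, 0)\<bar> \<le> H" using K by (intro H) auto
  then have H0: "0 \<le> H" by linarith
  have "uniformly_continuous_on ({0..1} \<times> {0..K}) h" by (rule compact_uniformly_continuous[OF ch cpt])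
  moreover have "0 < e / (2 * \<rho>)" using e params by simp
  ultimately obtain d where d: "0 < d" "\<And>p q. p \<in> {0..1} \<times> {0..K} \<Longrightarrow> q \<in> {0..1} \<times> {0..K} \<Longrightarrow> dist q p < d \<Longrightarrow> dist (h q) (h p) < e / (2 * \<rho>)"
    unfolding uniformly_continuous_on_def by metis
  have "0 < e / (2 * (H + 1))" using e H0 by simp
  then obtain r where r: "0 \<le> r" "\<And>t z. 0 \<le> t \<Longrightarrow> 0 \<le> z \<Longrightarrow> r \<le> t + z \<Longrightarrow> \<bar>f t z * (1 + t) powr (- \<gamma>) * (1 + z) powr (- \<alpha>) - \<rho>\<bar> \<le> e / (2 * (H + 1))"
    using Af unfolding assumption_Af_def by meson
  have "eventually (\<lambda>t. max 1 (max (r / u) (2 / d)) \<le> t) at_top" by (rule eventually_ge_at_top)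
  then show ?thesis
  proof (rule eventually_mono)
    fix t assume "max 1 (max (r / u) (2 / d)) \<le> t"
    then have t: "1 \<le> t" "r / u \<le> t" "2 / d \<le> t" by auto
    have tr: "r \<le> t * u" using t(2) u by (simp add: field_simps)
    have "2 \<le> t * d" using t(3) d by (simp add: field_simps)
    then have td: "1 / t < d" using t(1) by (simp add: field_simps)
    show "\<forall>x\<in>{0..K}. \<bar>t powr (- (\<gamma> + \<alpha>)) * f (t * u) (t * x) - \<rho> * u powr \<gamma> * pw \<alpha> x\<bar> \<le> e"
    proof
      fix x assume x: "x \<in> {0..K}"
      define \<phi> where "\<phi> = f (t * u) (t * x) * (1 + t * u) powr (- \<gamma>) * (1 + t * x) powr (- \<alpha>)"
      have tx: "0 \<le> t * x" "0 \<le> t * u" using t x u by auto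
      have \<phi>: "\<bar>\<phi> - \<rho>\<bar> \<le> e / (2 * (H + 1))" unfolding \<phi>_def by (rule r(2)) (use tx tr in auto)
      have "f (t * u) (t * x) = \<phi> * ((1 + t * u) powr \<gamma> * (1 + t * x) powr \<alpha>)"
        using tx by (simp add: \<phi>_def powr_minus field_simps)
      moreover have "t powr (- (\<gamma> + \<alpha>)) * ((1 + t * u) powr \<gamma> * (1 + t * x) powr \<alpha>) = h (1 / t, x)"
      proof -
        have "0 < 1 / t + x" using t x by (auto intro!: add_pos_nonneg)
        then have "pw \<alpha> (max 0 (1 / t + x)) = (1 / t + x) powr \<alpha>" by (simp add: pw_pos_eq max_absorb2)
        then show ?thesis using powr_rescale[of t \<gamma> \<alpha> u x] t by (simp add: h_def)
      qed
      ultimately have 1: "t powr (- (\<gamma> + \<alpha>)) * f (t * u) (t * x) = \<phi> * h (1 / t, x)" by (simp add: mult.left_commute)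
      have 2: "\<rho> * u powr \<gamma> * pw \<alpha> x = \<rho> * h (0, x)" using x by (simp add: h_def max_absorb2)
      have mem: "(1 / t, x) \<in> {0..1} \<times> {0..K}" "(0 :: real, x) \<in> {0..1} \<times> {0..K}" using t x by auto
      have "dist (1 / t, x) (0, x) < d" using td t by (simp add: dist_Pair_Pair)
      from d(2)[OF mem(2,1) this] have hd: "\<bar>h (1 / t, x) - h (0, x)\<bar> < e / (2 * \<rho>)" by (simp add: dist_real_def)
      have "\<phi> * h (1 / t, x) - \<rho> * h (0, x) = (\<phi> - \<rho>) * h (1 / t, x) + \<rho> * (h (1 / t, x) - h (0, x))" by (simp add: algebra_simps)
      then have "\<bar>\<phi> * h (1 / t, x) - \<rho> * h (0, x)\<bar> \<le> \<bar>\<phi> - \<rho>\<bar> * \<bar>h (1 / t, x)\<bar> + \<rho> * \<bar>h (1 / t, x) - h (0, x)\<bar>"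
        using params abs_triangle_ineq[of "(\<phi> - \<rho>) * h (1 / t, x)" "\<rho> * (h (1 / t, x) - h (0, x))"] by (simp only: abs_mult)
      also have "\<dots> \<le> e / (2 * (H + 1)) * (H + 1) + \<rho> * (e / (2 * \<rho>))"
        using \<phi> hd H[OF mem(1)] H0 params e by (intro add_mono mult_mono) auto
      also have "\<dots> = e" using H0 params by (simp add: field_simps)
      finally show "\<bar>t powr (- (\<gamma> + \<alpha>)) * f (t * u) (t * x) - \<rho> * u powr \<gamma> * pw \<alpha> x\<bar> \<le> e" unfolding 1 2 .
    qed
  qed
qed

lemma eL_cong: "(\<And>l u. (l, u) \<in> set L \<Longrightarrow> w u = w' u) \<Longrightarrow> eL L w = eL L w'"
proof (induction L)
  case (Cons p L)
  obtain l u where p: "p = (l, u)" by force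
  have "eL L w = eL L w'" by (rule Cons.IH) (use Cons.prems in auto)
  moreover have "w u = w' u" by (rule Cons.prems[of l]) (simp add: p)
  ultimately show ?case by (simp add: p eL_Cons)
qed simp

lemma (in besq) Y_moment_nn:
  assumes s: "0 \<le> s" and p: "0 \<le> p" and c: "0 \<le> c"
    and le: "\<And>w. w \<in> space M \<Longrightarrow> h w \<le> c * (1 + \<bar>Y s w\<bar>) powr p"
  shows "(\<integral>\<^sup>+w. ennreal (h w) \<partial>M) \<le> ennreal (c * (MP p * (1 + s) powr p))"
proof -
  have i: "integrable M (\<lambda>w. c * (1 + \<bar>Y s w\<bar>) powr p)" by (intro integrable_mult_right Y_moment_powr s p)
  have "(\<integral>\<^sup>+w. ennreal (h w) \<partial>M) \<le> (\<integral>\<^sup>+w. ennreal (c * (1 + \<bar>Y s w\<bar>) powr p) \<partial>M)"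
    by (intro nn_integral_mono ennreal_leI le)
  also have "\<dots> = ennreal (expectation (\<lambda>w. c * (1 + \<bar>Y s w\<bar>) powr p))"
    by (rule nn_integral_eq_integral[OF i]) (use c in auto)
  also have "\<dots> = ennreal (c * expectation (\<lambda>w. (1 + \<bar>Y s w\<bar>) powr p))" by simp
  also have "\<dots> \<le> ennreal (c * (MP p * (1 + s) powr p))"
    by (intro ennreal_leI mult_left_mono Y_moment_powr s p c)
  finally show ?thesis .
qed

section \<open>The rescaled processes and their moments\<close>

locale besq_scaling = besq_drift M F W \<delta> y Y f \<rho> \<alpha> \<gamma> + Q: besq P G W' \<delta> 0 Z
  for M :: "'a measure" and F W \<delta> y Y f \<rho> \<alpha> \<gamma> and P :: "'b measure" and G W' Z +
  fixes tn :: "nat \<Rightarrow> real"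
  assumes tn_top: "filterlim tn at_top sequentially" and tn_ge: "\<And>n. 1 \<le> tn n"
begin

lemma tn_pos: "0 < tn n" using tn_ge[of n] by simp

text \<open>Clipped in time and value because \<open>fdd_conv\<close> asks for non-negativity on
  every path and joint measurability is used on the whole time line.\<close>

definition U :: "nat \<Rightarrow> real \<Rightarrow> 'a \<Rightarrow> real" where "U n u w = max 0 (Y (max 0 (tn n * u)) w) / tn n"

definition V :: "real \<Rightarrow> 'b \<Rightarrow> real" where "V u w = max 0 (Z (max 0 u) w)"

lemma U_nonneg: "0 \<le> U n u w" using tn_pos[of n] by (simp add: U_def)
lemma V_nonneg: "0 \<le> V u w" by (simp add: V_def)

lemma U_joint [measurable]: "(\<lambda>(u, w). U n u w) \<in> borel_measurable (borel \<Otimes>\<^sub>M M)"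
proof -
  have "(\<lambda>p. (tn n * fst p, snd p)) \<in> measurable (borel \<Otimes>\<^sub>M M) (borel \<Otimes>\<^sub>M M)" by (intro measurable_Pair) auto
  from measurable_compose[OF this Y_joint] have [measurable]: "(\<lambda>p. Y (max 0 (tn n * fst p)) (snd p)) \<in> borel_measurable (borel \<Otimes>\<^sub>M M)"
    by simp
  have "(\<lambda>p. max 0 (Y (max 0 (tn n * fst p)) (snd p)) / tn n) \<in> borel_measurable (borel \<Otimes>\<^sub>M M)" by measurable
  then show ?thesis by (simp add: U_def case_prod_beta')
qed

lemma V_joint [measurable]: "(\<lambda>(u, w). V u w) \<in> borel_measurable (borel \<Otimes>\<^sub>M P)"
proof -
  have "(\<lambda>p. max 0 ((\<lambda>(u, w). Z (max 0 u) w) p)) \<in> borel_measurable (borel \<Otimes>\<^sub>M P)" by measurable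
  then show ?thesis by (simp add: V_def case_prod_beta')
qed

sublocale FC: fdd_conv M P U V
proof
  show "U n u \<in> borel_measurable M" for n u using measurable_compose[OF measurable_Pair1' U_joint, of u] by simp
  show "V u \<in> borel_measurable P" for u using measurable_compose[OF measurable_Pair1' V_joint, of u] by simp
  show "0 \<le> U n u w" for n u w by (rule U_nonneg)
  show "0 \<le> V u w" for u w by (rule V_nonneg)
  fix L assume L: "valid L"
  have p: "0 \<le> u" if "(l, u) \<in> set L" for l u using that L by (auto simp: valid_def)
  have 1: "eL L (\<lambda>u. U n u w) = eL L (\<lambda>u. max 0 (Y (tn n * u) w) / tn n)" for n w
    by (rule eL_cong) (use p tn_pos[of n] in \<open>auto simp: U_def max_absorb2 less_imp_le\<close>)
  have 2: "eL L (\<lambda>u. V u w) = eL L (\<lambda>u. max 0 (Z u w))" for w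
    by (rule eL_cong) (use p in \<open>auto simp: V_def max_absorb2\<close>)
  show "(\<lambda>n. \<integral>w. eL L (\<lambda>u. U n u w) \<partial>M) \<longlonglongrightarrow> (\<integral>w. eL L (\<lambda>u. V u w) \<partial>P)"
    unfolding 1 2 by (rule fdd_limit[OF Q.besq_axioms tn_top tn_pos L])
qed

lemma U_eq: "0 \<le> u \<Longrightarrow> tn n * U n u w = max 0 (Y (tn n * u) w)"
  using tn_pos[of n] by (simp add: U_def max_absorb2)

text \<open>Transferred from the rescaled Y: convergence of the capped moments, then Fatou as the
  cap is removed. The rescaled bound \<open>(1 / tn n + u) powr p\<close> tends to
  \<open>u powr p\<close>, and this decay at 0, absent from \<open>(1 + u) powr p\<close>, is what
  compensates a negative \<gamma> in the limit.\<close>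

lemma V_moment:
  assumes p: "0 \<le> p" and u: "0 < u"
  shows "(\<integral>\<^sup>+w. ennreal (pw p (V u w)) \<partial>P) \<le> ennreal (MP p * u powr p)"
proof -
  have u0: "0 \<le> u" using u by simp
  note [measurable] = FC.V_meas[OF u0] FC.U_meas[OF u0]
  have [measurable]: "(\<lambda>x. pw p (max 0 x)) \<in> borel_measurable borel" by (rule pw_measurable[OF p])
  have capped: "(\<integral>w. pw p (max 0 (min (V u w) (real K))) \<partial>P) \<le> MP p * u powr p" for K :: nat
  proof (rule LIMSEQ_le)
    show "(\<lambda>n. \<integral>w. pw p (max 0 (min (U n u w) (real K))) \<partial>M) \<longlonglongrightarrow> (\<integral>w. pw p (max 0 (min (V u w) (real K))) \<partial>P)"
      using FC.goodD(3)[OF FC.good_mult_capped[OF FC.good_one u0 pw_cont[OF p], of "real K"], of "[]"] by simp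
    have "(\<lambda>n. inverse (tn n)) \<longlonglongrightarrow> 0" using tn_top by (rule tendsto_inverse_0_at_top)
    then have "(\<lambda>n. MP p * (inverse (tn n) + u) powr p) \<longlonglongrightarrow> MP p * (0 + u) powr p"
      using u by (intro tendsto_mult tendsto_const tendsto_powr tendsto_add) auto
    then show "(\<lambda>n. MP p * (inverse (tn n) + u) powr p) \<longlonglongrightarrow> MP p * u powr p" by simp
    have "(\<integral>w. pw p (max 0 (min (U n u w) (real K))) \<partial>M) \<le> MP p * (inverse (tn n) + u) powr p" for n
    proof -
      have t: "0 < tn n" by (rule tn_pos)
      have tu: "0 \<le> tn n * u" using t u by simp
      have le: "pw p (max 0 (min (U n u w) (real K))) \<le> inverse (tn n) powr p * (1 + \<bar>Y (tn n * u) w\<bar>) powr p" for w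
      proof -
        have "max 0 (min (U n u w) (real K)) \<le> U n u w" using U_nonneg by auto
        also have "U n u w \<le> inverse (tn n) * (1 + \<bar>Y (tn n * u) w\<bar>)"
          using t tu by (auto simp: U_def max_absorb2 divide_inverse mult.commute intro!: mult_left_mono)
        finally have "pw p (max 0 (min (U n u w) (real K))) \<le> (inverse (tn n) * (1 + \<bar>Y (tn n * u) w\<bar>)) powr p"
          using t by (intro pw_le[OF p]) (auto intro!: mult_pos_pos)
        then show ?thesis by (simp only: powr_mult)
      qed
      have i: "integrable M (\<lambda>w. inverse (tn n) powr p * (1 + \<bar>Y (tn n * u) w\<bar>) powr p)"
        by (intro integrable_mult_right Y_moment_powr tu p)
      have "integrable M (\<lambda>w. pw p (max 0 (min (U n u w) (real K))))"
        by (rule Bochner_Integration.integrable_bound[OF i]) (use le in \<open>auto simp: pw_nonneg\<close>)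
      then have "(\<integral>w. pw p (max 0 (min (U n u w) (real K))) \<partial>M) \<le> expectation (\<lambda>w. inverse (tn n) powr p * (1 + \<bar>Y (tn n * u) w\<bar>) powr p)"
        by (rule integral_mono[OF _ i le])
      also have "\<dots> = inverse (tn n) powr p * expectation (\<lambda>w. (1 + \<bar>Y (tn n * u) w\<bar>) powr p)" by simp
      also have "\<dots> \<le> inverse (tn n) powr p * (MP p * (1 + tn n * u) powr p)"
        by (intro mult_left_mono Y_moment_powr tu p) simp
      also have "\<dots> = MP p * (inverse (tn n) * (1 + tn n * u)) powr p" by (simp only: powr_mult mult_ac)
      also have "inverse (tn n) * (1 + tn n * u) = inverse (tn n) + u" using t by (simp add: field_simps)
      finally show ?thesis .
    qed
    then show "\<exists>N. \<forall>n\<ge>N. (\<integral>w. pw p (max 0 (min (U n u w) (real K))) \<partial>M) \<le> MP p * (inverse (tn n) + u) powr p" by blast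
  qed
  have cnn: "(\<integral>\<^sup>+w. ennreal (pw p (max 0 (min (V u w) (real K)))) \<partial>P) \<le> ennreal (MP p * u powr p)" for K :: nat
  proof -
    have b: "pw p (max 0 (min (V u w) (real K))) \<le> (real K + 1) powr p" for w by (intro pw_le[OF p]) auto
    have "integrable P (\<lambda>w. pw p (max 0 (min (V u w) (real K))))"
      by (rule Q.integrable_const_bound[where B="(real K + 1) powr p"]) (use b in \<open>auto simp: pw_nonneg\<close>)
    then have "(\<integral>\<^sup>+w. ennreal (pw p (max 0 (min (V u w) (real K)))) \<partial>P) = ennreal (\<integral>w. pw p (max 0 (min (V u w) (real K))) \<partial>P)"
      by (rule nn_integral_eq_integral) (auto simp: pw_nonneg)
    then show ?thesis using capped[of K] by (simp add: ennreal_leI)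
  qed
  have lim: "liminf (\<lambda>K. ennreal (pw p (max 0 (min (V u w) (real K))))) = ennreal (pw p (V u w))" for w
  proof (rule lim_imp_Liminf)
    have "eventually (\<lambda>K. V u w \<le> real K) sequentially"
      using filterlim_real_sequentially by (simp add: filterlim_at_top)
    then have "eventually (\<lambda>K. ennreal (pw p (max 0 (min (V u w) (real K)))) = ennreal (pw p (V u w))) sequentially"
      by (rule eventually_mono) (use V_nonneg in \<open>simp add: max_absorb2 min_absorb1\<close>)
    then show "(\<lambda>K. ennreal (pw p (max 0 (min (V u w) (real K))))) \<longlonglongrightarrow> ennreal (pw p (V u w))" by (rule tendsto_eventually)
  qed simp
  have "(\<integral>\<^sup>+w. ennreal (pw p (V u w)) \<partial>P) = (\<integral>\<^sup>+w. liminf (\<lambda>K. ennreal (pw p (max 0 (min (V u w) (real K))))) \<partial>P)"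
    by (simp only: lim)
  also have "\<dots> \<le> liminf (\<lambda>K. \<integral>\<^sup>+w. ennreal (pw p (max 0 (min (V u w) (real K)))) \<partial>P)"
    by (rule nn_integral_liminf) measurable
  also have "\<dots> \<le> liminf (\<lambda>K :: nat. ennreal (MP p * u powr p))"
    by (intro Liminf_mono always_eventually allI cnn)
  also have "\<dots> = ennreal (MP p * u powr p)" by (simp add: Liminf_const)
  finally show ?thesis .
qed

text \<open>\<xi> stands for the integrand of the rescaled \<open>A\<close> after the substitution
  \<open>s = tn n * u\<close>, and \<zeta> for its limit; the suffix \<open>K\<close> marks the
  versions with the space variable capped at \<open>K\<close>.\<close>

definition \<xi>f :: "nat \<Rightarrow> real \<Rightarrow> 'a \<Rightarrow> real" where
  "\<xi>f n u w = tn n powr (- (\<gamma> + \<alpha>)) * fY (tn n * u) w"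

definition \<xi>K :: "real \<Rightarrow> nat \<Rightarrow> real \<Rightarrow> 'a \<Rightarrow> real" where
  "\<xi>K K n u w = tn n powr (- (\<gamma> + \<alpha>)) * f (max 0 (tn n * u)) (max 0 (tn n * min (U n u w) K))"

definition \<zeta>f :: "real \<Rightarrow> 'b \<Rightarrow> real" where
  "\<zeta>f u w = \<rho> * u powr \<gamma> * pw \<alpha> (V u w)"

definition \<zeta>K :: "real \<Rightarrow> real \<Rightarrow> 'b \<Rightarrow> real" where
  "\<zeta>K K u w = \<rho> * u powr \<gamma> * pw \<alpha> (max 0 (min (V u w) K))"

lemma \<xi>f_joint [measurable]: "(\<lambda>(u, w). \<xi>f n u w) \<in> borel_measurable (borel \<Otimes>\<^sub>M M)"
proof -
  have "(\<lambda>p. (tn n * fst p, snd p)) \<in> measurable (borel \<Otimes>\<^sub>M M) (borel \<Otimes>\<^sub>M M)" by (intro measurable_Pair) auto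
  from measurable_compose[OF this fY_joint] have [measurable]: "(\<lambda>p. fY (tn n * fst p) (snd p)) \<in> borel_measurable (borel \<Otimes>\<^sub>M M)"
    by simp
  have "(\<lambda>p. tn n powr (- (\<gamma> + \<alpha>)) * fY (tn n * fst p) (snd p)) \<in> borel_measurable (borel \<Otimes>\<^sub>M M)" by measurable
  then show ?thesis by (simp add: \<xi>f_def case_prod_beta')
qed

lemma \<xi>K_joint [measurable]: "(\<lambda>(u, w). \<xi>K K n u w) \<in> borel_measurable (borel \<Otimes>\<^sub>M M)"
proof -
  have "(\<lambda>p. (tn n * fst p, tn n * min ((\<lambda>(u, w). U n u w) p) K)) \<in> measurable (borel \<Otimes>\<^sub>M M) (borel \<Otimes>\<^sub>M borel)"
    by measurable
  from measurable_compose[OF this f_measurable] have [measurable]: "(\<lambda>p. f (max 0 (tn n * fst p)) (max 0 (tn n * min (U n (fst p) (snd p)) K))) \<in> borel_measurable (borel \<Otimes>\<^sub>M M)"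
    by (simp add: case_prod_beta')
  have "(\<lambda>p. tn n powr (- (\<gamma> + \<alpha>)) * f (max 0 (tn n * fst p)) (max 0 (tn n * min (U n (fst p) (snd p)) K))) \<in> borel_measurable (borel \<Otimes>\<^sub>M M)" by measurable
  then show ?thesis by (simp add: \<xi>K_def case_prod_beta')
qed

lemma \<zeta>_joint [measurable]: 
  "(\<lambda>(u, w). \<zeta>f u w) \<in> borel_measurable (borel \<Otimes>\<^sub>M P)" "(\<lambda>(u, w). \<zeta>K K u w) \<in> borel_measurable (borel \<Otimes>\<^sub>M P)"
proof -
  have pm: "(\<lambda>x. pw \<alpha> (max 0 x)) \<in> borel_measurable borel" by (rule pw_measurable[OF params(2)])
  have "(\<lambda>p. \<rho> * fst p powr \<gamma> * (\<lambda>x. pw \<alpha> (max 0 x)) ((\<lambda>(u, w). V u w) p)) \<in> borel_measurable (borel \<Otimes>\<^sub>M P)"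
    using measurable_compose[OF V_joint pm] by measurable
  then show "(\<lambda>(u, w). \<zeta>f u w) \<in> borel_measurable (borel \<Otimes>\<^sub>M P)" using V_nonneg by (simp add: \<zeta>f_def case_prod_beta' max_absorb2)
  have "(\<lambda>p. min ((\<lambda>(u, w). V u w) p) K) \<in> borel_measurable (borel \<Otimes>\<^sub>M P)" by measurable
  from measurable_compose[OF this pm]
  have "(\<lambda>p. \<rho> * fst p powr \<gamma> * (\<lambda>x. pw \<alpha> (max 0 x)) (min ((\<lambda>(u, w). V u w) p) K)) \<in> borel_measurable (borel \<Otimes>\<^sub>M P)"
    by measurable
  then show "(\<lambda>(u, w). \<zeta>K K u w) \<in> borel_measurable (borel \<Otimes>\<^sub>M P)" by (simp add: \<zeta>K_def case_prod_beta')
qed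

lemma f_nonneg: "0 \<le> f (max 0 t) (max 0 z)" using Af by (auto simp: assumption_Af_def)

lemma \<xi>_nonneg: "0 \<le> \<xi>f n u w" "0 \<le> \<xi>K K n u w" "0 \<le> \<zeta>f u w'" "0 \<le> \<zeta>K K u w'"
  using fY_nonneg f_nonneg params by (auto simp: \<xi>f_def \<xi>K_def \<zeta>f_def \<zeta>K_def pw_nonneg)

text \<open>The moment of Y turns the two powers into the single power
  \<open>\<gamma> + \<alpha>\<close> of \<open>1 + tn n * u\<close>. As that exponent is positive,
  the bound is uniform down to \<open>u = 0\<close> even when \<gamma> is negative.\<close>

lemma \<xi>f_expectation:
  assumes u: "u \<in> {0..1}"
  shows "(\<integral>\<^sup>+w. ennreal (\<xi>f n u w) \<partial>M) \<le> ennreal (Cf * MP \<alpha> * 2 powr (\<gamma> + \<alpha>))"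
proof -
  have t: "1 \<le> tn n" by (rule tn_ge)
  have s: "0 \<le> tn n * u" using t u by simp
  have "(\<integral>\<^sup>+w. ennreal (\<xi>f n u w) \<partial>M) \<le> ennreal ((tn n powr (- (\<gamma> + \<alpha>)) * (Cf * (1 + tn n * u) powr \<gamma>)) * (MP \<alpha> * (1 + tn n * u) powr \<alpha>))"
  proof (rule Y_moment_nn[OF s params(2)])
    show "\<xi>f n u w \<le> tn n powr (- (\<gamma> + \<alpha>)) * (Cf * (1 + tn n * u) powr \<gamma>) * (1 + \<bar>Y (tn n * u) w\<bar>) powr \<alpha>" for w
      unfolding \<xi>f_def mult.assoc using fY_le[OF s, of w] by (intro mult_left_mono) (auto simp: mult.assoc)
  qed (use Cf(1) in auto)
  also have "\<dots> \<le> ennreal (Cf * MP \<alpha> * 2 powr (\<gamma> + \<alpha>))"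
  proof (rule ennreal_leI)
    have "tn n * u \<le> tn n * 1" using u t by (intro mult_left_mono) auto
    then have "1 + tn n * u \<le> 2 * tn n" using t by linarith
    then have "(1 + tn n * u) powr (\<gamma> + \<alpha>) \<le> (2 * tn n) powr (\<gamma> + \<alpha>)" using s params by (intro powr_mono2) auto
    then have "tn n powr (- (\<gamma> + \<alpha>)) * (1 + tn n * u) powr (\<gamma> + \<alpha>) \<le> tn n powr (- (\<gamma> + \<alpha>)) * (2 * tn n) powr (\<gamma> + \<alpha>)" by (intro mult_left_mono) auto
    also have "\<dots> = 2 powr (\<gamma> + \<alpha>) * (tn n powr (- (\<gamma> + \<alpha>)) * tn n powr (\<gamma> + \<alpha>))" by (simp only: powr_mult mult_ac)
    also have "tn n powr (- (\<gamma> + \<alpha>)) * tn n powr (\<gamma> + \<alpha>) = 1" using t by (simp add: powr_add[symmetric])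
    finally have "(Cf * MP \<alpha>) * (tn n powr (- (\<gamma> + \<alpha>)) * (1 + tn n * u) powr (\<gamma> + \<alpha>)) \<le> (Cf * MP \<alpha>) * (2 powr (\<gamma> + \<alpha>) * 1)"
      using Cf(1) MP_nonneg[OF params(2)] by (intro mult_left_mono) auto
    then show "tn n powr (- (\<gamma> + \<alpha>)) * (Cf * (1 + tn n * u) powr \<gamma>) * (MP \<alpha> * (1 + tn n * u) powr \<alpha>) \<le> Cf * MP \<alpha> * 2 powr (\<gamma> + \<alpha>)"
      by (simp only: powr_add mult_ac mult_1_right)
  qed
  finally show ?thesis .
qed

text \<open>One spare moment pays for the cap: the two integrands differ only where the value of Y
  is at least \<open>t * K\<close>, and there \<open>1 \<le> (1 + z) / (t * K)\<close> raises the
  power \<alpha> to \<open>\<alpha> + 1\<close> and leaves the factor \<open>1 / K\<close>.\<close>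

lemma \<xi>_error:
  assumes u: "u \<in> {0..1}" and K: "0 < K"
  shows "(\<integral>\<^sup>+w. ennreal \<bar>\<xi>f n u w - \<xi>K K n u w\<bar> \<partial>M) \<le> ennreal (Cf * MP (\<alpha> + 1) * 2 powr \<kappa> / K)"
proof -
  define t where "t = tn n"
  have t: "1 \<le> t" unfolding t_def by (rule tn_ge)
  define s where "s = t * u"
  have s: "0 \<le> s" using t u by (simp add: s_def)
  define c where "c = t powr (- (\<gamma> + \<alpha>)) * (Cf * (1 + s) powr \<gamma>) * inverse (t * K)"
  have "(\<integral>\<^sup>+w. ennreal \<bar>\<xi>f n u w - \<xi>K K n u w\<bar> \<partial>M) \<le> ennreal (c * (MP (\<alpha> + 1) * (1 + s) powr (\<alpha> + 1)))"
  proof (rule Y_moment_nn[OF s])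
    show "0 \<le> \<alpha> + 1" using params by simp
    show c0: "0 \<le> c" using Cf(1) t K by (simp add: c_def)
    fix w
    define z where "z = max 0 (Y s w)"
    have z: "0 \<le> z" "z \<le> \<bar>Y s w\<bar>" by (auto simp: z_def)
    have tU: "t * U n u w = z" using U_eq[of u n w] u by (simp add: z_def t_def s_def)
    have f1: "\<xi>f n u w = t powr (- (\<gamma> + \<alpha>)) * f s z" using s by (simp add: \<xi>f_def fY_def t_def[symmetric] s_def[symmetric] z_def max_absorb2)
    have f2: "\<xi>K K n u w = t powr (- (\<gamma> + \<alpha>)) * f s (max 0 (t * min (U n u w) K))" using s by (simp add: \<xi>K_def t_def[symmetric] s_def[symmetric] max_absorb2)
    show "\<bar>\<xi>f n u w - \<xi>K K n u w\<bar> \<le> c * (1 + \<bar>Y s w\<bar>) powr (\<alpha> + 1)"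
    proof (cases "U n u w \<le> K")
      case True
      then have "max 0 (t * min (U n u w) K) = z" using tU z by (simp add: min_absorb1 max_absorb2)
      then show ?thesis using c0 by (simp add: f1 f2)
    next
      case False
      then have "t * K \<le> t * U n u w" using t by (intro mult_left_mono) auto
      then have tK: "t * K \<le> z" by (simp add: tU)
      have tK0: "0 < t * K" using t K by simp
      have f2': "\<xi>K K n u w = t powr (- (\<gamma> + \<alpha>)) * f s (t * K)" using False tK0 by (simp add: f2 min_absorb2 max_absorb2)
      have b: "f s z \<le> Cf * (1 + s) powr \<gamma> * (1 + z) powr \<alpha>" by (rule Cf(2)[OF s z(1)])
      have "f s (t * K) \<le> Cf * (1 + s) powr \<gamma> * (1 + t * K) powr \<alpha>" using tK0 by (intro Cf(2)[OF s]) simp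
      also have "\<dots> \<le> Cf * (1 + s) powr \<gamma> * (1 + z) powr \<alpha>" using Cf(1) params tK tK0 by (intro mult_left_mono powr_mono2) auto
      finally have b2: "f s (t * K) \<le> Cf * (1 + s) powr \<gamma> * (1 + z) powr \<alpha>" .
      have n: "0 \<le> f s z" "0 \<le> f s (t * K)" using Af s z tK0 by (auto simp: assumption_Af_def)
      have "\<bar>\<xi>f n u w - \<xi>K K n u w\<bar> = t powr (- (\<gamma> + \<alpha>)) * \<bar>f s z - f s (t * K)\<bar>" 
        unfolding f1 f2' right_diff_distrib[symmetric] by (simp add: abs_mult)
      also have "\<dots> \<le> t powr (- (\<gamma> + \<alpha>)) * (Cf * (1 + s) powr \<gamma> * (1 + z) powr \<alpha>)"
        using b b2 n by (intro mult_left_mono) auto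
      also have "\<dots> \<le> t powr (- (\<gamma> + \<alpha>)) * (Cf * (1 + s) powr \<gamma> * ((1 + \<bar>Y s w\<bar>) powr (\<alpha> + 1) * inverse (t * K)))"
      proof -
        have "(1 + z) powr \<alpha> \<le> (1 + z) powr \<alpha> * ((1 + z) * inverse (t * K))"
        proof -
          have "1 \<le> (1 + z) * inverse (t * K)" using tK tK0 by (simp add: divide_inverse[symmetric])
          then have "(1 + z) powr \<alpha> * 1 \<le> (1 + z) powr \<alpha> * ((1 + z) * inverse (t * K))" by (intro mult_left_mono) auto
          then show ?thesis by simp
        qed
        also have "\<dots> = (1 + z) powr (\<alpha> + 1) * inverse (t * K)" using z by (simp add: powr_add)
        also have "\<dots> \<le> (1 + \<bar>Y s w\<bar>) powr (\<alpha> + 1) * inverse (t * K)" using z params t K by (intro mult_right_mono powr_mono2) auto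
        finally show ?thesis using Cf(1) by (intro mult_left_mono) auto
      qed
      also have "\<dots> = c * (1 + \<bar>Y s w\<bar>) powr (\<alpha> + 1)" by (simp only: c_def mult_ac)
      finally show ?thesis .
    qed
  qed
  also have "\<dots> \<le> ennreal (Cf * MP (\<alpha> + 1) * 2 powr \<kappa> / K)"
  proof (rule ennreal_leI)
    have "t * u \<le> t * 1" using u t by (intro mult_left_mono) auto
    then have "1 + s \<le> 2 * t" using t unfolding s_def by linarith
    then have "(1 + s) powr \<kappa> \<le> (2 * t) powr \<kappa>" using s \<kappa>_gt_1 by (intro powr_mono2) auto
    then have "t powr (- \<kappa>) * (1 + s) powr \<kappa> \<le> t powr (- \<kappa>) * (2 * t) powr \<kappa>" by (intro mult_left_mono) auto
    also have "\<dots> = 2 powr \<kappa> * (t powr (- \<kappa>) * t powr \<kappa>)" by (simp only: powr_mult mult_ac)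
    also have "t powr (- \<kappa>) * t powr \<kappa> = 1" using t by (simp add: powr_add[symmetric])
    finally have 1: "(Cf * MP (\<alpha> + 1) * inverse K) * (t powr (- \<kappa>) * (1 + s) powr \<kappa>) \<le> (Cf * MP (\<alpha> + 1) * inverse K) * (2 powr \<kappa> * 1)"
      using Cf(1) MP_nonneg[of "\<alpha> + 1"] params K by (intro mult_left_mono) auto
    have 2: "(1 + s) powr \<kappa> = (1 + s) powr \<gamma> * (1 + s) powr (\<alpha> + 1)" by (simp add: powr_add[symmetric] \<kappa>_def add_ac)
    have "t powr (- \<kappa>) = t powr (- (\<gamma> + \<alpha>) + (- 1))" by (rule arg_cong[where f="(powr) t"]) (simp add: \<kappa>_def)
    also have "\<dots> = t powr (- (\<gamma> + \<alpha>)) * t powr (- 1)" by (rule powr_add)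
    also have "t powr (- 1) = inverse t" using t by (simp add: powr_minus)
    finally have 3: "t powr (- \<kappa>) = t powr (- (\<gamma> + \<alpha>)) * inverse t" .
    show "c * (MP (\<alpha> + 1) * (1 + s) powr (\<alpha> + 1)) \<le> Cf * MP (\<alpha> + 1) * 2 powr \<kappa> / K"
      using 1 unfolding 2 3 c_def inverse_mult_distrib divide_inverse mult_1_right by (simp only: mult_ac)
  qed
  finally show ?thesis .
qed

text \<open>\<open>u powr \<gamma>\<close> may blow up at 0, but the moment contributes
  \<open>u powr \<alpha>\<close>, and \<open>\<gamma> + \<alpha> > 0\<close>.\<close>

lemma \<zeta>f_expectation:
  assumes u: "u \<in> {0..1}"
  shows "(\<integral>\<^sup>+w. ennreal (\<zeta>f u w) \<partial>P) \<le> ennreal (\<rho> * MP \<alpha>)"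
proof (cases "u = 0")
  case True
  then show ?thesis by (simp add: \<zeta>f_def)
next
  case False
  then have u0: "0 < u" "u \<le> 1" using u by auto
  have "0 \<le> u" using u0 by simp
  note [measurable] = FC.V_meas[OF this] 
  have "(\<lambda>w. pw \<alpha> (max 0 (V u w))) \<in> borel_measurable P" using pw_measurable[OF params(2)] by (rule measurable_compose[rotated]) measurable
  then have [measurable]: "(\<lambda>w. pw \<alpha> (V u w)) \<in> borel_measurable P" using V_nonneg by (simp add: max_absorb2)
  have "(\<integral>\<^sup>+w. ennreal (\<zeta>f u w) \<partial>P) = (\<integral>\<^sup>+w. ennreal (\<rho> * u powr \<gamma>) * ennreal (pw \<alpha> (V u w)) \<partial>P)"
    unfolding \<zeta>f_def using params by (simp add: ennreal_mult pw_nonneg)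
  also have "\<dots> = ennreal (\<rho> * u powr \<gamma>) * (\<integral>\<^sup>+w. ennreal (pw \<alpha> (V u w)) \<partial>P)" by (rule nn_integral_cmult) measurable
  also have "\<dots> \<le> ennreal (\<rho> * u powr \<gamma>) * ennreal (MP \<alpha> * u powr \<alpha>)" by (intro mult_left_mono V_moment params u0) simp
  also have "\<dots> = ennreal (\<rho> * MP \<alpha> * u powr (\<gamma> + \<alpha>))"
    using params MP_nonneg[OF params(2)] by (simp add: ennreal_mult[symmetric] powr_add mult_ac)
  also have "\<dots> \<le> ennreal (\<rho> * MP \<alpha>)"
  proof (rule ennreal_leI)
    have "u powr (\<gamma> + \<alpha>) \<le> 1" using u0 params by (intro powr_le1) auto
    then have "\<rho> * MP \<alpha> * u powr (\<gamma> + \<alpha>) \<le> \<rho> * MP \<alpha> * 1" using params MP_nonneg[OF params(2)] by (intro mult_left_mono) auto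
    then show "\<rho> * MP \<alpha> * u powr (\<gamma> + \<alpha>) \<le> \<rho> * MP \<alpha>" by simp
  qed
  finally show ?thesis .
qed

text \<open>As for \<open>\<xi>_error\<close>, a spare moment is traded for \<open>1 / K\<close>,
  now with the moments of the limit process.\<close>

lemma \<zeta>_error:
  assumes u: "u \<in> {0..1}" and K: "0 < K"
  shows "(\<integral>\<^sup>+w. ennreal \<bar>\<zeta>f u w - \<zeta>K K u w\<bar> \<partial>P) \<le> ennreal (\<rho> * MP (\<alpha> + 1) / K)"
proof (cases "u = 0")
  case True
  then show ?thesis by (simp add: \<zeta>f_def \<zeta>K_def)
next
  case False
  then have u0: "0 < u" "u \<le> 1" using u by auto
  have p1: "0 \<le> \<alpha> + 1" using params by simp
  have "0 \<le> u" using u0 by simp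
  note [measurable] = FC.V_meas[OF this] 
  have "(\<lambda>w. pw (\<alpha> + 1) (max 0 (V u w))) \<in> borel_measurable P" using pw_measurable[OF p1] by (rule measurable_compose[rotated]) measurable
  then have [measurable]: "(\<lambda>w. pw (\<alpha> + 1) (V u w)) \<in> borel_measurable P" using V_nonneg by (simp add: max_absorb2)
  have le: "\<bar>\<zeta>f u w - \<zeta>K K u w\<bar> \<le> (\<rho> * u powr \<gamma> * inverse K) * pw (\<alpha> + 1) (V u w)" for w
  proof (cases "V u w \<le> K")
    case True
    then have "\<zeta>f u w = \<zeta>K K u w" using V_nonneg by (simp add: \<zeta>f_def \<zeta>K_def min_absorb1 max_absorb2)
    then show ?thesis using params K by (simp add: pw_nonneg)
  next
    case False
    then have v: "K < V u w" "0 < V u w" using K by auto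
    have "pw \<alpha> K \<le> pw \<alpha> (V u w)" using v K by (intro pw_mono params) auto
    then have "\<bar>pw \<alpha> (V u w) - pw \<alpha> K\<bar> \<le> pw \<alpha> (V u w)" using pw_nonneg[of \<alpha> K] by simp
    also have "\<dots> = V u w powr \<alpha> * 1" using v by (simp add: pw_pos_eq)
    also have "\<dots> \<le> V u w powr \<alpha> * (V u w * inverse K)"
      using v K by (intro mult_left_mono) (auto simp: divide_inverse[symmetric])
    also have "\<dots> = inverse K * pw (\<alpha> + 1) (V u w)" using v by (simp add: pw_pos_eq powr_add)
    finally have 1: "\<bar>pw \<alpha> (V u w) - pw \<alpha> K\<bar> \<le> inverse K * pw (\<alpha> + 1) (V u w)" .
    have "\<zeta>f u w - \<zeta>K K u w = (\<rho> * u powr \<gamma>) * (pw \<alpha> (V u w) - pw \<alpha> K)"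
      using v K by (simp add: \<zeta>f_def \<zeta>K_def min_absorb2 max_absorb2 right_diff_distrib)
    then have "\<bar>\<zeta>f u w - \<zeta>K K u w\<bar> = (\<rho> * u powr \<gamma>) * \<bar>pw \<alpha> (V u w) - pw \<alpha> K\<bar>"
      using params by (simp add: abs_mult)
    also have "\<dots> \<le> (\<rho> * u powr \<gamma>) * (inverse K * pw (\<alpha> + 1) (V u w))" using params by (intro mult_left_mono 1) auto
    finally show ?thesis by (simp only: mult_ac)
  qed
  have "(\<integral>\<^sup>+w. ennreal \<bar>\<zeta>f u w - \<zeta>K K u w\<bar> \<partial>P) \<le> (\<integral>\<^sup>+w. ennreal (\<rho> * u powr \<gamma> * inverse K) * ennreal (pw (\<alpha> + 1) (V u w)) \<partial>P)"
  proof (rule nn_integral_mono)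
    fix w
    have "ennreal \<bar>\<zeta>f u w - \<zeta>K K u w\<bar> \<le> ennreal ((\<rho> * u powr \<gamma> * inverse K) * pw (\<alpha> + 1) (V u w))" by (rule ennreal_leI[OF le])
    also have "\<dots> = ennreal (\<rho> * u powr \<gamma> * inverse K) * ennreal (pw (\<alpha> + 1) (V u w))"
      by (rule ennreal_mult) (use params K in \<open>auto simp: pw_nonneg\<close>)
    finally show "ennreal \<bar>\<zeta>f u w - \<zeta>K K u w\<bar> \<le> ennreal (\<rho> * u powr \<gamma> * inverse K) * ennreal (pw (\<alpha> + 1) (V u w))" .
  qed
  also have "\<dots> = ennreal (\<rho> * u powr \<gamma> * inverse K) * (\<integral>\<^sup>+w. ennreal (pw (\<alpha> + 1) (V u w)) \<partial>P)" by (rule nn_integral_cmult) measurable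
  also have "\<dots> \<le> ennreal (\<rho> * u powr \<gamma> * inverse K) * ennreal (MP (\<alpha> + 1) * u powr (\<alpha> + 1))" by (intro mult_left_mono V_moment p1 u0) simp
  also have "\<dots> = ennreal (\<rho> * MP (\<alpha> + 1) * inverse K * (u powr \<gamma> * u powr (\<alpha> + 1)))"
    using params MP_nonneg[OF p1] K by (simp add: ennreal_mult[symmetric] mult_ac)
  also have "\<dots> \<le> ennreal (\<rho> * MP (\<alpha> + 1) / K)"
  proof (rule ennreal_leI)
    have "u powr \<gamma> * u powr (\<alpha> + 1) \<le> 1" unfolding powr_add[symmetric] using u0 params by (intro powr_le1) auto
    then have "\<rho> * MP (\<alpha> + 1) * inverse K * (u powr \<gamma> * u powr (\<alpha> + 1)) \<le> \<rho> * MP (\<alpha> + 1) * inverse K * 1" using params MP_nonneg[OF p1] K by (intro mult_left_mono) auto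
    then show "\<rho> * MP (\<alpha> + 1) * inverse K * (u powr \<gamma> * u powr (\<alpha> + 1)) \<le> \<rho> * MP (\<alpha> + 1) / K" by (simp add: divide_inverse)
  qed
  finally show ?thesis .
qed

end

lemma leb_on_integral_bounds:
  fixes h :: "real \<Rightarrow> real"
  assumes h: "h \<in> borel_measurable borel" "\<And>u. 0 \<le> h u" "\<And>u. h u \<le> D" and ab: "0 \<le> b - a" "b - a \<le> 1"
  shows "(\<integral>u. h u \<partial>leb_on a b) \<in> {0..D}"
proof -
  have D: "0 \<le> D" using h(2,3)[of 0] by linarith
  have i: "integrable lborel (\<lambda>u. D * indicator {a..b} u)"
    by (intro integrable_mult_right) (simp add: integrable_indicator_iff emeasure_lborel_Icc_eq)
  have i2: "integrable lborel (\<lambda>u. indicator {a..b} u * h u)"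
    using h(1) by (intro Bochner_Integration.integrable_bound[OF i]) (use h D in \<open>auto simp: indicator_def\<close>)
  have "(\<integral>u. indicator {a..b} u * h u \<partial>lborel) \<le> (\<integral>u. D * indicator {a..b} u \<partial>lborel)"
    by (rule integral_mono[OF i2 i]) (use h D in \<open>auto simp: indicator_def\<close>)
  also have "\<dots> = D * (b - a)" using ab by simp
  also have "\<dots> \<le> D" using D ab by (simp add: mult_left_le)
  finally have "(\<integral>u. h u \<partial>leb_on a b) \<le> D" unfolding leb_on_integral[OF h(1)] .
  moreover have "0 \<le> (\<integral>u. h u \<partial>leb_on a b)" by (intro integral_nonneg_AE AE_I2 h(2))
  ultimately show ?thesis by simp
qed

lemma (in prob_space) expectation_diff_le:
  assumes [measurable]: "X \<in> borel_measurable M" "X' \<in> borel_measurable M" "h \<in> borel_measurable borel"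
    and nn: "\<And>w. 0 \<le> X w" "\<And>w. 0 \<le> X' w" and h1: "\<And>x. \<bar>h x\<bar> \<le> (1 :: real)"
    and h: "\<And>x x'. 0 \<le> x \<Longrightarrow> 0 \<le> x' \<Longrightarrow> \<bar>h x - h x'\<bar> \<le> \<epsilon> + C * \<bar>x - x'\<bar>" and C: "0 \<le> C"
    and i: "integrable M (\<lambda>w. \<bar>X w - X' w\<bar>)" and b: "expectation (\<lambda>w. \<bar>X w - X' w\<bar>) \<le> b"
  shows "\<bar>expectation (\<lambda>w. h (2 * X w)) - expectation (\<lambda>w. h (2 * X' w))\<bar> \<le> \<epsilon> + 2 * C * b"
proof -
  have i1: "integrable M (\<lambda>w. h (2 * X w))" "integrable M (\<lambda>w. h (2 * X' w))"
    using h1 by (auto intro!: integrable_const_bound[where B=1])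
  have i2: "integrable M (\<lambda>w. \<epsilon> + 2 * C * \<bar>X w - X' w\<bar>)" by (intro Bochner_Integration.integrable_add integrable_mult_right i) simp
  have "\<bar>expectation (\<lambda>w. h (2 * X w)) - expectation (\<lambda>w. h (2 * X' w))\<bar> = \<bar>expectation (\<lambda>w. h (2 * X w) - h (2 * X' w))\<bar>"
    using i1 by simp
  also have "\<dots> \<le> expectation (\<lambda>w. \<bar>h (2 * X w) - h (2 * X' w)\<bar>)" by (rule integral_abs_bound)
  also have "\<dots> \<le> expectation (\<lambda>w. \<epsilon> + 2 * C * \<bar>X w - X' w\<bar>)"
  proof (rule integral_mono[OF _ i2])
    show "integrable M (\<lambda>w. \<bar>h (2 * X w) - h (2 * X' w)\<bar>)" using i1 by (intro integrable_abs Bochner_Integration.integrable_diff)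
    fix w
    have "\<bar>2 * X w - 2 * X' w\<bar> = 2 * \<bar>X w - X' w\<bar>" unfolding right_diff_distrib[symmetric] abs_mult by simp
    then show "\<bar>h (2 * X w) - h (2 * X' w)\<bar> \<le> \<epsilon> + 2 * C * \<bar>X w - X' w\<bar>"
      using h[of "2 * X w" "2 * X' w"] nn by (simp add: mult_ac)
  qed
  also have "\<dots> = \<epsilon> + 2 * C * expectation (\<lambda>w. \<bar>X w - X' w\<bar>)"
    using i by (simp add: prob_space)
  also have "\<dots> \<le> \<epsilon> + 2 * C * b" using b C by (intro add_left_mono mult_left_mono) auto
  finally show ?thesis .
qed

section \<open>Truncated functionals and the limit of the rescaled integral\<close>

context besq_scaling
begin

lemma powr_interval:
  assumes "0 < \<eta>" "\<eta> \<le> a" "a \<le> 2" shows "a powr \<gamma> \<le> \<eta> powr \<gamma> + 2 powr \<gamma>"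
proof (cases "0 \<le> \<gamma>")
  case True
  then have "a powr \<gamma> \<le> 2 powr \<gamma>" using assms by (intro powr_mono2) auto
  then show ?thesis using powr_ge_zero[of \<eta> \<gamma>] by linarith
next
  case False
  then have "a powr \<gamma> \<le> \<eta> powr \<gamma>" using assms by (intro powr_mono2') auto
  then show ?thesis using powr_ge_zero[of 2 \<gamma>] by linarith
qed

definition DK :: "real \<Rightarrow> real \<Rightarrow> real" where
  "DK \<eta> K = (Cf + \<rho>) * ((\<eta> powr \<gamma> + 2 powr \<gamma>) * (1 + K) powr \<alpha>)"

lemma K_bounds:
  assumes \<eta>: "0 < \<eta>" and K: "0 \<le> K" and u: "u \<in> {\<eta>..1}"
  shows "\<xi>K K n u w \<le> DK \<eta> K" "\<zeta>K K u w' \<le> DK \<eta> K"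
proof -
  let ?m = "(\<eta> powr \<gamma> + 2 powr \<gamma>) * (1 + K) powr \<alpha>"
  have m0: "0 \<le> ?m" by simp
  define t where "t = tn n"
  have t: "1 \<le> t" unfolding t_def by (rule tn_ge)
  define x where "x = min (U n u w) K"
  have x: "0 \<le> x" "x \<le> K" using U_nonneg K by (auto simp: x_def)
  have tx: "0 \<le> t * u" "0 \<le> t * x" using t u \<eta> x by auto
  have "\<xi>K K n u w = t powr (- (\<gamma> + \<alpha>)) * f (t * u) (t * x)" using tx by (simp add: \<xi>K_def t_def x_def max_absorb2)
  also have "\<dots> \<le> t powr (- (\<gamma> + \<alpha>)) * (Cf * (1 + t * u) powr \<gamma> * (1 + t * x) powr \<alpha>)"
    by (intro mult_left_mono Cf(2) tx) simp
  also have "\<dots> = Cf * (t powr (- (\<gamma> + \<alpha>)) * ((1 + t * u) powr \<gamma> * (1 + t * x) powr \<alpha>))" by (simp only: mult_ac)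
  also have "\<dots> = Cf * ((1 / t + u) powr \<gamma> * (1 / t + x) powr \<alpha>)" using t by (simp only: powr_rescale)
  also have "\<dots> \<le> Cf * ?m"
  proof (intro mult_left_mono mult_mono)
    have t1: "0 \<le> 1 / t" "1 / t \<le> 1" using t by auto
    have "\<eta> \<le> u" "u \<le> 1" using u by auto
    with t1 have "\<eta> \<le> 1 / t + u" "1 / t + u \<le> 2" by linarith+
    then show "(1 / t + u) powr \<gamma> \<le> \<eta> powr \<gamma> + 2 powr \<gamma>" by (rule powr_interval[OF \<eta>])
    show "(1 / t + x) powr \<alpha> \<le> (1 + K) powr \<alpha>" using t1 x params by (intro powr_mono2) auto
  qed (use Cf(1) in auto)
  also have "\<dots> \<le> (Cf + \<rho>) * ?m" using params m0 by (intro mult_right_mono) auto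
  finally show "\<xi>K K n u w \<le> DK \<eta> K" unfolding DK_def .
  have "\<zeta>K K u w' \<le> \<rho> * ?m"
    unfolding \<zeta>K_def mult.assoc
  proof (intro mult_left_mono mult_mono)
    show "u powr \<gamma> \<le> \<eta> powr \<gamma> + 2 powr \<gamma>" using u by (intro powr_interval[OF \<eta>]) auto
    show "pw \<alpha> (max 0 (min (V u w') K)) \<le> (1 + K) powr \<alpha>" using K by (intro pw_le params) auto
  qed (use params in \<open>auto simp: pw_nonneg\<close>)
  also have "\<dots> \<le> (Cf + \<rho>) * ?m" using Cf(1) m0 by (intro mult_right_mono) auto
  finally show "\<zeta>K K u w' \<le> DK \<eta> K" unfolding DK_def .
qed

text \<open>By \<open>f_scaled_uniform\<close> the capped integrand is, up to a uniformly small
  error, \<open>\<rho> * u powr \<gamma>\<close> times a continuous function of the capped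
  \<open>U n u\<close>, which is the situation of \<open>good_mult_capped\<close>.\<close>

lemma good_\<xi>K:
  assumes E: "FC.good E E'" and \<eta>: "0 < \<eta>" and K: "0 \<le> K" and u: "u \<in> {\<eta>..1}"
  shows "FC.good (\<lambda>n w. E n w * \<xi>K K n u w) (\<lambda>w. E' w * \<zeta>K K u w)"
proof -
  obtain C where C: "0 \<le> C" "\<And>n w. w \<in> space M \<Longrightarrow> \<bar>E n w\<bar> \<le> C" "\<And>w. w \<in> space P \<Longrightarrow> \<bar>E' w\<bar> \<le> C"
    using FC.good_bound[OF E] by blast
  have u0: "0 < u" "0 \<le> u" using u \<eta> by auto
  have [measurable]: "\<xi>K K n u \<in> borel_measurable M" for n using measurable_compose[OF measurable_Pair1' \<xi>K_joint, of u] by simp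
  have [measurable]: "\<zeta>K K u \<in> borel_measurable P" using measurable_compose[OF measurable_Pair1' \<zeta>_joint(2), of u] by simp
  note [measurable] = FC.goodD(1,2)[OF E]
  show ?thesis
  proof (rule FC.good_limit)
    show "(\<lambda>w. E n w * \<xi>K K n u w) \<in> borel_measurable M" for n by measurable
    show "(\<lambda>w. E' w * \<zeta>K K u w) \<in> borel_measurable P" by measurable
    show "\<bar>E n w * \<xi>K K n u w\<bar> \<le> C * DK \<eta> K" if "w \<in> space M" for n w
      unfolding abs_mult using C(1) C(2)[OF that] K_bounds(1)[OF \<eta> K u] \<xi>_nonneg(2) by (intro mult_mono) auto
    show "\<bar>E' w * \<zeta>K K u w\<bar> \<le> C * DK \<eta> K" if "w \<in> space P" for w
      unfolding abs_mult using C(1) C(3)[OF that] K_bounds(2)[OF \<eta> K u] \<xi>_nonneg(4) by (intro mult_mono) auto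
    fix \<epsilon> :: real assume e: "0 < \<epsilon>"
    let ?c = "\<rho> * u powr \<gamma>"
    let ?H = "\<lambda>n w. ?c * (E n w * pw \<alpha> (max 0 (min (U n u w) K)))"
    let ?H' = "\<lambda>w. ?c * (E' w * pw \<alpha> (max 0 (min (V u w) K)))"
    have 1: "FC.good ?H ?H'"
      by (intro FC.good_cmult FC.good_mult_capped[OF E u0(2) pw_cont[OF params(2)] K])
    have "0 < \<epsilon> / (C + 1)" using e C by simp
    then have "eventually (\<lambda>n. \<forall>x\<in>{0..K}. \<bar>tn n powr (- (\<gamma> + \<alpha>)) * f (tn n * u) (tn n * x) - \<rho> * u powr \<gamma> * pw \<alpha> x\<bar> \<le> \<epsilon> / (C + 1)) sequentially"
      by (intro eventually_compose_filterlim[OF f_scaled_uniform tn_top] u0 K)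
    then have 2: "eventually (\<lambda>n. \<forall>w\<in>space M. \<bar>E n w * \<xi>K K n u w - ?H n w\<bar> \<le> \<epsilon>) sequentially"
    proof (rule eventually_mono, intro ballI)
      fix n w assume b: "\<forall>x\<in>{0..K}. \<bar>tn n powr (- (\<gamma> + \<alpha>)) * f (tn n * u) (tn n * x) - \<rho> * u powr \<gamma> * pw \<alpha> x\<bar> \<le> \<epsilon> / (C + 1)"
        and w: "w \<in> space M"
      let ?x = "min (U n u w) K"
      have x: "?x \<in> {0..K}" using U_nonneg K by auto
      have z: "\<xi>K K n u w = tn n powr (- (\<gamma> + \<alpha>)) * f (tn n * u) (tn n * ?x)" "max 0 ?x = ?x"
        using x u0 tn_pos[of n] by (auto simp: \<xi>K_def max_absorb2)
      have "\<bar>E n w * \<xi>K K n u w - ?H n w\<bar> = \<bar>E n w\<bar> * \<bar>\<xi>K K n u w - ?c * pw \<alpha> ?x\<bar>"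
        unfolding z(2) abs_mult[symmetric] by (simp add: algebra_simps)
      also have "\<dots> \<le> C * (\<epsilon> / (C + 1))" unfolding z(1) using C(1) C(2)[OF w] bspec[OF b x] by (intro mult_mono) auto
      also have "\<dots> \<le> \<epsilon>" using C(1) e by (simp add: field_simps)
      finally show "\<bar>E n w * \<xi>K K n u w - ?H n w\<bar> \<le> \<epsilon>" .
    qed
    have 3: "\<forall>w\<in>space P. \<bar>E' w * \<zeta>K K u w - ?H' w\<bar> \<le> \<epsilon>" using e by (simp add: \<zeta>K_def)
    show "\<exists>H H'. FC.good H H' \<and> eventually (\<lambda>n. \<forall>w\<in>space M. \<bar>E n w * \<xi>K K n u w - H n w\<bar> \<le> \<epsilon>) sequentially \<and> (\<forall>w\<in>space P. \<bar>E' w * \<zeta>K K u w - H' w\<bar> \<le> \<epsilon>)"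
      by (rule exI[of _ ?H], rule exI[of _ ?H']) (intro conjI 1 2 3)
  qed
qed

text \<open>One parameter for both truncations: times below \<eta> are dropped and values are capped
  at \<open>1 / \<eta>\<close>, so that both errors are of order \<eta>.\<close>

definition \<Xi> :: "real \<Rightarrow> nat \<Rightarrow> real \<Rightarrow> 'a \<Rightarrow> real" where "\<Xi> \<eta> n u w = indicator {\<eta>..1} u * \<xi>K (1 / \<eta>) n u w"
definition Zt :: "real \<Rightarrow> real \<Rightarrow> 'b \<Rightarrow> real" where "Zt \<eta> u w = indicator {\<eta>..1} u * \<zeta>K (1 / \<eta>) u w"

lemma trunc_bounds:
  assumes "0 < \<eta>"
  shows "0 \<le> \<Xi> \<eta> n u w" "\<Xi> \<eta> n u w \<le> DK \<eta> (1 / \<eta>)" "0 \<le> Zt \<eta> u w'" "Zt \<eta> u w' \<le> DK \<eta> (1 / \<eta>)"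
proof -
  have D: "0 \<le> DK \<eta> (1 / \<eta>)" using Cf(1) params by (simp add: DK_def)
  show "0 \<le> \<Xi> \<eta> n u w" "0 \<le> Zt \<eta> u w'" using \<xi>_nonneg by (auto simp: \<Xi>_def Zt_def)
  show "\<Xi> \<eta> n u w \<le> DK \<eta> (1 / \<eta>)" "Zt \<eta> u w' \<le> DK \<eta> (1 / \<eta>)"
    using K_bounds[OF assms, of "1 / \<eta>" u] assms D by (auto simp: \<Xi>_def Zt_def indicator_def)
qed

lemma trunc_joint [measurable]:
  "(\<lambda>(u, w). \<Xi> \<eta> n u w) \<in> borel_measurable (borel \<Otimes>\<^sub>M M)" "(\<lambda>(u, w). Zt \<eta> u w) \<in> borel_measurable (borel \<Otimes>\<^sub>M P)"
proof -
  have "(\<lambda>p. indicator {\<eta>..1} (fst p) * (\<lambda>(u, w). \<xi>K (1 / \<eta>) n u w) p) \<in> borel_measurable (borel \<Otimes>\<^sub>M M)" by measurable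
  then show "(\<lambda>(u, w). \<Xi> \<eta> n u w) \<in> borel_measurable (borel \<Otimes>\<^sub>M M)" by (simp add: \<Xi>_def case_prod_beta')
  have "(\<lambda>p. indicator {\<eta>..1} (fst p) * (\<lambda>(u, w). \<zeta>K (1 / \<eta>) u w) p) \<in> borel_measurable (borel \<Otimes>\<^sub>M P)" by measurable
  then show "(\<lambda>(u, w). Zt \<eta> u w) \<in> borel_measurable (borel \<Otimes>\<^sub>M P)" by (simp add: Zt_def case_prod_beta')
qed

text \<open>\<open>good_integral\<close> supplies the step that \<open>good_continuous\<close>
  iterates. The empty list of test times then turns goodness into convergence of the plain
  expectation.\<close>

lemma trunc_convergence:
  assumes \<eta>: "0 < \<eta>" "\<eta> \<le> 1" and q: "continuous_on UNIV (q :: real \<Rightarrow> real)"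
  shows "(\<lambda>n. \<integral>w. q (\<integral>u. \<Xi> \<eta> n u w \<partial>leb_on \<eta> 1) \<partial>M) \<longlonglongrightarrow> (\<integral>w. q (\<integral>u. Zt \<eta> u w \<partial>leb_on \<eta> 1) \<partial>P)"
proof -
  have K: "0 \<le> 1 / \<eta>" using \<eta> by simp
  have swap: "(\<lambda>p. (snd p, fst p)) \<in> measurable (M \<Otimes>\<^sub>M borel) (borel \<Otimes>\<^sub>M M)" "(\<lambda>p. (snd p, fst p)) \<in> measurable (P \<Otimes>\<^sub>M borel) (borel \<Otimes>\<^sub>M P)"
    by (intro measurable_Pair; simp)+
  have m: "(\<lambda>(w, u). \<Xi> \<eta> n u w) \<in> borel_measurable (M \<Otimes>\<^sub>M borel)" "(\<lambda>(w, u). Zt \<eta> u w) \<in> borel_measurable (P \<Otimes>\<^sub>M borel)" for n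
    using measurable_compose[OF swap(1) trunc_joint(1)] measurable_compose[OF swap(2) trunc_joint(2)] by (simp_all add: case_prod_beta')
  have secM: "(\<lambda>u. \<Xi> \<eta> n u w) \<in> borel_measurable borel" if "w \<in> space M" for n w
    using measurable_compose[OF measurable_Pair2'[OF that] trunc_joint(1)] by simp
  have secP: "(\<lambda>u. Zt \<eta> u w) \<in> borel_measurable borel" if "w \<in> space P" for w
    using measurable_compose[OF measurable_Pair2'[OF that] trunc_joint(2)] by simp
  have "FC.good (\<lambda>n w. 1 * q (\<integral>u. \<Xi> \<eta> n u w \<partial>leb_on \<eta> 1)) (\<lambda>w. 1 * q (\<integral>u. Zt \<eta> u w \<partial>leb_on \<eta> 1))"
  proof (rule FC.good_continuous[OF FC.good_one _ _ _ q])
    show "(\<integral>u. \<Xi> \<eta> n u w \<partial>leb_on \<eta> 1) \<in> {0..DK \<eta> (1 / \<eta>)}" if "w \<in> space M" for n w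
      by (rule leb_on_integral_bounds[OF secM[OF that]]) (use trunc_bounds[OF \<eta>(1)] \<eta> in auto)
    show "(\<integral>u. Zt \<eta> u w \<partial>leb_on \<eta> 1) \<in> {0..DK \<eta> (1 / \<eta>)}" if "w \<in> space P" for w
      by (rule leb_on_integral_bounds[OF secP[OF that]]) (use trunc_bounds[OF \<eta>(1)] \<eta> in auto)
    fix G G' assume G: "FC.good G G'"
    show "FC.good (\<lambda>n w. G n w * (\<integral>u. \<Xi> \<eta> n u w \<partial>leb_on \<eta> 1)) (\<lambda>w. G' w * (\<integral>u. Zt \<eta> u w \<partial>leb_on \<eta> 1))"
    proof (rule FC.good_integral[OF G m])
      show "\<bar>\<Xi> \<eta> n u w\<bar> \<le> DK \<eta> (1 / \<eta>)" for n u w using trunc_bounds[OF \<eta>(1)] by simp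
      show "\<bar>Zt \<eta> u w\<bar> \<le> DK \<eta> (1 / \<eta>)" for u w using trunc_bounds[OF \<eta>(1)] by simp
      show "FC.good (\<lambda>n w. G n w * \<Xi> \<eta> n u w) (\<lambda>w. G' w * Zt \<eta> u w)" if "u \<in> {\<eta>..1}" for u
        using good_\<xi>K[OF G \<eta>(1) K that] that by (simp add: \<Xi>_def Zt_def)
    qed
  qed
  from FC.goodD(3)[OF this, of "[]"] show ?thesis by simp
qed

definition C1 :: real where "C1 = Cf * MP \<alpha> * 2 powr (\<gamma> + \<alpha>) + \<rho> * MP \<alpha>"
definition C2 :: real where "C2 = Cf * MP (\<alpha> + 1) * 2 powr \<kappa> + \<rho> * MP (\<alpha> + 1)"

lemma C12: "0 \<le> C1" "0 \<le> C2" "Cf * MP \<alpha> * 2 powr (\<gamma> + \<alpha>) \<le> C1" "\<rho> * MP \<alpha> \<le> C1"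
  "Cf * MP (\<alpha> + 1) * 2 powr \<kappa> \<le> C2" "\<rho> * MP (\<alpha> + 1) \<le> C2"
  using Cf(1) params MP_nonneg[of \<alpha>] MP_nonneg[of "\<alpha> + 1"] by (auto simp: C1_def C2_def)

lemma trunc_error_bound: "0 \<le> \<eta> \<Longrightarrow> \<eta> \<le> 1 \<Longrightarrow> (C1 + C2 * \<eta>) * \<eta> + C2 * \<eta> \<le> (C1 + 2 * C2) * \<eta>"
proof -
  assume e: "0 \<le> \<eta>" "\<eta> \<le> 1"
  have "C2 * \<eta> * \<eta> \<le> C2 * \<eta> * 1" using C12 e by (intro mult_left_mono) auto
  then show ?thesis by (simp add: algebra_simps)
qed

lemma trunc_M:
  fixes n
  assumes \<eta>: "0 < \<eta>" "\<eta> \<le> 1"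
  defines "I \<equiv> \<lambda>w. \<integral>s. indicator {0..1} s * \<xi>f n s w \<partial>lborel" and "J \<equiv> \<lambda>w. \<integral>s. \<Xi> \<eta> n s w \<partial>leb_on \<eta> 1"
  shows "I \<in> borel_measurable M" "J \<in> borel_measurable M" "integrable M (\<lambda>w. \<bar>I w - J w\<bar>)"
    "expectation (\<lambda>w. \<bar>I w - J w\<bar>) \<le> (C1 + 2 * C2) * \<eta>"
proof -
  have K: "0 < 1 / \<eta>" using \<eta> by simp
  have in1: "(\<integral>\<^sup>+w. ennreal \<bar>\<xi>f n s w - \<Xi> \<eta> n s w\<bar> \<partial>M) \<le> ennreal (C2 * \<eta>)" if "s \<in> {\<eta>..1}" for s
  proof -
    have "(\<integral>\<^sup>+w. ennreal \<bar>\<xi>f n s w - \<Xi> \<eta> n s w\<bar> \<partial>M) \<le> ennreal (Cf * MP (\<alpha> + 1) * 2 powr \<kappa> / (1 / \<eta>))"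
      using \<xi>_error[OF _ K, of s n] that \<eta> by (simp add: \<Xi>_def)
    also have "\<dots> \<le> ennreal (C2 * \<eta>)" using C12(5) \<eta> by (intro ennreal_leI) (simp add: mult_right_mono)
    finally show ?thesis .
  qed
  have c: "0 \<le> C1" "0 \<le> C2 * \<eta>" using C12 \<eta> by auto
  have in2: "(\<integral>\<^sup>+w. ennreal \<bar>\<xi>f n s w - \<Xi> \<eta> n s w\<bar> \<partial>M) \<le> ennreal (C1 + C2 * \<eta>)" if s: "s \<in> {0..\<eta>}" for s
  proof (cases "s = \<eta>")
    case True
    then have "(\<integral>\<^sup>+w. ennreal \<bar>\<xi>f n s w - \<Xi> \<eta> n s w\<bar> \<partial>M) \<le> ennreal (C2 * \<eta>)" using \<eta> by (intro in1) auto
    also have "\<dots> \<le> ennreal (C1 + C2 * \<eta>)" using c by (intro ennreal_leI) simp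
    finally show ?thesis .
  next
    case False
    then have "(\<integral>\<^sup>+w. ennreal \<bar>\<xi>f n s w - \<Xi> \<eta> n s w\<bar> \<partial>M) = (\<integral>\<^sup>+w. ennreal (\<xi>f n s w) \<partial>M)"
      using s \<xi>_nonneg(1) by (simp add: \<Xi>_def)
    also have "\<dots> \<le> ennreal (Cf * MP \<alpha> * 2 powr (\<gamma> + \<alpha>))" using s \<eta> by (intro \<xi>f_expectation) auto
    also have "\<dots> \<le> ennreal (C1 + C2 * \<eta>)" using c C12(3) by (intro ennreal_leI) simp
    finally show ?thesis .
  qed
  have z: "s < \<eta> \<Longrightarrow> \<Xi> \<eta> n s w = 0" for s w by (simp add: \<Xi>_def)
  note te = trunc_error[OF \<xi>f_joint trunc_joint(1) \<xi>_nonneg(1) trunc_bounds(1,2)[OF \<eta>(1)] less_imp_le[OF \<eta>(1)] \<eta>(2) z c in2 in1]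
  show "I \<in> borel_measurable M" "J \<in> borel_measurable M" "integrable M (\<lambda>w. \<bar>I w - J w\<bar>)"
    unfolding I_def J_def by (rule te; assumption)+
  have "expectation (\<lambda>w. \<bar>I w - J w\<bar>) \<le> (C1 + C2 * \<eta>) * \<eta> + C2 * \<eta>"
    unfolding I_def J_def by (rule te; assumption)
  also have "\<dots> \<le> (C1 + 2 * C2) * \<eta>" using \<eta> by (intro trunc_error_bound) auto
  finally show "expectation (\<lambda>w. \<bar>I w - J w\<bar>) \<le> (C1 + 2 * C2) * \<eta>" .
qed

lemma trunc_P:
  assumes \<eta>: "0 < \<eta>" "\<eta> \<le> 1"
  defines "I \<equiv> \<lambda>w. \<integral>s. indicator {0..1} s * \<zeta>f s w \<partial>lborel" and "J \<equiv> \<lambda>w. \<integral>s. Zt \<eta> s w \<partial>leb_on \<eta> 1"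
  shows "I \<in> borel_measurable P" "J \<in> borel_measurable P" "integrable P (\<lambda>w. \<bar>I w - J w\<bar>)"
    "Q.expectation (\<lambda>w. \<bar>I w - J w\<bar>) \<le> (C1 + 2 * C2) * \<eta>"
proof -
  have K: "0 < 1 / \<eta>" using \<eta> by simp
  have in1: "(\<integral>\<^sup>+w. ennreal \<bar>\<zeta>f s w - Zt \<eta> s w\<bar> \<partial>P) \<le> ennreal (C2 * \<eta>)" if "s \<in> {\<eta>..1}" for s
  proof -
    have "(\<integral>\<^sup>+w. ennreal \<bar>\<zeta>f s w - Zt \<eta> s w\<bar> \<partial>P) \<le> ennreal (\<rho> * MP (\<alpha> + 1) / (1 / \<eta>))"
      using \<zeta>_error[OF _ K, of s] that \<eta> by (simp add: Zt_def)
    also have "\<dots> \<le> ennreal (C2 * \<eta>)" using C12(6) \<eta> by (intro ennreal_leI) (simp add: mult_right_mono)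
    finally show ?thesis .
  qed
  have c: "0 \<le> C1" "0 \<le> C2 * \<eta>" using C12 \<eta> by auto
  have in2: "(\<integral>\<^sup>+w. ennreal \<bar>\<zeta>f s w - Zt \<eta> s w\<bar> \<partial>P) \<le> ennreal (C1 + C2 * \<eta>)" if s: "s \<in> {0..\<eta>}" for s
  proof (cases "s = \<eta>")
    case True
    then have "(\<integral>\<^sup>+w. ennreal \<bar>\<zeta>f s w - Zt \<eta> s w\<bar> \<partial>P) \<le> ennreal (C2 * \<eta>)" using \<eta> by (intro in1) auto
    also have "\<dots> \<le> ennreal (C1 + C2 * \<eta>)" using c by (intro ennreal_leI) simp
    finally show ?thesis .
  next
    case False
    then have "(\<integral>\<^sup>+w. ennreal \<bar>\<zeta>f s w - Zt \<eta> s w\<bar> \<partial>P) = (\<integral>\<^sup>+w. ennreal (\<zeta>f s w) \<partial>P)"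
      using s \<xi>_nonneg(3) by (simp add: Zt_def)
    also have "\<dots> \<le> ennreal (\<rho> * MP \<alpha>)" using s \<eta> by (intro \<zeta>f_expectation) auto
    also have "\<dots> \<le> ennreal (C1 + C2 * \<eta>)" using c C12(4) by (intro ennreal_leI) simp
    finally show ?thesis .
  qed
  have z: "s < \<eta> \<Longrightarrow> Zt \<eta> s w = 0" for s w by (simp add: Zt_def)
  note te = Q.trunc_error[OF \<zeta>_joint(1) trunc_joint(2) \<xi>_nonneg(3) trunc_bounds(3,4)[OF \<eta>(1)] less_imp_le[OF \<eta>(1)] \<eta>(2) z c in2 in1]
  show "I \<in> borel_measurable P" "J \<in> borel_measurable P" "integrable P (\<lambda>w. \<bar>I w - J w\<bar>)"
    unfolding I_def J_def by (rule te; assumption)+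
  have "Q.expectation (\<lambda>w. \<bar>I w - J w\<bar>) \<le> (C1 + C2 * \<eta>) * \<eta> + C2 * \<eta>"
    unfolding I_def J_def by (rule te; assumption)
  also have "\<dots> \<le> (C1 + 2 * C2) * \<eta>" using \<eta> by (intro trunc_error_bound) auto
  finally show "Q.expectation (\<lambda>w. \<bar>I w - J w\<bar>) \<le> (C1 + 2 * C2) * \<eta>" .
qed

text \<open>The condition \<open>hu\<close> is the modulus of continuity that turns L1 errors into
  errors of \<open>h\<close>. It is weaker than a Lipschitz condition so as to admit functions of
  the square root, whose slope is infinite at 0.\<close>

lemma additive_convergence:
  assumes h: "continuous_on UNIV (h :: real \<Rightarrow> real)" "\<And>x. \<bar>h x\<bar> \<le> 1"
    and hu: "\<And>\<epsilon>. 0 < \<epsilon> \<Longrightarrow> \<exists>C\<ge>0. \<forall>x\<ge>0. \<forall>x'\<ge>0. \<bar>h x - h x'\<bar> \<le> \<epsilon> + C * \<bar>x - x'\<bar>"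
  shows "(\<lambda>n. \<integral>w. h (2 * (\<integral>s. indicator {0..1} s * \<xi>f n s w \<partial>lborel)) \<partial>M) \<longlonglongrightarrow> (\<integral>w. h (2 * (\<integral>s. indicator {0..1} s * \<zeta>f s w \<partial>lborel)) \<partial>P)"
proof (rule tendstoI)
  fix e :: real assume e: "0 < e"
  then have "0 < e / 6" by simp
  from hu[OF this] obtain C where C: "0 \<le> C" "\<And>x x'. 0 \<le> x \<Longrightarrow> 0 \<le> x' \<Longrightarrow> \<bar>h x - h x'\<bar> \<le> e / 6 + C * \<bar>x - x'\<bar>" by auto
  define B where "B = 2 * C * (C1 + 2 * C2)"
  have B: "0 \<le> B" using C12 C(1) by (simp add: B_def)
  \<comment> \<open>Makes the truncation error \<open>B * \<eta>\<close> at most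
    \<open>e / 6\<close>, to be added to the \<open>e / 6\<close> from the modulus of
    \<open>h\<close>.\<close>
  define \<eta> where "\<eta> = min 1 (e / (6 * (B + 1)))"
  have \<eta>: "0 < \<eta>" "\<eta> \<le> 1" "\<eta> \<le> e / (6 * (B + 1))" using e B by (auto simp: \<eta>_def)
  have "B * \<eta> \<le> B * (e / (6 * (B + 1)))" using B \<eta> by (intro mult_left_mono) auto
  also have "\<dots> \<le> e / 6" using B e by (simp add: field_simps)
  finally have err: "e / 6 + 2 * C * ((C1 + 2 * C2) * \<eta>) \<le> e / 3" by (simp add: B_def)
  have [measurable]: "h \<in> borel_measurable borel" using h(1) by (rule borel_measurable_continuous_onI)
  let ?I = "\<lambda>n w. \<integral>s. indicator {0..1} s * \<xi>f n s w \<partial>lborel" and ?J = "\<lambda>n w. \<integral>s. \<Xi> \<eta> n s w \<partial>leb_on \<eta> 1"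
  let ?I' = "\<lambda>w. \<integral>s. indicator {0..1} s * \<zeta>f s w \<partial>lborel" and ?J' = "\<lambda>w. \<integral>s. Zt \<eta> s w \<partial>leb_on \<eta> 1"
  have 1: "\<bar>(\<integral>w. h (2 * ?I n w) \<partial>M) - (\<integral>w. h (2 * ?J n w) \<partial>M)\<bar> \<le> e / 3" for n
  proof -
    have "\<bar>(\<integral>w. h (2 * ?I n w) \<partial>M) - (\<integral>w. h (2 * ?J n w) \<partial>M)\<bar> \<le> e / 6 + 2 * C * ((C1 + 2 * C2) * \<eta>)"
    proof (rule expectation_diff_le[OF trunc_M(1,2)[OF \<eta>(1,2)] _ _ _ h(2) C(2,1) trunc_M(3,4)[OF \<eta>(1,2)]])
      show "0 \<le> ?I n w" for w by (intro integral_nonneg_AE AE_I2) (use \<xi>_nonneg in auto)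
      show "0 \<le> ?J n w" for w by (intro integral_nonneg_AE AE_I2) (use trunc_bounds[OF \<eta>(1)] in auto)
    qed measurable
    with err show ?thesis by linarith
  qed
  have 2: "\<bar>(\<integral>w. h (2 * ?I' w) \<partial>P) - (\<integral>w. h (2 * ?J' w) \<partial>P)\<bar> \<le> e / 3"
  proof -
    have "\<bar>(\<integral>w. h (2 * ?I' w) \<partial>P) - (\<integral>w. h (2 * ?J' w) \<partial>P)\<bar> \<le> e / 6 + 2 * C * ((C1 + 2 * C2) * \<eta>)"
    proof (rule Q.expectation_diff_le[OF trunc_P(1,2)[OF \<eta>(1,2)] _ _ _ h(2) C(2,1) trunc_P(3,4)[OF \<eta>(1,2)]])
      show "0 \<le> ?I' w" for w by (intro integral_nonneg_AE AE_I2) (use \<xi>_nonneg in auto)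
      show "0 \<le> ?J' w" for w by (intro integral_nonneg_AE AE_I2) (use trunc_bounds[OF \<eta>(1)] in auto)
    qed measurable
    with err show ?thesis by linarith
  qed
  have "continuous_on UNIV (\<lambda>x. h (2 * x))" by (rule continuous_on_compose2[OF h(1)]) (auto intro!: continuous_intros)
  from tendstoD[OF trunc_convergence[OF \<eta>(1,2) this], of "e / 3"] e
  have "eventually (\<lambda>n. \<bar>(\<integral>w. h (2 * ?J n w) \<partial>M) - (\<integral>w. h (2 * ?J' w) \<partial>P)\<bar> < e / 3) sequentially"
    by (simp add: dist_real_def)
  then show "eventually (\<lambda>n. dist (\<integral>w. h (2 * ?I n w) \<partial>M) (\<integral>w. h (2 * ?I' w) \<partial>P) < e) sequentially"
  proof eventually_elim
    case (elim n)
    have gen: "\<bar>a - d\<bar> < e" if "\<bar>a - b\<bar> \<le> e / 3" "\<bar>d - c\<bar> \<le> e / 3" "\<bar>b - c\<bar> < e / 3" for a b c d :: real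
      using that by linarith
    show ?case unfolding dist_real_def by (rule gen[OF 1 2 elim])
  qed
qed

lemma A_scaled:
  "2 * (\<integral>s. indicator {0..1} s * \<xi>f n s w \<partial>lborel) = 2 * A (tn n) w / tn n powr \<kappa>"
proof -
  define t where "t = tn n"
  have t: "0 < t" unfolding t_def by (rule tn_pos)
  have "A t w = \<bar>t\<bar> *\<^sub>R (\<integral>s. indicator {0..t} (0 + t * s) * fY (0 + t * s) w \<partial>lborel)"
    unfolding A_def by (rule lborel_integral_real_affine) (use t in simp)
  also have "\<dots> = t * (\<integral>s. indicator {0..1} s * fY (t * s) w \<partial>lborel)"
  proof -
    have "indicator {0..t} (0 + t * s) = (indicator {0..1} s :: real)" for s
      using t by (simp add: indicator_def zero_le_mult_iff)
    then show ?thesis using t by simp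
  qed
  finally have At: "A t w = t * (\<integral>s. indicator {0..1} s * fY (t * s) w \<partial>lborel)" .
  have "(\<integral>s. indicator {0..1} s * \<xi>f n s w \<partial>lborel) = (\<integral>s. t powr (- (\<gamma> + \<alpha>)) * (indicator {0..1} s * fY (t * s) w) \<partial>lborel)"
    by (simp add: \<xi>f_def t_def mult_ac)
  also have "\<dots> = t powr (- (\<gamma> + \<alpha>)) * (\<integral>s. indicator {0..1} s * fY (t * s) w \<partial>lborel)"
    by (rule integral_mult_right_zero)
  also have "t powr (- (\<gamma> + \<alpha>)) = t / t powr \<kappa>"
  proof -
    have "t powr \<kappa> = t * t powr (\<gamma> + \<alpha>)" using t by (simp add: \<kappa>_def powr_add add.assoc)
    moreover have "t powr (- (\<gamma> + \<alpha>)) = inverse (t powr (\<gamma> + \<alpha>))" by (rule powr_minus)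
    ultimately show ?thesis using t by (simp only: divide_inverse inverse_mult_distrib) simp
  qed
  finally show ?thesis by (simp add: At t_def[symmetric])
qed

end

text \<open>\<open>cts_step\<close> is Lipschitz and the square root is Hoelder of order 1/2;
  \<open>sqrt z \<le> d + z / d\<close> converts the latter into a small constant plus a linear
  term.\<close>

lemma cts_step_sqrt:
  assumes ab: "a < b" and e: "0 < \<epsilon>"
  shows "\<exists>C\<ge>0. \<forall>x\<ge>0. \<forall>x'\<ge>0. \<bar>cts_step a b (sqrt x) - cts_step a b (sqrt x')\<bar> \<le> \<epsilon> + C * \<bar>x - x'\<bar>"
proof -
  have lip: "\<bar>cts_step a b v - cts_step a b v'\<bar> \<le> \<bar>v - v'\<bar> / (b - a)" for v v'
  proof -
    let ?g = "\<lambda>v. (b - v) / (b - a)"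
    have c: "cts_step a b v = min 1 (max 0 (?g v))" for v
      using ab by (simp add: cts_step_def min_def max_def divide_le_eq le_divide_eq zero_le_divide_iff divide_le_0_iff)
    have "\<bar>min 1 (max 0 p) - min 1 (max 0 q)\<bar> \<le> \<bar>p - q\<bar>" for p q :: real by (simp add: min_def max_def)
    then have "\<bar>cts_step a b v - cts_step a b v'\<bar> \<le> \<bar>?g v - ?g v'\<bar>" unfolding c .
    also have "?g v - ?g v' = (v' - v) / (b - a)" by (simp add: diff_divide_distrib[symmetric])
    also have "\<bar>(v' - v) / (b - a)\<bar> = \<bar>v - v'\<bar> / (b - a)" using ab by (simp add: abs_divide abs_minus_commute)
    finally show ?thesis .
  qed
  have sq: "\<bar>sqrt x - sqrt x'\<bar> \<le> sqrt \<bar>x - x'\<bar>" if "0 \<le> x" "0 \<le> x'" for x x'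
  proof -
    have w: "sqrt p - sqrt q \<le> sqrt (p - q)" if "0 \<le> q" "q \<le> p" for p q :: real
      using sqrt_add_le_add_sqrt[of "p - q" q] that by simp
    show ?thesis using w[of x x'] w[of x' x] that by (cases "x \<le> x'") (auto simp: abs_if)
  qed
  have yg: "sqrt z \<le> d + z / d" if "0 \<le> z" "0 < d" for z d :: real
  proof (cases "sqrt z \<le> d")
    case True
    then show ?thesis using that by (simp add: add_increasing2)
  next
    case False
    then have "sqrt z * d \<le> sqrt z * sqrt z" using that by (intro mult_left_mono) auto
    then have "sqrt z \<le> z / d" using that by (simp add: field_simps)
    then show ?thesis using that by linarith
  qed
  \<comment> \<open>Division by \<open>b - a\<close>, from the Lipschitz constant of
    \<open>cts_step\<close>, turns \<open>d\<close> into \<epsilon>.\<close>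
  define d where "d = \<epsilon> * (b - a)"
  have d: "0 < d" using ab e by (simp add: d_def)
  show ?thesis
  proof (intro exI[of _ "1 / (d * (b - a))"] conjI allI impI)
    show "0 \<le> 1 / (d * (b - a))" using d ab by simp
    fix x x' :: real assume x: "0 \<le> x" "0 \<le> x'"
    have "\<bar>cts_step a b (sqrt x) - cts_step a b (sqrt x')\<bar> \<le> \<bar>sqrt x - sqrt x'\<bar> / (b - a)" by (rule lip)
    also have "\<dots> \<le> (d + \<bar>x - x'\<bar> / d) / (b - a)"
      using sq[OF x] yg[of "\<bar>x - x'\<bar>" d] d ab by (intro divide_right_mono) auto
    also have "\<dots> = \<epsilon> + 1 / (d * (b - a)) * \<bar>x - x'\<bar>" using d ab by (simp add: d_def add_divide_distrib)
    finally show "\<bar>cts_step a b (sqrt x) - cts_step a b (sqrt x')\<bar> \<le> \<epsilon> + 1 / (d * (b - a)) * \<bar>x - x'\<bar>" .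
  qed
qed

section \<open>From the time integral to the driven process\<close>

locale besq_driven_scaling = besq_driven M F W \<delta> y Y f \<rho> \<alpha> \<gamma> B S s0 + besq_scaling M F W \<delta> y Y f \<rho> \<alpha> \<gamma> P G W' Z tn
  for M :: "'a measure" and F W \<delta> y Y f \<rho> \<alpha> \<gamma> B S s0 and P :: "'b measure" and G W' Z tn
begin

lemma S_measurable: "0 \<le> t \<Longrightarrow> S t \<in> borel_measurable M"
  using S_adapted measurable_F_le by (auto simp: adapted_proc_def)

text \<open>The difference is \<open>s0 + t + 2 * NS t\<close> over \<open>t powr \<kappa>\<close>,
  and each term loses a power of \<open>t\<close>, by \<open>\<kappa> > 1\<close> and
  \<open>NS_growth\<close>.\<close>

lemma remainder_vanishes:
  "AE w in M. (\<lambda>n. S (tn n) w / tn n powr \<kappa> - 2 * A (tn n) w / tn n powr \<kappa>) \<longlonglongrightarrow> 0"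
  using NS_growth
proof eventually_elim
  case (elim w)
  have lim: "(\<lambda>n. tn n powr (- c)) \<longlonglongrightarrow> 0" if "0 < c" for c
    using tendsto_neg_powr[of "- c" tn] that tn_top by simp
  have "(\<lambda>n. \<bar>s0\<bar> * tn n powr (- \<kappa>) + tn n powr (- (\<kappa> - 1)) + 2 * tn n powr (- (e0 / 2))) \<longlonglongrightarrow> \<bar>s0\<bar> * 0 + 0 + 2 * 0"
    using \<kappa>_gt_1 e0_pos by (intro tendsto_add tendsto_mult tendsto_const lim) auto
  then have z: "(\<lambda>n. \<bar>s0\<bar> * tn n powr (- \<kappa>) + tn n powr (- (\<kappa> - 1)) + 2 * tn n powr (- (e0 / 2))) \<longlonglongrightarrow> 0" by simp
  have "eventually (\<lambda>n. \<bar>NS (tn n) w\<bar> \<le> tn n powr (\<kappa> - e0 / 2)) sequentially"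
    by (rule eventually_compose_filterlim[OF elim tn_top])
  then have "eventually (\<lambda>n. norm (S (tn n) w / tn n powr \<kappa> - 2 * A (tn n) w / tn n powr \<kappa>)
    \<le> \<bar>s0\<bar> * tn n powr (- \<kappa>) + tn n powr (- (\<kappa> - 1)) + 2 * tn n powr (- (e0 / 2))) sequentially"
  proof eventually_elim
    case (elim n)
    define t where "t = tn n"
    have t: "0 < t" unfolding t_def by (rule tn_pos)
    have i: "inverse (t powr \<kappa>) = t powr (- \<kappa>)" by (rule powr_minus[symmetric])
    have e1: "t * t powr (- \<kappa>) = t powr (- (\<kappa> - 1))"
    proof -
      have "t * t powr (- \<kappa>) = t powr 1 * t powr (- \<kappa>)" using t by simp
      also have "\<dots> = t powr (1 + - \<kappa>)" by (rule powr_add[symmetric])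
      finally show ?thesis by simp
    qed
    have e2: "t powr (\<kappa> - e0 / 2) * t powr (- \<kappa>) = t powr (- (e0 / 2))" by (simp add: powr_add[symmetric])
    have num: "S t w - 2 * A t w = s0 + t + 2 * NS t w" 
    proof -
      have "2 * ((a - b - c - d) / 2) = a - b - c - d" for a b c d :: real by simp
      then have "2 * NS t w = S t w - s0 - t - 2 * A t w" unfolding NS_def .
      then show ?thesis by simp
    qed
    have "S t w / t powr \<kappa> - 2 * A t w / t powr \<kappa> = (s0 + t + 2 * NS t w) * t powr (- \<kappa>)"
      unfolding i[symmetric] divide_inverse left_diff_distrib[symmetric] num ..
    then have "norm (S t w / t powr \<kappa> - 2 * A t w / t powr \<kappa>) = \<bar>s0 + t + 2 * NS t w\<bar> * t powr (- \<kappa>)"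
      by (simp add: abs_mult)
    also have "\<dots> \<le> (\<bar>s0\<bar> + t + 2 * t powr (\<kappa> - e0 / 2)) * t powr (- \<kappa>)"
    proof (rule mult_right_mono)
      have gen: "\<bar>a + t + 2 * b\<bar> \<le> \<bar>a\<bar> + t + 2 * c" if "\<bar>b\<bar> \<le> c" for a b c :: real using that t by linarith
      show "\<bar>s0 + t + 2 * NS t w\<bar> \<le> \<bar>s0\<bar> + t + 2 * t powr (\<kappa> - e0 / 2)" by (rule gen) (use elim in \<open>simp add: t_def\<close>)
    qed simp
    also have "\<dots> = \<bar>s0\<bar> * t powr (- \<kappa>) + t * t powr (- \<kappa>) + 2 * (t powr (\<kappa> - e0 / 2) * t powr (- \<kappa>))"
      by (simp only: distrib_right mult.assoc)
    finally show ?case unfolding e1 e2 unfolding t_def .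
  qed
  then show ?case by (rule Lim_null_comparison[OF _ z])
qed

lemma S_convergence:
  assumes h: "continuous_on UNIV (h :: real \<Rightarrow> real)" "\<And>x. \<bar>h x\<bar> \<le> 1"
    and hu: "\<And>\<epsilon>. 0 < \<epsilon> \<Longrightarrow> \<exists>C\<ge>0. \<forall>x\<ge>0. \<forall>x'\<ge>0. \<bar>h x - h x'\<bar> \<le> \<epsilon> + C * \<bar>x - x'\<bar>"
  shows "(\<lambda>n. \<integral>w. h (S (tn n) w / tn n powr \<kappa>) \<partial>M) \<longlonglongrightarrow> (\<integral>w. h (2 * (\<integral>s. indicator {0..1} s * \<zeta>f s w \<partial>lborel)) \<partial>P)"
proof -
  have mh[measurable]: "h \<in> borel_measurable borel" using h(1) by (rule borel_measurable_continuous_onI)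
  have mS[measurable]: "S (tn n) \<in> borel_measurable M" for n using tn_pos[of n] by (intro S_measurable) simp
  let ?X = "\<lambda>n w. S (tn n) w / tn n powr \<kappa>" and ?X' = "\<lambda>n w. 2 * A (tn n) w / tn n powr \<kappa>"
  have "(\<lambda>n. \<integral>w. h (?X n w) - h (?X' n w) \<partial>M) \<longlonglongrightarrow> (\<integral>w. 0 \<partial>M)"
  proof (rule integral_dominated_convergence[where w="\<lambda>_. 2"])
    show "AE w in M. (\<lambda>n. h (?X n w) - h (?X' n w)) \<longlonglongrightarrow> 0"
      using remainder_vanishes AE_space
    proof eventually_elim
      case (elim w)
      show ?case
      proof (rule tendstoI)
        fix e :: real assume e: "0 < e"
        then have "0 < e / 2" by simp
        from hu[OF this] obtain C where C: "0 \<le> C" "\<And>x x'. 0 \<le> x \<Longrightarrow> 0 \<le> x' \<Longrightarrow> \<bar>h x - h x'\<bar> \<le> e / 2 + C * \<bar>x - x'\<bar>" by auto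
        have "0 < e / (2 * (C + 1))" using e C by simp
        from tendstoD[OF elim(1) this]
        show "eventually (\<lambda>n. dist (h (?X n w) - h (?X' n w)) 0 < e) sequentially"
        proof eventually_elim
          case (elim n)
          have x: "0 \<le> ?X n w" "0 \<le> ?X' n w"
            using S_nonneg tn_pos[of n] \<open>w \<in> space M\<close> A_nonneg by auto
          have "\<bar>h (?X n w) - h (?X' n w)\<bar> \<le> e / 2 + C * \<bar>?X n w - ?X' n w\<bar>" by (rule C(2)[OF x])
          also have "\<dots> \<le> e / 2 + C * (e / (2 * (C + 1)))" using elim C(1) by (intro add_left_mono mult_left_mono) (auto simp: dist_real_def)
          also have "\<dots> < e" using e C(1) by (simp add: field_simps)
          finally show ?case by (simp add: dist_real_def)
        qed
      qed
    qed
    have "\<bar>h a - h b\<bar> \<le> 2" for a b using h(2)[of a] h(2)[of b] by linarith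
    then show "AE w in M. norm (h (?X n w) - h (?X' n w)) \<le> 2" for n by simp
  qed (simp_all, measurable)
  then have d: "(\<lambda>n. \<integral>w. h (?X n w) - h (?X' n w) \<partial>M) \<longlonglongrightarrow> 0" by simp
  have "(\<integral>w. h (?X n w) - h (?X' n w) \<partial>M) + (\<integral>w. h (?X' n w) \<partial>M) = (\<integral>w. h (?X n w) \<partial>M)" for n
  proof -
    have "integrable M (\<lambda>w. h (?X n w))" "integrable M (\<lambda>w. h (?X' n w))"
      using h(2) by (auto intro!: integrable_const_bound[where B=1])
    then show ?thesis by simp
  qed
  then show ?thesis
    using tendsto_add[OF d additive_convergence[OF h hu]] by (simp add: A_scaled)
qed

abbreviation Rint :: "'b \<Rightarrow> real" where "Rint w \<equiv> integral {0..1} (\<lambda>s. s powr \<gamma> * Z s w powr \<alpha>)"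

definition r :: "real \<Rightarrow> 'b \<Rightarrow> real" where "r s w = s powr \<gamma> * Z (max 0 s) w powr \<alpha>"

lemma r_joint: "(\<lambda>(s, w). r s w) \<in> borel_measurable (borel \<Otimes>\<^sub>M P)"
proof -
  have "(\<lambda>p. fst p powr \<gamma> * (\<lambda>(s, w). Z (max 0 s) w) p powr \<alpha>) \<in> borel_measurable (borel \<Otimes>\<^sub>M P)" by measurable
  then show ?thesis by (simp add: r_def case_prod_beta')
qed

text \<open>The limit is stated with the gauge integral, while the convergence uses the Lebesgue
  one. For a non-negative integrand they exist together, and when they do not exist both have the
  default value 0.\<close>

lemma R_eq: assumes w: "w \<in> space P" shows "Rint w = (\<integral>s. indicator {0..1} s * r s w \<partial>lborel)"
proof -
  have m: "(\<lambda>s. r s w) \<in> borel_measurable borel" using measurable_compose[OF measurable_Pair2'[OF w] r_joint] by simp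
  have mi: "(\<lambda>s. indicator {0..1} s * r s w) \<in> borel_measurable lborel" using m by measurable
  have c: "Rint w = integral {0..1} (\<lambda>s. r s w)" by (rule Henstock_Kurzweil_Integration.integral_cong) (simp add: r_def max_absorb2)
  show ?thesis
  proof (cases "integrable lborel (\<lambda>s. indicator {0..1} s * r s w)")
    case True
    then have "set_integrable lborel {0..1} (\<lambda>s. r s w)" by (simp add: set_integrable_def)
    from set_borel_integral_eq_integral(2)[OF this] show ?thesis by (simp add: c set_lebesgue_integral_def)
  next
    case False
    then have "\<not> set_integrable lebesgue {0..1} (\<lambda>s. r s w)"
      using integrable_completion[OF mi] by (simp add: set_integrable_def)
    then have "\<not> (\<lambda>s. r s w) integrable_on {0..1}"
      using nonnegative_absolutely_integrable_1[of "\<lambda>s. r s w" "{0..1}"] by (auto simp: r_def)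
    then show ?thesis unfolding c using False by (simp add: not_integrable_integral not_integrable_integral_eq)
  qed
qed

lemma R_measurable: "Rint \<in> borel_measurable P"
proof -
  have swap: "(\<lambda>p. (snd p, fst p)) \<in> measurable (P \<Otimes>\<^sub>M lborel) (borel \<Otimes>\<^sub>M P)" by (intro measurable_Pair) auto
  have [measurable]: "(\<lambda>p. r (snd p) (fst p)) \<in> borel_measurable (P \<Otimes>\<^sub>M lborel)" using measurable_compose[OF swap r_joint] by simp
  have "(\<lambda>p. indicator {0..1} (snd p) * r (snd p) (fst p)) \<in> borel_measurable (P \<Otimes>\<^sub>M lborel)" by measurable
  then have "(\<lambda>(w, s). indicator {0..1} s * r s w) \<in> borel_measurable (P \<Otimes>\<^sub>M lborel)" by (simp add: case_prod_beta')
  from lborel.borel_measurable_lebesgue_integral[OF this]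
  have "(\<lambda>w. \<integral>s. indicator {0..1} s * r s w \<partial>lborel) \<in> borel_measurable P" by simp
  then show ?thesis by (rule measurable_cong[THEN iffD2, rotated]) (rule R_eq)
qed

text \<open>\<open>\<zeta>f\<close> uses \<open>pw\<close> and clipped values, the statement
  \<open>powr\<close> and the process itself. They agree where the process is positive, which by
  \<open>Y_pos\<close> and Fubini holds almost surely at almost every time.\<close>

lemma R_AE: "AE w in P. (\<integral>s. indicator {0..1} s * \<zeta>f s w \<partial>lborel) = \<rho> * Rint w"
proof -
  interpret PL: pair_sigma_finite lborel P ..
  have mz: "(\<lambda>p. (\<lambda>(s, w). Z (max 0 s) w) p) \<in> borel_measurable (lborel \<Otimes>\<^sub>M P)"
    using Q.Y_joint by (simp cong: measurable_cong_sets sets_pair_measure_cong)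
  have set: "{x \<in> space (lborel \<Otimes>\<^sub>M P). 0 < fst x \<longrightarrow> 0 < Z (max 0 (fst x)) (snd x)} \<in> sets (lborel \<Otimes>\<^sub>M P)"
    using mz unfolding case_prod_beta' by measurable
  have "AE s in lborel. AE w in P. 0 < s \<longrightarrow> 0 < Z (max 0 s) w"
  proof (rule AE_I2)
    fix s :: real
    show "AE w in P. 0 < s \<longrightarrow> 0 < Z (max 0 s) w"
      using Q.Y_pos[of s] by (cases "0 < s") (auto simp: max_absorb2)
  qed
  then have "AE w in P. AE s in lborel. 0 < s \<longrightarrow> 0 < Z (max 0 s) w"
    by (subst (asm) PL.AE_commute[OF set])
  then show ?thesis using AE_space
  proof eventually_elim
    case (elim w)
    have m: "(\<lambda>s. r s w) \<in> borel_measurable borel" "(\<lambda>s. \<zeta>f s w) \<in> borel_measurable borel"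
      using measurable_compose[OF measurable_Pair2'[OF elim(2)] r_joint] measurable_compose[OF measurable_Pair2'[OF elim(2)] \<zeta>_joint(1)] by simp_all
    have "AE s in lborel. s \<noteq> (0 :: real)" by (rule AE_lborel_singleton)
    with elim(1) have "AE s in lborel. indicator {0..1} s * \<zeta>f s w = \<rho> * (indicator {0..1} s * r s w)"
    proof eventually_elim
      case (elim s)
      show ?case
      proof (cases "s \<in> {0..1}")
        case True
        then have s: "0 < s" using elim by auto
        then have "0 < Z (max 0 s) w" using elim by simp
        then show ?thesis using True by (simp add: \<zeta>f_def r_def V_def pw_pos_eq max_absorb2)
      qed simp
    qed
    then have "(\<integral>s. indicator {0..1} s * \<zeta>f s w \<partial>lborel) = (\<integral>s. \<rho> * (indicator {0..1} s * r s w) \<partial>lborel)"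
      by (intro integral_cong_AE borel_measurable_times) (use m in simp_all)
    also have "\<dots> = \<rho> * (\<integral>s. indicator {0..1} s * r s w \<partial>lborel)" by (rule integral_mult_right_zero)
    finally show ?case by (simp add: R_eq[OF elim(2)])
  qed
qed

text \<open>Weak convergence may be tested on the functions \<open>cts_step a b\<close>; composed
  with the square root they satisfy the conditions of \<open>S_convergence\<close> by
  \<open>cts_step_sqrt\<close>.\<close>

lemma weak_limit:
  "weak_conv_m (\<lambda>n. distr M borel (\<lambda>w. tn n powr (- (1 + \<gamma> + \<alpha>) / 2) * sqrt (S (tn n) w)))
    (distr P borel (\<lambda>w. sqrt (2 * \<rho> * Rint w)))"
proof (rule integral_cts_step_conv_imp_weak_conv)
  let ?X = "\<lambda>n w. tn n powr (- (1 + \<gamma> + \<alpha>) / 2) * sqrt (S (tn n) w)"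
  have [measurable]: "S (tn n) \<in> borel_measurable M" for n using tn_pos[of n] by (intro S_measurable) simp
  note [measurable] = R_measurable
  have mX: "?X n \<in> borel_measurable M" for n by measurable
  have mR: "(\<lambda>w. sqrt (2 * \<rho> * Rint w)) \<in> borel_measurable P" by measurable
  show "real_distribution (distr M borel (?X n))" for n by (rule real_distribution_distr[OF mX])
  show "real_distribution (distr P borel (\<lambda>w. sqrt (2 * \<rho> * Rint w)))" by (rule Q.real_distribution_distr[OF mR])
  fix a b :: real assume ab: "a < b"
  have "uniformly_continuous_on UNIV (cts_step a b)" by (rule cts_step_uniformly_continuous[OF ab])
  then have cc: "continuous_on UNIV (cts_step a b)" by (rule uniformly_continuous_imp_continuous)
  then have mc[measurable]: "cts_step a b \<in> borel_measurable borel" by (rule borel_measurable_continuous_onI)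
  have ch: "continuous_on UNIV (\<lambda>x. cts_step a b (sqrt x))"
    by (rule continuous_on_compose2[OF cc]) (auto intro!: continuous_intros)
  have bh: "\<bar>cts_step a b v\<bar> \<le> 1" for v using ab by (auto simp: cts_step_def field_simps)
  have X: "?X n w = sqrt (S (tn n) w / tn n powr \<kappa>)" for n w
  proof -
    have "tn n powr (- (1 + \<gamma> + \<alpha>) / 2) = sqrt (tn n powr (- \<kappa>))"
      using tn_pos[of n] by (simp add: powr_half_sqrt[symmetric] powr_powr \<kappa>_def)
    also have "tn n powr (- \<kappa>) = inverse (tn n powr \<kappa>)" by (rule powr_minus)
    finally have "tn n powr (- (1 + \<gamma> + \<alpha>) / 2) = sqrt (inverse (tn n powr \<kappa>))" .
    then show ?thesis by (simp only: real_sqrt_mult divide_inverse mult.commute)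
  qed
  have "(\<lambda>n. \<integral>w. cts_step a b (sqrt (S (tn n) w / tn n powr \<kappa>)) \<partial>M)
    \<longlonglongrightarrow> (\<integral>w. cts_step a b (sqrt (2 * (\<integral>s. indicator {0..1} s * \<zeta>f s w \<partial>lborel))) \<partial>P)"
    by (rule S_convergence[OF ch bh cts_step_sqrt[OF ab]])
  moreover have "(\<integral>w. cts_step a b (sqrt (2 * (\<integral>s. indicator {0..1} s * \<zeta>f s w \<partial>lborel))) \<partial>P) = (\<integral>w. cts_step a b (sqrt (2 * \<rho> * Rint w)) \<partial>P)"
  proof (rule integral_cong_AE)
    show "AE w in P. cts_step a b (sqrt (2 * (\<integral>s. indicator {0..1} s * \<zeta>f s w \<partial>lborel))) = cts_step a b (sqrt (2 * \<rho> * Rint w))"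
      using R_AE by eventually_elim (simp add: mult.assoc)
    have [measurable]: "(\<lambda>w. \<integral>s. indicator {0..1} s * \<zeta>f s w \<partial>lborel) \<in> borel_measurable P" by (rule trunc_P(1)[of 1]) auto
    show "(\<lambda>w. cts_step a b (sqrt (2 * (\<integral>s. indicator {0..1} s * \<zeta>f s w \<partial>lborel)))) \<in> borel_measurable P" by measurable
  qed (use mR in measurable)
  ultimately show "(\<lambda>n. integral\<^sup>L (distr M borel (?X n)) (cts_step a b)) \<longlonglongrightarrow> integral\<^sup>L (distr P borel (\<lambda>w. sqrt (2 * \<rho> * Rint w))) (cts_step a b)"
    unfolding integral_distr[OF mX mc] integral_distr[OF mR mc] by (simp only: X)
qed

end

theorem theorem1p1:
  fixes M :: "'a measure" and F :: "real \<Rightarrow> 'a measure"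
    and f :: "real \<Rightarrow> real \<Rightarrow> real" and \<rho> \<alpha> \<gamma> \<delta> y s0 :: real
    and S Y B :: "real \<Rightarrow> 'a \<Rightarrow> real"
  assumes "prob_space M" and "filtration_of M F"
    and "assumption_Af f \<rho> \<alpha> \<gamma>"
    and "0 < \<delta>" and "0 \<le> y"
    and "is_brownian_motion M F B"
    and "\<exists>W. is_BESQ M F W \<delta> y Y"
    and "adapted_proc F S" and "continuous_paths M S"
    and "\<forall>t\<ge>0. \<forall>\<omega>\<in>space M. 0 \<le> S t \<omega>"
    and "0 \<le> s0" and "\<forall>\<omega>\<in>space M. S 0 \<omega> = s0"
    and "\<forall>t\<ge>0. \<exists>I. is_ito_integral M (\<lambda>s \<omega>. sqrt (S s \<omega>)) B t I \<and>
           (AE \<omega> in M. S t \<omega> = s0 + integral {0..t} (\<lambda>s. 2 * f s (Y s \<omega>) + 1) + 2 * I \<omega>)"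
  shows "(AE \<omega> in M. ((\<lambda>t. ln (sqrt (S t \<omega>)) / ln t) \<longlongrightarrow> (1 + \<gamma> + \<alpha>) / 2) at_top)
    \<and> (\<forall>(N :: 'b measure) (G :: real \<Rightarrow> 'b measure) (Yt :: real \<Rightarrow> 'b \<Rightarrow> real).
         prob_space N \<and> filtration_of N G \<and> (\<exists>W. is_BESQ N G W \<delta> 0 Yt) \<longrightarrow>
         conv_distr_at_top M (\<lambda>t \<omega>. t powr (- (1 + \<gamma> + \<alpha>) / 2) * sqrt (S t \<omega>))
           (distr N borel (\<lambda>\<omega>. sqrt (2 * \<rho> * integral {0..1} (\<lambda>s. s powr \<gamma> * Yt s \<omega> powr \<alpha>)))))"
proof -
  obtain W where W: "is_BESQ M F W \<delta> y Y" using assms(7) by blast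
  interpret prob_space M by (rule assms(1))
  interpret D: besq_driven M F W \<delta> y Y f \<rho> \<alpha> \<gamma> B S s0
    by unfold_locales (use assms W in \<open>simp_all add: is_BESQ_def\<close>)
  show ?thesis
  proof (intro conjI allI impI D.log_growth)
    fix N :: "'b measure" and G :: "real \<Rightarrow> 'b measure" and Yt :: "real \<Rightarrow> 'b \<Rightarrow> real"
    assume N: "prob_space N \<and> filtration_of N G \<and> (\<exists>W. is_BESQ N G W \<delta> 0 Yt)"
    then obtain W' where W': "is_BESQ N G W' \<delta> 0 Yt" by blast
    interpret N: prob_space N using N by simp
    show "conv_distr_at_top M (\<lambda>t \<omega>. t powr (- (1 + \<gamma> + \<alpha>) / 2) * sqrt (S t \<omega>))
           (distr N borel (\<lambda>\<omega>. sqrt (2 * \<rho> * integral {0..1} (\<lambda>s. s powr \<gamma> * Yt s \<omega> powr \<alpha>))))"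
      unfolding conv_distr_at_top_def
    proof (intro allI impI)
      fix tn :: "nat \<Rightarrow> real" assume tn: "filterlim tn at_top sequentially"
      then have "eventually (\<lambda>n. 1 \<le> tn n) sequentially" by (simp add: filterlim_at_top)
      then obtain n0 where n0: "\<And>n. n0 \<le> n \<Longrightarrow> 1 \<le> tn n" by (auto simp: eventually_sequentially)
      \<comment> \<open>The scaling locale demands \<open>1 \<le> tn n\<close> at every index, so
        the first \<open>n0\<close> terms are shifted away; the shift does not affect the weak
        limit.\<close>
      have tn': "filterlim (\<lambda>n. tn (n + n0)) at_top sequentially"
        using filterlim_compose[OF tn filterlim_add_const_nat_at_top[of n0]] .
      interpret besq_driven_scaling M F W \<delta> y Y f \<rho> \<alpha> \<gamma> B S s0 N G W' Yt "\<lambda>n. tn (n + n0)"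
        by unfold_locales (use N W' tn' n0 assms(4) in \<open>simp_all add: is_BESQ_def\<close>)
      show "weak_conv_m (\<lambda>n. distr M borel (\<lambda>\<omega>. tn n powr (- (1 + \<gamma> + \<alpha>) / 2) * sqrt (S (tn n) \<omega>)))
        (distr N borel (\<lambda>\<omega>. sqrt (2 * \<rho> * integral {0..1} (\<lambda>s. s powr \<gamma> * Yt s \<omega> powr \<alpha>))))"
        using weak_limit unfolding weak_conv_m_def weak_conv_def by (blast intro: LIMSEQ_offset)
    qed
  qed
qed

end
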